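(* Let $\Gamma$ be a co-compact Fuchsian group and consider a symmetric, irreducible, finite-range random walk on $\Gamma$ whose Green's function has radius of convergence $R$. Then: (A) The Green's function at $R$ decays exponentially: there are constants $C<\infty$ and $\varrho<1$ such that $G_R(x,y)\le C\varrho^{d(x,y)}$ for all $x,y\in\Gamma$. (B) Ancona's inequalities hold up to $R$ with a uniform constant: there is a constant $C<\infty$ such that for all $r\in[1,R]$, every geodesic segment $x_0x_1\cdots x_m$ in the Cayley graph of $\Gamma$, and every $1\le k\le m$, $$G_r(x_0,x_m)\le C\,G_r(x_0,x_k)\,G_r(x_k,x_m).$$
   Context: A co-compact Fuchsian group is a co-compact discrete subgroup of $PSL(2,\mathbb R)$. The Cayley graph of $\Gamma$ is taken with respect to a fixed finite symmetric generating set, and $d$ denotes the corresponding word metric. A (right) random walk on $\Gamma$ is a Markov chain $X_n=x\xi_1\cdots\xi_n$ with $\xi_i$ i.i.d. $\Gamma$-valued; $p^n(x,y)=P^x\{X_n=y\}$. It is symmetric if the law of $\xi_1$ (the step distribution) is invariant under $x\mapsto x^{-1}$, finite-range if this law has finite support, irreducible if the semigroup generated by its support is $\Gamma$. The Green's function is $G_r(x,y)=\sum_{n\ge0}p^n(x,y)r^n$; by irreducibility its radius of convergence $R$ does not depend on $x,y$. Here $R>1$ and $G_R(x,y)<\infty$. *)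

theory Defs
  imports "HOL-Probability.Probability" "HOL-Algebra.Generated_Groups"
begin

section \<open>The topological group PSL(2,R)\<close>

definition SL2R :: "(real^2^2) monoid" where
  "SL2R = \<lparr>carrier = {A. det A = 1}, mult = (**), one = mat 1\<rparr>"

definition SL2R_centre :: "(real^2^2) set" where
  "SL2R_centre = {mat 1, - mat 1}"

definition PSL2R :: "(real^2^2) set monoid" where
  "PSL2R = SL2R Mod SL2R_centre"

text \<open>The finest topology on \<open>f ` topspace X\<close> that makes \<open>f\<close> continuous.\<close>

definition quotient_topology :: "'a topology \<Rightarrow> ('a \<Rightarrow> 'b) \<Rightarrow> 'b topology" where
  "quotient_topology X f =
     topology (\<lambda>U. U \<subseteq> f ` topspace X \<and> openin X {x \<in> topspace X. f x \<in> U})"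

lemma openin_quotient_topology:
  "openin (quotient_topology X f) U \<longleftrightarrow>
     U \<subseteq> f ` topspace X \<and> openin X {x \<in> topspace X. f x \<in> U}"
proof -
  have int: "openin X {x \<in> topspace X. f x \<in> S \<inter> T}"
    if "openin X {x \<in> topspace X. f x \<in> S}" "openin X {x \<in> topspace X. f x \<in> T}" for S T
  proof -
    have "{x \<in> topspace X. f x \<in> S \<inter> T} =
        {x \<in> topspace X. f x \<in> S} \<inter> {x \<in> topspace X. f x \<in> T}" by auto
    with that show ?thesis by (simp only: openin_Int)
  qed
  have union: "openin X {x \<in> topspace X. f x \<in> \<Union>K}"
    if "\<forall>S\<in>K. openin X {x \<in> topspace X. f x \<in> S}" for K
  proof -
    have "{x \<in> topspace X. f x \<in> \<Union>K} = \<Union>((\<lambda>S. {x \<in> topspace X. f x \<in> S}) ` K)" by auto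
    with that show ?thesis by (auto simp del: Union_iff)
  qed
  have "istopology (\<lambda>U. U \<subseteq> f ` topspace X \<and> openin X {x \<in> topspace X. f x \<in> U})"
    unfolding istopology_def
    by (intro conjI allI impI) (use int union in \<open>blast+\<close>)
  then show ?thesis
    by (simp add: quotient_topology_def topology_inverse')
qed

lemma topspace_quotient_topology [simp]:
  "topspace (quotient_topology X f) = f ` topspace X"
proof (rule subset_antisym)
  show "topspace (quotient_topology X f) \<subseteq> f ` topspace X"
    by (metis openin_quotient_topology openin_topspace)
  have "{x \<in> topspace X. f x \<in> f ` topspace X} = topspace X" by auto
  then have "openin (quotient_topology X f) (f ` topspace X)"
    by (simp add: openin_quotient_topology)
  then show "f ` topspace X \<subseteq> topspace (quotient_topology X f)"
    by (rule openin_subset)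
qed

lemma quotient_map_quotient_topology: "quotient_map X (quotient_topology X f) f"
  by (simp add: quotient_map_def openin_quotient_topology)

definition PSL2R_topology :: "(real^2^2) set topology" where
  "PSL2R_topology =
     quotient_topology (top_of_set (carrier SL2R)) (\<lambda>A. SL2R_centre #>\<^bsub>SL2R\<^esub> A)"

definition cocompact_Fuchsian :: "(real^2^2) set set \<Rightarrow> bool" where
  "cocompact_Fuchsian \<Gamma> \<longleftrightarrow>
     subgroup \<Gamma> PSL2R \<and>
     subtopology PSL2R_topology \<Gamma> = discrete_topology \<Gamma> \<and>
     compact_space (quotient_topology PSL2R_topology (\<lambda>g. \<Gamma> #>\<^bsub>PSL2R\<^esub> g))"

lemma group_SL2R: "group SL2R"
proof (rule groupI)
  fix A assume "A \<in> carrier SL2R"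
  then have d: "det A = 1" by (simp add: SL2R_def)
  then have "invertible A" by (simp add: invertible_det_nz)
  then obtain B where B: "A ** B = mat 1" "B ** A = mat 1"
    by (auto simp: invertible_def)
  then have "det B = 1" using d by (metis det_I det_mul mult_1)
  with B show "\<exists>B\<in>carrier SL2R. B \<otimes>\<^bsub>SL2R\<^esub> A = \<one>\<^bsub>SL2R\<^esub>"
    by (auto simp: SL2R_def)
qed (auto simp: SL2R_def det_mul matrix_mul_assoc)

lemma minus_matrix_mult: "(- A) ** (B :: real^2^2) = - (A ** B)" "B ** (- A) = - (B ** A)"
  by (simp_all add: vec_eq_iff matrix_matrix_mult_def sum_negf)

lemma normal_SL2R_centre: "SL2R_centre \<lhd> SL2R"
proof -
  interpret group SL2R by (rule group_SL2R)
  have neg: "- mat 1 \<in> carrier SL2R" by (simp add: SL2R_def det_2 mat_def)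
  then have "inv\<^bsub>SL2R\<^esub> (- mat 1) = - mat 1"
    by (intro inv_equality) (auto simp: SL2R_def minus_matrix_mult)
  moreover have "inv\<^bsub>SL2R\<^esub> (mat 1) = mat 1"
    using inv_one by (simp add: SL2R_def)
  ultimately have "subgroup SL2R_centre SL2R"
    using neg by (intro subgroupI) (auto simp: SL2R_centre_def SL2R_def minus_matrix_mult)
  then show ?thesis
    by (intro normalI) (auto simp: SL2R_centre_def r_coset_def l_coset_def SL2R_def minus_matrix_mult)
qed

lemma group_PSL2R: "group PSL2R"
  unfolding PSL2R_def using normal_SL2R_centre by (rule normal.factorgroup_is_group)

lemma topspace_PSL2R_topology: "topspace PSL2R_topology = carrier PSL2R"
  by (simp add: PSL2R_topology_def PSL2R_def carrier_FactGroup)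


section \<open>Cayley graphs\<close>

definition finite_symmetric_generating_set ::
    "('a, 'b) monoid_scheme \<Rightarrow> 'a set \<Rightarrow> 'a set \<Rightarrow> bool" where
  "finite_symmetric_generating_set G \<Gamma> S \<longleftrightarrow>
     finite S \<and> S \<subseteq> \<Gamma> \<and> (\<forall>s\<in>S. inv\<^bsub>G\<^esub> s \<in> S) \<and> generate G S = \<Gamma>"

text \<open>
  Edges join \<open>x\<close> to \<open>x s\<close>, so that left multiplication acts by automorphisms of the graph and
  preserves the law of the right random walk.
\<close>

definition cayley_adj :: "('a, 'b) monoid_scheme \<Rightarrow> 'a set \<Rightarrow> 'a \<Rightarrow> 'a \<Rightarrow> bool" where
  "cayley_adj G S x y \<longleftrightarrow> (\<exists>s\<in>S. y = x \<otimes>\<^bsub>G\<^esub> s)"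

definition word_metric :: "('a, 'b) monoid_scheme \<Rightarrow> 'a set \<Rightarrow> 'a \<Rightarrow> 'a \<Rightarrow> nat" where
  "word_metric G S x y =
     (LEAST n. \<exists>ss \<in> lists S. length ss = n \<and> y = foldl (mult G) x ss)"

definition geodesic_segment ::
    "('a, 'b) monoid_scheme \<Rightarrow> 'a set \<Rightarrow> 'a set \<Rightarrow> (nat \<Rightarrow> 'a) \<Rightarrow> nat \<Rightarrow> bool" where
  "geodesic_segment G \<Gamma> S x m \<longleftrightarrow>
     x 0 \<in> \<Gamma> \<and> (\<forall>i<m. cayley_adj G S (x i) (x (Suc i))) \<and> word_metric G S (x 0) (x m) = m"


section \<open>Random walks\<close>

inductive_set generated_semigroup :: "('a, 'b) monoid_scheme \<Rightarrow> 'a set \<Rightarrow> 'a set"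
  for G and A where
  incl: "a \<in> A \<Longrightarrow> a \<in> generated_semigroup G A"
| mult: "a \<in> generated_semigroup G A \<Longrightarrow> b \<in> generated_semigroup G A \<Longrightarrow>
    a \<otimes>\<^bsub>G\<^esub> b \<in> generated_semigroup G A"

definition symmetric_step :: "('a, 'b) monoid_scheme \<Rightarrow> 'a pmf \<Rightarrow> bool" where
  "symmetric_step G \<mu> \<longleftrightarrow> map_pmf (m_inv G) \<mu> = \<mu>"

definition finite_range_step :: "'a pmf \<Rightarrow> bool" where
  "finite_range_step \<mu> \<longleftrightarrow> finite (set_pmf \<mu>)"

definition irreducible_step :: "('a, 'b) monoid_scheme \<Rightarrow> 'a set \<Rightarrow> 'a pmf \<Rightarrow> bool" where
  "irreducible_step G \<Gamma> \<mu> \<longleftrightarrow> generated_semigroup G (set_pmf \<mu>) = \<Gamma>"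

text \<open>
  \<open>replicate_pmf n \<mu>\<close> is the joint law of the i.i.d. steps \<open>\<xi>\<^sub>1, \<dots>, \<xi>\<^sub>n\<close>, and
  \<open>foldl (mult G) x\<close> sends them to \<open>X\<^sub>n = x \<xi>\<^sub>1 \<cdots> \<xi>\<^sub>n\<close>.
\<close>

definition walk_law :: "('a, 'b) monoid_scheme \<Rightarrow> 'a pmf \<Rightarrow> nat \<Rightarrow> 'a \<Rightarrow> 'a pmf" where
  "walk_law G \<mu> n x = map_pmf (foldl (mult G) x) (replicate_pmf n \<mu>)"

definition transition_prob ::
    "('a, 'b) monoid_scheme \<Rightarrow> 'a pmf \<Rightarrow> nat \<Rightarrow> 'a \<Rightarrow> 'a \<Rightarrow> real" where
  "transition_prob G \<mu> n x y = pmf (walk_law G \<mu> n x) y"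

text \<open>Only meaningful for \<open>r \<ge> 0\<close>, since \<open>ennreal\<close> truncates negative reals.\<close>

definition green ::
    "('a, 'b) monoid_scheme \<Rightarrow> 'a pmf \<Rightarrow> real \<Rightarrow> 'a \<Rightarrow> 'a \<Rightarrow> ennreal" where
  "green G \<mu> r x y = (\<Sum>n. ennreal (transition_prob G \<mu> n x y * r ^ n))"

text \<open>For an irreducible walk the radius does not depend on the pair of points.\<close>

definition green_radius :: "('a, 'b) monoid_scheme \<Rightarrow> 'a pmf \<Rightarrow> ereal" where
  "green_radius G \<mu> = conv_radius (\<lambda>n. transition_prob G \<mu> n \<one>\<^bsub>G\<^esub> \<one>\<^bsub>G\<^esub>)"

end

theory Submission
  imports Defs "HOL-Real_Asymp.Real_Asymp"
begin

text \<open>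
  On \<open>\<Gamma>\<close> take \<open>N g\<close>, the Frobenius norm of a matrix representing \<open>g\<close>. It is submultiplicative,
  grows polynomially and satisfies a Ptolemy inequality, which is hyperbolicity in a multiplicative
  form; cocompactness gives an element \<open>a\<close> of a fixed finite set with
  \<open>N (x a y) \<ge> c * N x * N y\<close> for all \<open>x\<close>, \<open>y\<close>. Normalise \<open>G\<^sub>r(1,x)\<close> to the first-passage
  generating function \<open>F\<^sub>r(x)\<close>.

  Concatenating paths through such an \<open>a\<close> gives \<open>H\<^sup>2 \<le> K * H'\<close> between the sums of
  \<open>F\<^sub>r(x)\<^sup>2\<close> over bands \<open>N x \<approx> T\<close> and \<open>N x \<approx> T\<^sup>2\<close>. For \<open>r < R\<close> these sums are bounded, so they are bounded
  by \<open>K\<close>, uniformly in \<open>r\<close>. Hence, by Cauchy-Schwarz and the growth of the bands, a path that winds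
  around a ball of radius \<open>T\<close> (in the scale of \<open>N\<close>) through a fixed visual angle has a weight that is
  exponentially small in a power of \<open>T\<close>. This yields Ancona's inequality by an induction over
  scales with a convergent product of constants. With Ancona's inequality the same bound on the bands
  forces \<open>F\<^sub>r\<close> to tend to zero uniformly, hence exponentially, and everything passes to the limit
  \<open>r \<rightarrow> R\<close> by monotone convergence.
\<close>

section \<open>Green functions of symmetric random walks\<close>

text \<open>Neither finiteness of the Green function at \<open>R\<close> nor convergence of its
  derivative there is available, so all estimates are made for 1/2 <= r < R with constants
  independent of \<open>r\<close>. The sum of squared Green functions over the whole group is
  controlled by a derivative in \<open>r\<close>, with a bound that depends on \<open>r\<close>;
  over a single band the bound becomes uniform, because a finite quantity that satisfies a quadratic
  inequality bounds itself. Working with \<open>fpg\<close>, which is at most 1, avoids circularity: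
  its band sums are bounded before transience at \<open>R\<close> is known, and boundedness of the
  Green function is then deduced from them. Word geodesics are compared with chains that are
  geodesic for \<open>N\<close> only up to errors polynomial in the length. This is enough for the
  induction over scales: the balls to be avoided have radius exponential in the length, so the
  weight of the avoiding paths is doubly exponentially small, while the Green function between the
  end points is at least exponentially small and the visual angle to be turned is at least
  polynomially small.\<close>

locale sym_walk = group G for G (structure) +
  fixes \<mu> :: "'a pmf" and R :: real
  assumes supp: "set_pmf \<mu> \<subseteq> carrier G"
    and finite_supp: "finite (set_pmf \<mu>)"
    and symmetric: "s \<in> carrier G \<Longrightarrow> pmf \<mu> (inv s) = pmf \<mu> s"
    and irreducible: "carrier G \<subseteq> generated_semigroup G (set_pmf \<mu>)"
    and radius: "conv_radius (\<lambda>n. transition_prob G \<mu> n \<one> \<one>) = ereal R"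
begin

text \<open>\<open>r\<^sup>n\<close> times the probability of going from \<open>x\<close> to \<open>y\<close> in \<open>n\<close> steps without
  visiting \<open>Y\<close> at any of the times \<open>1, \<dots>, n\<close>; the starting point may lie in \<open>Y\<close>.\<close>

primrec ker :: "real \<Rightarrow> 'a set \<Rightarrow> nat \<Rightarrow> 'a \<Rightarrow> 'a \<Rightarrow> real" where
  "ker r Y 0 x y = of_bool (x = y)"
| "ker r Y (Suc n) x y =
     (\<Sum>s\<in>set_pmf \<mu>. r * pmf \<mu> s * (if x \<otimes> s \<in> Y then 0 else ker r Y n (x \<otimes> s) y))"

text \<open>Real-valued, hence meaningful only where the series converges, which
  \<open>summable_ker\<close> gives for 0 < r < R. The value at \<open>R\<close> is reached through
  \<open>green\<close>, which lives in \<open>ennreal\<close>.\<close>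

definition grn :: "real \<Rightarrow> 'a set \<Rightarrow> 'a \<Rightarrow> 'a \<Rightarrow> real" where
  "grn r Y x y = (\<Sum>n. ker r Y n x y)"

lemma supp_carrier [simp]: "s \<in> set_pmf \<mu> \<Longrightarrow> s \<in> carrier G"
  using supp by auto

lemma transition_prob_Suc:
  "transition_prob G \<mu> (Suc n) x y = (\<Sum>s\<in>set_pmf \<mu>. pmf \<mu> s * transition_prob G \<mu> n (x \<otimes> s) y)"
proof -
  have "walk_law G \<mu> (Suc n) x = bind_pmf \<mu> (\<lambda>s. walk_law G \<mu> n (x \<otimes> s))"
    by (simp add: walk_law_def map_bind_pmf map_pmf_def bind_assoc_pmf bind_return_pmf)
  then have "transition_prob G \<mu> (Suc n) x y =
      (\<integral>s. pmf (walk_law G \<mu> n (x \<otimes> s)) y \<partial>measure_pmf \<mu>)"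
    by (simp add: transition_prob_def pmf_bind)
  also have "\<dots> = (\<Sum>s\<in>set_pmf \<mu>. pmf (walk_law G \<mu> n (x \<otimes> s)) y * pmf \<mu> s)"
    by (rule integral_measure_pmf_real[OF finite_supp]) (auto simp: set_pmf_iff)
  finally show ?thesis by (simp add: transition_prob_def mult.commute)
qed

lemma ker_empty: "ker r {} n x y = transition_prob G \<mu> n x y * r ^ n"
proof (induction n arbitrary: x)
  case 0
  then show ?case by (auto simp: transition_prob_def walk_law_def indicator_def)
next
  case (Suc n)
  show ?case
    by (simp add: transition_prob_Suc Suc.IH sum_distrib_right sum_distrib_left mult_ac)
qed

lemma ker_nonneg [simp]: "0 \<le> r \<Longrightarrow> 0 \<le> ker r Y n x y"
  by (induction n arbitrary: x) (auto intro!: sum_nonneg)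

lemma ker_mono:
  assumes "0 \<le> r" "r \<le> r'" "Y' \<subseteq> Y"
  shows "ker r Y n x y \<le> ker r' Y' n x y"
proof (induction n arbitrary: x)
  case (Suc n)
  have "r * pmf \<mu> s * (if x \<otimes> s \<in> Y then 0 else ker r Y n (x \<otimes> s) y)
      \<le> r' * pmf \<mu> s * (if x \<otimes> s \<in> Y' then 0 else ker r' Y' n (x \<otimes> s) y)" for s
    using assms Suc.IH[of "x \<otimes> s"] by (intro mult_mono) (auto simp: order_trans[OF ker_nonneg])
  then show ?case by (simp add: sum_mono)
qed auto

text \<open>Only an inequality, since the finite set \<open>X\<close> may miss some of the positions
  after \<open>k\<close> steps.\<close>

lemma ker_chapman:
  assumes "0 \<le> r" "finite X"
  shows "(\<Sum>b\<in>X. ker r Y k x b * ker r Y n b y) \<le> ker r Y (k + n) x y"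
proof (induction k arbitrary: x)
  case 0
  have "(\<Sum>b\<in>X. ker r Y 0 x b * ker r Y n b y) = (\<Sum>b\<in>X. if b = x then ker r Y n x y else 0)"
    by (intro sum.cong) auto
  also have "\<dots> \<le> ker r Y n x y" using assms by (simp add: sum.delta)
  finally show ?case by simp
next
  case (Suc k)
  have "(\<Sum>b\<in>X. ker r Y (Suc k) x b * ker r Y n b y) =
     (\<Sum>s\<in>set_pmf \<mu>. r * pmf \<mu> s * (if x \<otimes> s \<in> Y then 0 else
        (\<Sum>b\<in>X. ker r Y k (x \<otimes> s) b * ker r Y n b y)))"
    unfolding ker.simps sum_distrib_right
    by (subst sum.swap) (auto intro!: sum.cong simp: sum_distrib_left mult_ac)
  also have "\<dots> \<le> (\<Sum>s\<in>set_pmf \<mu>. r * pmf \<mu> s *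
      (if x \<otimes> s \<in> Y then 0 else ker r Y (k + n) (x \<otimes> s) y))"
    using assms Suc.IH by (intro sum_mono mult_left_mono) auto
  finally show ?case by simp
qed

lemma ker_mult:
  assumes "0 \<le> r"
  shows "ker r Y k x b * ker r Y n b y \<le> ker r Y (k + n) x y"
  using ker_chapman[OF assms, of "{b}"] by simp

text \<open>Each path that meets \<open>Y\<close> is cut at its last time in \<open>Y\<close>. The
  remaining piece starts in \<open>Y\<close> and never returns, which is why \<open>ker\<close>
  tests the times after 0 only; the first summand collects the paths that never meet
  \<open>Y\<close>.\<close>

lemma ker_last_visit:
  assumes "finite Y"
  shows "ker r {} n x v = of_bool (x \<notin> Y) * ker r Y n x v +
    (\<Sum>k\<le>n. \<Sum>b\<in>Y. ker r {} k x b * ker r Y (n - k) b v)"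
proof (induction n arbitrary: x)
  case 0
  have "(\<Sum>b\<in>Y. ker r {} 0 x b * ker r Y 0 b v) = (\<Sum>b\<in>Y. if b = x then of_bool (x = v) else 0)"
    by (intro sum.cong) auto
  then show ?case using assms by (auto simp: sum.delta)
next
  case (Suc n)
  have 0: "(\<Sum>b\<in>Y. ker r {} 0 x b * ker r Y (Suc n) b v) = of_bool (x \<in> Y) * ker r Y (Suc n) x v"
  proof -
    have "(\<Sum>b\<in>Y. ker r {} 0 x b * ker r Y (Suc n) b v)
        = (\<Sum>b\<in>Y. if b = x then ker r Y (Suc n) x v else 0)"
      by (intro sum.cong) auto
    also have "\<dots> = of_bool (x \<in> Y) * ker r Y (Suc n) x v"
      using assms by (simp del: ker.simps)
    finally show ?thesis .
  qed
  have "ker r {} (Suc n) x v = (\<Sum>s\<in>set_pmf \<mu>. r * pmf \<mu> s *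
      (of_bool (x \<otimes> s \<notin> Y) * ker r Y n (x \<otimes> s) v +
    (\<Sum>k\<le>n. \<Sum>b\<in>Y. ker r {} k (x \<otimes> s) b * ker r Y (n - k) b v)))"
    using Suc.IH by simp
  also have "\<dots> = ker r Y (Suc n) x v +
    (\<Sum>s\<in>set_pmf \<mu>. \<Sum>k\<le>n. \<Sum>b\<in>Y. r * pmf \<mu> s * ker r {} k (x \<otimes> s) b * ker r Y (n - k) b v)"
    by (simp add: distrib_left sum.distrib sum_distrib_left mult.assoc)
       (auto intro!: sum.cong)
  also have "(\<Sum>s\<in>set_pmf \<mu>. \<Sum>k\<le>n. \<Sum>b\<in>Y. r * pmf \<mu> s * ker r {} k (x \<otimes> s) b * ker r Y (n - k) b v)
     = (\<Sum>k\<le>n. \<Sum>b\<in>Y. ker r {} (Suc k) x b * ker r Y (n - k) b v)"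
    by (subst sum.swap, rule sum.cong, simp, subst sum.swap) (simp add: sum_distrib_right)
  also have "ker r Y (Suc n) x v + \<dots> = of_bool (x \<notin> Y) * ker r Y (Suc n) x v +
    (\<Sum>k\<le>Suc n. \<Sum>b\<in>Y. ker r {} k x b * ker r Y (Suc n - k) b v)"
    unfolding sum.atMost_Suc_shift 0 diff_zero by (cases "x \<in> Y") (simp_all del: ker.simps)
  finally show ?case .
qed

lemma ker_left_mult:
  assumes "g \<in> carrier G" "x \<in> carrier G" "y \<in> carrier G"
  shows "ker r {} n (g \<otimes> x) (g \<otimes> y) = ker r {} n x y"
  using assms(2)
proof (induction n arbitrary: x)
  case (Suc n)
  have "ker r {} n (g \<otimes> x \<otimes> s) (g \<otimes> y) = ker r {} n (x \<otimes> s) y" if "s \<in> set_pmf \<mu>" for s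
    using Suc.IH[of "x \<otimes> s"] that Suc.prems assms by (simp add: m_assoc)
  then show ?case by simp
qed (use assms in auto)

text \<open>Conditions on the last step instead of the first one, as the reversal of paths in
  \<open>ker_sym\<close> requires.\<close>

lemma ker_Suc_right:
  assumes "x \<in> carrier G" "y \<in> carrier G"
  shows "ker r {} (Suc n) x y = (\<Sum>s\<in>set_pmf \<mu>. r * pmf \<mu> s * ker r {} n x (y \<otimes> inv s))"
  using assms(1)
proof (induction n arbitrary: x)
  case 0
  have "x \<otimes> s = y \<longleftrightarrow> x = y \<otimes> inv s" if "s \<in> set_pmf \<mu>" for s
    using that 0 assms by (metis inv_solve_right' supp_carrier)
  then show ?case by simp
next
  case (Suc n)
  have "ker r {} (Suc (Suc n)) x y = (\<Sum>t\<in>set_pmf \<mu>. r * pmf \<mu> t * ker r {} (Suc n) (x \<otimes> t) y)"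
    by simp
  also have "\<dots> = (\<Sum>t\<in>set_pmf \<mu>. r * pmf \<mu> t *
      (\<Sum>s\<in>set_pmf \<mu>. r * pmf \<mu> s * ker r {} n (x \<otimes> t) (y \<otimes> inv s)))"
    using Suc.prems by (intro sum.cong refl) (subst Suc.IH, auto)
  also have "\<dots> = (\<Sum>s\<in>set_pmf \<mu>. r * pmf \<mu> s *
      (\<Sum>t\<in>set_pmf \<mu>. r * pmf \<mu> t * ker r {} n (x \<otimes> t) (y \<otimes> inv s)))"
    unfolding sum_distrib_left by (subst sum.swap) (simp add: mult_ac)
  finally show ?case by simp
qed

lemma inv_in_supp: "s \<in> set_pmf \<mu> \<Longrightarrow> inv s \<in> set_pmf \<mu>"
  using symmetric by (simp add: set_pmf_iff)

lemma ker_sym: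
  assumes "x \<in> carrier G" "y \<in> carrier G"
  shows "ker r {} n x y = ker r {} n y x"
  using assms
proof (induction n arbitrary: x y)
  case (Suc n)
  have "ker r {} (Suc n) y x = (\<Sum>s\<in>set_pmf \<mu>. r * pmf \<mu> s * ker r {} n y (x \<otimes> inv s))"
    using Suc.prems by (intro ker_Suc_right)
  also have "\<dots> = (\<Sum>s\<in>set_pmf \<mu>. r * pmf \<mu> s * ker r {} n y (x \<otimes> s))"
    by (rule sum.reindex_bij_witness[where i="m_inv G" and j="m_inv G"])
       (auto simp: inv_in_supp symmetric)
  also have "\<dots> = ker r {} (Suc n) x y"
    using Suc by (auto intro!: sum.cong)
  finally show ?case by simp
qed auto

lemma ker_pos_generated:
  assumes "g \<in> generated_semigroup G (set_pmf \<mu>)" "0 < r"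
  shows "\<exists>n. \<forall>x\<in>carrier G. 0 < ker r {} n x (x \<otimes> g)"
  using assms(1)
proof induction
  case (incl a)
  have "0 < ker r {} 1 x (x \<otimes> a)" for x
  proof -
    have "0 < r * pmf \<mu> a * ker r {} 0 (x \<otimes> a) (x \<otimes> a)"
      using incl assms(2) by (simp add: pmf_positive)
    also have "\<dots> \<le> ker r {} (Suc 0) x (x \<otimes> a)"
      using incl assms(2) finite_supp
      by (simp add: member_le_sum[of a "set_pmf \<mu>" "\<lambda>s. r * pmf \<mu> s * of_bool (x \<otimes> s = x \<otimes> a)", simplified])
    finally show ?thesis by simp
  qed
  then show ?case by blast
next
  case (mult a b)
  have gen: "g \<in> generated_semigroup G (set_pmf \<mu>) \<Longrightarrow> g \<in> carrier G" for g
    by (induction rule: generated_semigroup.induct) auto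
  from mult obtain m n where
    m: "\<forall>x\<in>carrier G. 0 < ker r {} m x (x \<otimes> a)" and n: "\<forall>x\<in>carrier G. 0 < ker r {} n x (x \<otimes> b)"
    by blast
  have "0 < ker r {} (m + n) x (x \<otimes> (a \<otimes> b))" if x: "x \<in> carrier G" for x
  proof -
    have "0 < ker r {} m x (x \<otimes> a) * ker r {} n (x \<otimes> a) (x \<otimes> a \<otimes> b)"
      using x m n mult gen by (intro mult_pos_pos) auto
    also have "\<dots> \<le> ker r {} (m + n) x (x \<otimes> a \<otimes> b)"
      using assms by (intro ker_mult) auto
    finally show ?thesis using x mult gen by (simp add: m_assoc)
  qed
  then show ?case by blast
qed

lemma ker_pos:
  assumes "x \<in> carrier G" "y \<in> carrier G" "0 < r"
  obtains n where "0 < ker r {} n x y"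
proof -
  have "inv x \<otimes> y \<in> generated_semigroup G (set_pmf \<mu>)" using assms irreducible by auto
  from ker_pos_generated[OF this assms(3)] obtain n where "0 < ker r {} n x (x \<otimes> (inv x \<otimes> y))"
    using assms by blast
  then show ?thesis using assms that by (simp add: m_assoc[symmetric])
qed

text \<open>Transition probabilities are at most 1, so the geometric series dominates. This makes
  the intervals {1/2..<R} used below nonempty, with \<open>R\<close> in their closure.\<close>

lemma radius_ge_1: "1 \<le> R"
proof -
  have "1 \<le> conv_radius (\<lambda>n. transition_prob G \<mu> n \<one> \<one>)"
  proof (rule conv_radius_geI_ex)
    fix r :: real assume r: "0 < r" "ereal r < 1"
    have "summable (\<lambda>n. transition_prob G \<mu> n \<one> \<one> * r ^ n)"
    proof (rule summable_comparison_test'[where N=0 and g="\<lambda>n. r ^ n"])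
      show "summable (\<lambda>n. r ^ n)" using r by (simp add: one_ereal_def)
      show "norm (transition_prob G \<mu> n \<one> \<one> * r ^ n) \<le> r ^ n" for n
        using r by (auto simp: transition_prob_def abs_mult pmf_le_1 intro!: mult_left_le_one_le)
    qed
    then show "\<exists>z. norm z = r \<and> summable (\<lambda>n. transition_prob G \<mu> n \<one> \<one> * z ^ n)"
      using r by (intro exI[of _ r]) auto
  qed
  then show ?thesis by (simp add: radius one_ereal_def)
qed

end

section \<open>Green functions below the radius of convergence\<close>

context sym_walk
begin

text \<open>A fixed path from \<open>y\<close> back to \<open>x\<close> closes every path from
  \<open>x\<close> to \<open>y\<close> into a loop, and by translation loops are counted by the
  return series at \<one>.\<close>

lemma summable_ker:
  assumes r: "0 < r" "r < R" and xy: "x \<in> carrier G" "y \<in> carrier G"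
  shows "summable (\<lambda>n. ker r Y n x y)"
proof -
  have 0: "summable (\<lambda>n. ker r {} n \<one> \<one>)"
    unfolding ker_empty using r by (intro summable_in_conv_radius) (simp add: radius)
  obtain k where k: "0 < ker r {} k y x" using ker_pos xy r by metis
  have "ker r {} n x y \<le> inverse (ker r {} k y x) * ker r {} (n + k) \<one> \<one>" for n
  proof -
    have "ker r {} n x y * ker r {} k y x \<le> ker r {} (n + k) x x"
      using r by (intro ker_mult) auto
    also have "\<dots> = ker r {} (n + k) \<one> \<one>" using ker_left_mult[of x \<one> \<one>] xy by simp
    finally show ?thesis using k by (simp add: field_simps)
  qed
  moreover have "ker r Y n x y \<le> ker r {} n x y" for n using r by (intro ker_mono) auto
  ultimately have le: "ker r Y n x y \<le> inverse (ker r {} k y x) * ker r {} (n + k) \<one> \<one>" for n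
    using order_trans by blast
  show ?thesis
  proof (rule summable_comparison_test'[where N=0])
    show "summable (\<lambda>n. inverse (ker r {} k y x) * ker r {} (n + k) \<one> \<one>)"
      using 0 by (intro summable_mult summable_ignore_initial_segment)
  qed (use le r in auto)
qed

text \<open>The series is the derivative of \<open>r\<close> times the return series, so it
  converges strictly inside the disc of convergence.\<close>

lemma summable_Suc_mult_ker:
  assumes r: "0 < r" "r < R"
  shows "summable (\<lambda>n. real (Suc n) * ker r {} n \<one> \<one>)"
proof -
  let ?p = "\<lambda>n. transition_prob G \<mu> n \<one> \<one>"
  have s: "summable (\<lambda>n. ?p n * z ^ n)" if "norm z < R" for z :: real
    using that by (intro summable_in_conv_radius) (simp add: radius)
  have "summable (\<lambda>n. diffs ?p n * r ^ n)"
    using r s by (intro termdiff_converges[of r R]) auto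
  then have "summable (\<lambda>n. r * (diffs ?p n * r ^ n))" by (rule summable_mult)
  then have "summable (\<lambda>n. real (Suc n) * (?p (Suc n) * r ^ Suc n))"
    by (simp add: diffs_def mult_ac)
  then have "summable (\<lambda>n. real n * (?p n * r ^ n))"
    using summable_Suc_iff[of "\<lambda>n. real n * (?p n * r ^ n)"] by simp
  from summable_add[OF this s[of r]] r show ?thesis
    by (simp add: ker_empty algebra_simps)
qed

lemma grn_nonneg: "0 < r \<Longrightarrow> r < R \<Longrightarrow> x \<in> carrier G \<Longrightarrow> y \<in> carrier G \<Longrightarrow> 0 \<le> grn r Y x y"
  unfolding grn_def by (intro suminf_nonneg summable_ker) auto

lemma grn_mono:
  assumes "0 < r" "r \<le> r'" "r' < R" "Y' \<subseteq> Y" "x \<in> carrier G" "y \<in> carrier G"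
  shows "grn r Y x y \<le> grn r' Y' x y"
  unfolding grn_def using assms by (intro suminf_le ker_mono summable_ker) auto

lemma grn_left_mult:
  assumes "g \<in> carrier G" "x \<in> carrier G" "y \<in> carrier G"
  shows "grn r {} (g \<otimes> x) (g \<otimes> y) = grn r {} x y"
  unfolding grn_def using ker_left_mult[OF assms] by simp

lemma grn_sym:
  assumes "x \<in> carrier G" "y \<in> carrier G"
  shows "grn r {} x y = grn r {} y x"
  unfolding grn_def using ker_sym[OF assms] by simp

lemma grn_pos:
  assumes "0 < r" "r < R" "x \<in> carrier G" "y \<in> carrier G"
  shows "0 < grn r {} x y"
proof -
  obtain k where "0 < ker r {} k x y" using ker_pos assms by metis
  then show ?thesis unfolding grn_def using assms
    by (intro suminf_pos2[of _ k] summable_ker) auto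
qed

lemma grn_self_ge_1:
  assumes "0 < r" "r < R" "x \<in> carrier G"
  shows "1 \<le> grn r Y x x"
  using sum_le_suminf[OF summable_ker[OF assms(1,2) assms(3) assms(3)], of "{0}" Y] assms
  by (simp add: grn_def)

lemma Cauchy_ker_sums:
  assumes "0 < r" "r < R" "x \<in> carrier G" "y \<in> carrier G" "b \<in> carrier G"
  shows "(\<lambda>n. \<Sum>k\<le>n. ker r Y k x b * ker r Y' (n - k) b y) sums (grn r Y x b * grn r Y' b y)"
  unfolding grn_def using assms
  by (intro Cauchy_product_sums) (auto simp: summable_ker)

lemma grn_last_visit:
  assumes r: "0 < r" "r < R" and xv: "x \<in> carrier G" "v \<in> carrier G"
    and Y: "finite Y" "Y \<subseteq> carrier G"
  shows "grn r {} x v = of_bool (x \<notin> Y) * grn r Y x v + (\<Sum>b\<in>Y. grn r {} x b * grn r Y b v)"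
proof -
  have "(\<lambda>n. of_bool (x \<notin> Y) * ker r Y n x v +
       (\<Sum>b\<in>Y. \<Sum>k\<le>n. ker r {} k x b * ker r Y (n - k) b v)) sums
     (of_bool (x \<notin> Y) * grn r Y x v + (\<Sum>b\<in>Y. grn r {} x b * grn r Y b v))"
    using r xv Y
    by (intro sums_add sums_mult sums_sum Cauchy_ker_sums)
       (auto simp: grn_def intro!: summable_sums summable_ker)
  also have "(\<lambda>n. of_bool (x \<notin> Y) * ker r Y n x v +
       (\<Sum>b\<in>Y. \<Sum>k\<le>n. ker r {} k x b * ker r Y (n - k) b v)) = (\<lambda>n. ker r {} n x v)"
  proof
    fix n
    have "(\<Sum>b\<in>Y. \<Sum>k\<le>n. ker r {} k x b * ker r Y (n - k) b v) =
        (\<Sum>k\<le>n. \<Sum>b\<in>Y. ker r {} k x b * ker r Y (n - k) b v)"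
      by (rule sum.swap)
    then show "of_bool (x \<notin> Y) * ker r Y n x v +
       (\<Sum>b\<in>Y. \<Sum>k\<le>n. ker r {} k x b * ker r Y (n - k) b v) = ker r {} n x v"
      using ker_last_visit[OF Y(1), of r n x v] by simp
  qed
  finally show ?thesis by (simp add: grn_def sums_iff)
qed

text \<open>The weight of the paths from \<open>\<one>\<close> to \<open>x\<close> that leave \<open>\<one>\<close> at once and for ever;
  by symmetry this is the first-passage generating function.\<close>

definition fpg :: "real \<Rightarrow> 'a \<Rightarrow> real" where
  "fpg r x = grn r {\<one>} \<one> x"

text \<open>After translation to the starting point \<one>, cut at the last visit to \<one>: the
  first piece is an arbitrary loop, the second one is counted by \<open>fpg\<close>.\<close>

lemma grn_eq_fpg:
  assumes r: "0 < r" "r < R" and "x \<in> carrier G" "y \<in> carrier G"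
  shows "grn r {} x y = grn r {} \<one> \<one> * fpg r (inv x \<otimes> y)"
proof -
  have "grn r {} x y = grn r {} \<one> (inv x \<otimes> y)"
    using grn_left_mult[of "inv x" x y r] assms by simp
  also have "\<dots> = grn r {} \<one> \<one> * fpg r (inv x \<otimes> y)"
    using grn_last_visit[of r \<one> "inv x \<otimes> y" "{\<one>}"] assms by (simp add: fpg_def)
  finally show ?thesis .
qed

lemma fpg_pos: "0 < r \<Longrightarrow> r < R \<Longrightarrow> x \<in> carrier G \<Longrightarrow> 0 < fpg r x"
  using grn_eq_fpg[of r \<one> x] grn_pos[of r \<one> x] grn_pos[of r \<one> \<one>]
  by (simp add: zero_less_mult_iff)

lemma fpg_mono: "0 < r \<Longrightarrow> r \<le> r' \<Longrightarrow> r' < R \<Longrightarrow> x \<in> carrier G \<Longrightarrow> fpg r x \<le> fpg r' x"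
  unfolding fpg_def by (intro grn_mono) auto

lemma fpg_inv:
  assumes "0 < r" "r < R" "x \<in> carrier G"
  shows "fpg r (inv x) = fpg r x"
  using grn_eq_fpg[of r \<one> x] grn_eq_fpg[of r x \<one>] grn_sym[of \<one> x r] grn_pos[of r \<one> \<one>] assms
  by simp

text \<open>A path to \<open>z\<close> followed by a path that leaves \<open>z\<close> for ever is a
  path from \<open>x\<close> to \<open>y\<close> cut at its last visit to \<open>z\<close>, so such
  concatenations are all distinct. Allowing returns to \<open>z\<close> in the second piece costs
  the factor \<open>grn r {} \<one> \<one>\<close>.\<close>

lemma grn_mult_le:
  assumes r: "0 < r" "r < R" and c: "x \<in> carrier G" "y \<in> carrier G" "z \<in> carrier G"
  shows "grn r {} x z * grn r {} z y \<le> grn r {} \<one> \<one> * grn r {} x y"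
proof -
  have zy: "grn r {} z y = grn r {} z z * grn r {z} z y"
    using grn_last_visit[of r z y "{z}"] assms by simp
  have zz: "grn r {} z z = grn r {} \<one> \<one>" using grn_left_mult[of z \<one> \<one> r] c by simp
  have "grn r {} x z * grn r {z} z y \<le> grn r {} x y"
    using grn_last_visit[of r x y "{z}"] assms grn_nonneg[of r x y "{z}"] by simp
  then show ?thesis
    using zy zz grn_nonneg[of r \<one> \<one> "{}"] r mult_left_mono by (fastforce simp: mult_ac)
qed

lemma fpg_mult_le:
  assumes r: "0 < r" "r < R" and c: "x \<in> carrier G" "y \<in> carrier G"
  shows "fpg r x * fpg r y \<le> fpg r (x \<otimes> y)"
proof -
  have "(grn r {} \<one> \<one>)\<^sup>2 * (fpg r x * fpg r y) \<le> (grn r {} \<one> \<one>)\<^sup>2 * fpg r (x \<otimes> y)"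
    using grn_mult_le[of r \<one> "x \<otimes> y" x] grn_eq_fpg[of r \<one> x] grn_eq_fpg[of r x "x \<otimes> y"]
      grn_eq_fpg[of r \<one> "x \<otimes> y"] assms by (simp add: m_assoc[symmetric] power2_eq_square mult_ac)
  then show ?thesis using grn_pos[of r \<one> \<one>] r by simp
qed

lemma fpg_one: "0 < r \<Longrightarrow> r < R \<Longrightarrow> fpg r \<one> = 1"
  using grn_eq_fpg[of r \<one> \<one>] grn_pos[of r \<one> \<one>] by simp

text \<open>Going to \<open>x\<close> and back gives (fpg r x)^2 <= fpg r \<one> = 1. Symmetry of
  the walk replaces the probabilistic interpretation, which is lost for r > 1.\<close>

lemma fpg_le_1:
  assumes "0 < r" "r < R" "x \<in> carrier G"
  shows "fpg r x \<le> 1"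
proof -
  have "(fpg r x)\<^sup>2 \<le> 1"
    using fpg_mult_le[of r x "inv x"] fpg_inv[of r x] fpg_one assms by (simp add: power2_eq_square)
  then show ?thesis using power2_le_imp_le[of "fpg r x" 1] by simp
qed

lemma grn_le_one_one:
  assumes "0 < r" "r < R" "x \<in> carrier G" "y \<in> carrier G"
  shows "grn r Y x y \<le> grn r {} \<one> \<one>"
proof -
  have "grn r Y x y \<le> grn r {} x y" using assms by (intro grn_mono) auto
  also have "\<dots> \<le> grn r {} \<one> \<one>"
    using grn_eq_fpg[of r x y] fpg_le_1[of r "inv x \<otimes> y"] grn_pos[of r \<one> \<one>] assms
    by (simp add: mult_le_cancel_left1)
  finally show ?thesis .
qed

text \<open>Killing the walk at another point \<open>z\<close> keeps its Green function bounded
  up to the radius of convergence: a loop at \<open>\<one>\<close> avoiding \<open>z\<close> can be preceded by a fixed path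
  from \<open>z\<close> to \<open>\<one>\<close>, and the result is counted by \<open>fpg r z \<le> 1\<close>.\<close>

lemma grn_one_one_le:
  assumes r0: "0 < r0" "r0 < R" and z: "z \<in> carrier G" "z \<noteq> \<one>"
  shows "\<exists>K>0. \<forall>r\<in>{r0..<R}. grn r {} \<one> \<one> * (1 - (fpg r z)\<^sup>2) \<le> K"
proof -
  have F: "grn r {z} z \<one> = fpg r z" if "0 < r" "r < R" for r
  proof -
    have "grn r {} z \<one> = grn r {} z z * grn r {z} z \<one>"
      using grn_last_visit[of r z \<one> "{z}"] that z by simp
    moreover have "grn r {} z z = grn r {} \<one> \<one>" using grn_left_mult[of z \<one> \<one> r] z by simp
    moreover have "grn r {} z \<one> = grn r {} \<one> \<one> * fpg r z"
      using grn_eq_fpg[of r z \<one>] fpg_inv[of r z] that z by simp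
    ultimately show ?thesis using grn_pos[of r \<one> \<one>] that by simp
  qed
  have "\<exists>k. 0 < ker r0 {z} k z \<one>"
  proof (rule ccontr)
    assume "\<not> ?thesis"
    then have "ker r0 {z} k z \<one> = 0" for k
      using ker_nonneg[of r0 "{z}" k z \<one>] r0 by (metis less_eq_real_def)
    then have "fpg r0 z = 0" using F[OF r0] by (simp add: grn_def)
    then show False using fpg_pos[OF r0 z(1)] by simp
  qed
  then obtain k where k: "0 < ker r0 {z} k z \<one>" by blast
  have "grn r {} \<one> \<one> * (1 - (fpg r z)\<^sup>2) \<le> 1 / ker r0 {z} k z \<one>" if "r \<in> {r0..<R}" for r
  proof -
    have r: "0 < r" "r < R" "r0 \<le> r" using that r0 by auto
    \<comment> \<open>A loop at \<one> either avoids \<open>z\<close> or has a last visit to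
      \<open>z\<close>; the loops of the second kind have total weight
      \<open>grn r {} \<one> \<one>\<close> times the square of \<open>fpg r z\<close>.\<close>
    have "grn r {} \<one> \<one> = grn r {z} \<one> \<one> + grn r {} \<one> z * grn r {z} z \<one>"
      using grn_last_visit[of r \<one> \<one> "{z}"] r z by simp
    then have 1: "grn r {} \<one> \<one> * (1 - (fpg r z)\<^sup>2) = grn r {z} \<one> \<one>"
      using F[OF r(1,2)] grn_eq_fpg[of r \<one> z] r z by (simp add: algebra_simps power2_eq_square)
    have "ker r0 {z} k z \<one> * grn r {z} \<one> \<one> = (\<Sum>n. ker r0 {z} k z \<one> * ker r {z} n \<one> \<one>)"
      unfolding grn_def using r by (intro suminf_mult[symmetric] summable_ker) auto
    also have "\<dots> \<le> (\<Sum>n. ker r {z} (n + k) z \<one>)"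
    proof (intro suminf_le)
      show "ker r0 {z} k z \<one> * ker r {z} n \<one> \<one> \<le> ker r {z} (n + k) z \<one>" for n
      proof -
        have "ker r0 {z} k z \<one> * ker r {z} n \<one> \<one> \<le> ker r {z} k z \<one> * ker r {z} n \<one> \<one>"
          using r r0 by (intro mult_right_mono ker_mono) auto
        also have "\<dots> \<le> ker r {z} (k + n) z \<one>" using r by (intro ker_mult) auto
        finally show ?thesis by (simp add: add.commute)
      qed
    qed (use r z in \<open>auto intro!: summable_mult summable_ker summable_ignore_initial_segment\<close>)
    also have "\<dots> \<le> grn r {z} z \<one>"
      unfolding grn_def using r z
      by (subst suminf_split_initial_segment[of "\<lambda>n. ker r {z} n z \<one>" k])
         (auto intro!: summable_ker sum_nonneg)
    also have "\<dots> \<le> 1" using F[OF r(1,2)] fpg_le_1[OF r(1,2) z(1)] by simp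
    finally show ?thesis unfolding 1 using k by (simp add: field_simps)
  qed
  then show ?thesis using k by (intro exI[of _ "1 / ker r0 {z} k z \<one>"]) auto
qed

text \<open>A finite set that carries all paths of at most \<open>n\<close> steps from
  \<open>a\<close> avoiding \<open>Y\<close>, so that sums over intermediate points can be taken
  over finite sets.\<close>

primrec reach :: "'a set \<Rightarrow> nat \<Rightarrow> 'a \<Rightarrow> 'a set" where
  "reach Y 0 a = {a}"
| "reach Y (Suc n) a = insert a (\<Union>s\<in>{s\<in>set_pmf \<mu>. a \<otimes> s \<notin> Y}. reach Y n (a \<otimes> s))"

lemma finite_reach: "finite (reach Y n a)"
  using finite_supp by (induction n arbitrary: a) auto

lemma reach_subset: "a \<in> carrier G - Y \<Longrightarrow> reach Y n a \<subseteq> carrier G - Y"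
proof (induction n arbitrary: a)
  case (Suc n)
  have "reach Y n (a \<otimes> s) \<subseteq> carrier G - Y" if "s \<in> set_pmf \<mu>" "a \<otimes> s \<notin> Y" for s
    using Suc that by (intro Suc.IH) auto
  with Suc.prems show ?case by auto
qed auto

lemma reach_mono: "m \<le> n \<Longrightarrow> reach Y m a \<subseteq> reach Y n a"
proof (induction m arbitrary: n a)
  case 0
  then show ?case by (cases n) auto
next
  case (Suc m)
  then obtain n' where "n = Suc n'" "m \<le> n'" by (metis Suc_le_D Suc_le_mono)
  with Suc.IH show ?case by fastforce
qed

text \<open>Along a path the increment of \<phi> telescopes; each step is charged to the point
  \<open>b\<close> from which it starts, and the path is cut there. The step itself belongs to the
  second piece. The term k = n, with no step left, is only estimated by w >= 0.\<close>

lemma ker_increment: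
  assumes r: "0 \<le> r" and X: "finite X" "reach Y n a \<subseteq> X" and a: "a \<in> carrier G - Y"
    and w: "\<And>b s. b \<in> carrier G - Y \<Longrightarrow> s \<in> set_pmf \<mu> \<Longrightarrow> b \<otimes> s \<notin> Y \<Longrightarrow> \<phi> (b \<otimes> s) - \<phi> b \<le> w b"
    and w0: "\<And>b. 0 \<le> w b"
  shows "(\<phi> v - \<phi> a) * ker r Y n a v \<le> (\<Sum>b\<in>X. \<Sum>k\<le>n. ker r Y k a b * w b * ker r Y (n - k) b v)"
  using X(2) a
proof (induction n arbitrary: a)
  case 0
  then show ?case using r w0 by (auto intro!: sum_nonneg)
next
  case (Suc n)
  let ?q = "\<lambda>s. r * pmf \<mu> s"
  have aX: "a \<in> X" using Suc.prems by auto
  have "(\<phi> v - \<phi> a) * ker r Y (Suc n) a v =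
      (\<Sum>s\<in>set_pmf \<mu>. ?q s * (if a \<otimes> s \<in> Y then 0 else (\<phi> v - \<phi> a) * ker r Y n (a \<otimes> s) v))"
    by (simp add: sum_distrib_left) (auto intro!: sum.cong)
  also have "\<dots> \<le> (\<Sum>s\<in>set_pmf \<mu>. ?q s * (if a \<otimes> s \<in> Y then 0 else
      w a * ker r Y n (a \<otimes> s) v +
      (\<Sum>b\<in>X. \<Sum>k\<le>n. ker r Y k (a \<otimes> s) b * w b * ker r Y (n - k) b v)))"
  proof (intro sum_mono mult_left_mono)
    fix s assume s: "s \<in> set_pmf \<mu>"
    have "(\<phi> v - \<phi> a) * ker r Y n (a \<otimes> s) v \<le> w a * ker r Y n (a \<otimes> s) v +
      (\<Sum>b\<in>X. \<Sum>k\<le>n. ker r Y k (a \<otimes> s) b * w b * ker r Y (n - k) b v)" if "a \<otimes> s \<notin> Y"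
    proof -
      have "(\<phi> v - \<phi> (a \<otimes> s)) * ker r Y n (a \<otimes> s) v \<le>
          (\<Sum>b\<in>X. \<Sum>k\<le>n. ker r Y k (a \<otimes> s) b * w b * ker r Y (n - k) b v)"
        using Suc.prems s that by (intro Suc.IH) auto
      moreover have "(\<phi> (a \<otimes> s) - \<phi> a) * ker r Y n (a \<otimes> s) v \<le> w a * ker r Y n (a \<otimes> s) v"
        using w[of a s] Suc.prems s that r by (intro mult_right_mono) auto
      ultimately show ?thesis by (simp add: algebra_simps)
    qed
    then show "(if a \<otimes> s \<in> Y then 0 else (\<phi> v - \<phi> a) * ker r Y n (a \<otimes> s) v)
      \<le> (if a \<otimes> s \<in> Y then 0 else w a * ker r Y n (a \<otimes> s) v +
      (\<Sum>b\<in>X. \<Sum>k\<le>n. ker r Y k (a \<otimes> s) b * w b * ker r Y (n - k) b v))" by simp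
  qed (use r in auto)
  also have "\<dots> = w a * ker r Y (Suc n) a v + (\<Sum>s\<in>set_pmf \<mu>. \<Sum>b\<in>X. \<Sum>k\<le>n.
      ?q s * (if a \<otimes> s \<in> Y then 0 else ker r Y k (a \<otimes> s) b) * w b * ker r Y (n - k) b v)"
  proof -
    have *: "?q s * (if a \<otimes> s \<in> Y then 0 else
      w a * ker r Y n (a \<otimes> s) v +
      (\<Sum>b\<in>X. \<Sum>k\<le>n. ker r Y k (a \<otimes> s) b * w b * ker r Y (n - k) b v)) =
      w a * (?q s * (if a \<otimes> s \<in> Y then 0 else ker r Y n (a \<otimes> s) v)) + (\<Sum>b\<in>X. \<Sum>k\<le>n.
      ?q s * (if a \<otimes> s \<in> Y then 0 else ker r Y k (a \<otimes> s) b) * w b * ker r Y (n - k) b v)" for s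
      by (simp add: algebra_simps sum_distrib_left)
    show ?thesis unfolding * sum.distrib by (simp add: sum_distrib_left)
  qed
  also have "(\<Sum>s\<in>set_pmf \<mu>. \<Sum>b\<in>X. \<Sum>k\<le>n.
      ?q s * (if a \<otimes> s \<in> Y then 0 else ker r Y k (a \<otimes> s) b) * w b * ker r Y (n - k) b v) =
     (\<Sum>b\<in>X. \<Sum>k\<le>n. ker r Y (Suc k) a b * w b * ker r Y (n - k) b v)"
    by (subst sum.swap, rule sum.cong, simp, subst sum.swap) (simp add: sum_distrib_right)
  also have "w a * ker r Y (Suc n) a v = (\<Sum>b\<in>X. ker r Y 0 a b * w b * ker r Y (Suc n) b v)"
  proof -
    have "(\<Sum>b\<in>X. ker r Y 0 a b * w b * ker r Y (Suc n) b v)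
        = (\<Sum>b\<in>X. if b = a then w a * ker r Y (Suc n) a v else 0)"
      by (intro sum.cong) auto
    also have "\<dots> = w a * ker r Y (Suc n) a v" using X(1) aX by (simp del: ker.simps)
    finally show ?thesis by simp
  qed
  also have "(\<Sum>b\<in>X. ker r Y 0 a b * w b * ker r Y (Suc n) b v) +
      (\<Sum>b\<in>X. \<Sum>k\<le>n. ker r Y (Suc k) a b * w b * ker r Y (n - k) b v)
    = (\<Sum>b\<in>X. \<Sum>k\<le>Suc n. ker r Y k a b * w b * ker r Y (Suc n - k) b v)"
    unfolding sum.distrib[symmetric] sum.atMost_Suc_shift diff_zero diff_Suc_Suc ..
  finally show ?case .
qed

text \<open>A function \<open>\<phi>\<close> whose increment along the steps of the walk from \<open>b\<close> is at most \<open>w b\<close>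
  bounds the Green function by Green functions through the points where \<open>\<phi>\<close> varies.\<close>

lemma grn_increment:
  assumes r: "0 < r" "r < R" and a: "a \<in> carrier G - Y" and v: "v \<in> carrier G"
    and w: "\<And>b s. b \<in> carrier G - Y \<Longrightarrow> s \<in> set_pmf \<mu> \<Longrightarrow> b \<otimes> s \<notin> Y \<Longrightarrow> \<phi> (b \<otimes> s) - \<phi> b \<le> w b"
    and w0: "\<And>b. 0 \<le> w b"
    and B: "\<And>X. finite X \<Longrightarrow> X \<subseteq> carrier G - Y \<Longrightarrow> (\<Sum>b\<in>X. grn r Y a b * w b * grn r Y b v) \<le> B"
  shows "(\<phi> v - \<phi> a) * grn r Y a v \<le> B"
proof -
  have "(\<Sum>n<T. (\<phi> v - \<phi> a) * ker r Y n a v) \<le> B" for T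
  proof -
    let ?X = "reach Y T a"
    have "(\<Sum>n<T. (\<phi> v - \<phi> a) * ker r Y n a v) \<le>
        (\<Sum>n<T. \<Sum>b\<in>?X. \<Sum>k\<le>n. ker r Y k a b * w b * ker r Y (n - k) b v)"
    proof (rule sum_mono)
      fix n assume "n \<in> {..<T}"
      then show "(\<phi> v - \<phi> a) * ker r Y n a v \<le>
          (\<Sum>b\<in>?X. \<Sum>k\<le>n. ker r Y k a b * w b * ker r Y (n - k) b v)"
        using r a w w0 finite_reach reach_mono[of n T] by (intro ker_increment) auto
    qed
    also have "\<dots> = (\<Sum>b\<in>?X. w b * (\<Sum>n<T. \<Sum>k\<le>n. ker r Y k a b * ker r Y (n - k) b v))"
      by (subst sum.swap) (simp add: sum_distrib_left mult_ac)
    also have "\<dots> \<le> (\<Sum>b\<in>?X. w b * (grn r Y a b * grn r Y b v))"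
    proof (intro sum_mono mult_left_mono w0)
      fix b assume "b \<in> ?X"
      then have b: "b \<in> carrier G" using reach_subset[OF a] by blast
      have s: "(\<lambda>n. \<Sum>k\<le>n. ker r Y k a b * ker r Y (n - k) b v) sums (grn r Y a b * grn r Y b v)"
        using r a v b by (intro Cauchy_ker_sums) auto
      have "(\<Sum>n<T. \<Sum>k\<le>n. ker r Y k a b * ker r Y (n - k) b v) \<le>
          (\<Sum>n. \<Sum>k\<le>n. ker r Y k a b * ker r Y (n - k) b v)"
        using s r by (intro sum_le_suminf) (auto simp: sums_iff intro!: sum_nonneg)
      then show "(\<Sum>n<T. \<Sum>k\<le>n. ker r Y k a b * ker r Y (n - k) b v) \<le> grn r Y a b * grn r Y b v"
        using s by (simp add: sums_iff)
    qed
    also have "\<dots> \<le> B" using B[OF finite_reach reach_subset[OF a]] by (simp add: mult_ac)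
    finally show ?thesis .
  qed
  moreover have "(\<lambda>n. (\<phi> v - \<phi> a) * ker r Y n a v) sums ((\<phi> v - \<phi> a) * grn r Y a v)"
    unfolding grn_def using r a v by (intro sums_mult summable_sums summable_ker) auto
  ultimately show ?thesis
    unfolding sums_def by (intro LIMSEQ_le_const2) auto
qed

text \<open>By symmetry the sum counts loops at \<one> with a marked time, so a loop of
  \<open>n\<close> steps is counted at most n + 1 times. The bound depends on \<open>r\<close>; it
  serves only to know that the suprema below are finite.\<close>

lemma sum_grn_sq_le:
  assumes r: "0 < r" "r < R"
  shows "\<exists>B. \<forall>X. finite X \<longrightarrow> X \<subseteq> carrier G \<longrightarrow> (\<Sum>x\<in>X. (grn r {} \<one> x)\<^sup>2) \<le> B"
proof (intro exI allI impI)
  fix X assume X: "finite X" "X \<subseteq> carrier G"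
  have s: "(\<lambda>n. \<Sum>x\<in>X. \<Sum>k\<le>n. ker r {} k \<one> x * ker r {} (n - k) x \<one>) sums
      (\<Sum>x\<in>X. grn r {} \<one> x * grn r {} x \<one>)"
    using r X by (intro sums_sum Cauchy_ker_sums) auto
  have "(\<Sum>x\<in>X. (grn r {} \<one> x)\<^sup>2) = (\<Sum>x\<in>X. grn r {} \<one> x * grn r {} x \<one>)"
    using X by (intro sum.cong) (auto simp: power2_eq_square grn_sym)
  also have "\<dots> = (\<Sum>n. \<Sum>x\<in>X. \<Sum>k\<le>n. ker r {} k \<one> x * ker r {} (n - k) x \<one>)"
    using s by (simp add: sums_iff)
  also have "\<dots> \<le> (\<Sum>n. real (Suc n) * ker r {} n \<one> \<one>)"
  proof (rule suminf_le)
    fix n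
    have "(\<Sum>x\<in>X. \<Sum>k\<le>n. ker r {} k \<one> x * ker r {} (n - k) x \<one>) =
        (\<Sum>k\<le>n. \<Sum>x\<in>X. ker r {} k \<one> x * ker r {} (n - k) x \<one>)"
      by (rule sum.swap)
    also have "\<dots> \<le> (\<Sum>k\<le>n. ker r {} n \<one> \<one>)"
    proof (rule sum_mono)
      fix k assume "k \<in> {..n}"
      then show "(\<Sum>x\<in>X. ker r {} k \<one> x * ker r {} (n - k) x \<one>) \<le> ker r {} n \<one> \<one>"
        using ker_chapman[of r X "{}" k \<one> "n - k" \<one>] X r by simp
    qed
    finally show "(\<Sum>x\<in>X. \<Sum>k\<le>n. ker r {} k \<one> x * ker r {} (n - k) x \<one>)
        \<le> real (Suc n) * ker r {} n \<one> \<one>" by simp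
  qed (use s summable_Suc_mult_ker[OF r] in \<open>auto simp: sums_iff\<close>)
  finally show "(\<Sum>x\<in>X. (grn r {} \<one> x)\<^sup>2) \<le> (\<Sum>n. real (Suc n) * ker r {} n \<one> \<one>)" .
qed

end

section \<open>Groups with a hyperbolic norm\<close>

text \<open>\<open>N\<close> is the exponential of (half) a distance to the identity. The Ptolemy inequality says that
  \<open>N (a\<^sup>-\<^sup>1 b) / (N a * N b)\<close>, a visual distance seen from the identity, satisfies the triangle inequality.\<close>

locale norm_group = group G for G (structure) +
  fixes N :: "'a \<Rightarrow> real"
  assumes N_ge_1: "x \<in> carrier G \<Longrightarrow> 1 \<le> N x"
    and N_inv: "x \<in> carrier G \<Longrightarrow> N (inv x) = N x"
    and N_mult: "x \<in> carrier G \<Longrightarrow> y \<in> carrier G \<Longrightarrow> N (x \<otimes> y) \<le> N x * N y"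
    and N_ptolemy: "a \<in> carrier G \<Longrightarrow> b \<in> carrier G \<Longrightarrow> c \<in> carrier G \<Longrightarrow>
      N (inv a \<otimes> c) * N b \<le> N (inv a \<otimes> b) * N c + N (inv b \<otimes> c) * N a"
    and N_count: "\<exists>K::real. \<forall>T::real. 1 \<le> T \<longrightarrow> finite {x \<in> carrier G. N x \<le> T} \<and>
      real (card {x \<in> carrier G. N x \<le> T}) \<le> K * T ^ 3"
    and N_chain: "\<exists>C. \<forall>g\<in>carrier G. \<exists>T \<gamma>. \<gamma> 0 = \<one> \<and> \<gamma> T = g \<and> (\<forall>i\<le>T. \<gamma> i \<in> carrier G) \<and>
      (\<forall>i\<le>T. N (\<gamma> i) * N (inv (\<gamma> i) \<otimes> g) \<le> C * N g) \<and>
      (\<forall>i<T. N (inv (\<gamma> i) \<otimes> \<gamma> (Suc i)) \<le> C) \<and> real T \<le> C * (ln (N g) + 1)"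
    and N_branch: "\<exists>F c. finite F \<and> F \<subseteq> carrier G \<and> 0 < c \<and>
      (\<forall>x\<in>carrier G. \<forall>x'\<in>carrier G. \<forall>y\<in>carrier G. \<exists>a\<in>F.
         c * (N x * N y) \<le> N (x \<otimes> a \<otimes> y) \<and> c * (N x' * N y) \<le> N (x' \<otimes> a \<otimes> y))"
    and infinite_carrier: "infinite (carrier G)"
begin

definition dN :: "'a \<Rightarrow> 'a \<Rightarrow> real" where
  "dN x y = N (inv x \<otimes> y)"

text \<open>Not quite a metric: \<open>visual w a a\<close> equals \<open>N \<one>\<close> divided
  by the square of \<open>dN w a\<close>, which is positive. Hence the initial term in
  \<open>visual_path\<close>.\<close>

definition visual :: "'a \<Rightarrow> 'a \<Rightarrow> 'a \<Rightarrow> real" where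
  "visual w a b = dN a b / (dN w a * dN w b)"

definition ann :: "real \<Rightarrow> real \<Rightarrow> 'a set" where
  "ann s t = {x \<in> carrier G. s \<le> N x \<and> N x \<le> t}"

definition band :: "nat \<Rightarrow> 'a set" where
  "band q = {x \<in> carrier G. 2 ^ q \<le> N x \<and> N x < 2 ^ Suc q}"

lemma N_pos: "x \<in> carrier G \<Longrightarrow> 0 < N x"
  using N_ge_1 by fastforce

lemma dN_ge_1: "x \<in> carrier G \<Longrightarrow> y \<in> carrier G \<Longrightarrow> 1 \<le> dN x y"
  unfolding dN_def by (intro N_ge_1) auto

lemma dN_pos: "x \<in> carrier G \<Longrightarrow> y \<in> carrier G \<Longrightarrow> 0 < dN x y"
  using dN_ge_1 by fastforce

lemma dN_sym: "x \<in> carrier G \<Longrightarrow> y \<in> carrier G \<Longrightarrow> dN x y = dN y x"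
  using N_inv[of "inv x \<otimes> y"] by (simp add: dN_def inv_mult_group)

lemma dN_self: "x \<in> carrier G \<Longrightarrow> dN x x = N \<one>"
  by (simp add: dN_def)

lemma dN_one: "x \<in> carrier G \<Longrightarrow> dN \<one> x = N x"
  by (simp add: dN_def)

lemma dN_left:
  assumes "g \<in> carrier G" "x \<in> carrier G" "y \<in> carrier G"
  shows "dN (g \<otimes> x) (g \<otimes> y) = dN x y"
proof -
  have "inv (g \<otimes> x) \<otimes> (g \<otimes> y) = inv x \<otimes> (inv g \<otimes> (g \<otimes> y))"
    using assms by (simp add: inv_mult_group m_assoc)
  also have "\<dots> = inv x \<otimes> y" using assms by (simp add: m_assoc[symmetric])
  finally have "inv (g \<otimes> x) \<otimes> (g \<otimes> y) = inv x \<otimes> y" .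
  then show ?thesis by (simp add: dN_def)
qed

lemma dN_triangle:
  assumes "x \<in> carrier G" "y \<in> carrier G" "z \<in> carrier G"
  shows "dN x z \<le> dN x y * dN y z"
proof -
  have "inv x \<otimes> z = (inv x \<otimes> y) \<otimes> (inv y \<otimes> z)"
    using assms by (simp add: m_assoc) (simp add: m_assoc[symmetric])
  then show ?thesis unfolding dN_def using N_mult[of "inv x \<otimes> y" "inv y \<otimes> z"] assms by simp
qed

lemma dN_ptolemy:
  assumes "a \<in> carrier G" "b \<in> carrier G" "c \<in> carrier G" "w \<in> carrier G"
  shows "dN a c * dN w b \<le> dN a b * dN w c + dN b c * dN w a"
proof -
  have "dN (inv w \<otimes> a) (inv w \<otimes> b) = dN a b" if "a \<in> carrier G" "b \<in> carrier G" for a b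
    using dN_left[of "inv w"] that assms by simp
  then show ?thesis
    using N_ptolemy[of "inv w \<otimes> a" "inv w \<otimes> b" "inv w \<otimes> c"] assms unfolding dN_def by simp
qed

lemma visual_sym: "a \<in> carrier G \<Longrightarrow> b \<in> carrier G \<Longrightarrow> visual w a b = visual w b a"
  by (simp add: visual_def dN_sym mult.commute)

lemma visual_triangle:
  assumes "a \<in> carrier G" "b \<in> carrier G" "c \<in> carrier G" "w \<in> carrier G"
  shows "visual w a c \<le> visual w a b + visual w b c"
  using dN_ptolemy[OF assms] dN_pos[of w a] dN_pos[of w b] dN_pos[of w c] assms
  unfolding visual_def by (simp add: field_simps)

lemma visual_path:
  assumes "w \<in> carrier G" "\<And>l. l \<le> n \<Longrightarrow> x l \<in> carrier G"
  shows "visual w (x 0) (x n) \<le> visual w (x 0) (x 0) + (\<Sum>l<n. visual w (x l) (x (Suc l)))"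
  using assms(2)
proof (induction n)
  case (Suc n)
  have "visual w (x 0) (x (Suc n)) \<le> visual w (x 0) (x n) + visual w (x n) (x (Suc n))"
    using assms Suc.prems by (intro visual_triangle) auto
  with Suc show ?case by fastforce
qed auto

lemma finite_ball: "finite {x \<in> carrier G. N x \<le> T}"
proof -
  from N_count obtain K where "\<And>T::real. 1 \<le> T \<Longrightarrow> finite {x \<in> carrier G. N x \<le> T} \<and>
      real (card {x \<in> carrier G. N x \<le> T}) \<le> K * T ^ 3"
    by blast
  from this[of "max 1 T"] have "finite {x \<in> carrier G. N x \<le> max 1 T}" by simp
  then show ?thesis by (rule rev_finite_subset) auto
qed

lemma card_ball:
  obtains K :: real where "0 < K" "\<And>T::real. 1 \<le> T \<Longrightarrow> card {x \<in> carrier G. N x \<le> T} \<le> K * T ^ 3"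
proof -
  from N_count obtain K where K: "\<And>T::real. 1 \<le> T \<Longrightarrow> finite {x \<in> carrier G. N x \<le> T} \<and>
      real (card {x \<in> carrier G. N x \<le> T}) \<le> K * T ^ 3"
    by blast
  show ?thesis
  proof (rule that[of "max 1 K"])
    fix T :: real assume "1 \<le> T"
    then have "K * T ^ 3 \<le> max 1 K * T ^ 3" by (intro mult_right_mono) auto
    with K[OF \<open>1 \<le> T\<close>] show "card {x \<in> carrier G. N x \<le> T} \<le> max 1 K * T ^ 3" by linarith
  qed auto
qed

lemma finite_dN_ball:
  assumes "w \<in> carrier G"
  shows "finite {x \<in> carrier G. dN w x \<le> T}"
proof -
  have "{x \<in> carrier G. dN w x \<le> T} \<subseteq> (\<lambda>g. w \<otimes> g) ` {x \<in> carrier G. N x \<le> T}"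
  proof
    fix x assume "x \<in> {x \<in> carrier G. dN w x \<le> T}"
    then have "x = w \<otimes> (inv w \<otimes> x)" "inv w \<otimes> x \<in> {x \<in> carrier G. N x \<le> T}"
      using assms by (auto simp: dN_def m_assoc[symmetric])
    then show "x \<in> (\<lambda>g. w \<otimes> g) ` {x \<in> carrier G. N x \<le> T}" by blast
  qed
  then show ?thesis using finite_ball finite_surj by blast
qed

lemma finite_ann: "finite (ann s t)"
  unfolding ann_def by (rule finite_subset[OF _ finite_ball[of t]]) auto

lemma finite_band: "finite (band q)"
  unfolding band_def by (rule finite_subset[OF _ finite_ball[of "2 ^ Suc q"]]) auto

lemma band_exists:
  assumes "x \<in> carrier G"
  shows "x \<in> band (nat \<lfloor>log 2 (N x)\<rfloor>)"
proof -
  let ?q = "\<lfloor>log 2 (N x)\<rfloor>"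
  have q: "0 \<le> ?q" using N_ge_1[OF assms] by simp
  have "2 powr ?q \<le> N x" "N x < 2 powr (?q + 1)"
    using N_ge_1[OF assms] by (simp_all add: le_log_iff[symmetric] log_less_iff[symmetric])
  moreover have "2 powr ?q = 2 ^ nat ?q" "2 powr (?q + 1) = (2::real) ^ Suc (nat ?q)"
    using q by (simp_all add: powr_realpow[symmetric] powr_add)
  ultimately show ?thesis using assms by (auto simp: band_def)
qed

text \<open>An annulus with radii \<open>s\<close> and \<open>t\<close> meets at most log 2 (t / s)
  + 2 dyadic bands.\<close>

lemma sum_ann_le:
  fixes f :: "'a \<Rightarrow> real"
  assumes f0: "\<And>x. x \<in> carrier G \<Longrightarrow> 0 \<le> f x" and K: "\<And>q. (\<Sum>x\<in>band q. f x) \<le> K"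
    and s: "1 \<le> s" "s \<le> t" and Z: "Z \<subseteq> ann s t"
  shows "(\<Sum>x\<in>Z. f x) \<le> K * (log 2 (t / s) + 2)"
proof -
  define q where "q x = nat \<lfloor>log 2 (N x)\<rfloor>" for x
  have Zc: "Z \<subseteq> carrier G" and Zf: "finite Z"
    using Z finite_subset[OF Z finite_ann] by (auto simp: ann_def)
  have K0: "0 \<le> K"
    using order_trans[OF sum_nonneg K[of 0]] f0 by (fastforce simp: band_def)
  have "(\<Sum>x\<in>Z. f x) = (\<Sum>k\<in>q ` Z. \<Sum>x\<in>{x\<in>Z. q x = k}. f x)"
    by (rule sum.image_gen[OF Zf])
  also have "\<dots> \<le> (\<Sum>k\<in>q ` Z. K)"
  proof (rule sum_mono)
    fix k assume "k \<in> q ` Z"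
    have "(\<Sum>x\<in>{x\<in>Z. q x = k}. f x) \<le> (\<Sum>x\<in>band k. f x)"
      using Zc band_exists f0 finite_band by (intro sum_mono2) (auto simp: q_def band_def)
    then show "(\<Sum>x\<in>{x\<in>Z. q x = k}. f x) \<le> K" using K[of k] by linarith
  qed
  also have "\<dots> = K * card (q ` Z)" by simp
  also have "real (card (q ` Z)) \<le> log 2 (t / s) + 2"
  proof -
    have "q ` Z \<subseteq> {nat \<lfloor>log 2 s\<rfloor>..nat \<lfloor>log 2 t\<rfloor>}"
    proof (rule image_subsetI)
      fix x assume "x \<in> Z"
      then have "s \<le> N x" "N x \<le> t" using Z by (auto simp: ann_def)
      then have "log 2 s \<le> log 2 (N x)" "log 2 (N x) \<le> log 2 t" using s by auto
      then show "q x \<in> {nat \<lfloor>log 2 s\<rfloor>..nat \<lfloor>log 2 t\<rfloor>}"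
        unfolding q_def by (auto intro!: nat_mono floor_mono)
    qed
    then have "card (q ` Z) \<le> card {nat \<lfloor>log 2 s\<rfloor>..nat \<lfloor>log 2 t\<rfloor>}"
      by (intro card_mono) auto
    then have "real (card (q ` Z)) \<le> real (Suc (nat \<lfloor>log 2 t\<rfloor>) - nat \<lfloor>log 2 s\<rfloor>)"
      by simp
    also have "\<dots> \<le> log 2 (t / s) + 2"
    proof -
      have "0 \<le> log 2 s" "log 2 s \<le> log 2 t" "log 2 (t / s) = log 2 t - log 2 s"
        using s by (auto simp: log_divide)
      then show ?thesis by linarith
    qed
    finally show ?thesis .
  qed
  finally show ?thesis using K0 mult_left_mono by blast
qed

lemma dN_chain:
  obtains C where "1 \<le> C" "\<And>u v. u \<in> carrier G \<Longrightarrow> v \<in> carrier G \<Longrightarrow> \<exists>T \<gamma>. \<gamma> 0 = u \<and> \<gamma> T = v \<and>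
      (\<forall>i\<le>T. \<gamma> i \<in> carrier G) \<and> (\<forall>i\<le>T. dN u (\<gamma> i) * dN (\<gamma> i) v \<le> C * dN u v) \<and>
      (\<forall>i<T. dN (\<gamma> i) (\<gamma> (Suc i)) \<le> C) \<and> real T \<le> C * (ln (dN u v) + 1)"
proof -
  from N_chain obtain C where C: "\<forall>g\<in>carrier G. \<exists>T \<gamma>. \<gamma> 0 = \<one> \<and> \<gamma> T = g \<and> (\<forall>i\<le>T. \<gamma> i \<in> carrier G) \<and>
      (\<forall>i\<le>T. N (\<gamma> i) * N (inv (\<gamma> i) \<otimes> g) \<le> C * N g) \<and>
      (\<forall>i<T. N (inv (\<gamma> i) \<otimes> \<gamma> (Suc i)) \<le> C) \<and> real T \<le> C * (ln (N g) + 1)" by blast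
  show ?thesis
  proof (rule that[of "max 1 C"])
    fix u v assume uv: "u \<in> carrier G" "v \<in> carrier G"
    define g where "g = inv u \<otimes> v"
    have g: "g \<in> carrier G" "v = u \<otimes> g" using uv by (auto simp: g_def m_assoc[symmetric])
    from bspec[OF C g(1)] obtain T \<gamma> where \<gamma>: "\<gamma> 0 = \<one>" "\<gamma> T = g" "\<forall>i\<le>T. \<gamma> i \<in> carrier G"
      "\<forall>i\<le>T. dN \<one> (\<gamma> i) * dN (\<gamma> i) g \<le> C * N g" "\<forall>i<T. dN (\<gamma> i) (\<gamma> (Suc i)) \<le> C"
      "real T \<le> C * (ln (N g) + 1)" by (auto simp: dN_def)
    have Ng: "dN u v = N g" by (simp add: dN_def g_def)
    have le: "C * N g \<le> max 1 C * N g" "C * (ln (N g) + 1) \<le> max 1 C * (ln (N g) + 1)"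
      using N_ge_1[OF g(1)] by (auto intro!: mult_right_mono)
    let ?g = "\<lambda>i. u \<otimes> \<gamma> i"
    have 1: "dN u (?g i) * dN (?g i) v \<le> max 1 C * dN u v" if "i \<le> T" for i
    proof -
      have "dN u (?g i) = dN \<one> (\<gamma> i)" "dN (?g i) v = dN (\<gamma> i) g"
        using dN_left[of u \<one> "\<gamma> i"] dN_left[of u "\<gamma> i" g] uv g \<gamma>(3) that by auto
      then show ?thesis using \<gamma>(4) that le Ng by fastforce
    qed
    have 2: "dN (?g i) (?g (Suc i)) \<le> max 1 C" if "i < T" for i
    proof -
      have "\<gamma> i \<in> carrier G" "\<gamma> (Suc i) \<in> carrier G" using \<gamma>(3) that by auto
      then show ?thesis using \<gamma>(5) that uv by (auto simp: dN_left max_def intro: order_trans)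
    qed
    have "real T \<le> max 1 C * (ln (dN u v) + 1)" using \<gamma>(6) le Ng by simp
    then show "\<exists>T \<gamma>. \<gamma> 0 = u \<and> \<gamma> T = v \<and>
      (\<forall>i\<le>T. \<gamma> i \<in> carrier G) \<and> (\<forall>i\<le>T. dN u (\<gamma> i) * dN (\<gamma> i) v \<le> max 1 C * dN u v) \<and>
      (\<forall>i<T. dN (\<gamma> i) (\<gamma> (Suc i)) \<le> max 1 C) \<and> real T \<le> max 1 C * (ln (dN u v) + 1)"
      using 1 2 \<gamma>(1,2,3) uv g by (intro exI[of _ T] exI[of _ ?g]) auto
  qed auto
qed

end

section \<open>Word geodesics\<close>

locale norm_group_gen = norm_group +
  fixes S :: "'a set"
  assumes gens: "finite_symmetric_generating_set G (carrier G) S"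
begin

definition wl :: "'a \<Rightarrow> nat" where "wl g = word_metric G S \<one> g"

text \<open>Prescribes all word distances along the path, so that passing to a subsegment or to the
  reversed path is immediate; \<open>geodesic_segment_geo\<close> derives it from adjacency and the
  total length.\<close>

definition geo :: "(nat \<Rightarrow> 'a) \<Rightarrow> nat \<Rightarrow> bool" where
  "geo x m \<longleftrightarrow> (\<forall>i\<le>m. x i \<in> carrier G) \<and> (\<forall>j\<le>m. \<forall>i\<le>j. wl (inv (x i) \<otimes> x j) = j - i)"

lemma S_carrier: "s \<in> S \<Longrightarrow> s \<in> carrier G"
  and S_inv: "s \<in> S \<Longrightarrow> inv s \<in> S" and finite_S: "finite S"
  using gens by (auto simp: finite_symmetric_generating_set_def)

lemma foldl_closed: "ss \<in> lists S \<Longrightarrow> x \<in> carrier G \<Longrightarrow> foldl (\<otimes>) x ss \<in> carrier G"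
  by (induction ss arbitrary: x) (auto simp: S_carrier)

lemma foldl_left:
  "ss \<in> lists S \<Longrightarrow> x \<in> carrier G \<Longrightarrow> y \<in> carrier G \<Longrightarrow> foldl (\<otimes>) (x \<otimes> y) ss = x \<otimes> foldl (\<otimes>) y ss"
  by (induction ss arbitrary: y) (auto simp: S_carrier m_assoc)

lemma foldl_inv:
  "ss \<in> lists S \<Longrightarrow> x \<in> carrier G \<Longrightarrow> foldl (\<otimes>) \<one> (map (m_inv G) (rev ss)) = inv (foldl (\<otimes>) \<one> ss)"
proof (induction ss rule: rev_induct)
  case (snoc s ss)
  have "map (m_inv G) (rev ss) \<in> lists S" using snoc.prems S_inv by auto
  then have "foldl (\<otimes>) (inv s) (map (m_inv G) (rev ss)) = inv s \<otimes> foldl (\<otimes>) \<one> (map (m_inv G) (rev ss))"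
    using foldl_left[of _ "inv s" \<one>] snoc.prems S_carrier by auto
  then show ?case using snoc foldl_closed[of ss \<one>] S_carrier by (simp add: inv_mult_group)
qed auto

lemma word_exists:
  assumes "g \<in> carrier G"
  shows "\<exists>ss\<in>lists S. g = foldl (\<otimes>) \<one> ss"
proof -
  have "g \<in> generate G S" using gens assms by (simp add: finite_symmetric_generating_set_def)
  then show ?thesis
  proof (induction rule: generate.induct)
    case (incl h)
    then show ?case using S_carrier by (intro bexI[of _ "[h]"]) auto
  next
    case (inv h)
    then show ?case using S_carrier S_inv by (intro bexI[of _ "[inv h]"]) auto
  next
    case (eng h1 h2)
    then obtain s1 s2 where s: "s1 \<in> lists S" "h1 = foldl (\<otimes>) \<one> s1" "s2 \<in> lists S" "h2 = foldl (\<otimes>) \<one> s2"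
      by blast
    then have "foldl (\<otimes>) h1 s2 = h1 \<otimes> h2" using foldl_left[of s2 h1 \<one>] foldl_closed[of s1 \<one>] by auto
    then show ?case using s by (intro bexI[of _ "s1 @ s2"]) auto
  qed (auto intro!: bexI[of _ "[]"])
qed

lemma wl_word:
  assumes "g \<in> carrier G"
  obtains ss where "ss \<in> lists S" "length ss = wl g" "g = foldl (\<otimes>) \<one> ss"
proof -
  have "\<exists>n. \<exists>ss\<in>lists S. length ss = n \<and> g = foldl (\<otimes>) \<one> ss"
    using word_exists[OF assms] by blast
  from LeastI_ex[OF this] show ?thesis using that by (auto simp: wl_def word_metric_def)
qed

lemma wl_le:
  assumes "ss \<in> lists S"
  shows "wl (foldl (\<otimes>) \<one> ss) \<le> length ss"
  unfolding wl_def word_metric_def using assms by (intro Least_le) auto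

lemma word_metric_eq:
  assumes "x \<in> carrier G" "y \<in> carrier G"
  shows "word_metric G S x y = wl (inv x \<otimes> y)"
proof -
  have "y = foldl (\<otimes>) x ss \<longleftrightarrow> inv x \<otimes> y = foldl (\<otimes>) \<one> ss" if "ss \<in> lists S" for ss
  proof -
    have "foldl (\<otimes>) x ss = x \<otimes> foldl (\<otimes>) \<one> ss" using foldl_left[OF that assms(1), of \<one>] assms by simp
    then show ?thesis using assms foldl_closed[OF that, of \<one>]
      by (metis inv_solve_left one_closed)
  qed
  then have "(\<exists>ss\<in>lists S. length ss = n \<and> y = foldl (\<otimes>) x ss) \<longleftrightarrow>
      (\<exists>ss\<in>lists S. length ss = n \<and> inv x \<otimes> y = foldl (\<otimes>) \<one> ss)" for n by blast
  then show ?thesis unfolding wl_def word_metric_def by simp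
qed

lemma wl_one: "wl \<one> = 0"
  using wl_le[of "[]"] by simp

lemma wl_gen: "s \<in> S \<Longrightarrow> wl s \<le> 1"
  using wl_le[of "[s]"] S_carrier by simp

lemma wl_mult:
  assumes "x \<in> carrier G" "y \<in> carrier G"
  shows "wl (x \<otimes> y) \<le> wl x + wl y"
proof -
  obtain s where s: "s \<in> lists S" "length s = wl x" "x = foldl (\<otimes>) \<one> s" by (rule wl_word[OF assms(1)])
  obtain t where t: "t \<in> lists S" "length t = wl y" "y = foldl (\<otimes>) \<one> t" by (rule wl_word[OF assms(2)])
  have "foldl (\<otimes>) \<one> (s @ t) = x \<otimes> y" using s t foldl_left[OF t(1), of x \<one>] assms by simp
  then show ?thesis using wl_le[of "s @ t"] s t by auto
qed

lemma wl_inv: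
  assumes "x \<in> carrier G"
  shows "wl (inv x) = wl x"
proof -
  have "wl (inv x) \<le> wl x" if x: "x \<in> carrier G" for x
  proof -
    obtain s where s: "s \<in> lists S" "length s = wl x" "x = foldl (\<otimes>) \<one> s" by (rule wl_word[OF x])
    moreover from s S_inv have "map (m_inv G) (rev s) \<in> lists S" by auto
    ultimately show ?thesis using wl_le[of "map (m_inv G) (rev s)"] foldl_inv[of s \<one>] by simp
  qed
  from this[of x] this[of "inv x"] show ?thesis using assms by simp
qed

lemma geo_imp_carrier: "geo x m \<Longrightarrow> i \<le> m \<Longrightarrow> x i \<in> carrier G"
  by (simp add: geo_def)

lemma geo_wl: "geo x m \<Longrightarrow> i \<le> j \<Longrightarrow> j \<le> m \<Longrightarrow> wl (inv (x i) \<otimes> x j) = j - i"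
  by (simp add: geo_def)

lemma geo_rev:
  assumes "geo x m"
  shows "geo (\<lambda>i. x (m - i)) m"
  unfolding geo_def
proof (intro conjI allI impI)
  fix j i assume "j \<le> m" "i \<le> j"
  have "wl (inv (x (m - i)) \<otimes> x (m - j)) = wl (inv (inv (x (m - i)) \<otimes> x (m - j)))"
    using assms geo_imp_carrier[OF assms, of "m - i"] geo_imp_carrier[OF assms, of "m - j"]
    by (subst wl_inv) auto
  also have "\<dots> = wl (inv (x (m - j)) \<otimes> x (m - i))"
    using geo_imp_carrier[OF assms, of "m - i"] geo_imp_carrier[OF assms, of "m - j"]
    by (simp add: inv_mult_group)
  also have "\<dots> = j - i" using \<open>j \<le> m\<close> \<open>i \<le> j\<close> by (subst geo_wl[OF assms]) auto
  finally show "wl (inv (x (m - i)) \<otimes> x (m - j)) = j - i" .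
qed (use assms in \<open>auto simp: geo_def\<close>)

text \<open>The pieces before \<open>i\<close>, from \<open>i\<close> to \<open>j\<close> and after
  \<open>j\<close> are at most as long as their numbers of steps, and together they have to reach
  length \<open>m\<close>, so none can be shorter.\<close>

lemma geodesic_segment_geo:
  assumes "geodesic_segment G (carrier G) S x m"
  shows "geo x m"
proof -
  have x0: "x 0 \<in> carrier G" and st: "\<And>i. i < m \<Longrightarrow> \<exists>s\<in>S. x (Suc i) = x i \<otimes> s"
    and wm: "word_metric G S (x 0) (x m) = m"
    using assms by (auto simp: geodesic_segment_def cayley_adj_def)
  have xc: "x i \<in> carrier G" if "i \<le> m" for i
    using that
  proof (induction i)
    case (Suc i)
    then obtain s where "s \<in> S" "x (Suc i) = x i \<otimes> s" using st[of i] by auto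
    with Suc S_carrier show ?case by auto
  qed (rule x0)
  have le: "wl (inv (x i) \<otimes> x j) \<le> j - i" if "i \<le> j" "j \<le> m" for i j
    using that
  proof (induction j rule: dec_induct)
    case base
    then show ?case using xc wl_one by simp
  next
    case (step j)
    obtain s where s: "s \<in> S" "x (Suc j) = x j \<otimes> s" using st[of j] step by auto
    then have "inv (x i) \<otimes> x (Suc j) = inv (x i) \<otimes> x j \<otimes> s"
      using xc[of i] xc[of j] step S_carrier by (simp add: m_assoc)
    then have "wl (inv (x i) \<otimes> x (Suc j)) \<le> wl (inv (x i) \<otimes> x j) + wl s"
      using wl_mult[of "inv (x i) \<otimes> x j" s] xc[of i] xc[of j] step s S_carrier by simp
    then show ?case using wl_gen[OF s(1)] step by simp
  qed
  have tri: "wl (inv (x i) \<otimes> x k) \<le> wl (inv (x i) \<otimes> x j) + wl (inv (x j) \<otimes> x k)"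
    if "i \<le> m" "j \<le> m" "k \<le> m" for i j k
  proof -
    have "inv (x i) \<otimes> x k = (inv (x i) \<otimes> x j) \<otimes> (inv (x j) \<otimes> x k)"
      using xc that by (simp add: m_assoc) (simp add: m_assoc[symmetric])
    then show ?thesis using wl_mult xc that by simp
  qed
  have m: "wl (inv (x 0) \<otimes> x m) = m" using word_metric_eq[of "x 0" "x m"] xc wm by simp
  have "wl (inv (x i) \<otimes> x j) = j - i" if "i \<le> j" "j \<le> m" for i j
    using tri[of 0 i m] tri[of i j m] le[of 0 i] le[of j m] le[of i j] that m by linarith
  then show ?thesis using xc by (auto simp: geo_def)
qed

lemma geo_exists:
  assumes "g \<in> carrier G"
  obtains x where "geo x (wl g)" "x 0 = \<one>" "x (wl g) = g"
proof -
  obtain s where s: "s \<in> lists S" "length s = wl g" "g = foldl (\<otimes>) \<one> s" by (rule wl_word[OF assms])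
  define x where "x i = foldl (\<otimes>) \<one> (take i s)" for i
  have "geodesic_segment G (carrier G) S x (wl g)"
    unfolding geodesic_segment_def
  proof (intro conjI allI impI)
    show "x 0 \<in> carrier G" by (simp add: x_def)
    show "word_metric G S (x 0) (x (wl g)) = wl g" using s by (simp add: x_def wl_def)
    fix i assume "i < wl g"
    then have "x (Suc i) = x i \<otimes> s ! i" using s by (simp add: x_def take_Suc_conv_app_nth)
    then show "cayley_adj G S (x i) (x (Suc i))"
      using s \<open>i < wl g\<close> nth_mem[of i s] by (auto simp: cayley_adj_def simp del: nth_mem)
  qed
  then show ?thesis using geodesic_segment_geo s by (intro that[of x]) (auto simp: x_def)
qed

end

section \<open>Word geodesics against chains for the norm\<close>

context norm_group_gen
begin

lemma geo_shift:
  assumes "geo x m" "i \<le> j" "j \<le> m"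
  shows "geo (\<lambda>l. x (i + l)) (j - i)"
  using assms by (auto simp: geo_def)

text \<open>Submultiplicativity along a shortest word. The additional factor \<Lambda> absorbs
  \<open>N \<one>\<close>, which may exceed 1.\<close>

lemma N_le_wl:
  obtains \<Lambda> where "1 \<le> \<Lambda>" "\<And>g. g \<in> carrier G \<Longrightarrow> N g \<le> \<Lambda> ^ Suc (wl g)"
proof -
  define \<Lambda> where "\<Lambda> = Max (N ` insert \<one> S)"
  have fin: "finite (N ` insert \<one> S)" using finite_S by simp
  have L: "N s \<le> \<Lambda>" if "s \<in> insert \<one> S" for s
    unfolding \<Lambda>_def by (intro Max_ge fin imageI that)
  have L1: "1 \<le> \<Lambda>" using L[of \<one>] N_ge_1[of \<one>] by simp
  have "N (foldl (\<otimes>) x ss) \<le> N x * \<Lambda> ^ length ss" if "ss \<in> lists S" "x \<in> carrier G" for ss x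
    using that
  proof (induction ss arbitrary: x rule: list.induct)
    case (Cons s ss)
    have s: "s \<in> S" "s \<in> carrier G" "ss \<in> lists S" using Cons.prems S_carrier by auto
    have "N (foldl (\<otimes>) x (s # ss)) \<le> N (x \<otimes> s) * \<Lambda> ^ length ss"
      using Cons s by simp
    also have "\<dots> \<le> (N x * \<Lambda>) * \<Lambda> ^ length ss"
    proof (rule mult_right_mono)
      have "N (x \<otimes> s) \<le> N x * N s" using N_mult s Cons.prems by simp
      also have "\<dots> \<le> N x * \<Lambda>" using L s N_pos[OF Cons.prems(2)] by (intro mult_left_mono) auto
      finally show "N (x \<otimes> s) \<le> N x * \<Lambda>" .
    qed (use L1 in auto)
    finally show ?case by (simp add: mult_ac)
  qed auto
  note fold = this
  have "N g \<le> \<Lambda> ^ Suc (wl g)" if g: "g \<in> carrier G" for g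
  proof -
    obtain ss where ss: "ss \<in> lists S" "length ss = wl g" "g = foldl (\<otimes>) \<one> ss" by (rule wl_word[OF g])
    have "N g \<le> N \<one> * \<Lambda> ^ wl g" using fold[OF ss(1), of \<one>] ss by simp
    also have "\<dots> \<le> \<Lambda> * \<Lambda> ^ wl g" using L[of \<one>] L1 by (intro mult_right_mono) auto
    finally show ?thesis by simp
  qed
  with L1 show ?thesis by (rule that)
qed

text \<open>The chain from \<open>N_chain\<close> has O(ln N) steps, each of them an element of a
  fixed finite ball and hence of word length at most \<open>W\<close>.\<close>

lemma wl_le_ln_N:
  obtains C where "1 \<le> C" "\<And>g. g \<in> carrier G \<Longrightarrow> real (wl g) \<le> C * (ln (N g) + 1)"
proof -
  obtain C where C: "1 \<le> C" "\<And>u v. u \<in> carrier G \<Longrightarrow> v \<in> carrier G \<Longrightarrow> \<exists>T \<gamma>. \<gamma> 0 = u \<and> \<gamma> T = v \<and>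
      (\<forall>i\<le>T. \<gamma> i \<in> carrier G) \<and> (\<forall>i\<le>T. dN u (\<gamma> i) * dN (\<gamma> i) v \<le> C * dN u v) \<and>
      (\<forall>i<T. dN (\<gamma> i) (\<gamma> (Suc i)) \<le> C) \<and> real T \<le> C * (ln (dN u v) + 1)"
    by (rule dN_chain) blast
  define W where "W = Max (insert 1 (wl ` {x \<in> carrier G. N x \<le> C}))"
  have fin: "finite (insert 1 (wl ` {x \<in> carrier G. N x \<le> C}))" using finite_ball by simp
  have W: "wl g \<le> W" if "g \<in> carrier G" "N g \<le> C" for g
    unfolding W_def using that by (intro Max_ge fin) auto
  have W1: "1 \<le> W" unfolding W_def by (intro Max_ge fin) auto
  have "real (wl g) \<le> real W * C * (ln (N g) + 1)" if g: "g \<in> carrier G" for g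
  proof -
    obtain T \<gamma> where \<gamma>: "\<gamma> 0 = \<one>" "\<gamma> T = g" "\<And>i. i \<le> T \<Longrightarrow> \<gamma> i \<in> carrier G"
      "\<And>i. i < T \<Longrightarrow> dN (\<gamma> i) (\<gamma> (Suc i)) \<le> C" "real T \<le> C * (ln (dN \<one> g) + 1)"
      using C(2)[OF one_closed g] by blast
    have "wl (\<gamma> i) \<le> i * W" if "i \<le> T" for i
      using that
    proof (induction i)
      case (Suc i)
      have c: "\<gamma> i \<in> carrier G" "\<gamma> (Suc i) \<in> carrier G" using \<gamma>(3) Suc.prems by auto
      have "\<gamma> (Suc i) = \<gamma> i \<otimes> (inv (\<gamma> i) \<otimes> \<gamma> (Suc i))" using c by (simp add: m_assoc[symmetric])
      then have "wl (\<gamma> (Suc i)) \<le> wl (\<gamma> i) + wl (inv (\<gamma> i) \<otimes> \<gamma> (Suc i))"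
        using wl_mult[of "\<gamma> i" "inv (\<gamma> i) \<otimes> \<gamma> (Suc i)"] c by simp
      also have "\<dots> \<le> i * W + W"
        using Suc W[of "inv (\<gamma> i) \<otimes> \<gamma> (Suc i)"] \<gamma>(4)[of i] c by (intro add_mono) (auto simp: dN_def)
      finally show ?case by simp
    qed (use \<gamma> wl_one in simp)
    from this[of T] have "wl g \<le> T * W" using \<gamma> by simp
    then have "real (wl g) \<le> real T * real W" by (metis of_nat_le_iff of_nat_mult)
    also have "\<dots> \<le> C * (ln (N g) + 1) * real W" using \<gamma>(5) g by (intro mult_right_mono) (auto simp: dN_one)
    finally show ?thesis by (simp add: mult_ac)
  qed
  moreover have "1 \<le> real W * C" using W1 C(1) by (metis mult_mono mult_1 of_nat_1 of_nat_le_iff of_nat_0_le_iff zero_le_one)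
  ultimately show ?thesis using that by blast
qed

lemma geo_constants:
  obtains \<Lambda> C where "1 \<le> \<Lambda>" "1 \<le> C"
    "\<And>x m i j. geo x m \<Longrightarrow> i \<le> j \<Longrightarrow> j \<le> m \<Longrightarrow> dN (x i) (x j) \<le> \<Lambda> ^ Suc (j - i)"
    "\<And>x m i j. geo x m \<Longrightarrow> i \<le> j \<Longrightarrow> j \<le> m \<Longrightarrow> real (j - i) \<le> C * (ln (dN (x i) (x j)) + 1)"
proof -
  obtain \<Lambda> where L: "1 \<le> \<Lambda>" "\<And>g. g \<in> carrier G \<Longrightarrow> N g \<le> \<Lambda> ^ Suc (wl g)" by (rule N_le_wl) blast
  obtain C where C: "1 \<le> C" "\<And>g. g \<in> carrier G \<Longrightarrow> real (wl g) \<le> C * (ln (N g) + 1)"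
    by (rule wl_le_ln_N) blast
  show ?thesis
  proof (rule that[OF L(1) C(1)])
    fix x m i j assume g: "geo x m" "i \<le> j" "j \<le> m"
    then have c: "inv (x i) \<otimes> x j \<in> carrier G" using geo_imp_carrier by simp
    show "dN (x i) (x j) \<le> \<Lambda> ^ Suc (j - i)" "real (j - i) \<le> C * (ln (dN (x i) (x j)) + 1)"
      using L(2)[OF c] C(2)[OF c] geo_wl[OF g] by (simp_all add: dN_def)
  qed
qed

text \<open>A weak form of the stability of quasi-geodesics: a point of a word geodesic is at distance
  \<open>O(log m)\<close> from the chain of \<open>N_chain\<close>. Indeed, seen from a point of the chain, the end points
  are at visual distance bounded below, so that some step of the geodesic has to be close.\<close>

lemma log_morse:
  obtains C :: real and p :: nat where "1 \<le> C"
    "\<And>x m k. geo x m \<Longrightarrow> k \<le> m \<Longrightarrow> dN (x 0) (x k) * dN (x k) (x m) \<le> C * real (Suc m) ^ p * dN (x 0) (x m)"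
proof -
  obtain \<Lambda> C1 where L: "1 \<le> \<Lambda>" and C1: "1 \<le> C1" and
    dN_le: "\<And>x m i j. geo x m \<Longrightarrow> i \<le> j \<Longrightarrow> j \<le> m \<Longrightarrow> dN (x i) (x j) \<le> \<Lambda> ^ Suc (j - i)" and
    len_le: "\<And>x m i j. geo x m \<Longrightarrow> i \<le> j \<Longrightarrow> j \<le> m \<Longrightarrow> real (j - i) \<le> C1 * (ln (dN (x i) (x j)) + 1)"
    by (rule geo_constants) blast
  obtain C0 where C0: "1 \<le> C0" "\<And>u v. u \<in> carrier G \<Longrightarrow> v \<in> carrier G \<Longrightarrow> \<exists>T \<gamma>. \<gamma> 0 = u \<and> \<gamma> T = v \<and>
      (\<forall>i\<le>T. \<gamma> i \<in> carrier G) \<and> (\<forall>i\<le>T. dN u (\<gamma> i) * dN (\<gamma> i) v \<le> C0 * dN u v) \<and>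
      (\<forall>i<T. dN (\<gamma> i) (\<gamma> (Suc i)) \<le> C0) \<and> real T \<le> C0 * (ln (dN u v) + 1)"
    by (rule dN_chain) blast
  \<comment> \<open>If the geodesic stayed farther than \<open>M m\<close> from a chain point, its m
    + 1 visual increments, each at most \<Lambda>^2 / (M m)^2, would add up to 1 / (2 * C0 * M m),
    while the end points are at visual distance at least 1 / C0. \<open>B m\<close> adds the length
    of geodesic between the points attached to two consecutive chain points.\<close>
  define M where "M m = 2 * C0 * \<Lambda>\<^sup>2 * real (Suc m)" for m
  define B where "B m = M m * \<Lambda> * exp (ln \<Lambda> * (C1 * (ln (C0 * (M m)\<^sup>2) + 1)))" for m
  have M2: "2 \<le> M m" "\<Lambda> \<le> M m" for m
  proof -
    have 1: "1 * 1 * 1 \<le> C0 * \<Lambda> * real (Suc m)" and 2: "1 * 1 * 1 \<le> C0 * \<Lambda>\<^sup>2 * real (Suc m)"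
      using L C0(1) by (intro mult_mono; simp)+
    have M: "M m = 2 * (C0 * \<Lambda>\<^sup>2 * real (Suc m))" "M m = 2 * (\<Lambda> * (C0 * \<Lambda> * real (Suc m)))"
      by (simp_all only: M_def power2_eq_square mult_ac)
    show "2 \<le> M m" using 2 unfolding M(1) by linarith
    have "\<Lambda> * 1 \<le> \<Lambda> * (C0 * \<Lambda> * real (Suc m))" using 1 L by (intro mult_left_mono) auto
    then show "\<Lambda> \<le> M m" using L unfolding M(2) by linarith
  qed
  have MB: "M m \<le> B m" for m
  proof -
    have "1 \<le> C0 * (M m)\<^sup>2" using C0(1) M2(1)[of m]
      by (metis mult_mono' mult_1 one_le_power le_numeral_extra(1) one_le_numeral order_trans zero_le_one)
    then have "1 \<le> exp (ln \<Lambda> * (C1 * (ln (C0 * (M m)\<^sup>2) + 1)))"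
      using L C1 by (simp add: mult_nonneg_nonneg)
    then have "1 * 1 \<le> \<Lambda> * exp (ln \<Lambda> * (C1 * (ln (C0 * (M m)\<^sup>2) + 1)))"
      using L by (intro mult_mono) auto
    then show ?thesis using M2(1)[of m] mult_left_mono[of 1 "\<Lambda> * exp (ln \<Lambda> * (C1 * (ln (C0 * (M m)\<^sup>2) + 1)))" "M m"]
      unfolding B_def by (simp add: mult_ac)
  qed
  have key: "\<exists>g\<in>carrier G. dN (x 0) g * dN g (x m) \<le> C0 * dN (x 0) (x m) \<and> dN g (x k) \<le> B m"
    if g: "geo x m" and k: "k \<le> m" for x m k
  proof -
    note xc = geo_imp_carrier[OF g]
    obtain T \<gamma> where \<gamma>: "\<gamma> 0 = x 0" "\<gamma> T = x m" "\<And>i. i \<le> T \<Longrightarrow> \<gamma> i \<in> carrier G"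
      "\<And>i. i \<le> T \<Longrightarrow> dN (x 0) (\<gamma> i) * dN (\<gamma> i) (x m) \<le> C0 * dN (x 0) (x m)"
      "\<And>i. i < T \<Longrightarrow> dN (\<gamma> i) (\<gamma> (Suc i)) \<le> C0"
      using C0(2)[of "x 0" "x m"] xc by blast
    have near: "\<exists>l\<le>m. dN (\<gamma> t) (x l) \<le> M m" if t: "t \<le> T" for t
    proof (rule ccontr)
      let ?w = "\<gamma> t"
      assume "\<not> ?thesis"
      then have far: "M m < dN ?w (x l)" if "l \<le> m" for l using that by force
      have v: "visual ?w (x i) (x j) \<le> \<Lambda>\<^sup>2 / (M m * M m)"
        if "i \<le> m" "j \<le> m" "dN (x i) (x j) \<le> \<Lambda>\<^sup>2" for i j
        unfolding visual_def using that far[of i] far[of j] M2(1)[of m] dN_pos[of "x i" "x j"] xc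
        by (intro frac_le mult_mono mult_pos_pos) auto
      have "1 / C0 \<le> visual ?w (x 0) (x m)"
        using \<gamma>(4)[OF t] \<gamma>(3)[OF t] dN_pos[of ?w "x 0"] dN_pos[of ?w "x m"] dN_sym[of "x 0" ?w] xc C0(1)
        unfolding visual_def by (simp add: field_simps)
      also have "\<dots> \<le> visual ?w (x 0) (x 0) + (\<Sum>l<m. visual ?w (x l) (x (Suc l)))"
        using \<gamma>(3)[OF t] xc by (intro visual_path) auto
      also have "\<dots> \<le> \<Lambda>\<^sup>2 / (M m * M m) + (\<Sum>l<m. \<Lambda>\<^sup>2 / (M m * M m))"
      proof (intro add_mono sum_mono v)
        show "dN (x 0) (x 0) \<le> \<Lambda>\<^sup>2"
          using dN_le[OF g, of 0 0] L power_increasing[of 1 2 \<Lambda>] by simp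
        show "dN (x l) (x (Suc l)) \<le> \<Lambda>\<^sup>2" if "l \<in> {..<m}" for l
          using dN_le[OF g, of l "Suc l"] that by (simp add: power2_eq_square)
      qed auto
      also have "\<dots> = real (Suc m) * \<Lambda>\<^sup>2 / (M m * M m)"
        by (simp add: add_divide_distrib algebra_simps)
      also have "real (Suc m) * \<Lambda>\<^sup>2 = M m / (2 * C0)"
        using C0(1) by (simp add: M_def)
      also have "M m / (2 * C0) / (M m * M m) = 1 / (2 * C0 * M m)"
        using M2(1)[of m] C0(1) by (simp add: field_simps)
      finally have "2 * M m \<le> 1" using C0(1) M2(1)[of m] by (simp add: field_simps)
      then show False using M2(1)[of m] by simp
    qed
    then obtain l where l: "\<And>t. t \<le> T \<Longrightarrow> l t \<le> m \<and> dN (\<gamma> t) (x (l t)) \<le> M m" by metis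
    \<comment> \<open>Forcing the values 0 and \<open>m\<close> at the two ends makes the attached
      indices pass over \<open>k\<close>: at the first \<open>t\<close> with k <= l' t, the point
      \<open>x k\<close> lies on the geodesic between the points attached to t - 1 and
      \<open>t\<close>.\<close>
    define l' where "l' t = (if t = 0 then 0 else if t = T then m else l t)" for t
    have N1: "N \<one> \<le> M m" using dN_le[OF g, of 0 0] dN_self[of "x 0"] xc M2(2)[of m] by simp
    have l': "l' t \<le> m" "dN (\<gamma> t) (x (l' t)) \<le> M m" if "t \<le> T" for t
      using l[OF that] \<gamma>(1,2) xc N1 by (auto simp: l'_def dN_self)
    have T: "l' T = m"
    proof (cases "T = 0")
      case True
      then have "wl \<one> = m" using geo_wl[OF g, of 0 m] \<gamma>(1,2) xc by simp
      then show ?thesis using True wl_one by (simp add: l'_def)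
    qed (simp add: l'_def)
    define t where "t = (LEAST t. k \<le> l' t)"
    have t: "k \<le> l' t" "t \<le> T" unfolding t_def using T k by (auto intro: LeastI Least_le)
    show ?thesis
    proof (cases t)
      case 0
      then have "k = 0" using t by (simp add: l'_def)
      then have "dN (\<gamma> 0) (x k) \<le> B m" using MB[of m] N1 \<gamma>(1) xc by (simp add: dN_self)
      then show ?thesis using \<gamma>(3,4)[of 0] by auto
    next
      case (Suc t')
      have lt: "l' t' < k" using not_less_Least[of t' "\<lambda>t. k \<le> l' t"] Suc by (simp add: t_def)
      have t'T: "t' < T" using Suc t by simp
      let ?u = "l' t'" and ?v = "l' t"
      have c: "\<gamma> t' \<in> carrier G" "\<gamma> t \<in> carrier G" "x ?u \<in> carrier G" "x ?v \<in> carrier G" "x k \<in> carrier G"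
        using \<gamma>(3) xc l'(1) t t'T k by auto
      have "dN (x ?u) (x ?v) \<le> dN (x ?u) (\<gamma> t') * dN (\<gamma> t') (x ?v)"
        using c by (intro dN_triangle)
      also have "\<dots> \<le> dN (x ?u) (\<gamma> t') * (dN (\<gamma> t') (\<gamma> t) * dN (\<gamma> t) (x ?v))"
        using c dN_pos[of "x ?u" "\<gamma> t'"] by (intro mult_left_mono dN_triangle) auto
      also have "\<dots> \<le> M m * (C0 * M m)"
        using l'(2)[of t] l'(2)[of t'] t t'T \<gamma>(5)[of t'] c dN_pos M2(1)[of m] C0(1) Suc
        by (intro mult_mono mult_nonneg_nonneg) (auto simp: dN_sym[of "x ?u"] less_imp_le)
      finally have d: "dN (x ?u) (x ?v) \<le> C0 * (M m)\<^sup>2" by (simp add: power2_eq_square mult_ac)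
      have "real (?v - ?u) \<le> C1 * (ln (dN (x ?u) (x ?v)) + 1)"
        using lt t l'(1)[of t] by (intro len_le[OF g]) auto
      also have "\<dots> \<le> C1 * (ln (C0 * (M m)\<^sup>2) + 1)"
        using C1 d dN_pos[OF c(3,4)] by (intro mult_left_mono) auto
      finally have len: "real (?v - ?u) \<le> C1 * (ln (C0 * (M m)\<^sup>2) + 1)" .
      have "dN (\<gamma> t') (x k) \<le> dN (\<gamma> t') (x ?u) * dN (x ?u) (x k)"
        using c by (intro dN_triangle)
      also have "\<dots> \<le> M m * \<Lambda> ^ Suc (k - ?u)"
        using l'(2)[of t'] t'T dN_le[OF g, of ?u k] lt k dN_pos c M2(1)[of m]
        by (intro mult_mono) (auto simp: less_imp_le)
      also have "\<dots> \<le> M m * \<Lambda> ^ Suc (?v - ?u)"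
        using t L M2(1)[of m] by (intro mult_left_mono power_increasing) auto
      also have "\<dots> = M m * \<Lambda> * exp (ln \<Lambda> * real (?v - ?u))"
        using L by (simp add: exp_of_nat2_mult mult_ac)
      also have "\<dots> \<le> B m"
        unfolding B_def using len L M2(1)[of m] by (intro mult_left_mono) (auto intro!: mult_left_mono)
      finally show ?thesis using \<gamma>(3,4)[of t'] t'T by auto
    qed
  qed
  \<comment> \<open>\<open>M m\<close> is linear in m + 1, so the exponential in \<open>B m\<close>
    is a power of m + 1; the square of \<open>M m\<close> makes its exponent 2 * a.\<close>
  define a where "a = ln \<Lambda> * C1"
  have a0: "0 \<le> a" using L C1 by (simp add: a_def)
  define q where "q = nat \<lceil>2 * a\<rceil>"
  define c where "c = C0 * (2 * C0 * \<Lambda>\<^sup>2)\<^sup>2"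
  have c0: "0 < c" using C0(1) L by (simp add: c_def)
  define E where "E = 2 * C0 * \<Lambda>\<^sup>2 * \<Lambda> * exp a * exp (a * ln c)"
  have E0: "0 < E" using C0(1) L by (simp add: E_def)
  have B: "B m \<le> E * real (Suc m) ^ Suc q" for m
  proof -
    let ?s = "real (Suc m)"
    have "ln (C0 * (M m)\<^sup>2) = ln c + 2 * ln ?s"
    proof -
      have "C0 * (M m)\<^sup>2 = c * ?s\<^sup>2" by (simp add: M_def c_def power2_eq_square algebra_simps)
      then show ?thesis using c0 by (simp add: ln_mult ln_realpow)
    qed
    then have "B m = E * ?s * exp (2 * a * ln ?s)"
      by (simp add: B_def M_def E_def a_def exp_add[symmetric] algebra_simps)
    also have "exp (2 * a * ln ?s) \<le> exp (real q * ln ?s)"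
    proof -
      have "2 * a \<le> real q" unfolding q_def using a0 by linarith
      then show ?thesis by (intro iffD2[OF exp_le_cancel_iff] mult_right_mono) auto
    qed
    also have "exp (real q * ln ?s) = ?s ^ q" by (subst exp_of_nat_mult) simp
    finally show ?thesis using E0 by (simp add: mult_left_mono mult_ac)
  qed
  show ?thesis
  proof (rule that[of "max 1 (C0 * E\<^sup>2)" "2 * Suc q"])
    fix x m k assume g: "geo x m" and k: "k \<le> m"
    note xc = geo_imp_carrier[OF g]
    obtain h where h: "h \<in> carrier G" "dN (x 0) h * dN h (x m) \<le> C0 * dN (x 0) (x m)" "dN h (x k) \<le> B m"
      using key[OF g k] by blast
    have B0: "0 \<le> B m" using MB[of m] M2(1)[of m] by simp
    have "dN (x 0) (x k) * dN (x k) (x m) \<le> (dN (x 0) h * dN h (x k)) * (dN (x k) h * dN h (x m))"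
      using h xc k dN_pos by (intro mult_mono dN_triangle mult_nonneg_nonneg) (auto simp: less_imp_le)
    also have "\<dots> = (dN (x 0) h * dN h (x m)) * (dN h (x k))\<^sup>2"
      using h xc k by (simp add: dN_sym[of "x k" h] power2_eq_square)
    also have "\<dots> \<le> (C0 * dN (x 0) (x m)) * (B m)\<^sup>2"
      using h xc k dN_pos C0(1) by (intro mult_mono[OF h(2)] power_mono mult_nonneg_nonneg) (auto simp: less_imp_le)
    also have "\<dots> \<le> (C0 * dN (x 0) (x m)) * (E * real (Suc m) ^ Suc q)\<^sup>2"
      using B[of m] B0 xc dN_pos C0(1) by (intro mult_left_mono power_mono mult_nonneg_nonneg) (auto simp: less_imp_le)
    also have "\<dots> = (C0 * E\<^sup>2) * real (Suc m) ^ (2 * Suc q) * dN (x 0) (x m)"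
      by (simp only: power_mult_distrib power_mult[symmetric] mult_ac)
    also have "\<dots> \<le> max 1 (C0 * E\<^sup>2) * real (Suc m) ^ (2 * Suc q) * dN (x 0) (x m)"
      using xc dN_pos by (intro mult_right_mono) (auto simp: less_imp_le)
    finally show "dN (x 0) (x k) * dN (x k) (x m) \<le> max 1 (C0 * E\<^sup>2) * real (Suc m) ^ (2 * Suc q) * dN (x 0) (x m)" .
  qed auto
qed

end

section \<open>Branching along word geodesics\<close>

context norm_group_gen
begin

text \<open>Inserting a branching element at many points of a word geodesic produces linearly many
  different points at roughly the same distance from the identity: the insertion point can be read off
  from the distance between the new end point and the old one.\<close>

lemma branching_points:
  obtains F and c C :: real and p :: nat where "finite F" "F \<subseteq> carrier G" "0 < c" "c \<le> 1" "1 \<le> C"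
    "\<And>x m. geo x m \<Longrightarrow> x 0 = \<one> \<Longrightarrow> \<exists>I a. I \<subseteq> {..m} \<and> c * real m - C \<le> card I \<and> (\<forall>i\<in>I. a i \<in> F) \<and>
       inj_on (\<lambda>i. x i \<otimes> a i \<otimes> (inv (x i) \<otimes> x m)) I \<and>
       (\<lambda>i. x i \<otimes> a i \<otimes> (inv (x i) \<otimes> x m)) ` I \<subseteq> ann (c * N (x m)) (C * real (Suc m) ^ p * N (x m))"
proof -
  obtain \<Lambda> C1 where L: "1 \<le> \<Lambda>" and C1: "1 \<le> C1" and
    dN_le: "\<And>x m i j. geo x m \<Longrightarrow> i \<le> j \<Longrightarrow> j \<le> m \<Longrightarrow> dN (x i) (x j) \<le> \<Lambda> ^ Suc (j - i)" and
    len_le: "\<And>x m i j. geo x m \<Longrightarrow> i \<le> j \<Longrightarrow> j \<le> m \<Longrightarrow> real (j - i) \<le> C1 * (ln (dN (x i) (x j)) + 1)"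
    by (rule geo_constants) blast
  obtain C2 p where C2: "1 \<le> C2" and morse:
    "\<And>x m k. geo x m \<Longrightarrow> k \<le> m \<Longrightarrow> dN (x 0) (x k) * dN (x k) (x m) \<le> C2 * real (Suc m) ^ p * dN (x 0) (x m)"
    by (rule log_morse) blast
  obtain F c0 where F: "finite F" "F \<subseteq> carrier G" "0 < c0" and br:
      "\<And>x x' y. x \<in> carrier G \<Longrightarrow> x' \<in> carrier G \<Longrightarrow> y \<in> carrier G \<Longrightarrow> \<exists>a\<in>F.
         c0 * (N x * N y) \<le> N (x \<otimes> a \<otimes> y) \<and> c0 * (N x' * N y) \<le> N (x' \<otimes> a \<otimes> y)"
    using N_branch by blast
  define A where "A = Max (insert 1 (N ` F))"
  have A: "1 \<le> A" "\<And>a. a \<in> F \<Longrightarrow> N a \<le> A"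
    unfolding A_def using F(1) by (auto intro!: Max_ge)
  \<comment> \<open>The insertion points sit where the remaining distance \<open>h\<close> is about
    \<beta>^j, and inserting there moves the end point by a distance between c0 * h^2 and A * h^2.
    The term with c0 makes these ranges disjoint for different \<open>j\<close>; the term
    \<Lambda>^2 keeps each chosen index below \<open>m\<close>.\<close>
  define \<beta> where "\<beta> = A * \<Lambda> ^ 4 / c0 + \<Lambda>\<^sup>2 + 1"
  have b1: "1 < \<beta>" and bL: "\<Lambda>\<^sup>2 < \<beta>" and bA: "A * \<Lambda> ^ 4 < c0 * \<beta>"
  proof -
    have "0 \<le> A * \<Lambda> ^ 4 / c0" "0 < \<Lambda>\<^sup>2" using A L F(3) by auto
    then show "1 < \<beta>" "\<Lambda>\<^sup>2 < \<beta>" unfolding \<beta>_def by linarith+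
    have "c0 * \<beta> = A * \<Lambda> ^ 4 + c0 * (\<Lambda>\<^sup>2 + 1)" unfolding \<beta>_def using F(3) by (simp add: field_simps)
    moreover have "0 < c0 * (\<Lambda>\<^sup>2 + 1)" using F(3) by (intro mult_pos_pos) (auto simp: add_nonneg_pos)
    ultimately show "A * \<Lambda> ^ 4 < c0 * \<beta>" by linarith
  qed
  define c where "c = min (min 1 c0) (1 / (C1 * ln \<beta>))"
  define C where "C = max (A * C2) (1 / ln \<beta> + 1)"
  have lb: "0 < ln \<beta>" using b1 by simp
  have c: "0 < c" "c \<le> 1" "c \<le> c0" "c \<le> 1 / (C1 * ln \<beta>)" using F(3) C1 lb by (auto simp: c_def)
  have C: "1 \<le> C" "A * C2 \<le> C" "1 / ln \<beta> + 1 \<le> C" using lb by (auto simp: C_def le_max_iff_disj)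
  have main: "\<exists>I a. I \<subseteq> {..m} \<and> c * real m - C \<le> card I \<and> (\<forall>i\<in>I. a i \<in> F) \<and>
       inj_on (\<lambda>i. x i \<otimes> a i \<otimes> (inv (x i) \<otimes> x m)) I \<and>
       (\<lambda>i. x i \<otimes> a i \<otimes> (inv (x i) \<otimes> x m)) ` I \<subseteq> ann (c * N (x m)) (C * real (Suc m) ^ p * N (x m))"
    if g: "geo x m" and x0: "x 0 = \<one>" for x m
  proof -
    note xc = geo_imp_carrier[OF g]
    define y where "y i = inv (x i) \<otimes> x m" for i
    have y: "y i \<in> carrier G" "x i \<otimes> y i = x m" if "i \<le> m" for i
      using xc that by (auto simp: y_def m_assoc[symmetric])
    define h where "h i = N (y i)" for i
    have h_dN: "h i = dN (x i) (x m)" for i by (simp add: h_def y_def dN_def)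
    have h1: "1 \<le> h i" if "i \<le> m" for i unfolding h_def by (intro N_ge_1 y that)
    have h0: "h 0 = N (x m)" using xc x0 by (simp add: h_def y_def)
    have hm: "h m \<le> \<Lambda>" using dN_le[OF g, of m m] by (simp add: h_dN)
    have hS: "h i \<le> \<Lambda>\<^sup>2 * h (Suc i)" if "i < m" for i
    proof -
      have "h i \<le> dN (x i) (x (Suc i)) * h (Suc i)" unfolding h_dN using xc that by (intro dN_triangle) auto
      also have "\<dots> \<le> \<Lambda>\<^sup>2 * h (Suc i)"
        using dN_le[OF g, of i "Suc i"] that h1[of "Suc i"] by (intro mult_right_mono) (auto simp: power2_eq_square)
      finally show ?thesis .
    qed
    \<comment> \<open>One branching element serves two products with the same right factor: the
      first keeps the new end point far from \<one>, the second, a conjugate of \<open>a\<close>, is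
      the displacement from the old end point to the new one.\<close>
    have "\<exists>a\<in>F. c0 * (N (x i) * h i) \<le> N (x i \<otimes> a \<otimes> y i) \<and> c0 * (h i * h i) \<le> N (inv (y i) \<otimes> a \<otimes> y i)"
      if "i \<le> m" for i
      using br[of "x i" "inv (y i)" "y i"] xc y that N_inv by (simp add: h_def)
    then obtain a where a: "\<And>i. i \<le> m \<Longrightarrow> a i \<in> F"
      and a1: "\<And>i. i \<le> m \<Longrightarrow> c0 * (N (x i) * h i) \<le> N (x i \<otimes> a i \<otimes> y i)"
      and a2: "\<And>i. i \<le> m \<Longrightarrow> c0 * (h i * h i) \<le> N (inv (y i) \<otimes> a i \<otimes> y i)" by metis
    define z where "z i = x i \<otimes> a i \<otimes> y i" for i
    have ac: "a i \<in> carrier G" if "i \<le> m" for i using a that F(2) by auto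
    have zc: "z i \<in> carrier G" if "i \<le> m" for i using ac[OF that] xc y that by (simp add: z_def)
    have xz: "inv (x m) \<otimes> z i = inv (y i) \<otimes> a i \<otimes> y i" if "i \<le> m" for i
    proof -
      have "inv (x m) = inv (y i) \<otimes> inv (x i)" using y[OF that] xc that inv_mult_group[of "x i" "y i"] by simp
      moreover have "inv (y i) \<otimes> inv (x i) \<otimes> (x i \<otimes> a i \<otimes> y i) = inv (y i) \<otimes> (inv (x i) \<otimes> x i) \<otimes> a i \<otimes> y i"
        using y[OF that] xc[OF that] ac[OF that] by (simp only: m_assoc inv_closed m_closed)
      ultimately show ?thesis using y[OF that] xc[OF that] ac[OF that] by (simp add: z_def)
    qed
    have zup: "N (inv (x m) \<otimes> z i) \<le> A * (h i * h i)" if "i \<le> m" for i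
    proof -
      have "N (inv (y i) \<otimes> a i \<otimes> y i) \<le> N (inv (y i) \<otimes> a i) * N (y i)"
        using ac y that by (intro N_mult) auto
      also have "\<dots> \<le> N (inv (y i)) * N (a i) * N (y i)"
        using ac y that N_pos by (intro mult_right_mono N_mult) (auto simp: less_imp_le)
      also have "\<dots> \<le> h i * A * h i"
        using A(2)[OF a[OF that]] N_inv y that h1[OF that] by (auto simp: h_def intro!: mult_right_mono mult_left_mono)
      finally show ?thesis unfolding xz[OF that] by (simp add: mult_ac)
    qed
    have zann: "z i \<in> ann (c * N (x m)) (C * real (Suc m) ^ p * N (x m))" if i: "i \<le> m" for i
    proof -
      have "c * N (x m) \<le> c0 * (N (x i) * h i)"
      proof (rule mult_mono)
        show "N (x m) \<le> N (x i) * h i" using N_mult[of "x i" "y i"] xc y i by (simp add: h_def)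
      qed (use c F(3) N_pos xc in \<open>auto simp: less_imp_le\<close>)
      also have "\<dots> \<le> N (z i)" unfolding z_def by (rule a1[OF i])
      finally have 1: "c * N (x m) \<le> N (z i)" .
      have "N (z i) \<le> N (x i \<otimes> a i) * N (y i)"
        unfolding z_def using ac y xc i by (intro N_mult) auto
      also have "\<dots> \<le> N (x i) * N (a i) * N (y i)"
        using ac y xc i N_pos by (intro mult_right_mono N_mult) (auto simp: less_imp_le)
      also have "\<dots> \<le> N (x i) * A * h i"
        using A(2)[OF a[OF i]] xc i N_pos h1[OF i] by (auto simp: h_def intro!: mult_right_mono mult_left_mono less_imp_le)
      also have "\<dots> = A * (dN (x 0) (x i) * dN (x i) (x m))"
        using x0 xc i by (simp add: h_dN dN_one)
      also have "\<dots> \<le> A * (C2 * real (Suc m) ^ p * dN (x 0) (x m))"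
        using A(1) morse[OF g i] by (intro mult_left_mono) auto
      also have "\<dots> = A * C2 * (real (Suc m) ^ p * N (x m))" using x0 xc by (simp add: dN_one)
      also have "\<dots> \<le> C * (real (Suc m) ^ p * N (x m))"
        using C N_pos[OF xc[of m]] by (intro mult_right_mono mult_nonneg_nonneg) auto
      finally have "N (z i) \<le> C * (real (Suc m) ^ p * N (x m))" .
      with 1 zc[OF i] show ?thesis by (simp add: ann_def mult.assoc)
    qed
    define J where "J = nat \<lfloor>ln (N (x m)) / ln \<beta>\<rfloor>"
    \<comment> \<open>The last index with remaining distance at least \<beta>^j. One step changes
      \<open>h\<close> by a factor of at most \<Lambda>^2, so \<open>h (s j)\<close> exceeds
      \<beta>^j by less than this factor.\<close>
    define s where "s j = Max {i. i \<le> m \<and> \<beta> ^ j \<le> h i}" for j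
    have s: "s j \<le> m" "\<beta> ^ j \<le> h (s j)" "h (s j) < \<Lambda>\<^sup>2 * \<beta> ^ j" if j: "j \<in> {1..J}" for j
    proof -
      have "0 \<le> ln (N (x m)) / ln \<beta>" using N_ge_1[OF xc[of m]] lb by simp
      then have "real J \<le> ln (N (x m)) / ln \<beta>" unfolding J_def by linarith
      then have "real J * ln \<beta> \<le> ln (N (x m))" using lb by (simp add: field_simps)
      moreover have "real j * ln \<beta> \<le> real J * ln \<beta>" using j lb by (intro mult_right_mono) auto
      ultimately have "real j * ln \<beta> \<le> ln (N (x m))" by (rule order_trans[rotated])
      then have "ln (\<beta> ^ j) \<le> ln (N (x m))" using b1 by (simp add: ln_realpow)
      then have "\<beta> ^ j \<le> h 0" using b1 N_pos[OF xc[of m]] h0 by simp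
      then have ne: "0 \<in> {i. i \<le> m \<and> \<beta> ^ j \<le> h i}" by simp
      have fin: "finite {i. i \<le> m \<and> \<beta> ^ j \<le> h i}" by simp
      have "s j \<in> {i. i \<le> m \<and> \<beta> ^ j \<le> h i}"
        unfolding s_def using ne by (intro Max_in fin) auto
      then show 1: "s j \<le> m" "\<beta> ^ j \<le> h (s j)" by auto
      have bj: "\<beta> \<le> \<beta> ^ j" using j b1 power_increasing[of 1 j \<beta>] by simp
      have "s j \<noteq> m"
      proof
        assume "s j = m"
        then have "\<beta> ^ j \<le> \<Lambda>" using 1 hm by simp
        moreover have "\<Lambda> \<le> \<Lambda>\<^sup>2" using L power_increasing[of 1 2 \<Lambda>] by simp
        ultimately show False using bj bL by simp
      qed
      with 1 have lt: "s j < m" by simp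
      have "\<not> \<beta> ^ j \<le> h (Suc (s j))"
      proof
        assume "\<beta> ^ j \<le> h (Suc (s j))"
        then have "Suc (s j) \<le> s j" unfolding s_def using lt by (intro Max_ge fin) (simp add: s_def)
        then show False by simp
      qed
      then have "\<Lambda>\<^sup>2 * h (Suc (s j)) < \<Lambda>\<^sup>2 * \<beta> ^ j" using L by simp
      with hS[OF lt] show "h (s j) < \<Lambda>\<^sup>2 * \<beta> ^ j" by simp
    qed
    have neq: "z (s j) \<noteq> z (s j')" if jj: "j \<in> {1..J}" "j' \<in> {1..J}" "j < j'" for j j'
    proof
      assume eq: "z (s j) = z (s j')"
      have "c0 * (\<beta> ^ j' * \<beta> ^ j') \<le> c0 * (h (s j') * h (s j'))"
        using s[OF jj(2)] F(3) b1 by (intro mult_left_mono mult_mono) (auto intro: order_trans[OF _ s(2)[OF jj(2)]])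
      also have "\<dots> \<le> N (inv (x m) \<otimes> z (s j'))" using a2[OF s(1)[OF jj(2)]] xz[OF s(1)[OF jj(2)]] by simp
      also have "\<dots> = N (inv (x m) \<otimes> z (s j))" using eq by simp
      also have "\<dots> \<le> A * (h (s j) * h (s j))" by (rule zup[OF s(1)[OF jj(1)]])
      also have "\<dots> \<le> A * ((\<Lambda>\<^sup>2 * \<beta> ^ j) * (\<Lambda>\<^sup>2 * \<beta> ^ j))"
        using A(1) s(3)[OF jj(1)] h1[OF s(1)[OF jj(1)]] by (intro mult_left_mono mult_mono) auto
      also have "\<dots> = (A * \<Lambda> ^ 4) * (\<beta> ^ j * \<beta> ^ j)" by (simp add: power2_eq_square power4_eq_xxxx mult_ac)
      finally have 1: "c0 * (\<beta> ^ j' * \<beta> ^ j') \<le> (A * \<Lambda> ^ 4) * (\<beta> ^ j * \<beta> ^ j)" .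
      have "\<beta> * \<beta> ^ j \<le> \<beta> ^ j'" using jj b1 power_increasing[of "Suc j" j' \<beta>] by simp
      then have "(\<beta> * \<beta> ^ j) * (1 * \<beta> ^ j) \<le> \<beta> ^ j' * \<beta> ^ j'"
        using b1 jj power_increasing[of j j' \<beta>] by (intro mult_mono) auto
      then have "c0 * \<beta> * (\<beta> ^ j * \<beta> ^ j) \<le> c0 * (\<beta> ^ j' * \<beta> ^ j')" using F(3) by (simp add: mult_ac)
      with 1 have "c0 * \<beta> * (\<beta> ^ j * \<beta> ^ j) \<le> (A * \<Lambda> ^ 4) * (\<beta> ^ j * \<beta> ^ j)" by simp
      then have "c0 * \<beta> \<le> A * \<Lambda> ^ 4" using b1 by (simp add: mult_le_cancel_right)
      then show False using bA by simp
    qed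
    have inj: "inj_on (z \<circ> s) {1..J}"
    proof (rule inj_onI)
      fix j j' assume jj: "j \<in> {1..J}" "j' \<in> {1..J}" and e: "(z \<circ> s) j = (z \<circ> s) j'"
      show "j = j'" using neq[OF jj] neq[OF jj(2) jj(1)] e by (cases j j' rule: linorder_cases) auto
    qed
    show ?thesis
    proof (intro exI[of _ "s ` {1..J}"] exI[of _ a] conjI)
      show "s ` {1..J} \<subseteq> {..m}" using s by auto
      show "\<forall>i\<in>s ` {1..J}. a i \<in> F" using s a by auto
      show "inj_on (\<lambda>i. x i \<otimes> a i \<otimes> (inv (x i) \<otimes> x m)) (s ` {1..J})"
        using inj_on_imageI[OF inj] by (simp add: z_def[abs_def] y_def)
      show "(\<lambda>i. x i \<otimes> a i \<otimes> (inv (x i) \<otimes> x m)) ` s ` {1..J} \<subseteq> ann (c * N (x m)) (C * real (Suc m) ^ p * N (x m))"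
        using zann s(1) by (auto simp: z_def y_def)
      have "real m \<le> C1 * (ln (N (x m)) + 1)" using len_le[OF g, of 0 m] x0 xc by (simp add: dN_one)
      then have "real m / (C1 * ln \<beta>) \<le> (ln (N (x m)) + 1) / ln \<beta>"
        using C1 lb by (simp add: field_simps)
      moreover have "c * real m \<le> real m / (C1 * ln \<beta>)"
        using mult_right_mono[OF c(4), of "real m"] by simp
      moreover have "ln (N (x m)) / ln \<beta> - 1 \<le> real J" unfolding J_def by linarith
      ultimately have "c * real m - C \<le> real J" using C(3) by (simp add: add_divide_distrib)
      also have "real J = card (s ` {1..J})" using card_image[OF inj_on_imageI2[OF inj]] by simp
      finally show "c * real m - C \<le> card (s ` {1..J})" .
    qed
  qed
  show ?thesis
    by (rule that[OF F(1,2) c(1,2) C(1)]) (rule main)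
qed

lemma wl_unbounded: "\<exists>g\<in>carrier G. n \<le> wl g"
proof (rule ccontr)
  obtain \<Lambda> where L: "1 \<le> \<Lambda>" "\<And>g. g \<in> carrier G \<Longrightarrow> N g \<le> \<Lambda> ^ Suc (wl g)" by (rule N_le_wl) blast
  assume "\<not> ?thesis"
  then have lt: "wl g < n" if "g \<in> carrier G" for g using that not_less by blast
  have "N g \<le> \<Lambda> ^ Suc n" if "g \<in> carrier G" for g
  proof -
    have "\<Lambda> ^ Suc (wl g) \<le> \<Lambda> ^ Suc n" using lt[OF that] L(1) by (intro power_increasing) auto
    with L(2)[OF that] show ?thesis by simp
  qed
  then have "carrier G \<subseteq> {x \<in> carrier G. N x \<le> \<Lambda> ^ Suc n}" by blast
  then show False using infinite_carrier finite_ball finite_subset by blast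
qed

end

section \<open>Bounds up to the radius of convergence\<close>

context norm_group
begin

lemma sum_ann_le':
  fixes f :: "'a \<Rightarrow> real"
  assumes f0: "\<And>x. x \<in> carrier G \<Longrightarrow> 0 \<le> f x" and K: "\<And>q. (\<Sum>x\<in>band q. f x) \<le> K"
    and s: "0 < s" "s \<le> t" "1 \<le> t" and Z: "Z \<subseteq> ann s t"
  shows "(\<Sum>x\<in>Z. f x) \<le> K * (log 2 (t / s) + 2)"
proof -
  have "Z \<subseteq> ann (max 1 s) t" using Z N_ge_1 by (auto simp: ann_def)
  then have "(\<Sum>x\<in>Z. f x) \<le> K * (log 2 (t / max 1 s) + 2)"
    using s by (intro sum_ann_le f0 K) auto
  also have "\<dots> \<le> K * (log 2 (t / s) + 2)"
  proof -
    have "0 \<le> K" using order_trans[OF sum_nonneg K[of 0]] f0 by (fastforce simp: band_def)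
    moreover have "log 2 (t / max 1 s) \<le> log 2 (t / s)"
      using s by (subst log_le_cancel_iff) (auto intro!: divide_left_mono)
    ultimately show ?thesis by (intro mult_left_mono) auto
  qed
  finally show ?thesis .
qed

lemma card_close_le:
  assumes X: "X \<subseteq> carrier G" and d: "\<And>x x'. x \<in> X \<Longrightarrow> x' \<in> X \<Longrightarrow> dN x x' \<le> T"
  shows "card X \<le> card {x \<in> carrier G. N x \<le> T}"
proof (cases "X = {}")
  case False
  then obtain x0 where x0: "x0 \<in> X" by blast
  show ?thesis
  proof (rule card_inj_on_le[where f="\<lambda>x. inv x0 \<otimes> x"])
    show "inj_on (\<lambda>x. inv x0 \<otimes> x) X" using X x0 by (auto simp: inj_on_def subset_iff)
    show "(\<lambda>x. inv x0 \<otimes> x) ` X \<subseteq> {x \<in> carrier G. N x \<le> T}"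
      using X x0 d[OF x0] by (auto simp: dN_def)
  qed (rule finite_ball)
qed simp

end

locale hyp_walk = sym_walk G \<mu> R + norm_group_gen G N S
  for G (structure) and \<mu> :: "'a pmf" and R :: real and N :: "'a \<Rightarrow> real" and S :: "'a set"
begin

text \<open>By monotonicity the values at r = 1/2 bound all later ones from below; this is what the
  lower end of {1/2..<R} is for.\<close>

lemma fpg_lower_finite:
  assumes "finite F" "F \<subseteq> carrier G"
  obtains c where "0 < c" "\<And>r a. r \<in> {1/2..<R} \<Longrightarrow> a \<in> F \<Longrightarrow> c \<le> fpg r a"
proof (rule that[of "Min (insert 1 (fpg (1/2) ` F))"])
  have R: "0 < (1/2::real)" "1/2 < R" using radius_ge_1 by auto
  show "0 < Min (insert 1 (fpg (1/2) ` F))"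
    using assms fpg_pos[OF R] by (subst Min_gr_iff) auto
  fix r a assume r: "r \<in> {1/2..<R}" and a: "a \<in> F"
  have "Min (insert 1 (fpg (1/2) ` F)) \<le> fpg (1/2) a" using assms a by (intro Min_le) auto
  also have "\<dots> \<le> fpg r a" using r a assms by (intro fpg_mono) auto
  finally show "Min (insert 1 (fpg (1/2) ` F)) \<le> fpg r a" .
qed

text \<open>Backscattering: if \<open>H q\<close> is the sum over the band \<open>q\<close>, concatenation through a branching
  element gives \<open>(H q)\<^sup>2 \<le> K * Sup H\<close>; since \<open>Sup H\<close> is finite below the radius of convergence,
  \<open>Sup H \<le> K\<close>.\<close>

lemma sum_band_fpg_sq_le:
  obtains K where "0 < K" "\<And>r q. r \<in> {1/2..<R} \<Longrightarrow> (\<Sum>x\<in>band q. (fpg r x)\<^sup>2) \<le> K"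
proof -
  obtain F c where F: "finite F" "F \<subseteq> carrier G" "0 < c" and br':
      "\<And>x x' y. x \<in> carrier G \<Longrightarrow> x' \<in> carrier G \<Longrightarrow> y \<in> carrier G \<Longrightarrow> \<exists>a\<in>F.
         c * (N x * N y) \<le> N (x \<otimes> a \<otimes> y) \<and> c * (N x' * N y) \<le> N (x' \<otimes> a \<otimes> y)"
    using N_branch by blast
  have br: "\<exists>a\<in>F. c * (N x * N y) \<le> N (x \<otimes> a \<otimes> y)" if "x \<in> carrier G" "y \<in> carrier G" for x y
    using br'[OF that(1) that] by blast
  obtain cF where cF: "0 < cF" "\<And>r a. r \<in> {1/2..<R} \<Longrightarrow> a \<in> F \<Longrightarrow> cF \<le> fpg r a"
    using fpg_lower_finite[OF F(1,2)] by blast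
  define A where "A = Max (insert 1 (N ` F))"
  have A: "1 \<le> A" "\<And>a. a \<in> F \<Longrightarrow> N a \<le> A"
    unfolding A_def using F(1) by (auto intro!: Max_ge)
  \<comment> \<open>\<open>M\<close> bounds the number of pairs with the same product: their first
    components lie within 16 * A / c of each other, and the first component with its branching
    element determines the second. The logarithm in \<open>K\<close> counts the bands that the
    products can reach.\<close>
  define M where "M = card {x \<in> carrier G. N x \<le> 16 * A / c} * card F"
  define K where "K = (1 / cF\<^sup>2) * real M * (log 2 (4 * A / c) + 2)"
  have bound: "(\<Sum>x\<in>band q. (fpg r x)\<^sup>2) \<le> max 1 K" if r: "r \<in> {1/2..<R}" for r q
  proof -
    define H where "H q = (\<Sum>x\<in>band q. (fpg r x)\<^sup>2)" for q
    have r': "0 < r" "r < R" using r by auto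
    have bc: "band q \<subseteq> carrier G" for q by (auto simp: band_def)
    have H0: "0 \<le> H q" for q unfolding H_def by (intro sum_nonneg) auto
    have "\<exists>B. \<forall>q. H q \<le> B"
    proof -
      obtain B where B: "\<And>X. finite X \<Longrightarrow> X \<subseteq> carrier G \<Longrightarrow> (\<Sum>x\<in>X. (grn r {} \<one> x)\<^sup>2) \<le> B"
        using sum_grn_sq_le[OF r'] by blast
      have "H q \<le> B" for q
      proof -
        have "H q \<le> (\<Sum>x\<in>band q. (grn r {} \<one> x)\<^sup>2)"
          unfolding H_def
        proof (intro sum_mono power_mono)
          fix x assume "x \<in> band q"
          then have x: "x \<in> carrier G" using bc by blast
          have "1 * fpg r x \<le> grn r {} \<one> \<one> * fpg r x"
            using r' x grn_self_ge_1 fpg_pos[OF r' x] by (intro mult_right_mono) auto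
          then show "fpg r x \<le> grn r {} \<one> x" "0 \<le> fpg r x"
            using grn_eq_fpg[of r \<one> x] fpg_pos[OF r' x] r' x by auto
        qed
        also have "\<dots> \<le> B" by (intro B finite_band bc)
        finally show ?thesis .
      qed
      then show ?thesis by blast
    qed
    then have bdd: "bdd_above (range H)" by (auto simp: bdd_above_def)
    define s where "s = (SUP q. H q)"
    have Hs: "H q \<le> s" for q unfolding s_def by (rule cSUP_upper[OF _ bdd]) simp
    have s0: "0 \<le> s" using H0[of 0] Hs[of 0] by linarith
    have sq: "(H q)\<^sup>2 \<le> K * s" for q
    proof -
      let ?P = "band q \<times> band q"
      have "\<exists>a\<in>F. c * (N (fst p) * N (snd p)) \<le> N (fst p \<otimes> a \<otimes> snd p)" if "p \<in> ?P" for p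
        using br[of "fst p" "snd p"] that by (auto simp: band_def)
      then obtain a where a: "\<And>p. p \<in> ?P \<Longrightarrow> a p \<in> F"
        "\<And>p. p \<in> ?P \<Longrightarrow> c * (N (fst p) * N (snd p)) \<le> N (fst p \<otimes> a p \<otimes> snd p)" by metis
      define z where "z p = fst p \<otimes> a p \<otimes> snd p" for p
      have P: "fst p \<in> carrier G" "snd p \<in> carrier G" "a p \<in> carrier G" "a p \<in> F"
         "2 ^ q \<le> N (fst p)" "N (fst p) < 2 ^ Suc q" "2 ^ q \<le> N (snd p)" "N (snd p) < 2 ^ Suc q"
        if "p \<in> ?P" for p using a(1)[OF that] F(2) that by (auto simp: band_def)
      have zc: "z p \<in> carrier G" if "p \<in> ?P" for p using P[OF that] by (simp add: z_def)
      have Nz: "c * 4 ^ q \<le> N (z p)" if "p \<in> ?P" for p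
      proof -
        have "c * (2 ^ q * 2 ^ q) \<le> c * (N (fst p) * N (snd p))"
          using P[OF that] F(3) N_pos by (intro mult_left_mono mult_mono) (auto simp: less_imp_le)
        also have "\<dots> \<le> N (z p)" using a(2)[OF that] by (simp add: z_def)
        finally show ?thesis by (simp add: power_mult_distrib[symmetric])
      qed
      have Nz2: "N (inv (fst p) \<otimes> z p) \<le> A * 2 ^ Suc q" "N (z p) \<le> A * 4 ^ Suc q" if "p \<in> ?P" for p
      proof -
        have "inv (fst p) \<otimes> z p = a p \<otimes> snd p" using P[OF that] by (simp add: z_def m_assoc[symmetric])
        then have "N (inv (fst p) \<otimes> z p) \<le> N (a p) * N (snd p)" using P[OF that] N_mult by simp
        also have "\<dots> \<le> A * 2 ^ Suc q"
          using P[OF that] A N_pos by (intro mult_mono) (auto simp: less_imp_le)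
        finally show 1: "N (inv (fst p) \<otimes> z p) \<le> A * 2 ^ Suc q" .
        have "z p = fst p \<otimes> (inv (fst p) \<otimes> z p)" using P[OF that] zc[OF that] by (simp add: m_assoc[symmetric])
        then have "N (z p) \<le> N (fst p) * N (inv (fst p) \<otimes> z p)"
          using P[OF that] zc[OF that] N_mult[of "fst p" "inv (fst p) \<otimes> z p"] by simp
        also have "\<dots> \<le> 2 ^ Suc q * (A * 2 ^ Suc q)"
          using 1 P[OF that] zc[OF that] N_pos by (intro mult_mono) (auto simp: less_imp_le)
        also have "\<dots> = A * 4 ^ Suc q" by (simp add: power_mult_distrib[symmetric])
        finally show "N (z p) \<le> A * 4 ^ Suc q" .
      qed
      have mult: "card {p \<in> ?P. z p = w} \<le> M" for w
      proof -
        let ?Q = "{p \<in> ?P. z p = w}"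
        have "dN x x' \<le> 16 * A / c" if x: "x \<in> fst ` ?Q" and x': "x' \<in> fst ` ?Q" for x x'
        proof -
          obtain p where p: "p \<in> ?P" "z p = w" "x = fst p" using x by auto
          obtain p' where p': "p' \<in> ?P" "z p' = w" "x' = fst p'" using x' by auto
          have w: "w \<in> carrier G" "c * 4 ^ q \<le> N w" using zc[OF p(1)] Nz[OF p(1)] p by auto
          have d: "dN x w \<le> A * 2 ^ Suc q" "dN x' w \<le> A * 2 ^ Suc q"
            using Nz2(1)[OF p(1)] Nz2(1)[OF p'(1)] p p' by (auto simp: dN_def)
          have c: "x \<in> carrier G" "x' \<in> carrier G" using P p p' by auto
          \<comment> \<open>Ptolemy's inequality with base point \<one>: both first components lie
            on the way from \<one> to \<open>w\<close>, at the same scale 2^q, and are therefore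
            close to each other.\<close>
          have "dN x x' * N w \<le> dN x w * N x' + dN w x' * N x"
            using dN_ptolemy[of x w x' \<one>] c w by (simp add: dN_one)
          also have "\<dots> \<le> (A * 2 ^ Suc q) * 2 ^ Suc q + (A * 2 ^ Suc q) * 2 ^ Suc q"
            using d dN_sym[of w x'] P(6)[OF p(1)] P(6)[OF p'(1)] p p' c w A(1) N_pos
            by (intro add_mono mult_mono) (auto simp: less_imp_le)
          also have "\<dots> = (8 * A) * 4 ^ q"
            by (simp add: mult_ac power_mult_distrib[symmetric])
          also have "\<dots> \<le> (16 * A / c) * (c * 4 ^ q)" using A F(3) by simp
          finally have "dN x x' * N w \<le> (16 * A / c) * (c * 4 ^ q)" .
          moreover have "dN x x' * (c * 4 ^ q) \<le> dN x x' * N w"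
            using w dN_pos[OF c] by (intro mult_left_mono) auto
          ultimately have "dN x x' * (c * 4 ^ q) \<le> (16 * A / c) * (c * 4 ^ q)" by linarith
          then show ?thesis using F(3) by (simp add: field_simps)
        qed
        then have 1: "card (fst ` ?Q) \<le> card {x \<in> carrier G. N x \<le> 16 * A / c}"
          using P(1) by (intro card_close_le) auto
        have "card ?Q \<le> card (fst ` ?Q \<times> F)"
        proof (rule card_inj_on_le[where f="\<lambda>p. (fst p, a p)"])
          show "inj_on (\<lambda>p. (fst p, a p)) ?Q"
          proof (rule inj_onI)
            fix p p' assume p: "p \<in> ?Q" "p' \<in> ?Q" and e: "(fst p, a p) = (fst p', a p')"
            then have "fst p \<otimes> a p \<otimes> snd p = fst p \<otimes> a p \<otimes> snd p'" by (auto simp: z_def)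
            then have "snd p = snd p'" using P[of p] P[of p'] p by (subst (asm) Units_l_cancel) auto
            then show "p = p'" using e by (simp add: prod_eq_iff)
          qed
          show "(\<lambda>p. (fst p, a p)) ` ?Q \<subseteq> fst ` ?Q \<times> F" using P(4) by auto
          show "finite (fst ` ?Q \<times> F)" using finite_band F(1)
            by (intro finite_cartesian_product finite_imageI) (auto intro: rev_finite_subset)
        qed
        also have "\<dots> = card (fst ` ?Q) * card F" by (rule card_cartesian_product)
        also have "\<dots> \<le> M" unfolding M_def using 1 by (rule mult_right_mono) simp
        finally show ?thesis .
      qed
      have "(H q)\<^sup>2 = (\<Sum>p\<in>?P. (fpg r (fst p))\<^sup>2 * (fpg r (snd p))\<^sup>2)"
        by (simp add: H_def power2_eq_square[of "sum _ _"] sum_product sum.cartesian_product case_prod_beta)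
      also have "\<dots> \<le> (\<Sum>p\<in>?P. (1 / cF\<^sup>2) * (fpg r (z p))\<^sup>2)"
      proof (rule sum_mono)
        fix p assume p: "p \<in> ?P"
        have "cF * (fpg r (fst p) * fpg r (snd p)) \<le> fpg r (fst p) * fpg r (a p) * fpg r (snd p)"
          using cF(2)[OF r P(4)[OF p]] fpg_pos[OF r'] P[OF p]
          by (simp add: mult_ac mult_right_mono less_imp_le)
        also have "\<dots> \<le> fpg r (fst p \<otimes> a p) * fpg r (snd p)"
          using fpg_mult_le[OF r'] fpg_pos[OF r'] P[OF p] by (intro mult_right_mono) (auto simp: less_imp_le)
        also have "\<dots> \<le> fpg r (z p)" unfolding z_def using P[OF p] by (intro fpg_mult_le[OF r']) auto
        finally have "(cF * (fpg r (fst p) * fpg r (snd p)))\<^sup>2 \<le> (fpg r (z p))\<^sup>2"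
          using cF(1) fpg_pos[OF r'] P[OF p] by (intro power_mono) (auto simp: less_imp_le)
        then show "(fpg r (fst p))\<^sup>2 * (fpg r (snd p))\<^sup>2 \<le> (1 / cF\<^sup>2) * (fpg r (z p))\<^sup>2"
          using cF(1) by (simp add: field_simps)
      qed
      also have "\<dots> = (1 / cF\<^sup>2) * (\<Sum>w\<in>z ` ?P. \<Sum>p\<in>{p\<in>?P. z p = w}. (fpg r (z p))\<^sup>2)"
        unfolding sum_distrib_left[symmetric]
        by (subst sum.image_gen[of ?P _ z]) (auto intro: finite_band)
      also have "\<dots> = (1 / cF\<^sup>2) * (\<Sum>w\<in>z ` ?P. card {p\<in>?P. z p = w} * (fpg r w)\<^sup>2)" by simp
      also have "\<dots> \<le> (1 / cF\<^sup>2) * (\<Sum>w\<in>z ` ?P. real M * (fpg r w)\<^sup>2)"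
        using mult by (intro mult_left_mono sum_mono mult_right_mono) auto
      also have "\<dots> = (1 / cF\<^sup>2) * real M * (\<Sum>w\<in>z ` ?P. (fpg r w)\<^sup>2)"
        by (simp add: sum_distrib_left mult_ac)
      also have "\<dots> \<le> (1 / cF\<^sup>2) * real M * (s * (log 2 (4 * A / c) + 2))"
      proof (cases "?P = {}")
        case False
        then obtain p where p: "p \<in> ?P" by blast
        have "(\<Sum>w\<in>z ` ?P. (fpg r w)\<^sup>2) \<le> s * (log 2 ((A * 4 ^ Suc q) / (c * 4 ^ q)) + 2)"
        proof (rule sum_ann_le')
          show "(\<Sum>x\<in>band q. (fpg r x)\<^sup>2) \<le> s" for q using Hs[of q] by (simp add: H_def)
          show "c * 4 ^ q \<le> A * 4 ^ Suc q" using Nz[OF p] Nz2(2)[OF p] by linarith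
          show "1 \<le> A * 4 ^ Suc q" using Nz2(2)[OF p] N_ge_1[OF zc[OF p]] by linarith
          show "z ` ?P \<subseteq> ann (c * 4 ^ q) (A * 4 ^ Suc q)" using zc Nz Nz2 by (auto simp: ann_def)
        qed (use F(3) in auto)
        also have "(A * 4 ^ Suc q) / (c * 4 ^ q) = 4 * A / c" by simp
        finally show ?thesis by (intro mult_left_mono) auto
      next
        case True
        then have "H q = 0" by (simp add: H_def)
        have "4 * A / c \<ge> 1"
        proof -
          obtain b where b: "b \<in> F" "c * (N \<one> * N \<one>) \<le> N (\<one> \<otimes> b \<otimes> \<one>)" using br[of \<one> \<one>] by auto
          have "c * 1 \<le> c * (N \<one> * N \<one>)" using F(3) N_ge_1[of \<one>] mult_mono[of 1 "N \<one>" 1 "N \<one>"] by (intro mult_left_mono) auto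
          then have "c \<le> A" using b A(2)[of b] F(2) by auto
          then show ?thesis using F(3) A by (simp add: field_simps)
        qed
        then show ?thesis using True s0 by (simp add: mult_nonneg_nonneg)
      qed
      finally show ?thesis by (simp add: K_def mult_ac)
    qed
    \<comment> \<open>Taking the supremum on the left as well gives s^2 <= max 1 K * s; since
      \<open>s\<close> is known to be finite, it can be cancelled.\<close>
    have "s \<le> sqrt (max 1 K * s)"
      unfolding s_def
    proof (rule cSUP_least)
      fix q
      have "(H q)\<^sup>2 \<le> max 1 K * s" using sq[of q] mult_right_mono[of K "max 1 K" s] s0 by simp
      then show "H q \<le> sqrt (max 1 K * (SUP q. H q))" unfolding s_def by (rule real_le_rsqrt)
    qed simp
    then have "s\<^sup>2 \<le> max 1 K * s" using s0 by (simp add: sqrt_ge_absD)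
    then have "s \<le> max 1 K" using s0 by (cases "s = 0") (auto simp: power2_eq_square)
    then have "H q \<le> max 1 K" using Hs[of q] by linarith
    then show ?thesis by (simp add: H_def)
  qed
  show ?thesis by (rule that[of "max 1 K"]) (use bound in auto)
qed

text \<open>The walk is transient at the radius of convergence: among the many points of
  \<open>branching_points\<close> one has \<open>fpg r z \<le> 1/2\<close> by backscattering, which bounds the Green function by
  \<open>grn_one_one_le\<close>.\<close>

lemma sum_branching_le:
  obtains F and c C :: real and p :: nat where "finite F" "F \<subseteq> carrier G" "0 < c" "0 < C"
    "\<And>x m. geo x m \<Longrightarrow> x 0 = \<one> \<Longrightarrow> \<exists>I a. I \<subseteq> {..m} \<and> c * real m - C \<le> card I \<and> (\<forall>i\<in>I. a i \<in> F) \<and>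
       (\<forall>r\<in>{1/2..<R}. (\<Sum>i\<in>I. (fpg r (x i \<otimes> a i \<otimes> (inv (x i) \<otimes> x m)))\<^sup>2) \<le> C * (ln (real (Suc m)) + 1))"
proof -
  obtain F c C p where F: "finite F" "F \<subseteq> carrier G" and c: "0 < c" "c \<le> 1" and C: "1 \<le> C" and
    bp: "\<And>x m. geo x m \<Longrightarrow> x 0 = \<one> \<Longrightarrow> \<exists>I a. I \<subseteq> {..m} \<and> c * real m - C \<le> card I \<and> (\<forall>i\<in>I. a i \<in> F) \<and>
       inj_on (\<lambda>i. x i \<otimes> a i \<otimes> (inv (x i) \<otimes> x m)) I \<and>
       (\<lambda>i. x i \<otimes> a i \<otimes> (inv (x i) \<otimes> x m)) ` I \<subseteq> ann (c * N (x m)) (C * real (Suc m) ^ p * N (x m))"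
    by (rule branching_points) blast
  obtain K where K: "0 < K" "\<And>r q. r \<in> {1/2..<R} \<Longrightarrow> (\<Sum>x\<in>band q. (fpg r x)\<^sup>2) \<le> K"
    by (rule sum_band_fpg_sq_le) blast
  define D where "D = log 2 (C / c) + 2"
  define C' where "C' = max C (K * max D (real p / ln 2))"
  have D: "2 \<le> D" using C c by (simp add: D_def zero_le_log_cancel_iff)
  have bound: "K * (log 2 (C * real (Suc m) ^ p / c) + 2) \<le> C' * (ln (real (Suc m)) + 1)" for m
  proof -
    let ?l = "ln (real (Suc m))"
    have l0: "0 \<le> ?l" by simp
    have "log 2 (C * real (Suc m) ^ p / c) = log 2 (C / c) + real p * ?l / ln 2"
      using C c by (simp add: log_def ln_mult ln_div ln_realpow field_simps)
    then have "K * (log 2 (C * real (Suc m) ^ p / c) + 2) = K * (D * 1 + (real p / ln 2) * ?l)"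
      by (simp add: D_def)
    also have "\<dots> \<le> K * (max D (real p / ln 2) * 1 + max D (real p / ln 2) * ?l)"
      using K(1) l0 by (intro mult_left_mono add_mono mult_right_mono) auto
    also have "\<dots> = (K * max D (real p / ln 2)) * (?l + 1)" by (simp add: algebra_simps)
    also have "\<dots> \<le> C' * (?l + 1)" using l0 by (intro mult_right_mono) (auto simp: C'_def)
    finally show ?thesis .
  qed
  have "\<exists>I a. I \<subseteq> {..m} \<and> c * real m - C' \<le> card I \<and> (\<forall>i\<in>I. a i \<in> F) \<and>
       (\<forall>r\<in>{1/2..<R}. (\<Sum>i\<in>I. (fpg r (x i \<otimes> a i \<otimes> (inv (x i) \<otimes> x m)))\<^sup>2) \<le> C' * (ln (real (Suc m)) + 1))"
    if g: "geo x m" "x 0 = \<one>" for x m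
  proof -
    let ?z = "\<lambda>a i. x i \<otimes> a i \<otimes> (inv (x i) \<otimes> x m)"
    obtain I a where I: "I \<subseteq> {..m}" "c * real m - C \<le> card I" "\<forall>i\<in>I. a i \<in> F"
      "inj_on (?z a) I" "?z a ` I \<subseteq> ann (c * N (x m)) (C * real (Suc m) ^ p * N (x m))"
      using bp[OF g] by blast
    have xm: "x m \<in> carrier G" using geo_imp_carrier[OF g(1)] by simp
    have "(\<Sum>i\<in>I. (fpg r (?z a i))\<^sup>2) \<le> C' * (ln (real (Suc m)) + 1)" if r: "r \<in> {1/2..<R}" for r
    proof -
      have "(\<Sum>i\<in>I. (fpg r (?z a i))\<^sup>2) = (\<Sum>w\<in>?z a ` I. (fpg r w)\<^sup>2)"
        using sum.reindex[OF I(4), of "\<lambda>w. (fpg r w)\<^sup>2"] by simp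
      also have "\<dots> \<le> K * (log 2 ((C * real (Suc m) ^ p * N (x m)) / (c * N (x m))) + 2)"
      proof (rule sum_ann_le'[OF _ _ _ _ _ I(5)])
        show "(\<Sum>x\<in>band q. (fpg r x)\<^sup>2) \<le> K" for q using K(2)[OF r] .
        show "0 < c * N (x m)" using c N_pos[OF xm] by simp
        have 1: "1 * 1 \<le> C * real (Suc m) ^ p" using C one_le_power[of "real (Suc m)" p] by (intro mult_mono) auto
        then have "c * N (x m) \<le> 1 * N (x m)" "1 * N (x m) \<le> C * real (Suc m) ^ p * N (x m)"
          using c N_pos[OF xm] by (auto intro!: mult_right_mono)
        then show "c * N (x m) \<le> C * real (Suc m) ^ p * N (x m)" "1 \<le> C * real (Suc m) ^ p * N (x m)"
          using N_ge_1[OF xm] by linarith+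
      qed auto
      also have "(C * real (Suc m) ^ p * N (x m)) / (c * N (x m)) = C * real (Suc m) ^ p / c"
        using N_pos[OF xm] by simp
      also note bound
      finally show ?thesis .
    qed
    moreover have "c * real m - C' \<le> card I" using I(2) by (auto simp: C'_def)
    ultimately show ?thesis using I(1,3) by (intro exI[of _ I] exI[of _ a]) auto
  qed
  moreover have "0 < C'" using C by (simp add: C'_def)
  ultimately show ?thesis using that[of F c C' ] F c(1) by blast
qed

text \<open>The length \<open>m\<close>, the geodesic and the branching points are fixed before
  \<open>r\<close>; only the point with a small value of \<open>fpg\<close> may change with
  \<open>r\<close>. As there are finitely many candidates, the maximum of their constants serves for
  all \<open>r\<close>.\<close>

lemma grn_bounded:
  obtains K where "1 \<le> K" "\<And>r x y Y. r \<in> {1/2..<R} \<Longrightarrow> x \<in> carrier G \<Longrightarrow> y \<in> carrier G \<Longrightarrow> grn r Y x y \<le> K"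
proof -
  obtain F c C and p :: nat where F: "finite F" "F \<subseteq> carrier G" and c: "0 < c" and C: "0 < C" and
    bp: "\<And>x m. geo x m \<Longrightarrow> x 0 = \<one> \<Longrightarrow> \<exists>I a. I \<subseteq> {..m} \<and> c * real m - C \<le> card I \<and> (\<forall>i\<in>I. a i \<in> F) \<and>
       (\<forall>r\<in>{1/2..<R}. (\<Sum>i\<in>I. (fpg r (x i \<otimes> a i \<otimes> (inv (x i) \<otimes> x m)))\<^sup>2) \<le> C * (ln (real (Suc m)) + 1))"
    by (rule sum_branching_le) blast
  have "eventually (\<lambda>m. 4 * (C * (ln (real (Suc m)) + 1)) < c * real m - C) sequentially"
    using c C by real_asymp
  then obtain m0 where m0: "\<And>m. m0 \<le> m \<Longrightarrow> 4 * (C * (ln (real (Suc m)) + 1)) < c * real m - C"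
    by (auto simp: eventually_sequentially)
  obtain g where g: "g \<in> carrier G" "m0 \<le> wl g" using wl_unbounded by blast
  define m where "m = wl g"
  obtain x where x: "geo x m" "x 0 = \<one>" using geo_exists[OF g(1)] unfolding m_def by metis
  define z where "z a i = x i \<otimes> a i \<otimes> (inv (x i) \<otimes> x m)" for a i
  obtain I a where I: "I \<subseteq> {..m}" "c * real m - C \<le> card I" "\<forall>i\<in>I. a i \<in> F"
    and sm: "\<forall>r\<in>{1/2..<R}. (\<Sum>i\<in>I. (fpg r (z a i))\<^sup>2) \<le> C * (ln (real (Suc m)) + 1)"
    using bp[OF x] unfolding z_def by blast
  have R: "0 < (1/2::real)" "1/2 < R" using radius_ge_1 by auto
  have zc: "z a i \<in> carrier G" if "i \<in> I" for i
  proof -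
    have "a i \<in> carrier G" "x i \<in> carrier G" "x m \<in> carrier G"
      using I that F(2) geo_imp_carrier[OF x(1)] by auto
    then show ?thesis by (simp add: z_def)
  qed
  have "\<exists>K. \<forall>r\<in>{1/2..<R}. z a i \<noteq> \<one> \<longrightarrow> grn r {} \<one> \<one> * (1 - (fpg r (z a i))\<^sup>2) \<le> K" if "i \<in> I" for i
    using grn_one_one_le[OF R zc[OF that]] by blast
  then obtain K where K: "\<And>i r. i \<in> I \<Longrightarrow> r \<in> {1/2..<R} \<Longrightarrow> z a i \<noteq> \<one> \<Longrightarrow>
      grn r {} \<one> \<one> * (1 - (fpg r (z a i))\<^sup>2) \<le> K i" by metis
  define B where "B = Max (insert 1 (K ` I))"
  have If: "finite I" using I(1) finite_subset by blast
  have B: "1 \<le> B" "\<And>i. i \<in> I \<Longrightarrow> K i \<le> B" unfolding B_def using If by (auto intro!: Max_ge)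
  have main: "grn r {} \<one> \<one> \<le> 2 * B" if r: "r \<in> {1/2..<R}" for r
  proof -
    have r': "0 < r" "r < R" using r by auto
    have "\<exists>i\<in>I. (fpg r (z a i))\<^sup>2 < 1 / 4"
    proof (rule ccontr)
      assume "\<not> ?thesis"
      then have "(\<Sum>i\<in>I. 1 / 4) \<le> (\<Sum>i\<in>I. (fpg r (z a i))\<^sup>2)" by (intro sum_mono) (auto simp: not_less)
      also have "\<dots> \<le> C * (ln (real (Suc m)) + 1)" using sm r by blast
      finally have "real (card I) \<le> 4 * (C * (ln (real (Suc m)) + 1))" by simp
      then show False using I(2) m0[of m] g(2) by (simp add: m_def)
    qed
    then obtain i where i: "i \<in> I" "(fpg r (z a i))\<^sup>2 < 1 / 4" by blast
    have "z a i \<noteq> \<one>" using i(2) fpg_one[OF r'] by auto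
    then have "grn r {} \<one> \<one> * (1 - (fpg r (z a i))\<^sup>2) \<le> B" using K[OF i(1) r] B(2)[OF i(1)] by simp
    moreover have "grn r {} \<one> \<one> * (1 / 2) \<le> grn r {} \<one> \<one> * (1 - (fpg r (z a i))\<^sup>2)"
      using i(2) grn_pos[OF r' one_closed one_closed] by (intro mult_left_mono) auto
    ultimately show ?thesis by simp
  qed
  show ?thesis
  proof (rule that[of "2 * B"])
    show "1 \<le> 2 * B" using B(1) by simp
    fix r x y Y assume a: "r \<in> {1/2..<R}" "x \<in> carrier G" "y \<in> carrier G"
    then have "grn r Y x y \<le> grn r {} \<one> \<one>" by (intro grn_le_one_one) auto
    with main[OF a(1)] show "grn r Y x y \<le> 2 * B" by linarith
  qed
qed

end

section \<open>Walks avoiding a ball\<close>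

context hyp_walk
begin

text \<open>By Cauchy-Schwarz on each band, the number of points of the band, at most the cube of its
  radius, loses against the weight \<open>1 / (dN w b)\<^sup>2\<close>.\<close>

lemma sum_grn_weighted_le:
  obtains A where "1 \<le> A" "\<And>r w a \<eta> \<rho> X. r \<in> {1/2..<R} \<Longrightarrow> w \<in> carrier G \<Longrightarrow> a \<in> carrier G \<Longrightarrow>
    0 < \<eta> \<Longrightarrow> \<eta> \<le> 1 \<Longrightarrow> 1 \<le> \<rho> \<Longrightarrow> finite X \<Longrightarrow> X \<subseteq> carrier G \<Longrightarrow>
    (\<And>b. b \<in> X \<Longrightarrow> \<rho> < dN w b \<and> \<eta> \<le> visual w a b) \<Longrightarrow>
    (\<Sum>b\<in>X. grn r {} a b / (dN w b)\<^sup>2) \<le> sqrt (A / (\<eta> * \<rho>))"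
proof -
  obtain K where K: "0 < K" "\<And>r q. r \<in> {1/2..<R} \<Longrightarrow> (\<Sum>x\<in>band q. (fpg r x)\<^sup>2) \<le> K"
    by (rule sum_band_fpg_sq_le) blast
  obtain L where L: "1 \<le> L" "\<And>r x y Y. r \<in> {1/2..<R} \<Longrightarrow> x \<in> carrier G \<Longrightarrow> y \<in> carrier G \<Longrightarrow> grn r Y x y \<le> L"
    by (rule grn_bounded) blast
  obtain D :: real where D: "0 < D" "\<And>T::real. 1 \<le> T \<Longrightarrow> card {x \<in> carrier G. N x \<le> T} \<le> D * T ^ 3"
    by (rule card_ball) blast
  define A where "A = max 1 (8 * D * (L\<^sup>2 * (K * 10)) * 32)"
  have main: "(\<Sum>b\<in>X. grn r {} a b / (dN w b)\<^sup>2) \<le> sqrt (A / (\<eta> * \<rho>))"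
    if r: "r \<in> {1/2..<R}" and w: "w \<in> carrier G" and a: "a \<in> carrier G" and eta: "0 < \<eta>" "\<eta> \<le> 1"
    and rho: "1 \<le> \<rho>" and X: "finite X" "X \<subseteq> carrier G"
    and XX: "\<And>b. b \<in> X \<Longrightarrow> \<rho> < dN w b \<and> \<eta> \<le> visual w a b" for r w a \<eta> \<rho> X
  proof -
    have r': "0 < r" "r < R" using r by auto
    \<comment> \<open>On the band 2^q about \<open>w\<close> Cauchy-Schwarz gives sqrt (8 ^ q) from
      the number of points against the weight 4 ^ (- q), so the bands decay like \<theta> ^
      q.\<close>
    define \<theta> where "\<theta> = sqrt (1 / 2)"
    have th: "0 < \<theta>" "\<theta> \<le> 3 / 4" "\<theta>\<^sup>2 = 1 / 2"
    proof -
      show "0 < \<theta>" "\<theta>\<^sup>2 = 1 / 2" by (simp_all add: \<theta>_def)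
      show "\<theta> \<le> 3 / 4" unfolding \<theta>_def by (rule real_le_lsqrt) (auto simp: power2_eq_square)
    qed
    define Q where "Q = sqrt (8 * D * (L\<^sup>2 * (K * 10)) / \<eta>)"
    have Q0: "0 \<le> Q" using D(1) K(1) eta by (simp add: Q_def)
    define k where "k b = nat \<lfloor>log 2 (dN w b)\<rfloor>" for b
    have k: "2 ^ k b \<le> dN w b" "dN w b < 2 ^ Suc (k b)" if "b \<in> X" for b
      using band_exists[of "inv w \<otimes> b"] that X w by (auto simp: k_def dN_def band_def)
    have band: "(\<Sum>b\<in>{b\<in>X. k b = q}. grn r {} a b / (dN w b)\<^sup>2) \<le> Q * \<theta> ^ q" for q
    proof -
      let ?X = "{b\<in>X. k b = q}"
      have fin: "finite ?X" using X by simp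
      have cardX: "real (card ?X) \<le> 8 * D * 8 ^ q"
      proof -
        have "card ?X \<le> card {x \<in> carrier G. N x \<le> 2 ^ Suc q}"
        proof (rule card_inj_on_le[where f="\<lambda>x. inv w \<otimes> x"])
          show "inj_on (\<lambda>x. inv w \<otimes> x) ?X" using X w by (auto simp: inj_on_def subset_iff)
          show "(\<lambda>x. inv w \<otimes> x) ` ?X \<subseteq> {x \<in> carrier G. N x \<le> 2 ^ Suc q}"
            using k X w by (fastforce simp: dN_def)
        qed (rule finite_ball)
        then have "real (card ?X) \<le> real (card {x \<in> carrier G. N x \<le> 2 ^ Suc q})" by (rule of_nat_mono)
        also have "\<dots> \<le> D * (2 ^ Suc q) ^ 3" by (intro D(2) one_le_power) simp
        also have "(2 ^ Suc q) ^ 3 = ((2::real) ^ 3) ^ Suc q" by (metis power_mult mult.commute)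
        finally show ?thesis by simp
      qed
      \<comment> \<open>The visual angle \<eta> confines dN a b between \<eta> * dN w a * dN w b and
        dN w a * dN w b. Seen from \<open>a\<close>, the band about \<open>w\<close> is thus
        contained in an annulus with ratio of radii 2 / \<eta>.\<close>
      have sq: "(\<Sum>b\<in>?X. (grn r {} a b)\<^sup>2) \<le> L\<^sup>2 * (K * 10 / \<eta>)"
      proof (cases "?X = {}")
        case False
        then obtain b0 where b0: "b0 \<in> X" "k b0 = q" by blast
        let ?s = "\<eta> * (dN w a * 2 ^ q)" and ?t = "dN w a * 2 ^ Suc q"
        have wa: "0 < dN w a" using dN_pos w a by simp
        have "(\<Sum>b\<in>?X. (grn r {} a b)\<^sup>2) = (\<Sum>b\<in>?X. (grn r {} \<one> \<one>)\<^sup>2 * (fpg r (inv a \<otimes> b))\<^sup>2)"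
          using X a r' by (intro sum.cong) (auto simp: grn_eq_fpg[of r a] power_mult_distrib)
        also have "\<dots> \<le> (\<Sum>b\<in>?X. L\<^sup>2 * (fpg r (inv a \<otimes> b))\<^sup>2)"
          using L(2)[OF r, of \<one> \<one>] grn_pos[OF r', of \<one> \<one>]
          by (intro sum_mono mult_right_mono power_mono) auto
        also have "\<dots> = L\<^sup>2 * (\<Sum>x\<in>(\<lambda>b. inv a \<otimes> b) ` ?X. (fpg r x)\<^sup>2)"
          using X a by (subst sum.reindex) (auto simp: inj_on_def subset_iff sum_distrib_left)
        also have "\<dots> \<le> L\<^sup>2 * (K * (log 2 (?t / ?s) + 2))"
        proof (intro mult_left_mono sum_ann_le')
          show "0 < ?s" using eta wa by simp
          show "?s \<le> ?t" using eta wa by (simp add: mult_ac mult_le_cancel_left)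
          show "1 \<le> ?t" using mult_mono[of 1 "dN w a" 1 "2 ^ Suc q"] dN_ge_1 w a wa
            by (simp add: one_le_power del: power_Suc)
          show "(\<lambda>b. inv a \<otimes> b) ` ?X \<subseteq> ann ?s ?t"
          proof (rule image_subsetI)
            fix b assume b: "b \<in> ?X"
            then have bc: "b \<in> carrier G" using X by auto
            have wb: "2 ^ q \<le> dN w b" "dN w b \<le> 2 ^ Suc q" using k[of b] b by auto
            have "\<eta> * (dN w a * dN w b) \<le> dN a b"
              using XX[of b] b wa dN_pos[OF w bc] by (auto simp: visual_def field_simps)
            moreover have "?s \<le> \<eta> * (dN w a * dN w b)" using eta wa wb by (intro mult_left_mono) auto
            moreover have "dN a b \<le> dN w a * dN w b"
              using dN_triangle[OF a w bc] dN_sym[OF a w] by simp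
            moreover have "dN w a * dN w b \<le> ?t" using wa wb by (intro mult_left_mono) auto
            ultimately show "inv a \<otimes> b \<in> ann ?s ?t" using a bc by (auto simp: ann_def dN_def)
          qed
        qed (use K(2)[OF r] in auto)
        also have "?t / ?s = 2 / \<eta>" using wa eta by simp
        also have "L\<^sup>2 * (K * (log 2 (2 / \<eta>) + 2)) \<le> L\<^sup>2 * (K * 10 / \<eta>)"
        proof -
          have "ln (2 / \<eta>) \<le> 2 / \<eta>" using eta ln_le_minus_one[of "2 / \<eta>"] by simp
          moreover have "1 / 2 \<le> ln (2::real)" using ln2_ge_two_thirds by simp
          moreover have "0 \<le> ln (2 / \<eta>)" using eta by simp
          ultimately have "ln (2 / \<eta>) / ln 2 \<le> (2 / \<eta>) / (1 / 2)" using eta by (intro frac_le) auto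
          then have "log 2 (2 / \<eta>) + 2 \<le> 4 / \<eta> + 2" by (simp add: log_def)
          also have "\<dots> \<le> 10 / \<eta>" using eta by (simp add: field_simps)
          finally have "K * (log 2 (2 / \<eta>) + 2) \<le> K * (10 / \<eta>)" using K(1) by (intro mult_left_mono) auto
          then show ?thesis by (intro mult_left_mono) auto
        qed
        finally show ?thesis .
      next
        case True
        show ?thesis unfolding True using K(1) eta by simp
      qed
      have "(\<Sum>b\<in>?X. grn r {} a b)\<^sup>2 \<le> (\<Sum>b\<in>?X. (grn r {} a b)\<^sup>2) * card ?X"
        by (rule sum_squared_le_sum_of_squares)
      also have "\<dots> \<le> (L\<^sup>2 * (K * 10 / \<eta>)) * (8 * D * 8 ^ q)"
        using sq cardX K(1) eta by (intro mult_mono) auto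
      also have "\<dots> = (Q * (\<theta> ^ q * 4 ^ q))\<^sup>2"
      proof -
        have "(\<theta> ^ q * 4 ^ q)\<^sup>2 = ((\<theta> * 4)\<^sup>2) ^ q"
          by (metis power_mult mult.commute power_mult_distrib)
        then have "(\<theta> ^ q * 4 ^ q)\<^sup>2 = 8 ^ q" by (simp add: th power_mult_distrib)
        moreover have "Q\<^sup>2 = 8 * D * (L\<^sup>2 * (K * 10)) / \<eta>" using D(1) K(1) eta by (simp add: Q_def)
        ultimately show ?thesis by (simp add: power_mult_distrib)
      qed
      finally have "(\<Sum>b\<in>?X. grn r {} a b) \<le> Q * (\<theta> ^ q * 4 ^ q)"
        by (rule power2_le_imp_le) (use Q0 th in auto)
      have "(\<Sum>b\<in>?X. grn r {} a b / (dN w b)\<^sup>2) \<le> (\<Sum>b\<in>?X. grn r {} a b / 4 ^ q)"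
      proof (rule sum_mono)
        fix b assume b: "b \<in> ?X"
        have "(2 ^ q)\<^sup>2 \<le> (dN w b)\<^sup>2" using k[of b] b by (intro power_mono) auto
        moreover have "(2 ^ q)\<^sup>2 = (4::real) ^ q" by (simp add: power2_eq_square power_mult_distrib[symmetric])
        ultimately show "grn r {} a b / (dN w b)\<^sup>2 \<le> grn r {} a b / 4 ^ q"
          using b X a r' dN_pos[OF w, of b]
          by (intro divide_left_mono grn_nonneg mult_pos_pos zero_less_power) auto
      qed
      also have "\<dots> = (\<Sum>b\<in>?X. grn r {} a b) / 4 ^ q" by (simp add: sum_divide_distrib)
      also have "\<dots> \<le> (Q * (\<theta> ^ q * 4 ^ q)) / 4 ^ q"
        using \<open>(\<Sum>b\<in>?X. grn r {} a b) \<le> Q * (\<theta> ^ q * 4 ^ q)\<close> by (intro divide_right_mono) auto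
      finally show ?thesis by simp
    qed
    define q0 where "q0 = nat \<lfloor>log 2 \<rho>\<rfloor>"
    have q0: "\<rho> < 2 ^ Suc q0"
    proof -
      have "log 2 \<rho> < real (Suc q0)" unfolding q0_def using rho by linarith
      then show ?thesis using rho by (simp add: log_less_iff powr_realpow[symmetric] del: power_Suc of_nat_Suc)
    qed
    have kq: "q0 \<le> k b" if "b \<in> X" for b
      unfolding k_def q0_def using XX[OF that] rho by (intro nat_mono floor_mono) auto
    have "(\<Sum>b\<in>X. grn r {} a b / (dN w b)\<^sup>2) = (\<Sum>q\<in>k ` X. \<Sum>b\<in>{b\<in>X. k b = q}. grn r {} a b / (dN w b)\<^sup>2)"
      by (rule sum.image_gen[OF X(1)])
    also have "\<dots> \<le> (\<Sum>q\<in>k ` X. Q * \<theta> ^ q)" by (intro sum_mono band)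
    also have "\<dots> \<le> (\<Sum>q\<in>{q0..q0 + Max (insert 0 (k ` X))}. Q * \<theta> ^ q)"
    proof (rule sum_mono2)
      show "k ` X \<subseteq> {q0..q0 + Max (insert 0 (k ` X))}"
      proof (rule image_subsetI)
        fix b assume "b \<in> X"
        then have "k b \<le> Max (insert 0 (k ` X))" using X(1) by (intro Max_ge) auto
        then show "k b \<in> {q0..q0 + Max (insert 0 (k ` X))}" using kq[OF \<open>b \<in> X\<close>] by simp
      qed
    qed (use Q0 th in auto)
    also have "\<dots> = Q * \<theta> ^ q0 * (\<Sum>q\<le>Max (insert 0 (k ` X)). \<theta> ^ q)"
    proof -
      have "(\<Sum>q\<in>{q0..q0 + n}. Q * \<theta> ^ q) = (\<Sum>q\<le>n. Q * \<theta> ^ (q0 + q))" for n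
        by (rule sum.reindex_bij_witness[where i="\<lambda>q. q0 + q" and j="\<lambda>q. q - q0"]) auto
      then show ?thesis by (simp add: power_add sum_distrib_left mult_ac)
    qed
    also have "\<dots> \<le> Q * \<theta> ^ q0 * 4"
    proof (rule mult_left_mono)
      have "(\<Sum>q\<le>n. \<theta> ^ q) \<le> 4" for n
      proof -
        have "(\<Sum>q\<le>n. \<theta> ^ q) = (1 - \<theta> ^ Suc n) / (1 - \<theta>)" using th by (simp add: sum_gp0)
        also have "\<dots> \<le> 1 / (1 / 4)" using th by (intro frac_le) auto
        finally show ?thesis by simp
      qed
      then show "(\<Sum>q\<le>Max (insert 0 (k ` X)). \<theta> ^ q) \<le> 4" .
    qed (use Q0 th in auto)
    also have "\<dots> \<le> sqrt (A / (\<eta> * \<rho>))"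
    proof (rule real_le_rsqrt)
      have "(\<theta> ^ q0)\<^sup>2 = (1 / 2) ^ q0" using th(3) by (metis power_mult mult.commute)
      also have "\<dots> \<le> 2 / \<rho>" using q0 rho by (simp add: field_simps)
      finally have t: "(\<theta> ^ q0)\<^sup>2 \<le> 2 / \<rho>" .
      have "(Q * \<theta> ^ q0 * 4)\<^sup>2 = Q\<^sup>2 * (\<theta> ^ q0)\<^sup>2 * 16" by (simp add: power_mult_distrib)
      also have "\<dots> \<le> Q\<^sup>2 * (2 / \<rho>) * 16" using t by (intro mult_right_mono mult_left_mono) auto
      also have "Q\<^sup>2 = 8 * D * (L\<^sup>2 * (K * 10)) / \<eta>" using D(1) K(1) eta by (simp add: Q_def)
      also have "8 * D * (L\<^sup>2 * (K * 10)) / \<eta> * (2 / \<rho>) * 16 = (8 * D * (L\<^sup>2 * (K * 10)) * 32) / (\<eta> * \<rho>)"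
        by simp
      also have "\<dots> \<le> A / (\<eta> * \<rho>)" unfolding A_def using eta rho by (intro divide_right_mono) auto
      finally show "(Q * \<theta> ^ q0 * 4)\<^sup>2 \<le> A / (\<eta> * \<rho>)" .
    qed
    finally show ?thesis .
  qed
  show ?thesis by (rule that[of A]) (use main in \<open>auto simp: A_def\<close>)
qed

lemma visual_lipschitz:
  assumes "w \<in> carrier G" "u \<in> carrier G" "a \<in> carrier G" "b \<in> carrier G"
  shows "visual w u b - visual w u a \<le> visual w a b"
  using visual_triangle[of u a b w] assms by simp

text \<open>\<open>grn_increment\<close> is applied to the visual angle seen from \<open>u\<close>,
  truncated to an interval of length \<eta>. Only points at an angle of at least \<eta> / 2 from
  \<open>a\<close> contribute, so their total weight is small by \<open>sum_grn_weighted_le\<close>,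
  and from each of them the bound \<open>M\<close> holds.\<close>

lemma grn_halving:
  obtains C where "1 \<le> C" "\<And>r w u v a \<eta> \<rho> M. r \<in> {1/2..<R} \<Longrightarrow> w \<in> carrier G \<Longrightarrow> u \<in> carrier G \<Longrightarrow>
    v \<in> carrier G \<Longrightarrow> a \<in> carrier G \<Longrightarrow> 0 < \<eta> \<Longrightarrow> \<eta> \<le> 1 \<Longrightarrow> 1 \<le> \<rho> \<Longrightarrow> C \<le> \<eta> ^ 3 * \<rho> \<Longrightarrow>
    \<rho> < dN w a \<Longrightarrow> visual w u a + 2 * \<eta> \<le> visual w u v \<Longrightarrow> 0 \<le> M \<Longrightarrow>
    (\<And>b. b \<in> carrier G \<Longrightarrow> \<rho> < dN w b \<Longrightarrow> visual w u b \<le> visual w u a + 3 * \<eta> \<Longrightarrow>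
       grn r {b \<in> carrier G. dN w b \<le> \<rho>} b v \<le> M) \<Longrightarrow>
    grn r {b \<in> carrier G. dN w b \<le> \<rho>} a v \<le> M / 2"
proof -
  obtain A where A: "1 \<le> A" "\<And>r w a \<eta> \<rho> X. r \<in> {1/2..<R} \<Longrightarrow> w \<in> carrier G \<Longrightarrow> a \<in> carrier G \<Longrightarrow>
    0 < \<eta> \<Longrightarrow> \<eta> \<le> 1 \<Longrightarrow> 1 \<le> \<rho> \<Longrightarrow> finite X \<Longrightarrow> X \<subseteq> carrier G \<Longrightarrow>
    (\<And>b. b \<in> X \<Longrightarrow> \<rho> < dN w b \<and> \<eta> \<le> visual w a b) \<Longrightarrow>
    (\<Sum>b\<in>X. grn r {} a b / (dN w b)\<^sup>2) \<le> sqrt (A / (\<eta> * \<rho>))"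
    by (rule sum_grn_weighted_le) blast
  define \<Lambda> where "\<Lambda> = Max (insert 1 (N ` set_pmf \<mu>))"
  have L: "1 \<le> \<Lambda>" "\<And>s. s \<in> set_pmf \<mu> \<Longrightarrow> N s \<le> \<Lambda>"
    unfolding \<Lambda>_def using finite_supp by (auto intro!: Max_ge)
  \<comment> \<open>Chosen so that \<Lambda>^2 * sqrt (A / ((\<eta> / 2) * \<rho>)) is at most
    \<eta> / 2 as soon as \<eta>^3 * \<rho> reaches \<open>C\<close>.\<close>
  define C where "C = 8 * A * \<Lambda> ^ 4"
  have C: "2 * \<Lambda>\<^sup>2 \<le> C" "1 \<le> C"
  proof -
    have "1 \<le> \<Lambda>\<^sup>2" "1 \<le> \<Lambda> ^ 4" using L(1) by auto
    then have 1: "1 * 1 \<le> A * \<Lambda> ^ 4" "1 * \<Lambda> ^ 4 \<le> A * \<Lambda> ^ 4"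
      using A(1) by (intro mult_mono mult_right_mono; simp)+
    have 2: "\<Lambda>\<^sup>2 \<le> \<Lambda> ^ 4" using L(1) by (intro power_increasing) auto
    have e: "C = 8 * (A * \<Lambda> ^ 4)" by (simp add: C_def)
    show "2 * \<Lambda>\<^sup>2 \<le> C" "1 \<le> C" unfolding e using 1 2 by linarith+
  qed
  have main: "grn r {b \<in> carrier G. dN w b \<le> \<rho>} a v \<le> M / 2"
    if r: "r \<in> {1/2..<R}" and c: "w \<in> carrier G" "u \<in> carrier G" "v \<in> carrier G" "a \<in> carrier G"
    and eta: "0 < \<eta>" "\<eta> \<le> 1" and rho: "1 \<le> \<rho>" "C \<le> \<eta> ^ 3 * \<rho>" and a: "\<rho> < dN w a"
    and v: "visual w u a + 2 * \<eta> \<le> visual w u v" and M: "0 \<le> M"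
    and IH: "\<And>b. b \<in> carrier G \<Longrightarrow> \<rho> < dN w b \<Longrightarrow> visual w u b \<le> visual w u a + 3 * \<eta> \<Longrightarrow>
       grn r {b \<in> carrier G. dN w b \<le> \<rho>} b v \<le> M" for r w u v a \<eta> \<rho> M
  proof -
    have r': "0 < r" "r < R" using r by auto
    let ?B = "{b \<in> carrier G. dN w b \<le> \<rho>}"
    define \<alpha> where "\<alpha> b = visual w u b" for b
    \<comment> \<open>Cutting off below at \<alpha> a + \<eta> separates the support of the
      increments from \<open>a\<close>: outside the ball one step changes \<alpha> by at most \<eta>
      / 2, so \<phi> can grow only from points with \<alpha> at least \<alpha> a + \<eta> /
      2.\<close>
    define \<phi> where "\<phi> b = max (\<alpha> a + \<eta>) (min (\<alpha> a + 2 * \<eta>) (\<alpha> b))" for b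
    define P where "P b \<longleftrightarrow> \<alpha> a + \<eta> / 2 \<le> \<alpha> b \<and> \<alpha> b \<le> \<alpha> a + 2 * \<eta>" for b
    define W where "W b = (if P b then \<Lambda>\<^sup>2 / (dN w b)\<^sup>2 else 0)" for b
    have W0: "0 \<le> W b" for b by (simp add: W_def)
    have small: "\<Lambda>\<^sup>2 / \<rho>\<^sup>2 \<le> \<eta> / 2"
    proof -
      have "\<eta> ^ 3 * \<rho> \<le> \<eta> * \<rho>\<^sup>2"
        using eta rho power_decreasing[of 1 3 \<eta>] power_increasing[of 1 2 \<rho>] by (intro mult_mono) auto
      then have "2 * \<Lambda>\<^sup>2 \<le> \<eta> * \<rho>\<^sup>2" using C rho by linarith
      then show ?thesis using rho by (simp add: field_simps)
    qed
    have step: "\<alpha> (b \<otimes> s) - \<alpha> b \<le> \<Lambda>\<^sup>2 / (dN w b)\<^sup>2" if b: "b \<in> carrier G" and s: "s \<in> set_pmf \<mu>" for b s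
    proof -
      have bs: "b \<otimes> s \<in> carrier G" using b s by simp
      have d: "dN b (b \<otimes> s) \<le> \<Lambda>" using b s L(2) by (simp add: dN_def m_assoc[symmetric])
      have "dN w b \<le> dN w (b \<otimes> s) * dN (b \<otimes> s) b" by (rule dN_triangle[OF c(1) bs b])
      also have "\<dots> \<le> dN w (b \<otimes> s) * \<Lambda>" using d dN_sym[OF b bs] dN_pos[OF c(1) bs] by (intro mult_left_mono) auto
      finally have d2: "dN w b / \<Lambda> \<le> dN w (b \<otimes> s)" using L(1) by (simp add: field_simps)
      have "\<alpha> (b \<otimes> s) - \<alpha> b \<le> visual w b (b \<otimes> s)"
        unfolding \<alpha>_def using c b bs by (intro visual_lipschitz) auto
      also have "\<dots> \<le> \<Lambda> / (dN w b * (dN w b / \<Lambda>))"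
        unfolding visual_def using d d2 dN_pos[OF c(1) b] L(1) by (intro frac_le mult_left_mono) auto
      also have "\<dots> = \<Lambda>\<^sup>2 / (dN w b)\<^sup>2" by (simp add: power2_eq_square)
      finally show ?thesis .
    qed
    have inc: "\<phi> (b \<otimes> s) - \<phi> b \<le> W b"
      if b: "b \<in> carrier G - ?B" and s: "s \<in> set_pmf \<mu>" and "b \<otimes> s \<notin> ?B" for b s
    proof -
      have st: "\<alpha> (b \<otimes> s) - \<alpha> b \<le> \<Lambda>\<^sup>2 / (dN w b)\<^sup>2" using step b s by auto
      consider "P b" | "\<alpha> b < \<alpha> a + \<eta> / 2" | "\<alpha> a + 2 * \<eta> < \<alpha> b" by (force simp: P_def)
      then show ?thesis
      proof cases
        case 1
        have "\<phi> (b \<otimes> s) - \<phi> b \<le> max 0 (\<alpha> (b \<otimes> s) - \<alpha> b)" by (auto simp: \<phi>_def max_def min_def)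
        also have "\<dots> \<le> \<Lambda>\<^sup>2 / (dN w b)\<^sup>2" using st by simp
        finally show ?thesis using 1 by (simp add: W_def)
      next
        case 2
        have "\<rho>\<^sup>2 \<le> (dN w b)\<^sup>2" using b rho by (intro power_mono) auto
        moreover have "0 < \<rho>\<^sup>2" using rho by simp
        ultimately have "\<Lambda>\<^sup>2 / (dN w b)\<^sup>2 \<le> \<Lambda>\<^sup>2 / \<rho>\<^sup>2"
          by (intro divide_left_mono mult_pos_pos) auto
        then have "\<alpha> (b \<otimes> s) \<le> \<alpha> a + \<eta>" using st small 2 by linarith
        then have "\<phi> (b \<otimes> s) = \<alpha> a + \<eta>" using eta by (simp add: \<phi>_def)
        then have "\<phi> (b \<otimes> s) - \<phi> b \<le> 0" by (simp add: \<phi>_def)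
        then show ?thesis using W0[of b] by linarith
      next
        case 3
        then have "\<phi> (b \<otimes> s) - \<phi> b \<le> 0" using eta by (auto simp: \<phi>_def)
        then show ?thesis using W0[of b] by linarith
      qed
    qed
    have "(\<phi> v - \<phi> a) * grn r ?B a v \<le> M * (\<eta> / 2)"
    proof (rule grn_increment[OF r' _ c(3) inc W0])
      show "a \<in> carrier G - ?B" using c a by auto
      fix X assume X: "finite X" "X \<subseteq> carrier G - ?B"
      let ?X = "{b\<in>X. P b}"
      have "(\<Sum>b\<in>X. grn r ?B a b * W b * grn r ?B b v) = (\<Sum>b\<in>?X. grn r ?B a b * W b * grn r ?B b v)"
        using X by (intro sum.mono_neutral_right) (auto simp: W_def)
      also have "\<dots> \<le> (\<Sum>b\<in>?X. (grn r {} a b * (\<Lambda>\<^sup>2 / (dN w b)\<^sup>2)) * M)"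
      proof (intro sum_mono mult_mono)
        fix b assume b: "b \<in> ?X"
        then have bc: "b \<in> carrier G" "\<rho> < dN w b" using X by auto
        show "grn r ?B a b \<le> grn r {} a b" using r' c bc by (intro grn_mono) auto
        show "W b \<le> \<Lambda>\<^sup>2 / (dN w b)\<^sup>2" by (simp add: W_def)
        show "grn r ?B b v \<le> M" using b bc eta by (intro IH) (auto simp: P_def \<alpha>_def)
        show "0 \<le> grn r ?B b v" "0 \<le> grn r {} a b" using r' c bc by (auto intro!: grn_nonneg)
        then show "0 \<le> grn r {} a b * (\<Lambda>\<^sup>2 / (dN w b)\<^sup>2)" by simp
      qed (rule W0)
      also have "\<dots> = M * \<Lambda>\<^sup>2 * (\<Sum>b\<in>?X. grn r {} a b / (dN w b)\<^sup>2)"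
        by (simp add: sum_distrib_left mult_ac)
      also have "\<dots> \<le> M * \<Lambda>\<^sup>2 * sqrt (A / ((\<eta> / 2) * \<rho>))"
      proof (intro mult_left_mono A(2)[OF r c(1,4)])
        fix b assume b: "b \<in> ?X"
        then have bc: "b \<in> carrier G" "\<rho> < dN w b" using X by auto
        have "\<alpha> b - \<alpha> a \<le> visual w a b" unfolding \<alpha>_def using c bc by (intro visual_lipschitz) auto
        then show "\<rho> < dN w b \<and> \<eta> / 2 \<le> visual w a b" using b bc by (auto simp: P_def)
      qed (use eta rho X M in auto)
      also have "\<dots> = M * (\<Lambda>\<^sup>2 * sqrt (A / ((\<eta> / 2) * \<rho>)))" by simp
      also have "\<dots> \<le> M * (\<eta> / 2)"
      proof (rule mult_left_mono[OF _ M])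
        have "A / ((\<eta> / 2) * \<rho>) \<le> (\<eta> / (2 * \<Lambda>\<^sup>2))\<^sup>2"
        proof -
          have "8 * A * \<Lambda> ^ 4 \<le> \<eta> ^ 3 * \<rho>" using rho by (simp add: C_def)
          then show ?thesis using eta rho L(1)
            by (simp add: field_simps power2_eq_square power3_eq_cube power4_eq_xxxx)
        qed
        then have "sqrt (A / ((\<eta> / 2) * \<rho>)) \<le> \<eta> / (2 * \<Lambda>\<^sup>2)" using eta by (intro real_le_lsqrt) auto
        then have "\<Lambda>\<^sup>2 * sqrt (A / ((\<eta> / 2) * \<rho>)) \<le> \<Lambda>\<^sup>2 * (\<eta> / (2 * \<Lambda>\<^sup>2))" by (intro mult_left_mono) auto
        then show "\<Lambda>\<^sup>2 * sqrt (A / ((\<eta> / 2) * \<rho>)) \<le> \<eta> / 2" using L(1) by simp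
      qed
      finally show "(\<Sum>b\<in>X. grn r ?B a b * W b * grn r ?B b v) \<le> M * (\<eta> / 2)" .
    qed
    moreover have "\<phi> v - \<phi> a = \<eta>" using v eta by (simp add: \<phi>_def \<alpha>_def)
    ultimately have "\<eta> * grn r ?B a v \<le> \<eta> * (M / 2)" by (simp add: mult_ac)
    then show ?thesis using eta by simp
  qed
  show ?thesis by (rule that[OF C(2)]) (rule main)
qed

text \<open>The walk needs to turn around the ball: each time the visual angle increases by a fixed
  amount, a factor of two is lost.\<close>

lemma grn_avoid_ball:
  obtains L c \<sigma>0 where "1 \<le> L" "0 < c" "1 \<le> \<sigma>0" "\<And>r w u v \<sigma> j. r \<in> {1/2..<R} \<Longrightarrow> w \<in> carrier G \<Longrightarrow>
    u \<in> carrier G \<Longrightarrow> v \<in> carrier G \<Longrightarrow> \<sigma>0 \<le> \<sigma> \<Longrightarrow> \<sigma> ^ 6 < dN w u \<Longrightarrow> 1 / \<sigma> \<le> visual w u v \<Longrightarrow>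
    real j \<le> c * \<sigma> \<Longrightarrow> grn r {b \<in> carrier G. dN w b \<le> \<sigma> ^ 6} u v \<le> L / 2 ^ j"
proof -
  obtain L where L: "1 \<le> L" "\<And>r x y Y. r \<in> {1/2..<R} \<Longrightarrow> x \<in> carrier G \<Longrightarrow> y \<in> carrier G \<Longrightarrow> grn r Y x y \<le> L"
    by (rule grn_bounded) blast
  obtain D where D: "1 \<le> D" "\<And>r w u v a \<eta> \<rho> M. r \<in> {1/2..<R} \<Longrightarrow> w \<in> carrier G \<Longrightarrow> u \<in> carrier G \<Longrightarrow>
    v \<in> carrier G \<Longrightarrow> a \<in> carrier G \<Longrightarrow> 0 < \<eta> \<Longrightarrow> \<eta> \<le> 1 \<Longrightarrow> 1 \<le> \<rho> \<Longrightarrow> D \<le> \<eta> ^ 3 * \<rho> \<Longrightarrow>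
    \<rho> < dN w a \<Longrightarrow> visual w u a + 2 * \<eta> \<le> visual w u v \<Longrightarrow> 0 \<le> M \<Longrightarrow>
    (\<And>b. b \<in> carrier G \<Longrightarrow> \<rho> < dN w b \<Longrightarrow> visual w u b \<le> visual w u a + 3 * \<eta> \<Longrightarrow>
       grn r {b \<in> carrier G. dN w b \<le> \<rho>} b v \<le> M) \<Longrightarrow>
    grn r {b \<in> carrier G. dN w b \<le> \<rho>} a v \<le> M / 2"
    by (rule grn_halving) blast
  define \<sigma>0 where "\<sigma>0 = max D (2 * N \<one>)"
  have main: "grn r {b \<in> carrier G. dN w b \<le> \<sigma> ^ 6} u v \<le> L / 2 ^ j"
    if r: "r \<in> {1/2..<R}" and c: "w \<in> carrier G" "u \<in> carrier G" "v \<in> carrier G" and s: "\<sigma>0 \<le> \<sigma>"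
    and u: "\<sigma> ^ 6 < dN w u" and v: "1 / \<sigma> \<le> visual w u v" and j: "real j \<le> (1 / (6 * D)) * \<sigma>" for r w u v \<sigma> j
  proof -
    have s1: "D \<le> \<sigma>" "2 * N \<one> \<le> \<sigma>" "1 \<le> \<sigma>" using s D(1) by (auto simp: \<sigma>0_def)
    \<comment> \<open>With \<rho> = \<sigma>^6 the product \<eta>^3 * \<rho> is D^3 whatever
      \<sigma> is. Of the angle 1 / \<sigma> at most half is lost to \<open>visual w u u\<close>;
      the rest, in portions of 3 * \<eta>, allows \<sigma> / (6 * D) halvings.\<close>
    define \<eta> where "\<eta> = D / \<sigma>\<^sup>2"
    have eta: "0 < \<eta>" "\<eta> \<le> 1" "D \<le> \<eta> ^ 3 * \<sigma> ^ 6"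
    proof -
      show "0 < \<eta>" using D(1) s1 by (simp add: \<eta>_def)
      have "\<sigma> \<le> \<sigma>\<^sup>2" using s1 power_increasing[of 1 2 \<sigma>] by simp
      then show "\<eta> \<le> 1" using s1 unfolding \<eta>_def by (simp add: field_simps)
      have "\<eta> ^ 3 * \<sigma> ^ 6 = D ^ 3" using s1 by (simp add: \<eta>_def power_divide power_mult[symmetric])
      then show "D \<le> \<eta> ^ 3 * \<sigma> ^ 6" using D(1) power_increasing[of 1 3 D] by simp
    qed
    have ind: "grn r {b \<in> carrier G. dN w b \<le> \<sigma> ^ 6} a v \<le> L / 2 ^ i"
      if "a \<in> carrier G" "\<sigma> ^ 6 < dN w a" "visual w u a + 3 * \<eta> * real i \<le> visual w u v" for a i
      using that
    proof (induction i arbitrary: a)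
      case 0
      then show ?case using L(2)[OF r _ c(3)] by simp
    next
      case (Suc i)
      have e0: "0 \<le> 3 * \<eta> * real i" using eta by simp
      have e1: "3 * \<eta> * real (Suc i) = 3 * \<eta> * real i + 3 * \<eta>" by (simp add: algebra_simps)
      have "grn r {b \<in> carrier G. dN w b \<le> \<sigma> ^ 6} a v \<le> (L / 2 ^ i) / 2"
      proof (rule D(2)[OF r c Suc.prems(1) eta(1,2) _ eta(3) Suc.prems(2)])
        show "1 \<le> \<sigma> ^ 6" using s1 by simp
        show "visual w u a + 2 * \<eta> \<le> visual w u v" using Suc.prems(3) e0 e1 eta by linarith
        show "0 \<le> L / 2 ^ i" using L(1) by simp
        fix b assume b: "b \<in> carrier G" "\<sigma> ^ 6 < dN w b" "visual w u b \<le> visual w u a + 3 * \<eta>"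
        show "grn r {b \<in> carrier G. dN w b \<le> \<sigma> ^ 6} b v \<le> L / 2 ^ i"
          using Suc.prems(3) b by (intro Suc.IH) (auto simp: algebra_simps)
      qed
      then show ?case by simp
    qed
    have "visual w u u \<le> 1 / (2 * \<sigma>)"
    proof -
      have "\<sigma> \<le> dN w u" using u s1 power_increasing[of 1 6 \<sigma>] by simp
      then have "\<sigma> * \<sigma> \<le> dN w u * dN w u" using s1 by (intro mult_mono) auto
      then have "visual w u u \<le> N \<one> / (\<sigma> * \<sigma>)"
        unfolding visual_def using c s1 N_pos[of \<one>] by (intro frac_le) (auto simp: dN_self)
      also have "\<dots> \<le> (\<sigma> / 2) / (\<sigma> * \<sigma>)" using s1 by (intro divide_right_mono) auto
      finally show ?thesis using s1 by simp
    qed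
    moreover have "3 * \<eta> * real j \<le> 1 / (2 * \<sigma>)"
    proof -
      have "3 * \<eta> * real j \<le> 3 * \<eta> * ((1 / (6 * D)) * \<sigma>)" using j eta by (intro mult_left_mono) auto
      also have "\<dots> = 1 / (2 * \<sigma>)" using D(1) s1 by (simp add: \<eta>_def power2_eq_square)
      finally show ?thesis .
    qed
    ultimately have "visual w u u + 3 * \<eta> * real j \<le> visual w u v" using v by simp
    then show ?thesis using ind[OF c(2) u] by simp
  qed
  show ?thesis
    by (rule that[of L "1 / (6 * D)" \<sigma>0]) (use L(1) D(1) main in \<open>auto simp: \<sigma>0_def\<close>)
qed

end

section \<open>Ancona inequalities\<close>

context hyp_walk
begin

text \<open>Following a word for \<open>g\<close> loses a constant factor per letter, so
  \<open>fpg\<close> decays at most like a power of \<open>N g\<close>. The weight of paths that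
  avoid a ball is compared with this.\<close>

lemma fpg_lower:
  obtains B where "0 < B" "\<And>r g. r \<in> {1/2..<R} \<Longrightarrow> g \<in> carrier G \<Longrightarrow> exp (- (B * (ln (N g) + 1))) \<le> fpg r g"
proof -
  obtain c0 where c0: "0 < c0" "\<And>r s. r \<in> {1/2..<R} \<Longrightarrow> s \<in> S \<Longrightarrow> c0 \<le> fpg r s"
    using fpg_lower_finite[OF finite_S] S_carrier by blast
  obtain C1 where C1: "1 \<le> C1" "\<And>g. g \<in> carrier G \<Longrightarrow> real (wl g) \<le> C1 * (ln (N g) + 1)"
    by (rule wl_le_ln_N) blast
  define c where "c = min c0 (1 / 2)"
  have c: "0 < c" "c < 1" using c0 by (auto simp: c_def)
  have "exp (- (C1 * ln (1 / c) * (ln (N g) + 1))) \<le> fpg r g" if r: "r \<in> {1/2..<R}" and g: "g \<in> carrier G" for r g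
  proof -
    have r': "0 < r" "r < R" using r by auto
    have fold: "c ^ length ss * fpg r x \<le> fpg r (foldl (\<otimes>) x ss)" if "ss \<in> lists S" "x \<in> carrier G" for ss x
      using that
    proof (induction ss arbitrary: x rule: list.induct)
      case (Cons s ss)
      have s: "s \<in> S" "s \<in> carrier G" "ss \<in> lists S" using Cons.prems S_carrier by auto
      have "c ^ length (s # ss) * fpg r x = c ^ length ss * (fpg r x * c)" by simp
      also have "\<dots> \<le> c ^ length ss * (fpg r x * fpg r s)"
        using c c0(2)[OF r s(1)] fpg_pos[OF r'] Cons.prems
        by (intro mult_left_mono) (auto simp: c_def less_imp_le)
      also have "\<dots> \<le> c ^ length ss * fpg r (x \<otimes> s)"
        using c s Cons.prems r' by (intro mult_left_mono fpg_mult_le) auto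
      also have "\<dots> \<le> fpg r (foldl (\<otimes>) (x \<otimes> s) ss)" using Cons s by simp
      finally show ?case by simp
    qed auto
    obtain ss where ss: "ss \<in> lists S" "length ss = wl g" "g = foldl (\<otimes>) \<one> ss" by (rule wl_word[OF g])
    have "exp (- (C1 * ln (1 / c) * (ln (N g) + 1))) \<le> exp (- (ln (1 / c) * real (wl g)))"
      using C1(2)[OF g] c mult_left_mono[of "real (wl g)" "C1 * (ln (N g) + 1)" "ln (1 / c)"]
      by (simp add: mult_ac)
    also have "\<dots> = exp (ln c * real (wl g))" using c by (simp add: ln_div)
    also have "\<dots> = c ^ wl g" using c by (simp add: exp_of_nat2_mult)
    also have "\<dots> \<le> fpg r g" using fold[OF ss(1), of \<one>] ss fpg_one[OF r'] by simp
    finally show ?thesis .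
  qed
  moreover have "0 < C1 * ln (1 / c)" using C1 c by simp
  ultimately show ?thesis using that by blast
qed

text \<open>The end points are replaced by balls whose radii grow with the distance from
  \<open>k\<close>. This makes the induction close: the last point visited in the ball about a
  nearer end point is an admissible \<open>v\<close> for the shorter configuration.\<close>

definition ancona_on :: "(nat \<Rightarrow> real) \<Rightarrow> real \<Rightarrow> (nat \<Rightarrow> 'a) \<Rightarrow> nat \<Rightarrow> nat \<Rightarrow> nat \<Rightarrow> bool" where
  "ancona_on rad K x k a b \<longleftrightarrow> (\<forall>r\<in>{1/2..<R}. \<forall>u\<in>carrier G. \<forall>v\<in>carrier G.
     dN (x a) u \<le> rad (k - a) \<longrightarrow> dN (x b) v \<le> rad (b - k) \<longrightarrow>
     grn r {} u v \<le> K * (grn r {} u (x k) * grn r {} (x k) v))"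

text \<open>Symmetry of the walk allows the geodesic to be reversed, so that the longer part may be
  assumed to follow \<open>k\<close>.\<close>

lemma ancona_on_rev:
  assumes g: "geo x m" and ab: "a \<le> k" "k \<le> b" "b \<le> m"
    and A: "ancona_on rad K (\<lambda>i. x (m - i)) (m - k) (m - b) (m - a)"
  shows "ancona_on rad K x k a b"
  unfolding ancona_on_def
proof (intro ballI impI)
  fix r u v assume r: "r \<in> {1/2..<R}" and c: "u \<in> carrier G" "v \<in> carrier G"
    and d: "dN (x a) u \<le> rad (k - a)" "dN (x b) v \<le> rad (b - k)"
  have e: "m - (m - b) = b" "m - (m - a) = a" "m - (m - k) = k" "m - k - (m - b) = b - k" "m - a - (m - k) = k - a"
    using ab by auto
  have xk: "x k \<in> carrier G" using geo_imp_carrier[OF g] ab by simp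
  have "grn r {} v u \<le> K * (grn r {} v (x k) * grn r {} (x k) u)"
    using A[unfolded ancona_on_def, rule_format, OF r c(2,1)] d unfolding e by simp
  then show "grn r {} u v \<le> K * (grn r {} u (x k) * grn r {} (x k) v)"
    using grn_sym[OF c] grn_sym[OF c(1) xk] grn_sym[OF c(2) xk] by (simp add: mult_ac)
qed

lemma visual_perturb:
  assumes "w \<in> carrier G" "y \<in> carrier G" "u \<in> carrier G" "dN y u \<le> T" "D \<le> dN w y" "0 < D"
  shows "visual w y u \<le> T\<^sup>2 / D\<^sup>2"
proof -
  have T: "0 < T" using assms dN_pos[of y u] by linarith
  have "dN w y \<le> dN w u * dN u y" using assms by (intro dN_triangle)
  also have "\<dots> \<le> dN w u * T" using assms dN_sym[of y u] dN_pos[of w u] by (intro mult_left_mono) auto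
  finally have "D / T \<le> dN w u" using assms T by (simp add: field_simps)
  then have "visual w y u \<le> T / (D * (D / T))"
    unfolding visual_def using assms T by (intro frac_le mult_mono) auto
  then show ?thesis using T assms by (simp add: power2_eq_square)
qed

text \<open>Two scales are compared: seen from the middle of the longer half of the geodesic, the paths
  avoiding a large ball are negligible by \<open>grn_avoid_ball\<close>; decomposing the others at the last visit to
  this ball reduces to a shorter configuration, at the price of a factor close to one.\<close>

lemma ancona_geo:
  obtains K where "1 \<le> K" "\<And>r x m k. r \<in> {1/2..<R} \<Longrightarrow> geo x m \<Longrightarrow> k \<le> m \<Longrightarrow>
    grn r {} (x 0) (x m) \<le> K * (grn r {} (x 0) (x k) * grn r {} (x k) (x m))"
proof -
  obtain \<Lambda> C1 where L: "1 \<le> \<Lambda>" and C1: "1 \<le> C1" and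
    dN_le: "\<And>x m i j. geo x m \<Longrightarrow> i \<le> j \<Longrightarrow> j \<le> m \<Longrightarrow> dN (x i) (x j) \<le> \<Lambda> ^ Suc (j - i)" and
    len_le: "\<And>x m i j. geo x m \<Longrightarrow> i \<le> j \<Longrightarrow> j \<le> m \<Longrightarrow> real (j - i) \<le> C1 * (ln (dN (x i) (x j)) + 1)"
    by (rule geo_constants) blast
  obtain C2 p where C2: "1 \<le> C2" and morse:
    "\<And>x m k. geo x m \<Longrightarrow> k \<le> m \<Longrightarrow> dN (x 0) (x k) * dN (x k) (x m) \<le> C2 * real (Suc m) ^ p * dN (x 0) (x m)"
    by (rule log_morse) blast
  obtain L c \<sigma>0 where Lc: "1 \<le> L" "0 < c" "1 \<le> \<sigma>0" and avoid:
    "\<And>r w u v \<sigma> j. r \<in> {1/2..<R} \<Longrightarrow> w \<in> carrier G \<Longrightarrow>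
    u \<in> carrier G \<Longrightarrow> v \<in> carrier G \<Longrightarrow> \<sigma>0 \<le> \<sigma> \<Longrightarrow> \<sigma> ^ 6 < dN w u \<Longrightarrow> 1 / \<sigma> \<le> visual w u v \<Longrightarrow>
    real j \<le> c * \<sigma> \<Longrightarrow> grn r {b \<in> carrier G. dN w b \<le> \<sigma> ^ 6} u v \<le> L / 2 ^ j"
    by (rule grn_avoid_ball) blast
  obtain M where M: "1 \<le> M" "\<And>r x y Y. r \<in> {1/2..<R} \<Longrightarrow> x \<in> carrier G \<Longrightarrow> y \<in> carrier G \<Longrightarrow> grn r Y x y \<le> M"
    by (rule grn_bounded) blast
  obtain B where B: "0 < B" "\<And>r g. r \<in> {1/2..<R} \<Longrightarrow> g \<in> carrier G \<Longrightarrow> exp (- (B * (ln (N g) + 1))) \<le> fpg r g"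
    by (rule fpg_lower) blast
  \<comment> \<open>The square of \<open>rad d\<close> will grow like exp (d / (4 * C1)), slower
    than the lower bound exp (2 * d / C1 - 2) for squared distances along a geodesic. So the balls
    about the end points look small from \<open>w\<close>.\<close>
  define \<kappa> where "\<kappa> = 1 / (48 * C1)"
  have kappa: "0 < \<kappa>" "12 * \<kappa> = 1 / (4 * C1)" using C1 by (auto simp: \<kappa>_def)
  define n1 where "n1 = N \<one>"
  have n1: "1 \<le> n1" unfolding n1_def by (rule N_ge_1) simp
  \<comment> \<open>The factor \<open>n1\<close> puts each point into its own ball, since dN y y = N
    \<one>; the sixth power in \<open>rad\<close> is the ball radius of
    \<open>grn_avoid_ball\<close>.\<close>
  define sg where "sg d = n1 * exp (\<kappa> * real d)" for d :: nat
  define rad where "rad d = sg d ^ 6" for d :: nat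
  have sg1: "1 \<le> sg d" for d using n1 kappa mult_mono[of 1 n1 1 "exp (\<kappa> * real d)"] by (simp add: sg_def)
  have sg_mono: "sg d \<le> sg e" if "d \<le> e" for d e
    using that n1 kappa by (auto simp: sg_def intro!: mult_left_mono)
  have rad1: "n1 \<le> rad d" "1 \<le> rad d" for d
  proof -
    have "n1 \<le> sg d" using n1 kappa mult_left_mono[of 1 "exp (\<kappa> * real d)" n1] by (simp add: sg_def)
    also have "\<dots> \<le> rad d" unfolding rad_def using sg1[of d] power_increasing[of 1 6 "sg d"] by simp
    finally show "n1 \<le> rad d" .
    then show "1 \<le> rad d" using n1 by simp
  qed
  have rad_mono: "rad d \<le> rad e" if "d \<le> e" for d e
    unfolding rad_def using sg_mono[OF that] sg1[of d] by (intro power_mono) auto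
  have rad_sq: "(rad d)\<^sup>2 = n1 ^ 12 * exp (12 * \<kappa> * real d)" for d
    by (simp add: rad_def sg_def power_mult[symmetric] power_mult_distrib exp_of_nat_mult[symmetric] mult_ac)
  define E where "E = B * (12 * ln n1 + 12 * \<kappa> + ln \<Lambda> + 1)"
  have E0: "0 < E"
  proof -
    have "0 \<le> ln n1" "0 \<le> ln \<Lambda>" using n1 L by auto
    then have "0 < 12 * ln n1 + 12 * \<kappa> + ln \<Lambda> + 1" using kappa(1) by linarith
    then show ?thesis unfolding E_def using B(1) by simp
  qed
  have low: "exp (- (E * real (Suc n))) \<le> grn r {} u v"
    if r: "r \<in> {1/2..<R}" and g: "geo x m" "a \<le> k" "k \<le> b" "b \<le> m" and uv: "u \<in> carrier G" "v \<in> carrier G"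
    and d: "dN (x a) u \<le> rad (k - a)" "dN (x b) v \<le> rad (b - k)" and n: "b - a \<le> n" for r x m a k b u v n
  proof -
    have r': "0 < r" "r < R" using r by auto
    have xc: "x a \<in> carrier G" "x b \<in> carrier G" using geo_imp_carrier[OF g(1)] g by auto
    have "dN u v \<le> dN u (x a) * dN (x a) v" using xc uv by (intro dN_triangle)
    also have "\<dots> \<le> dN u (x a) * (dN (x a) (x b) * dN (x b) v)"
      using xc uv dN_pos[of u "x a"] by (intro mult_left_mono dN_triangle) auto
    also have "\<dots> \<le> rad n * (\<Lambda> ^ Suc n * rad n)"
    proof (intro mult_mono)
      have "k - a \<le> n" "b - k \<le> n" using g n by linarith+
      then show "dN u (x a) \<le> rad n" "dN (x b) v \<le> rad n"
        using d dN_sym[OF uv(1) xc(1)] rad_mono[of "k - a" n] rad_mono[of "b - k" n] by linarith+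
      have "dN (x a) (x b) \<le> \<Lambda> ^ Suc (b - a)" using g by (intro dN_le[OF g(1)]) auto
      also have "\<dots> \<le> \<Lambda> ^ Suc n" using L n by (intro power_increasing) auto
      finally show "dN (x a) (x b) \<le> \<Lambda> ^ Suc n" .
    qed (use xc uv dN_pos rad1(2)[of n] L in \<open>auto simp: less_imp_le mult_nonneg_nonneg\<close>)
    also have "\<dots> = \<Lambda> ^ Suc n * (rad n)\<^sup>2" by (simp add: power2_eq_square mult_ac)
    also have "\<dots> = exp (real (Suc n) * ln \<Lambda> + 12 * ln n1 + 12 * \<kappa> * real n)"
    proof -
      have "\<Lambda> ^ Suc n = exp (real (Suc n) * ln \<Lambda>)" using L by (subst exp_of_nat_mult) simp
      moreover have "n1 ^ 12 = exp (real 12 * ln n1)" using n1 by (subst exp_of_nat_mult) simp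
      ultimately show ?thesis unfolding rad_sq by (simp add: exp_add)
    qed
    finally have "ln (dN u v) \<le> real (Suc n) * ln \<Lambda> + 12 * ln n1 + 12 * \<kappa> * real n"
      using dN_pos[OF uv] by (subst (asm) ln_le_cancel_iff[symmetric]) auto
    also have "\<dots> \<le> real (Suc n) * ln \<Lambda> + 12 * ln n1 * real (Suc n) + 12 * \<kappa> * real (Suc n)"
    proof -
      have "12 * ln n1 * 1 \<le> 12 * ln n1 * real (Suc n)" "12 * \<kappa> * real n \<le> 12 * \<kappa> * real (Suc n)"
        using n1 kappa(1) by (intro mult_left_mono; simp)+
      then show ?thesis by linarith
    qed
    also have "\<dots> + 1 \<le> real (Suc n) * (12 * ln n1 + 12 * \<kappa> + ln \<Lambda> + 1)" by (simp add: algebra_simps)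
    finally have "B * (ln (dN u v) + 1) \<le> B * (real (Suc n) * (12 * ln n1 + 12 * \<kappa> + ln \<Lambda> + 1))"
      using B(1) by simp
    then have "exp (- (E * real (Suc n))) \<le> exp (- (B * (ln (dN u v) + 1)))"
      by (simp add: E_def mult_ac)
    also have "\<dots> \<le> fpg r (inv u \<otimes> v)" using B(2)[OF r, of "inv u \<otimes> v"] uv by (simp add: dN_def)
    also have "\<dots> \<le> grn r {} \<one> \<one> * fpg r (inv u \<otimes> v)"
      using mult_right_mono[OF grn_self_ge_1[OF r' one_closed], of "fpg r (inv u \<otimes> v)" "{}"]
        fpg_pos[OF r', of "inv u \<otimes> v"] uv by simp
    also have "\<dots> = grn r {} u v" using grn_eq_fpg[OF r' uv] by simp
    finally show ?thesis .
  qed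
  \<comment> \<open>For total length \<open>n\<close> the half of the longer part has at least n / 4
    - 1 / 2 steps. The three conditions say that the scale is admissible for
    \<open>grn_avoid_ball\<close>, that enough visual angle is left after moving the end points
    inside their balls, and that the avoiding paths carry at most the fraction 1 / (16 * (n + 1)) of
    the Green function.\<close>
  define ev where "ev n \<longleftrightarrow> \<sigma>0 \<le> exp (\<kappa> * (real n / 4 - 1 / 2)) \<and>
    1 / exp (\<kappa> * (real n / 4 - 1 / 2)) \<le> 1 / (C2 * real (Suc n) ^ p) - 2 * (n1 ^ 12 * exp (2 - (real n / 4 - 1 / 2) / C1)) \<and>
    2 * L * exp (- (ln 2 * c * exp (\<kappa> * (real n / 4 - 1 / 2)))) \<le> 1 / (16 * real (Suc n)) * exp (- (E * real (Suc n)))" for n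
  have "eventually ev sequentially"
  proof -
    have 1: "eventually (\<lambda>n. \<sigma>0 \<le> exp (\<kappa> * (real n / 4 - 1 / 2))) sequentially"
      using kappa(1) by real_asymp
    have 2: "eventually (\<lambda>n. 1 / exp (\<kappa> * (real n / 4 - 1 / 2)) \<le>
        1 / (C2 * real (Suc n) ^ p) - 2 * (n1 ^ 12 * exp (2 - (real n / 4 - 1 / 2) / C1))) sequentially"
      using kappa(1) C1 C2 n1 by real_asymp
    define l where "l = ln (2 * L)"
    define c' where "c' = ln 2 * c"
    have expl: "exp l = 2 * L" using Lc by (simp add: l_def)
    have expln: "exp (- ln t) = 1 / t" if "0 < t" for t :: real
      using that by (simp add: exp_minus divide_inverse)
    have "0 < c'" "0 < l" using Lc by (auto simp: c'_def l_def)
    then have "eventually (\<lambda>n. l + ln (16 * real (Suc n)) + E * real (Suc n) \<le>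
        c' * exp (\<kappa> * (real n / 4 - 1 / 2))) sequentially"
      using kappa(1) E0 by real_asymp
    then have 3: "eventually (\<lambda>n. 2 * L * exp (- (ln 2 * c * exp (\<kappa> * (real n / 4 - 1 / 2)))) \<le>
        1 / (16 * real (Suc n)) * exp (- (E * real (Suc n)))) sequentially"
    proof eventually_elim
      case (elim n)
      have "2 * L * exp (- (ln 2 * c * exp (\<kappa> * (real n / 4 - 1 / 2)))) =
          exp (l + - (c' * exp (\<kappa> * (real n / 4 - 1 / 2))))"
        unfolding exp_add expl c'_def ..
      also have "\<dots> \<le> exp (- ln (16 * real (Suc n)) + - (E * real (Suc n)))"
        unfolding exp_le_cancel_iff using elim by linarith
      also have "\<dots> = 1 / (16 * real (Suc n)) * exp (- (E * real (Suc n)))"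
        unfolding exp_add using expln[of "16 * real (Suc n)"] by simp
      finally show ?case .
    qed
    show ?thesis unfolding ev_def using 1 2 3 by (simp add: eventually_conj_iff)
  qed
  then obtain N0 where N0: "\<And>n. N0 \<le> n \<Longrightarrow> ev n" by (auto simp: eventually_sequentially)
  define N1 where "N1 = max N0 4"
  \<comment> \<open>For lengths up to \<open>N1\<close> the upper bound \<open>M\<close> and the
    lower bound \<open>low\<close> on both factors are enough.\<close>
  define K0 where "K0 = M / exp (- (E * real (Suc N1))) ^ 2"
  \<comment> \<open>A closed form that dominates the product over scales: it increases from
    \<open>K0\<close> towards 2 * K0, and passing from length \<open>n\<close> to at most 3 * n / 4
    gains the factor 1 - 1 / (16 * (n + 1)) lost in each step.\<close>
  define KK where "KK n = K0 * (2 - 1 / real (Suc n))" for n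
  have K0: "1 \<le> K0"
  proof -
    have "exp (- (E * real (Suc N1))) ^ 2 \<le> 1" using E0 by (intro power_le_one) auto
    then show ?thesis unfolding K0_def using M(1) by (simp add: le_divide_eq)
  qed
  have KK1: "K0 \<le> KK n" "KK n \<le> 2 * K0" for n
  proof -
    have "1 / real (Suc n) \<le> 1" "0 \<le> 1 / real (Suc n)" by auto
    then have "K0 * 1 \<le> K0 * (2 - 1 / real (Suc n))" "K0 * (2 - 1 / real (Suc n)) \<le> K0 * 2"
      using K0 by (intro mult_left_mono; simp)+
    then show "K0 \<le> KK n" "KK n \<le> 2 * K0" by (simp_all add: KK_def)
  qed
  have base: "ancona_on rad (KK (b - a)) x k a b"
    if g: "geo x m" "a \<le> k" "k \<le> b" "b \<le> m" and small: "b - a \<le> N1" for x m a k b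
    unfolding ancona_on_def
  proof (intro ballI impI)
    fix r u v assume r: "r \<in> {1/2..<R}" and uv: "u \<in> carrier G" "v \<in> carrier G"
      and d: "dN (x a) u \<le> rad (k - a)" "dN (x b) v \<le> rad (b - k)"
    have r': "0 < r" "r < R" using r by auto
    let ?e = "exp (- (E * real (Suc N1)))"
    have xk: "x k \<in> carrier G" using geo_imp_carrier[OF g(1)] g by simp
    have self: "dN (x k) (x k) \<le> rad (k - k)" using xk rad1(1) by (simp add: dN_self n1_def)
    have "?e \<le> grn r {} u (x k)"
      using low[OF r g(1) g(2) le_refl _ uv(1) xk d(1) self, of N1] g small by simp
    moreover have "?e \<le> grn r {} (x k) v"
      using low[OF r g(1) le_refl g(3,4) xk uv(2) self d(2), of N1] g small by simp
    ultimately have "?e * ?e \<le> grn r {} u (x k) * grn r {} (x k) v" by (intro mult_mono) (auto intro: order_trans[of _ ?e])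
    then have "K0 * (?e * ?e) \<le> KK (b - a) * (grn r {} u (x k) * grn r {} (x k) v)"
      using KK1[of "b - a"] K0 by (intro mult_mono[of K0]) auto
    moreover have "K0 * (?e * ?e) = M" by (simp add: K0_def power2_eq_square)
    ultimately show "grn r {} u v \<le> KK (b - a) * (grn r {} u (x k) * grn r {} (x k) v)"
      using M(2)[OF r uv, of "{}"] by linarith
  qed
  \<comment> \<open>The ball to be met is centred at the midpoint \<open>b'\<close> of the longer
    part, between \<open>k\<close> and \<open>b\<close>. Replacing \<open>b\<close> by
    \<open>b'\<close> leaves \<open>k\<close> inside and shortens the configuration to at most three
    quarters.\<close>
  have step: "ancona_on rad (KK (b - a)) x k a b"
    if g: "geo x m" "a \<le> k" "k \<le> b" "b \<le> m" and big: "N1 < b - a" and half: "k - a \<le> b - k"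
    and IH: "ancona_on rad (KK (k + (b - k) div 2 - a)) x k a (k + (b - k) div 2)" for x m a k b
    unfolding ancona_on_def
  proof (intro ballI impI)
    fix r u v assume r: "r \<in> {1/2..<R}" and uv: "u \<in> carrier G" "v \<in> carrier G"
      and d: "dN (x a) u \<le> rad (k - a)" "dN (x b) v \<le> rad (b - k)"
    have r': "0 < r" "r < R" using r by auto
    note xc = geo_imp_carrier[OF g(1)]
    define b' where "b' = k + (b - k) div 2"
    define n where "n = b - a"
    let ?h = "real n / 4 - 1 / 2"
    have b': "k \<le> b'" "b' \<le> b" "a \<le> b'" "b' - k = (b - k) div 2" using g by (auto simp: b'_def)
    have d': "?h \<le> real (b' - k)"
    proof -
      have "n \<le> 2 * (b - k)" using half g by (simp add: n_def)
      moreover have "b - k \<le> 2 * ((b - k) div 2) + 1" by simp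
      ultimately have "n \<le> 4 * ((b - k) div 2) + 2" by linarith
      then show ?thesis unfolding b'(4) by linarith
    qed
    have evn: "\<sigma>0 \<le> exp (\<kappa> * ?h)"
      "1 / exp (\<kappa> * ?h) \<le> 1 / (C2 * real (Suc n) ^ p) - 2 * (n1 ^ 12 * exp (2 - ?h / C1))"
      "2 * L * exp (- (ln 2 * c * exp (\<kappa> * ?h))) \<le> 1 / (16 * real (Suc n)) * exp (- (E * real (Suc n)))"
      using N0[of n] big by (auto simp: n_def N1_def ev_def)
    define \<sigma> where "\<sigma> = sg (b' - k)"
    have sig: "exp (\<kappa> * ?h) \<le> \<sigma>" "1 \<le> \<sigma>"
    proof -
      have "1 * exp (\<kappa> * ?h) \<le> n1 * exp (\<kappa> * real (b' - k))"
        using n1 kappa(1) d' by (intro mult_mono) auto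
      then show "exp (\<kappa> * ?h) \<le> \<sigma>" by (simp add: \<sigma>_def sg_def)
    qed (simp add: \<sigma>_def sg1)
    define w where "w = x b'"
    have cc: "w \<in> carrier G" "x a \<in> carrier G" "x b \<in> carrier G" "x k \<in> carrier G" using xc g b' by (auto simp: w_def)
    define Y where "Y = {y \<in> carrier G. dN w y \<le> \<sigma> ^ 6}"
    have Y: "finite Y" "Y \<subseteq> carrier G" unfolding Y_def using finite_dN_ball[OF cc(1)] by auto
    have len: "exp (real (j - i) / C1 - 1) \<le> dN (x i) (x j)" if "i \<le> j" "j \<le> m" for i j
    proof -
      have "real (j - i) / C1 - 1 \<le> ln (dN (x i) (x j))"
        using len_le[OF g(1) that] C1 by (simp add: field_simps)
      then show ?thesis using dN_pos[OF xc xc] that by (subst (asm) ln_ge_iff) auto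
    qed
    have v1: "visual w (x a) u \<le> n1 ^ 12 * exp (2 - ?h / C1)"
    proof -
      have "exp (real (b' - a) / C1 - 1) \<le> dN w (x a)"
        using len[of a b'] b' g dN_sym[OF cc(1,2)] by (simp add: w_def)
      then have "visual w (x a) u \<le> (rad (k - a))\<^sup>2 / (exp (real (b' - a) / C1 - 1))\<^sup>2"
        using cc uv d by (intro visual_perturb) auto
      also have "\<dots> = n1 ^ 12 * exp (12 * \<kappa> * real (k - a) - 2 * (real (b' - a) / C1 - 1))"
        unfolding rad_sq exp_double[symmetric] by (subst exp_diff) (simp only: times_divide_eq_right)
      also have "\<dots> \<le> n1 ^ 12 * exp (2 - ?h / C1)"
      proof -
        have "real (b' - a) = real (b' - k) + real (k - a)" using b' g by simp
        then have "12 * \<kappa> * real (k - a) - 2 * (real (b' - a) / C1 - 1)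
            = 2 - (2 * real (b' - k) + 7 / 4 * real (k - a)) / C1"
          unfolding kappa(2) using C1 by (simp add: field_simps)
        also have "\<dots> \<le> 2 - ?h / C1"
          using d' C1 by (intro diff_left_mono divide_right_mono) auto
        finally show ?thesis using n1 by (intro mult_left_mono) auto
      qed
      finally show ?thesis .
    qed
    have v2: "visual w (x b) v \<le> n1 ^ 12 * exp (2 - ?h / C1)"
    proof -
      have "exp (real (b - b') / C1 - 1) \<le> dN w (x b)"
        using len[of b' b] b' g by (simp add: w_def)
      then have "visual w (x b) v \<le> (rad (b - k))\<^sup>2 / (exp (real (b - b') / C1 - 1))\<^sup>2"
        using cc uv d by (intro visual_perturb) auto
      also have "\<dots> = n1 ^ 12 * exp (12 * \<kappa> * real (b - k) - 2 * (real (b - b') / C1 - 1))"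
        unfolding rad_sq exp_double[symmetric] by (subst exp_diff) (simp only: times_divide_eq_right)
      also have "\<dots> \<le> n1 ^ 12 * exp (2 - ?h / C1)"
      proof -
        have 1: "b - k \<le> 2 * (b - b')" using b' by (simp add: b'_def)
        have 2: "n \<le> 2 * (b - k)" using half g by (simp add: n_def)
        have 3: "real n \<le> 2 * real (b - k)" "real (b - k) \<le> 2 * real (b - b')" using 1 2 by linarith+
        have "12 * \<kappa> * real (b - k) - 2 * (real (b - b') / C1 - 1)
            = 2 - (2 * real (b - b') - real (b - k) / 4) / C1"
          unfolding kappa(2) using C1 by (simp add: field_simps)
        also have "\<dots> \<le> 2 - ?h / C1"
          using 3 C1 by (intro diff_left_mono divide_right_mono) auto
        finally show ?thesis using n1 by (intro mult_left_mono) auto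
      qed
      finally show ?thesis .
    qed
    \<comment> \<open>By \<open>log_morse\<close> the end points of the geodesic span a visual angle
      that is only polynomially small, whereas \<open>v1\<close> and \<open>v2\<close> are
      exponentially small.\<close>
    have v3: "1 / (C2 * real (Suc n) ^ p) \<le> visual w (x a) (x b)"
    proof -
      have gs: "geo (\<lambda>l. x (a + l)) (b - a)" using g by (intro geo_shift) auto
      have "dN (x a) w * dN w (x b) \<le> C2 * real (Suc n) ^ p * dN (x a) (x b)"
        using morse[OF gs, of "b' - a"] b' g by (simp add: w_def n_def)
      then show ?thesis using dN_sym[OF cc(1,2)] dN_pos[OF cc(1,2)] dN_pos[OF cc(1,3)] C2
        unfolding visual_def by (simp add: field_simps)
    qed
    have vis: "1 / \<sigma> \<le> visual w u v"
    proof -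
      have "visual w (x a) (x b) \<le> visual w (x a) u + visual w u (x b)" using cc uv by (intro visual_triangle)
      moreover have "visual w u (x b) \<le> visual w u v + visual w v (x b)" using cc uv by (intro visual_triangle)
      moreover have "visual w v (x b) = visual w (x b) v" using cc uv by (intro visual_sym)
      moreover have "1 / \<sigma> \<le> 1 / exp (\<kappa> * ?h)" using sig by (intro divide_left_mono) auto
      ultimately show ?thesis using v1 v2 v3 evn(2) by linarith
    qed
    have avoidY: "of_bool (u \<notin> Y) * grn r Y u v \<le> 1 / (16 * real (Suc n)) * grn r {} u v"
    proof (cases "u \<in> Y")
      case False
      define j where "j = nat \<lfloor>c * \<sigma>\<rfloor>"
      have "0 \<le> c * \<sigma>" using Lc sig by simp
      then have j: "real j \<le> c * \<sigma>" "c * \<sigma> - 1 \<le> real j" unfolding j_def by linarith+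
      have "grn r Y u v \<le> L / 2 ^ j"
        unfolding Y_def using False uv cc sig evn(1) vis j by (intro avoid[OF r]) (auto simp: Y_def)
      also have "\<dots> \<le> 2 * L * exp (- (ln 2 * c * exp (\<kappa> * ?h)))"
      proof -
        have "exp (ln 2 * (c * \<sigma> - 1)) \<le> exp (ln 2 * real j)" using j by simp
        also have "exp (ln 2 * real j) = 2 ^ j" by (simp add: exp_of_nat2_mult)
        finally have "exp (ln 2 * (c * \<sigma> - 1)) \<le> 2 ^ j" .
        then have "L / 2 ^ j \<le> L / exp (ln 2 * (c * \<sigma> - 1))" using Lc by (intro divide_left_mono) auto
        also have "\<dots> = 2 * L * exp (- (ln 2 * c * \<sigma>))"
          by (simp add: exp_diff exp_minus right_diff_distrib field_simps)
        also have "\<dots> \<le> 2 * L * exp (- (ln 2 * c * exp (\<kappa> * ?h)))"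
          using Lc sig(1) by (intro mult_left_mono) auto
        finally show ?thesis .
      qed
      also have "\<dots> \<le> 1 / (16 * real (Suc n)) * exp (- (E * real (Suc n)))" by (rule evn(3))
      also have "\<dots> \<le> 1 / (16 * real (Suc n)) * grn r {} u v"
        using low[OF r g uv d, of n] by (intro mult_left_mono) (auto simp: n_def)
      finally show ?thesis using False by simp
    qed (use r' uv grn_nonneg in simp)
    let ?K = "KK (b' - a)"
    have K'0: "0 \<le> ?K" using KK1(1)[of "b' - a"] K0 by linarith
    have "(\<Sum>y\<in>Y. grn r {} u y * grn r Y y v) \<le>
        (\<Sum>y\<in>Y. (?K * (grn r {} u (x k) * grn r {} (x k) y)) * grn r Y y v)"
    proof (intro sum_mono mult_right_mono)
      fix y assume y: "y \<in> Y"
      then have yc: "y \<in> carrier G" "dN (x b') y \<le> rad (b' - k)" by (auto simp: Y_def w_def rad_def \<sigma>_def)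
      show "grn r {} u y \<le> ?K * (grn r {} u (x k) * grn r {} (x k) y)"
        using IH[unfolded ancona_on_def, rule_format, OF r uv(1) yc(1)] d(1) yc(2) by (simp add: b'_def)
      show "0 \<le> grn r Y y v" using r' yc uv by (intro grn_nonneg)
    qed
    also have "\<dots> = ?K * grn r {} u (x k) * (\<Sum>y\<in>Y. grn r {} (x k) y * grn r Y y v)"
      by (simp add: sum_distrib_left mult_ac)
    also have "\<dots> \<le> ?K * grn r {} u (x k) * grn r {} (x k) v"
    proof (rule mult_left_mono)
      show "(\<Sum>y\<in>Y. grn r {} (x k) y * grn r Y y v) \<le> grn r {} (x k) v"
        using grn_last_visit[OF r' cc(4) uv(2) Y] grn_nonneg[OF r' cc(4) uv(2), of Y] by simp
      show "0 \<le> ?K * grn r {} u (x k)" using K'0 r' uv cc by (intro mult_nonneg_nonneg grn_nonneg)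
    qed
    finally have "grn r {} u v \<le> 1 / (16 * real (Suc n)) * grn r {} u v + ?K * (grn r {} u (x k) * grn r {} (x k) v)"
      using grn_last_visit[OF r' uv Y] avoidY by simp
    then have 1: "(1 - 1 / (16 * real (Suc n))) * grn r {} u v \<le> ?K * (grn r {} u (x k) * grn r {} (x k) v)"
      by (simp add: algebra_simps)
    have KKle: "?K \<le> (1 - 1 / (16 * real (Suc n))) * KK (b - a)"
    proof -
      define s where "s = real n"
      have s4: "4 \<le> s" using big by (simp add: s_def n_def N1_def)
      have "4 * (b' - a) \<le> 3 * n" using half g b' by (simp add: n_def b'_def)
      then have "4 * real (b' - a) \<le> 3 * s" unfolding s_def by linarith
      then have h1: "1 / (3 * s / 4 + 1) \<le> 1 / real (Suc (b' - a))" by (intro divide_left_mono) auto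
      have h2: "1 / (s + 1) + 1 / (8 * (s + 1)) \<le> 1 / (3 * s / 4 + 1)"
      proof -
        have "1 / (s + 1) + 1 / (8 * (s + 1)) = 9 / (8 * (s + 1))" using s4 by (simp add: divide_simps)
        also have "\<dots> \<le> 4 / (3 * s + 4)" using s4 by (simp add: divide_simps)
        also have "\<dots> = 1 / (3 * s / 4 + 1)" using s4 by (simp add: divide_simps)
        finally show ?thesis .
      qed
      have h3: "2 * (1 / (16 * (s + 1))) = 1 / (8 * (s + 1))" using s4 by (simp add: divide_simps)
      have "1 / (s + 1) + 2 * (1 / (16 * (s + 1))) \<le> 1 / real (Suc (b' - a))"
        unfolding h3 by (rule order_trans[OF h2 h1])
      moreover have "2 - z \<le> 2 - x - y" if "x + y \<le> z" for x y z :: real using that by simp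
      ultimately have "2 - 1 / real (Suc (b' - a)) \<le> 2 - 1 / (s + 1) - 2 * (1 / (16 * (s + 1)))" by blast
      also have "\<dots> \<le> (1 - 1 / (16 * (s + 1))) * (2 - 1 / (s + 1))"
      proof -
        have 0: "0 \<le> 1 / (16 * (s + 1)) * (1 / (s + 1))" using s4 by simp
        have "(1 - d) * (2 - t) = 2 - t - 2 * d + d * t" for d t :: real by (simp add: algebra_simps)
        then show ?thesis using 0 by simp
      qed
      finally have "K0 * (2 - 1 / real (Suc (b' - a))) \<le> K0 * ((1 - 1 / (16 * (s + 1))) * (2 - 1 / (s + 1)))"
        using K0 by (intro mult_left_mono) auto
      then show ?thesis by (simp add: KK_def s_def n_def mult_ac add.commute)
    qed
    have f: "0 < 1 - 1 / (16 * real (Suc n))" by (simp add: field_simps)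
    have "(1 - 1 / (16 * real (Suc n))) * grn r {} u v \<le>
        ((1 - 1 / (16 * real (Suc n))) * KK (b - a)) * (grn r {} u (x k) * grn r {} (x k) v)"
      by (rule order_trans[OF 1 mult_right_mono[OF KKle]]) (use grn_nonneg[OF r'] uv cc in simp)
    then show "grn r {} u v \<le> KK (b - a) * (grn r {} u (x k) * grn r {} (x k) v)"
      using f by (simp only: mult.assoc mult_le_cancel_left_pos)
  qed
  have all: "ancona_on rad (KK (b - a)) x k a b"
    if "geo x m" "a \<le> k" "k \<le> b" "b \<le> m" for x m a k b
    using that
  proof (induction "b - a" arbitrary: x a k b rule: less_induct)
    case less
    show ?case
    proof (cases "b - a \<le> N1")
      case True
      then show ?thesis using less.prems by (intro base)
    next
      case False
      have big: "N1 < b - a" "4 < b - a" using False by (auto simp: N1_def)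
      show ?thesis
      proof (cases "k - a \<le> b - k")
        case True
        show ?thesis
        proof (rule step[OF less.prems big(1) True])
          show "ancona_on rad (KK (k + (b - k) div 2 - a)) x k a (k + (b - k) div 2)"
            using less.prems big True by (intro less.hyps) auto
        qed
      next
        case F: False
        let ?x = "\<lambda>i. x (m - i)" and ?k = "m - k" and ?a = "m - b" and ?b = "m - a"
        have g: "geo ?x m" "?a \<le> ?k" "?k \<le> ?b" "?b \<le> m" using geo_rev less.prems by auto
        have e: "?b - ?a = b - a" "?k - ?a = b - k" "?b - ?k = k - a" using less.prems by auto
        have "ancona_on rad (KK (?b - ?a)) ?x ?k ?a ?b"
        proof (rule step[OF g])
          show "N1 < ?b - ?a" "?k - ?a \<le> ?b - ?k" unfolding e using big F by auto
          show "ancona_on rad (KK (?k + (?b - ?k) div 2 - ?a)) ?x ?k ?a (?k + (?b - ?k) div 2)"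
            using g(1) less.prems big F unfolding e by (intro less.hyps) auto
        qed
        then show ?thesis using ancona_on_rev[OF less.prems] unfolding e by blast
      qed
    qed
  qed
  have "grn r {} (x 0) (x m) \<le> 2 * K0 * (grn r {} (x 0) (x k) * grn r {} (x k) (x m))"
    if r: "r \<in> {1/2..<R}" and g: "geo x m" "k \<le> m" for r x m k
  proof -
    have r': "0 < r" "r < R" using r by auto
    have c: "x 0 \<in> carrier G" "x m \<in> carrier G" "x k \<in> carrier G" using geo_imp_carrier[OF g(1)] g by auto
    have self: "dN y y \<le> rad d" if "y \<in> carrier G" for y d using that rad1(1)[of d] by (simp add: dN_self n1_def)
    have "grn r {} (x 0) (x m) \<le> KK (m - 0) * (grn r {} (x 0) (x k) * grn r {} (x k) (x m))"
      using all[OF g(1) le0 g(2) le_refl, unfolded ancona_on_def, rule_format, OF r c(1,2) self[OF c(1)] self[OF c(2)]] .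
    also have "\<dots> \<le> 2 * K0 * (grn r {} (x 0) (x k) * grn r {} (x k) (x m))"
      using KK1(2)[of "m - 0"] grn_nonneg[OF r'] c by (intro mult_right_mono mult_nonneg_nonneg) auto
    finally show ?thesis .
  qed
  then show ?thesis using that[of "2 * K0"] K0 by auto
qed

text \<open>By Ancona's inequality all the points of \<open>branching_points\<close> have Green functions comparable to
  that of the end point of the geodesic, while there are linearly many of them in \<open>O(log m)\<close> bands.
  So \<open>fpg\<close> tends to zero; by Ancona's inequality again it decays exponentially.\<close>

lemma fpg_decay:
  obtains C \<rho> where "0 < C" "0 < \<rho>" "\<rho> < 1"
    "\<And>r g. r \<in> {1/2..<R} \<Longrightarrow> g \<in> carrier G \<Longrightarrow> fpg r g \<le> C * \<rho> ^ wl g"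
proof -
  obtain K where K: "1 \<le> K" and anc: "\<And>r x m k. r \<in> {1/2..<R} \<Longrightarrow> geo x m \<Longrightarrow> k \<le> m \<Longrightarrow>
    grn r {} (x 0) (x m) \<le> K * (grn r {} (x 0) (x k) * grn r {} (x k) (x m))"
    by (rule ancona_geo) blast
  obtain L where L: "1 \<le> L" "\<And>r x y Y. r \<in> {1/2..<R} \<Longrightarrow> x \<in> carrier G \<Longrightarrow> y \<in> carrier G \<Longrightarrow> grn r Y x y \<le> L"
    by (rule grn_bounded) blast
  \<comment> \<open>Ancona's inequality for \<open>grn\<close> rewritten for \<open>fpg\<close>
    contains one surplus factor \<open>grn r {} \<one> \<one>\<close>, which is at most
    \<open>L\<close>.\<close>
  define D where "D = K * L"
  have D: "1 \<le> D" using K L mult_mono[of 1 K 1 L] by (simp add: D_def)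
  have sub: "fpg r (inv (x 0) \<otimes> x m) \<le> D * (fpg r (inv (x 0) \<otimes> x k) * fpg r (inv (x k) \<otimes> x m))"
    if r: "r \<in> {1/2..<R}" and g: "geo x m" "k \<le> m" for r x m k
  proof -
    have r': "0 < r" "r < R" using r by auto
    let ?G = "grn r {} \<one> \<one>"
    have c: "x 0 \<in> carrier G" "x m \<in> carrier G" "x k \<in> carrier G" using geo_imp_carrier[OF g(1)] g by auto
    have f: "0 \<le> fpg r (inv (x 0) \<otimes> x k) * fpg r (inv (x k) \<otimes> x m)"
      using fpg_pos[OF r'] c by (intro mult_nonneg_nonneg) (auto simp: less_imp_le)
    have G0: "0 < ?G" using grn_pos[OF r'] by simp
    have "?G * fpg r (inv (x 0) \<otimes> x m) \<le> K * ((?G * fpg r (inv (x 0) \<otimes> x k)) * (?G * fpg r (inv (x k) \<otimes> x m)))"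
      using anc[OF r g] grn_eq_fpg[OF r' c(1,2)] grn_eq_fpg[OF r' c(1,3)] grn_eq_fpg[OF r' c(3,2)] by simp
    also have "\<dots> = ?G * ((K * ?G) * (fpg r (inv (x 0) \<otimes> x k) * fpg r (inv (x k) \<otimes> x m)))"
      by (simp add: mult_ac)
    finally have "fpg r (inv (x 0) \<otimes> x m) \<le> (K * ?G) * (fpg r (inv (x 0) \<otimes> x k) * fpg r (inv (x k) \<otimes> x m))"
      using G0 by simp
    also have "\<dots> \<le> D * (fpg r (inv (x 0) \<otimes> x k) * fpg r (inv (x k) \<otimes> x m))"
      unfolding D_def using L(2)[OF r, of \<one> \<one>] K f by (intro mult_right_mono mult_left_mono) auto
    finally show ?thesis .
  qed
  obtain F c C and p :: nat where F: "finite F" "F \<subseteq> carrier G" and c: "0 < c" and C: "0 < C" and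
    bp: "\<And>x m. geo x m \<Longrightarrow> x 0 = \<one> \<Longrightarrow> \<exists>I a. I \<subseteq> {..m} \<and> c * real m - C \<le> card I \<and> (\<forall>i\<in>I. a i \<in> F) \<and>
       (\<forall>r\<in>{1/2..<R}. (\<Sum>i\<in>I. (fpg r (x i \<otimes> a i \<otimes> (inv (x i) \<otimes> x m)))\<^sup>2) \<le> C * (ln (real (Suc m)) + 1))"
    by (rule sum_branching_le) blast
  obtain cF where cF: "0 < cF" "\<And>r a. r \<in> {1/2..<R} \<Longrightarrow> a \<in> F \<Longrightarrow> cF \<le> fpg r a"
    using fpg_lower_finite[OF F] by blast
  \<comment> \<open>If \<open>fpg r g\<close> exceeded 1 / (2 * D), the square of \<open>fpg\<close>
    at each branching point would be at least \<open>b\<close>: Ancona's inequality bounds the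
    product of the two halves from below, and the inserted element costs \<open>cF\<close>.\<close>
  define b where "b = (cF / D)\<^sup>2 * (1 / (2 * D))\<^sup>2"
  have b: "0 < b" using cF D by (simp add: b_def)
  have "eventually (\<lambda>m. C * (ln (real (Suc m)) + 1) < b * (c * real m - C) \<and> 0 < c * real m - C \<and> 0 < m) sequentially"
  proof -
    have "eventually (\<lambda>m. C * (ln (real (Suc m)) + 1) < b * (c * real m - C)) sequentially"
      "eventually (\<lambda>m. 0 < c * real m - C) sequentially"
      using b c C by real_asymp+
    then show ?thesis using eventually_gt_at_top[of "0::nat"] by (simp add: eventually_conj_iff)
  qed
  then obtain m where m: "C * (ln (real (Suc m)) + 1) < b * (c * real m - C)" "0 < c * real m - C" "0 < m"
    by (auto simp: eventually_sequentially)
  have half: "fpg r g \<le> 1 / (2 * D)" if r: "r \<in> {1/2..<R}" and g: "g \<in> carrier G" "wl g = m" for r g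
  proof (rule ccontr)
    assume "\<not> ?thesis"
    then have big: "1 / (2 * D) < fpg r g" by simp
    have r': "0 < r" "r < R" using r by auto
    obtain x where x: "geo x m" "x 0 = \<one>" "x m = g" using geo_exists[OF g(1)] g(2) by metis
    obtain I a where I: "I \<subseteq> {..m}" "c * real m - C \<le> card I" "\<forall>i\<in>I. a i \<in> F"
      and sm: "\<forall>r\<in>{1/2..<R}. (\<Sum>i\<in>I. (fpg r (x i \<otimes> a i \<otimes> (inv (x i) \<otimes> x m)))\<^sup>2) \<le> C * (ln (real (Suc m)) + 1)"
      using bp[OF x(1,2)] by blast
    have "b * real (card I) = (\<Sum>i\<in>I. b)" by simp
    also have "\<dots> \<le> (\<Sum>i\<in>I. (fpg r (x i \<otimes> a i \<otimes> (inv (x i) \<otimes> x m)))\<^sup>2)"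
    proof (rule sum_mono)
      fix i assume i: "i \<in> I"
      then have im: "i \<le> m" using I by auto
      have cc: "x i \<in> carrier G" "a i \<in> carrier G" "x m \<in> carrier G" "inv (x i) \<otimes> x m \<in> carrier G"
        using I i F(2) geo_imp_carrier[OF x(1)] im by auto
      let ?f = "fpg r (x i)" and ?h = "fpg r (inv (x i) \<otimes> x m)"
      have p: "0 < ?f" "0 < ?h" using fpg_pos[OF r'] cc by auto
      have "fpg r g \<le> D * (?f * ?h)" using sub[OF r x(1) im] x cc by simp
      then have "1 / (2 * D) \<le> D * (?f * ?h)" using big by simp
      then have "(cF / D) * (1 / (2 * D)) \<le> (cF / D) * (D * (?f * ?h))"
        using cF D by (intro mult_left_mono) auto
      also have "\<dots> = ?f * cF * ?h" using D by simp
      also have "\<dots> \<le> ?f * fpg r (a i) * ?h"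
        using cF(2)[OF r] I(3) i p by (intro mult_right_mono mult_left_mono) auto
      also have "\<dots> \<le> fpg r (x i \<otimes> a i) * ?h"
        using p cc fpg_mult_le[OF r'] by (intro mult_right_mono) auto
      also have "\<dots> \<le> fpg r (x i \<otimes> a i \<otimes> (inv (x i) \<otimes> x m))" using cc by (intro fpg_mult_le[OF r']) auto
      finally have "((cF / D) * (1 / (2 * D)))\<^sup>2 \<le> (fpg r (x i \<otimes> a i \<otimes> (inv (x i) \<otimes> x m)))\<^sup>2"
        using cF D by (intro power_mono) auto
      then show "b \<le> (fpg r (x i \<otimes> a i \<otimes> (inv (x i) \<otimes> x m)))\<^sup>2" by (simp only: b_def power_mult_distrib)
    qed
    also have "\<dots> \<le> C * (ln (real (Suc m)) + 1)" using sm r by blast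
    also have "\<dots> < b * (c * real m - C)" by (rule m)
    also have "\<dots> \<le> b * real (card I)" using I(2) b by (intro mult_left_mono) auto
    finally show False by simp
  qed
  \<comment> \<open>Cutting off an initial piece of length \<open>m\<close> costs \<open>D\<close>
    and gains 1 / (2 * D), hence gains a factor 1 / 2.\<close>
  have dec: "fpg r g \<le> (1 / 2) ^ (wl g div m)" if r: "r \<in> {1/2..<R}" and g: "g \<in> carrier G" for r g
    using g
  proof (induction "wl g" arbitrary: g rule: less_induct)
    case less
    have r': "0 < r" "r < R" using r by auto
    show ?case
    proof (cases "wl g < m")
      case True
      then show ?thesis using fpg_le_1[OF r' less.prems] by simp
    next
      case False
      let ?n = "wl g"
      have mn: "m \<le> ?n" using False by simp
      obtain x where x: "geo x ?n" "x 0 = \<one>" "x ?n = g" using geo_exists[OF less.prems] by metis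
      have xm: "x m \<in> carrier G" using geo_imp_carrier[OF x(1) mn] .
      let ?g = "inv (x m) \<otimes> g"
      have w: "wl ?g = ?n - m" "wl (x m) = m"
        using geo_wl[OF x(1) mn le_refl] geo_wl[OF x(1) le0 mn] x xm by simp_all
      have h: "fpg r ?g \<le> (1 / 2) ^ ((?n - m) div m)"
        using less.hyps[of ?g] w m(3) mn xm less.prems by simp
      have hp: "0 < fpg r ?g" using xm less.prems by (intro fpg_pos[OF r']) auto
      have "fpg r g \<le> D * (fpg r (x m) * fpg r ?g)" using sub[OF r x(1) mn] x xm less.prems by simp
      also have "\<dots> \<le> D * ((1 / (2 * D)) * fpg r ?g)"
        using half[OF r xm w(2)] D hp by (intro mult_left_mono mult_right_mono) auto
      also have "\<dots> = (1 / 2) * fpg r ?g" using D by simp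
      also have "\<dots> \<le> (1 / 2) * (1 / 2) ^ ((?n - m) div m)" using h by simp
      also have "\<dots> = (1 / 2) ^ (?n div m)"
        using mn m(3) by (simp add: le_div_geq)
      finally show ?thesis .
    qed
  qed
  \<comment> \<open>The incomplete last piece, of length less than \<open>m\<close>, accounts for
    the constant 2 in front of the powers of \<rho>.\<close>
  define \<rho> where "\<rho> = root m (1 / 2)"
  have rho: "0 < \<rho>" "\<rho> < 1" "\<rho> ^ m = 1 / 2" using m(3) by (auto simp: \<rho>_def)
  have "fpg r g \<le> 2 * \<rho> ^ wl g" if r: "r \<in> {1/2..<R}" and g: "g \<in> carrier G" for r g
  proof -
    have "wl g \<le> m * (wl g div m) + m" using m(3) by (metis add_left_mono less_imp_le mod_less_divisor mult_div_mod_eq)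
    then have "\<rho> ^ (m * (wl g div m) + m) \<le> \<rho> ^ wl g" using rho by (intro power_decreasing) auto
    moreover have "\<rho> ^ (m * (wl g div m) + m) = (1 / 2) ^ (wl g div m) * (1 / 2)"
      by (simp add: power_add power_mult rho(3))
    ultimately show ?thesis using dec[OF r g] by simp
  qed
  then show ?thesis using rho by (intro that[of 2 \<rho>]) auto
qed

end

section \<open>Passage to the radius of convergence\<close>

context hyp_walk
begin

lemma green_eq_grn:
  assumes "0 < r" "r < R" "x \<in> carrier G" "y \<in> carrier G"
  shows "green G \<mu> r x y = ennreal (grn r {} x y)"
proof -
  have "green G \<mu> r x y = (\<Sum>n. ennreal (ker r {} n x y))"
    by (simp add: green_def ker_empty)
  also have "\<dots> = ennreal (grn r {} x y)"
    unfolding grn_def using assms by (intro suminf_ennreal2 summable_ker) auto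
  finally show ?thesis .
qed

text \<open>Each partial sum is a polynomial in \<open>r\<close>, so its bound passes to r = R from
  the left; as the terms are nonnegative, this bounds the whole series.\<close>

lemma green_radius_le:
  assumes xy: "x \<in> carrier G" "y \<in> carrier G" and B: "\<And>r. r \<in> {1/2..<R} \<Longrightarrow> grn r {} x y \<le> B"
  shows "green G \<mu> R x y \<le> ennreal B"
proof -
  let ?p = "\<lambda>n. transition_prob G \<mu> n x y"
  have R1: "1 \<le> R" by (rule radius_ge_1)
  have p0: "0 \<le> ?p n" for n by (simp add: transition_prob_def)
  have part: "(\<Sum>n<T. ?p n * R ^ n) \<le> B" for T
  proof (rule tendsto_upperbound)
    show "((\<lambda>r. \<Sum>n<T. ?p n * r ^ n) \<longlongrightarrow> (\<Sum>n<T. ?p n * R ^ n)) (at_left R)"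
      by (intro tendsto_intros)
    have "eventually (\<lambda>r. r \<in> {1/2<..<R}) (at_left R)"
      using R1 by (intro eventually_at_leftI[of "1/2"]) auto
    then show "eventually (\<lambda>r. (\<Sum>n<T. ?p n * r ^ n) \<le> B) (at_left R)"
    proof eventually_elim
      case (elim r)
      have "(\<Sum>n<T. ker r {} n x y) \<le> grn r {} x y"
        unfolding grn_def using elim xy by (intro sum_le_suminf summable_ker) auto
      with B[of r] elim show ?case by (simp add: ker_empty)
    qed
  qed simp
  have "green G \<mu> R x y \<le> ennreal B"
    unfolding green_def
  proof (rule suminf_le_const)
    fix T
    have "(\<Sum>n<T. ennreal (?p n * R ^ n)) = ennreal (\<Sum>n<T. ?p n * R ^ n)"
      using p0 R1 by (intro sum_ennreal) auto
    also have "\<dots> \<le> ennreal B" using part by (rule ennreal_leI)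
    finally show "(\<Sum>n<T. ennreal (?p n * R ^ n)) \<le> ennreal B" .
  qed (rule summableI)
  then show ?thesis .
qed

theorem green_decay_and_ancona:
  "(\<exists>(C::real) (\<rho>::real). 0 < \<rho> \<and> \<rho> < 1 \<and>
      (\<forall>x\<in>carrier G. \<forall>y\<in>carrier G. green G \<mu> R x y \<le> ennreal (C * \<rho> ^ word_metric G S x y))) \<and>
   (\<exists>C::real. \<forall>r\<in>{1..R}. \<forall>m x. geodesic_segment G (carrier G) S x m \<longrightarrow>
      (\<forall>k\<in>{1..m}. green G \<mu> r (x 0) (x m)
         \<le> ennreal C * green G \<mu> r (x 0) (x k) * green G \<mu> r (x k) (x m)))"
proof (intro conjI)
  obtain L where L: "1 \<le> L" "\<And>r x y Y. r \<in> {1/2..<R} \<Longrightarrow> x \<in> carrier G \<Longrightarrow> y \<in> carrier G \<Longrightarrow> grn r Y x y \<le> L"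
    by (rule grn_bounded) blast
  show "\<exists>(C::real) (\<rho>::real). 0 < \<rho> \<and> \<rho> < 1 \<and>
      (\<forall>x\<in>carrier G. \<forall>y\<in>carrier G. green G \<mu> R x y \<le> ennreal (C * \<rho> ^ word_metric G S x y))"
  proof -
    obtain C \<rho> where C: "0 < C" "0 < \<rho>" "\<rho> < 1"
      and dec: "\<And>r g. r \<in> {1/2..<R} \<Longrightarrow> g \<in> carrier G \<Longrightarrow> fpg r g \<le> C * \<rho> ^ wl g"
      by (rule fpg_decay) blast
    have "green G \<mu> R x y \<le> ennreal (L * C * \<rho> ^ word_metric G S x y)"
      if xy: "x \<in> carrier G" "y \<in> carrier G" for x y
    proof (rule green_radius_le[OF xy])
      fix r assume r: "r \<in> {1/2..<R}"
      then have r': "0 < r" "r < R" by auto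
      have "grn r {} x y = grn r {} \<one> \<one> * fpg r (inv x \<otimes> y)" by (rule grn_eq_fpg[OF r' xy])
      also have "\<dots> \<le> L * (C * \<rho> ^ wl (inv x \<otimes> y))"
        using L dec[OF r, of "inv x \<otimes> y"] xy r fpg_pos[OF r', of "inv x \<otimes> y"]
        by (intro mult_mono) auto
      finally show "grn r {} x y \<le> L * C * \<rho> ^ word_metric G S x y"
        using word_metric_eq[OF xy] by (simp add: mult.assoc)
    qed
    then show ?thesis using C by blast
  qed
  obtain K where K: "1 \<le> K" and anc: "\<And>r x m k. r \<in> {1/2..<R} \<Longrightarrow> geo x m \<Longrightarrow> k \<le> m \<Longrightarrow>
    grn r {} (x 0) (x m) \<le> K * (grn r {} (x 0) (x k) * grn r {} (x k) (x m))"
    by (rule ancona_geo) blast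
  have "green G \<mu> r (x 0) (x m) \<le> ennreal K * green G \<mu> r (x 0) (x k) * green G \<mu> r (x k) (x m)"
    if r: "r \<in> {1..R}" and seg: "geodesic_segment G (carrier G) S x m" and k: "k \<in> {1..m}" for r m x k
  proof -
    have g: "geo x m" by (rule geodesic_segment_geo[OF seg])
    have c: "x 0 \<in> carrier G" "x m \<in> carrier G" "x k \<in> carrier G" using geo_imp_carrier[OF g] k by auto
    show ?thesis
    proof (cases "r = R")
      case False
      then have r': "0 < r" "r < R" "r \<in> {1/2..<R}" using r by auto
      have "ennreal (grn r {} (x 0) (x m)) \<le> ennreal (K * (grn r {} (x 0) (x k) * grn r {} (x k) (x m)))"
        using anc[OF r'(3) g, of k] k by (intro ennreal_leI) auto
      also have "\<dots> = ennreal K * ennreal (grn r {} (x 0) (x k)) * ennreal (grn r {} (x k) (x m))"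
        using K grn_nonneg[OF r'(1,2)] c by (simp add: ennreal_mult mult.assoc)
      finally show ?thesis using green_eq_grn[OF r'(1,2)] c by simp
    next
      case True
      \<comment> \<open>The Green function at \<open>R\<close> is finite by
        \<open>grn_bounded\<close>, so it can be handled as a real number. The right-hand side is
        first enlarged to its value at \<open>R\<close>, and only then does \<open>r\<close> tend to
        \<open>R\<close> on the left.\<close>
      define h where "h a b = enn2real (green G \<mu> R a b)" for a b
      have fin: "green G \<mu> R a b = ennreal (h a b)" if "a \<in> carrier G" "b \<in> carrier G" for a b
      proof -
        have "green G \<mu> R a b \<le> ennreal L" using L(2) that by (intro green_radius_le) auto
        then show ?thesis unfolding h_def by (metis ennreal_enn2real ennreal_less_top le_less_trans)
      qed
      have le: "grn s {} a b \<le> h a b" if s: "s \<in> {1/2..<R}" and ab: "a \<in> carrier G" "b \<in> carrier G" for s a b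
      proof -
        have "green G \<mu> s a b \<le> green G \<mu> R a b"
          unfolding green_def using s
          by (intro suminf_le ennreal_leI mult_left_mono power_mono summableI) (auto simp: transition_prob_def)
        then have "ennreal (grn s {} a b) \<le> ennreal (h a b)"
          using green_eq_grn[of s a b] fin[OF ab] s ab by simp
        then show ?thesis by (simp add: h_def)
      qed
      have "green G \<mu> R (x 0) (x m) \<le> ennreal (K * (h (x 0) (x k) * h (x k) (x m)))"
      proof (rule green_radius_le[OF c(1,2)])
        fix s assume s: "s \<in> {1/2..<R}"
        then have s': "0 < s" "s < R" by auto
        have "grn s {} (x 0) (x m) \<le> K * (grn s {} (x 0) (x k) * grn s {} (x k) (x m))"
          using anc[OF s g, of k] k by auto
        also have "\<dots> \<le> K * (h (x 0) (x k) * h (x k) (x m))"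
          using K c le[OF s] grn_nonneg[OF s'] by (intro mult_left_mono mult_mono) (auto simp: h_def)
        finally show "grn s {} (x 0) (x m) \<le> K * (h (x 0) (x k) * h (x k) (x m))" .
      qed
      also have "\<dots> = ennreal K * ennreal (h (x 0) (x k)) * ennreal (h (x k) (x m))"
        using K by (simp add: ennreal_mult mult.assoc h_def)
      finally show ?thesis using True fin c by simp
    qed
  qed
  then show "\<exists>C::real. \<forall>r\<in>{1..R}. \<forall>m x. geodesic_segment G (carrier G) S x m \<longrightarrow>
      (\<forall>k\<in>{1..m}. green G \<mu> r (x 0) (x m)
         \<le> ennreal C * green G \<mu> r (x 0) (x k) * green G \<mu> r (x k) (x m))" by blast
qed

end

section \<open>The Frobenius norm on SL(2,R)\<close>

definition mk2 :: "real \<Rightarrow> real \<Rightarrow> real \<Rightarrow> real \<Rightarrow> real^2^2" where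
  "mk2 a b c d = (\<chi> i j. if i = 1 then if j = 1 then a else b else if j = 1 then c else d)"

text \<open>The adjugate: the inverse on SL(2,R), but linear in the entries, so that it visibly
  preserves the Frobenius norm.\<close>

definition adj2 :: "real^2^2 \<Rightarrow> real^2^2" where
  "adj2 A = mk2 (A$2$2) (- A$1$2) (- A$2$1) (A$1$1)"

lemma mk2_sel [simp]:
  "mk2 a b c d $ 1 $ 1 = a" "mk2 a b c d $ 1 $ 2 = b" "mk2 a b c d $ 2 $ 1 = c" "mk2 a b c d $ 2 $ 2 = d"
  by (simp_all add: mk2_def)

lemma mat2_eq_iff: "A = B \<longleftrightarrow> A$1$1 = B$1$1 \<and> A$1$2 = B$1$2 \<and> A$2$1 = B$2$1 \<and> A$2$2 = (B$2$2 :: real)"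
  for A B :: "real^2^2"
  by (auto simp: vec_eq_iff forall_2)

lemma mult2_sel: "((A :: real^2^2) ** B) $ i $ j = A$i$1 * B$1$j + A$i$2 * B$2$j"
  by (simp add: matrix_matrix_mult_def sum_2)

lemma mult2_vec_sel: "((A :: real^2^2) *v x) $ i = A$i$1 * x$1 + A$i$2 * x$2"
  by (simp add: matrix_vector_mult_def sum_2)

lemma mat1_sel [simp]: "(mat 1 :: real^2^2) $ 1 $ 1 = 1" "(mat 1 :: real^2^2) $ 1 $ 2 = 0"
  "(mat 1 :: real^2^2) $ 2 $ 1 = 0" "(mat 1 :: real^2^2) $ 2 $ 2 = 1"
  by (simp_all add: mat_def)

lemma det_mk2 [simp]: "det (mk2 a b c d) = a * d - b * c"
  by (simp add: det_2)

lemma adj2_sel [simp]: "adj2 A $ 1 $ 1 = A$2$2" "adj2 A $ 1 $ 2 = - A$1$2"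
  "adj2 A $ 2 $ 1 = - A$2$1" "adj2 A $ 2 $ 2 = A$1$1"
  by (simp_all add: adj2_def)

lemma det_adj2 [simp]: "det (adj2 A) = det A"
  by (simp add: det_2)

lemma adj2_adj2 [simp]: "adj2 (adj2 A) = A"
  by (simp add: mat2_eq_iff)

lemma adj2_mult: "adj2 (A ** B) = adj2 B ** adj2 A"
  by (simp add: mat2_eq_iff mult2_sel algebra_simps)

lemma adj2_mat1 [simp]: "adj2 (mat 1) = mat 1"
  by (simp add: mat2_eq_iff)

lemma adj2_left: "det A = 1 \<Longrightarrow> adj2 A ** A = mat 1" and adj2_right: "det A = 1 \<Longrightarrow> A ** adj2 A = mat 1"
  by (simp_all add: mat2_eq_iff mult2_sel det_2 algebra_simps)

lemma adj2_cancel [simp]: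
  assumes "det A = 1"
  shows "adj2 A ** (A ** B) = B" "A ** (adj2 A ** B) = B"
  using adj2_left[OF assms] adj2_right[OF assms] by (simp_all add: matrix_mul_assoc)

lemma norm2_sq: "(norm (A :: real^2^2))\<^sup>2 = (A$1$1)\<^sup>2 + (A$1$2)\<^sup>2 + (A$2$1)\<^sup>2 + (A$2$2)\<^sup>2"
  by (simp add: norm_vec_def L2_set_def sum_2)

lemma norm_vec2_sq: "(norm (x :: real^2))\<^sup>2 = (x$1)\<^sup>2 + (x$2)\<^sup>2"
  by (simp add: norm_vec_def L2_set_def sum_2)

lemma norm2_eqI:
  fixes A B :: "real^2^2"
  assumes "(norm A)\<^sup>2 = (norm B)\<^sup>2"
  shows "norm A = norm B"
  using assms by (simp add: power2_eq_iff_nonneg)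

lemma norm_adj2 [simp]: "norm (adj2 A) = norm A"
  by (rule norm2_eqI) (simp add: norm2_sq)

lemma norm_mult2_le:
  fixes A B :: "real^2^2"
  shows "norm (A ** B) \<le> norm A * norm B"
proof (rule power2_le_imp_le)
  have cs: "(a * x + b * y)\<^sup>2 \<le> (a\<^sup>2 + b\<^sup>2) * (x\<^sup>2 + y\<^sup>2)" for a b x y :: real
  proof -
    have "(a\<^sup>2 + b\<^sup>2) * (x\<^sup>2 + y\<^sup>2) - (a * x + b * y)\<^sup>2 = (a * y - b * x)\<^sup>2"
      by (simp add: power2_eq_square algebra_simps)
    then show ?thesis by (metis diff_ge_0_iff_ge zero_le_power2)
  qed
  have "(norm (A ** B))\<^sup>2 \<le>
     ((A$1$1)\<^sup>2 + (A$1$2)\<^sup>2) * ((B$1$1)\<^sup>2 + (B$2$1)\<^sup>2) + ((A$1$1)\<^sup>2 + (A$1$2)\<^sup>2) * ((B$1$2)\<^sup>2 + (B$2$2)\<^sup>2) +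
     ((A$2$1)\<^sup>2 + (A$2$2)\<^sup>2) * ((B$1$1)\<^sup>2 + (B$2$1)\<^sup>2) + ((A$2$1)\<^sup>2 + (A$2$2)\<^sup>2) * ((B$1$2)\<^sup>2 + (B$2$2)\<^sup>2)"
    unfolding norm2_sq mult2_sel by (intro add_mono cs)
  also have "\<dots> = (norm A * norm B)\<^sup>2"
    unfolding power_mult_distrib norm2_sq by (simp add: algebra_simps)
  finally show "(norm (A ** B))\<^sup>2 \<le> (norm A * norm B)\<^sup>2" .
qed simp

lemma norm2_ge:
  assumes "det (A :: real^2^2) = 1"
  shows "2 \<le> (norm A)\<^sup>2" "1 \<le> norm A"
proof -
  have "0 \<le> (A$1$1 - A$2$2)\<^sup>2 + (A$1$2 + A$2$1)\<^sup>2" by simp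
  also have "\<dots> = (norm A)\<^sup>2 - 2 * det A"
    unfolding norm2_sq det_2 by (simp add: power2_eq_square algebra_simps)
  finally show 2: "2 \<le> (norm A)\<^sup>2" using assms by simp
  then have "1\<^sup>2 \<le> (norm A)\<^sup>2" by simp
  then show "1 \<le> norm A" by (rule power2_le_imp_le) simp
qed

text \<open>The point of the Klein disc that corresponds to \<open>A A\<^sup>T\<close>: if \<open>A A\<^sup>T\<close> has half trace \<open>t\<close>, the point
  is at Euclidean distance \<open>sqrt (1 - 1 / t\<^sup>2)\<close> from the centre.\<close>

definition half_trace :: "real^2^2 \<Rightarrow> real" where
  "half_trace A = (norm A)\<^sup>2 / 2"

definition klein :: "real^2^2 \<Rightarrow> complex" where
  "klein A = Complex (((A$1$1)\<^sup>2 + (A$1$2)\<^sup>2 - (A$2$1)\<^sup>2 - (A$2$2)\<^sup>2) / 2 / half_trace A)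
     ((A$1$1 * A$2$1 + A$1$2 * A$2$2) / half_trace A)"

lemma half_trace_ge_1: "det A = 1 \<Longrightarrow> 1 \<le> half_trace A"
  using norm2_ge(1)[of A] by (simp add: half_trace_def)

lemma norm_klein:
  assumes "det A = 1"
  shows "(cmod (klein A))\<^sup>2 = 1 - 1 / (half_trace A)\<^sup>2"
proof -
  let ?p = "((A$1$1)\<^sup>2 + (A$1$2)\<^sup>2 - (A$2$1)\<^sup>2 - (A$2$2)\<^sup>2) / 2" and ?q = "A$1$1 * A$2$1 + A$1$2 * A$2$2"
  have t: "0 < half_trace A" using half_trace_ge_1[OF assms] by simp
  have "(half_trace A)\<^sup>2 - ?p\<^sup>2 - ?q\<^sup>2 = (det A)\<^sup>2"
    unfolding half_trace_def norm2_sq det_2 by (simp add: power2_eq_square field_simps)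
  then have "?p\<^sup>2 + ?q\<^sup>2 = (half_trace A)\<^sup>2 - 1" using assms by simp
  moreover have "(cmod (klein A))\<^sup>2 = (?p\<^sup>2 + ?q\<^sup>2) / (half_trace A)\<^sup>2"
  proof -
    have "(cmod (klein A))\<^sup>2 = (?p / half_trace A)\<^sup>2 + (?q / half_trace A)\<^sup>2" by (simp add: klein_def cmod_def)
    moreover have "(p / h)\<^sup>2 + (q / h)\<^sup>2 = (p\<^sup>2 + q\<^sup>2) / h\<^sup>2" for p q h :: real
      by (simp add: power_divide add_divide_distrib)
    ultimately show ?thesis by (rule trans)
  qed
  ultimately show ?thesis using t by (simp add: diff_divide_distrib)
qed

text \<open>\<open>half_trace A\<close> is cosh of the hyperbolic distance from the base point to
  its image under \<open>A\<close>. The formula is the one for cosh of a distance in the Klein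
  model, with the inner product of the two points expressed by their distance through
  polarization.\<close>

lemma norm_adj2_mult_sq:
  assumes "det A = 1" "det B = 1"
  shows "(norm (adj2 A ** B))\<^sup>2 = half_trace A * half_trace B * (cmod (klein A - klein B))\<^sup>2
      + half_trace A / half_trace B + half_trace B / half_trace A"
proof -
  define t where "t = half_trace A"
  define s where "s = half_trace B"
  have ts: "0 < t" "0 < s" using half_trace_ge_1 assms by (fastforce simp: t_def s_def)+
  have "(norm (adj2 A ** B))\<^sup>2 = 2 * (t * s - ((A$1$1)\<^sup>2 + (A$1$2)\<^sup>2 - (A$2$1)\<^sup>2 - (A$2$2)\<^sup>2) / 2 *
      (((B$1$1)\<^sup>2 + (B$1$2)\<^sup>2 - (B$2$1)\<^sup>2 - (B$2$2)\<^sup>2) / 2)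
      - (A$1$1 * A$2$1 + A$1$2 * A$2$2) * (B$1$1 * B$2$1 + B$1$2 * B$2$2))"
    unfolding norm2_sq mult2_sel t_def s_def half_trace_def by (simp add: power2_eq_square field_simps)
  also have "\<dots> = 2 * (t * s) * (1 - (Re (klein A) * Re (klein B) + Im (klein A) * Im (klein B)))"
    using ts by (simp add: klein_def t_def[symmetric] s_def[symmetric] field_simps)
  also have "Re (klein A) * Re (klein B) + Im (klein A) * Im (klein B)
      = ((cmod (klein A))\<^sup>2 + (cmod (klein B))\<^sup>2 - (cmod (klein A - klein B))\<^sup>2) / 2"
    unfolding cmod_power2 by (simp add: power2_eq_square field_simps)
  also have "2 * (t * s) * (1 - ((cmod (klein A))\<^sup>2 + (cmod (klein B))\<^sup>2 - (cmod (klein A - klein B))\<^sup>2) / 2)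
      = t * s * (cmod (klein A - klein B))\<^sup>2 + t / s + s / t"
    unfolding norm_klein[OF assms(1)] norm_klein[OF assms(2)] t_def[symmetric] s_def[symmetric]
    using ts by (simp add: field_simps power2_eq_square)
  finally show ?thesis by (simp add: t_def s_def)
qed

text \<open>Displays the visual distance as a Euclidean norm. The two reciprocals of
  \<open>half_trace\<close> sit in separate coordinates, which prepares the triangle inequality of
  \<open>norm_ptolemy\<close>.\<close>

lemma norm_adj2_mult_eq:
  assumes "det A = 1" "det B = 1"
  shows "norm (adj2 A ** B) = norm A * norm B / 2 * norm (klein A - klein B, 1 / half_trace A, 1 / half_trace B)"
proof -
  have ts: "0 < half_trace A" "0 < half_trace B" using half_trace_ge_1 assms by fastforce+
  have "(norm (adj2 A ** B))\<^sup>2 = (norm A * norm B / 2 * norm (klein A - klein B, 1 / half_trace A, 1 / half_trace B))\<^sup>2"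
  proof -
    have "(norm A * norm B / 2)\<^sup>2 = half_trace A * half_trace B" by (simp add: half_trace_def power_mult_distrib power_divide)
    moreover have "(norm (klein A - klein B, 1 / half_trace A, 1 / half_trace B))\<^sup>2 =
       (cmod (klein A - klein B))\<^sup>2 + (1 / half_trace A)\<^sup>2 + (1 / half_trace B)\<^sup>2" using ts by (simp add: norm_Pair)
    ultimately show ?thesis
      using ts unfolding norm_adj2_mult_sq[OF assms] power_mult_distrib[of "norm A * norm B / 2"]
      by (simp add: field_simps power2_eq_square)
  qed
  then show ?thesis by (simp add: power2_eq_iff_nonneg)
qed

text \<open>After division by the three norms this is the triangle inequality through
  \<open>klein B\<close>, with the coordinates belonging to \<open>B\<close> set to 0; restoring
  them only increases the two norms on the right.\<close>

lemma norm_ptolemy: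
  assumes "det A = 1" "det B = 1" "det C = 1"
  shows "norm (adj2 A ** C) * norm B \<le> norm (adj2 A ** B) * norm C + norm (adj2 B ** C) * norm A"
proof -
  let ?a = "1 / half_trace A" and ?b = "1 / half_trace B" and ?c = "1 / half_trace C"
  have "norm (klein A - klein C, ?a, ?c) = norm ((klein A - klein B, ?a, 0) + (klein B - klein C, 0, ?c))" by simp
  also have "\<dots> \<le> norm (klein A - klein B, ?a, 0::real) + norm (klein B - klein C, 0::real, ?c)" by (rule norm_triangle_ineq)
  also have "\<dots> \<le> norm (klein A - klein B, ?a, ?b) + norm (klein B - klein C, ?b, ?c)"
    by (intro add_mono) (auto simp: norm_Pair)
  finally have "norm A * norm B * norm C / 2 * norm (klein A - klein C, ?a, ?c) \<le> norm A * norm B * norm C / 2 *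
     (norm (klein A - klein B, ?a, ?b) + norm (klein B - klein C, ?b, ?c))"
    by (intro mult_left_mono) auto
  then show ?thesis
    unfolding norm_adj2_mult_eq[OF assms(1,3)] norm_adj2_mult_eq[OF assms(1,2)] norm_adj2_mult_eq[OF assms(2,3)]
    by (simp add: algebra_simps)
qed

section \<open>Cocompact discrete subgroups of SL(2,R)\<close>

text \<open>Stated for sets of matrices in general, because besides the preimage of the Fuchsian
  group it is interpreted for a conjugate of \<Delta> and for a subgroup of index at most
  two.\<close>

locale sl2_lattice =
  fixes \<Delta> :: "(real^2^2) set"
  assumes det1: "A \<in> \<Delta> \<Longrightarrow> det A = 1"
    and one_mem: "mat 1 \<in> \<Delta>"
    and mult_mem: "A \<in> \<Delta> \<Longrightarrow> B \<in> \<Delta> \<Longrightarrow> A ** B \<in> \<Delta>"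
    and adj_mem: "A \<in> \<Delta> \<Longrightarrow> adj2 A \<in> \<Delta>"
    and finite_ball: "finite {A \<in> \<Delta>. norm A \<le> T}"
    and cocompact: "\<exists>M. \<forall>A. det A = 1 \<longrightarrow> (\<exists>D\<in>\<Delta>. norm (adj2 D ** A) \<le> M)"
begin

text \<open>By cocompactness the lower unipotent with entry \<open>x\<close> is moved into a bounded
  set by some upper triangular \<open>D x\<close>, which forces \<open>l\<close> to grow like
  \<open>x\<close>, \<open>d\<close> to decay like 1 / x and \<open>b\<close> to stay bounded and
  away from 0. Then D(x)^-1 D(2x) stays bounded and its corner entry tends to 0, so by discreteness
  the entry vanishes for large \<open>x\<close>. Hence l * b is constant along x, 2x, 4x, ...,
  although it has to grow like \<open>x\<close>.\<close>

lemma no_upper_triangular: "\<not> (\<forall>A\<in>\<Delta>. A$2$1 = 0)"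
proof
  assume up: "\<forall>A\<in>\<Delta>. A$2$1 = 0"
  obtain M0 where M0: "\<And>A. det A = 1 \<Longrightarrow> \<exists>D\<in>\<Delta>. norm (adj2 D ** A) \<le> M0" using cocompact by blast
  define M where "M = max 1 M0"
  have "M0 \<le> M" by (simp add: M_def)
  then have "\<exists>D\<in>\<Delta>. norm (adj2 D ** mk2 1 0 x 1) \<le> M" for x
    using M0[of "mk2 1 0 x 1"] order_trans by (metis det_mk2 diff_zero mult.commute mult_1 mult_zero_left)
  then have "\<exists>D\<in>\<Delta>. norm (D ** mk2 1 0 x 1) \<le> M" for x using adj_mem by blast
  then obtain D where D: "\<And>x. D x \<in> \<Delta>" "\<And>x. norm (D x ** mk2 1 0 x 1) \<le> M" by metis
  have M1: "1 \<le> M" by (simp add: M_def)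
  define l where "l x = D x $ 1 $ 1" for x
  define b where "b x = D x $ 1 $ 2" for x
  define d where "d x = D x $ 2 $ 2" for x
  have D21: "D x $ 2 $ 1 = 0" for x using up D by blast
  have ld: "l x * d x = 1" for x using det1[OF D(1)[of x]] D21[of x] by (simp add: det_2 l_def d_def)
  have entry: "\<bar>A $ i $ j\<bar> \<le> norm A" for A :: "real^2^2" and i j
    by (metis Finite_Cartesian_Product.norm_nth_le order_trans real_norm_def)
  have bd: "\<bar>l x + b x * x\<bar> \<le> M" "\<bar>b x\<bar> \<le> M" "\<bar>d x * x\<bar> \<le> M" for x
  proof -
    have "\<bar>(D x ** mk2 1 0 x 1) $ i $ j\<bar> \<le> M" for i j using entry D(2)[of x] by (meson order_trans)
    from this[of 1 1] this[of 1 2] this[of 2 1] show "\<bar>l x + b x * x\<bar> \<le> M" "\<bar>b x\<bar> \<le> M" "\<bar>d x * x\<bar> \<le> M"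
      by (simp_all add: mult2_sel l_def b_def d_def D21)
  qed
  have d_le: "\<bar>d x\<bar> \<le> M / x" and l_ge: "x / M \<le> \<bar>l x\<bar>" and l_le: "\<bar>l x\<bar> \<le> 2 * M * x" if x: "1 \<le> x" for x
  proof -
    show 1: "\<bar>d x\<bar> \<le> M / x" using bd(3)[of x] x by (simp add: abs_mult field_simps)
    have "1 = \<bar>l x\<bar> * \<bar>d x\<bar>" using ld[of x] by (simp add: abs_mult[symmetric])
    also have "\<dots> \<le> \<bar>l x\<bar> * (M / x)" using 1 by (intro mult_left_mono) auto
    finally show "x / M \<le> \<bar>l x\<bar>" using x M1 by (simp add: field_simps)
    have "\<bar>b x * x\<bar> = \<bar>b x\<bar> * x" using x by (simp add: abs_mult)
    then have "\<bar>l x\<bar> \<le> \<bar>l x + b x * x\<bar> + \<bar>b x\<bar> * x" by linarith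
    also have "\<dots> \<le> M + M * x" using bd(1,2)[of x] x by (intro add_mono mult_right_mono) auto
    also have "\<dots> \<le> 2 * M * x" using M1 x mult_left_mono[of 1 x M] by simp
    finally show "\<bar>l x\<bar> \<le> 2 * M * x" .
  qed
  have b_ge: "1 / (2 * M) \<le> \<bar>b x\<bar>" if x: "2 * M\<^sup>2 \<le> x" for x
  proof -
    have "1 \<le> M\<^sup>2" using M1 by simp
    then have x1: "1 \<le> x" "0 < x" using x by linarith+
    have "x / M - M \<le> \<bar>l x\<bar> - \<bar>l x + b x * x\<bar>" using l_ge[OF x1(1)] bd(1)[of x] by simp
    also have "\<dots> \<le> \<bar>b x * x\<bar>" by linarith
    also have "\<dots> = \<bar>b x\<bar> * x" using x1 by (simp add: abs_mult)
    finally have "x / M - M \<le> \<bar>b x\<bar> * x" .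
    moreover have "x / (2 * M) \<le> x / M - M" using x M1 by (simp add: field_simps power2_eq_square)
    ultimately have "x / (2 * M) \<le> \<bar>b x\<bar> * x" by linarith
    then have "(1 / (2 * M)) * x \<le> \<bar>b x\<bar> * x" by simp
    then show ?thesis using x1(2) mult_le_cancel_right_pos by blast
  qed
  have prod: "norm (adj2 (D x) ** D (2 * x)) \<le> 4 * M\<^sup>2 + 2 * M\<^sup>2 + M\<^sup>2"
      "(adj2 (D x) ** D (2 * x)) $ 1 $ 2 = d x * b (2 * x) - b x * d (2 * x)"
      "\<bar>d x * b (2 * x) - b x * d (2 * x)\<bar> \<le> 2 * M\<^sup>2 / x" if x: "1 \<le> x" for x
  proof -
    let ?P = "adj2 (D x) ** D (2 * x)"
    have x2: "1 \<le> 2 * x" using x by simp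
    show e: "?P $ 1 $ 2 = d x * b (2 * x) - b x * d (2 * x)" by (simp add: mult2_sel d_def b_def)
    have "\<bar>d x * b (2 * x) - b x * d (2 * x)\<bar> \<le> \<bar>d x\<bar> * \<bar>b (2 * x)\<bar> + \<bar>b x\<bar> * \<bar>d (2 * x)\<bar>"
      by (simp add: abs_mult[symmetric])
    also have "\<dots> \<le> (M / x) * M + M * (M / (2 * x))"
      using d_le[OF x] d_le[OF x2] bd(2) x M1 by (intro add_mono mult_mono) auto
    also have "\<dots> \<le> 2 * M\<^sup>2 / x" using x M1 by (simp add: field_simps power2_eq_square)
    finally show o: "\<bar>d x * b (2 * x) - b x * d (2 * x)\<bar> \<le> 2 * M\<^sup>2 / x" .
    also have "\<dots> \<le> 2 * M\<^sup>2" using x M1 by (simp add: field_simps)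
    finally have o': "\<bar>?P $ 1 $ 2\<bar> \<le> 2 * M\<^sup>2" unfolding e .
    have "\<bar>?P $ 1 $ 1\<bar> = \<bar>d x\<bar> * \<bar>l (2 * x)\<bar>" by (simp add: mult2_sel D21 d_def l_def abs_mult)
    also have "\<dots> \<le> (M / x) * (2 * M * (2 * x))" using d_le[OF x] l_le[OF x2] x M1 by (intro mult_mono) auto
    finally have o1: "\<bar>?P $ 1 $ 1\<bar> \<le> 4 * M\<^sup>2" using x by (simp add: power2_eq_square mult_ac)
    have "\<bar>?P $ 2 $ 2\<bar> = \<bar>l x\<bar> * \<bar>d (2 * x)\<bar>" by (simp add: mult2_sel D21 d_def l_def abs_mult)
    also have "\<dots> \<le> (2 * M * x) * (M / (2 * x))" using d_le[OF x2] l_le[OF x] x M1 by (intro mult_mono) auto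
    finally have o2: "\<bar>?P $ 2 $ 2\<bar> \<le> M\<^sup>2" using x by (simp add: power2_eq_square mult_ac)
    have "norm ?P \<le> \<bar>?P $ 1 $ 1\<bar> + \<bar>?P $ 1 $ 2\<bar> + \<bar>?P $ 2 $ 1\<bar> + \<bar>?P $ 2 $ 2\<bar>"
    proof (rule power2_le_imp_le)
      have "a\<^sup>2 + b\<^sup>2 + c\<^sup>2 + e\<^sup>2 \<le> (\<bar>a\<bar> + \<bar>b\<bar> + \<bar>c\<bar> + \<bar>e\<bar>)\<^sup>2" for a b c e :: real
      proof -
        have "(\<bar>a\<bar> + \<bar>b\<bar> + \<bar>c\<bar> + \<bar>e\<bar>)\<^sup>2 = a\<^sup>2 + b\<^sup>2 + c\<^sup>2 + e\<^sup>2 + 2 * (\<bar>a\<bar> * \<bar>b\<bar> + \<bar>a\<bar> * \<bar>c\<bar> + \<bar>a\<bar> * \<bar>e\<bar> + \<bar>b\<bar> * \<bar>c\<bar> + \<bar>b\<bar> * \<bar>e\<bar> + \<bar>c\<bar> * \<bar>e\<bar>)"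
          by (simp add: power2_eq_square algebra_simps abs_mult_self_eq)
        then show ?thesis by simp
      qed
      then show "(norm ?P)\<^sup>2 \<le> (\<bar>?P $ 1 $ 1\<bar> + \<bar>?P $ 1 $ 2\<bar> + \<bar>?P $ 2 $ 1\<bar> + \<bar>?P $ 2 $ 2\<bar>)\<^sup>2"
        unfolding norm2_sq .
    qed auto
    moreover have "?P $ 2 $ 1 = 0" by (simp add: mult2_sel D21)
    ultimately show "norm ?P \<le> 4 * M\<^sup>2 + 2 * M\<^sup>2 + M\<^sup>2" using o' o1 o2 by simp
  qed
  \<comment> \<open>The nonzero corner entries of the elements in a fixed ball are finitely many, so
    they are bounded below by some \<epsilon>; a corner entry below \<epsilon> must be 0.\<close>
  define V where "V = (\<lambda>A. \<bar>A $ 1 $ 2\<bar>) ` {A \<in> \<Delta>. norm A \<le> 4 * M\<^sup>2 + 2 * M\<^sup>2 + M\<^sup>2} - {0}"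
  have Vf: "finite V" unfolding V_def using finite_ball by simp
  define \<epsilon> where "\<epsilon> = Min (insert 1 V)"
  have eps: "0 < \<epsilon>" "\<And>v. v \<in> V \<Longrightarrow> \<epsilon> \<le> v"
  proof -
    show "0 < \<epsilon>" unfolding \<epsilon>_def using Vf by (subst Min_gr_iff) (auto simp: V_def)
    show "\<epsilon> \<le> v" if "v \<in> V" for v unfolding \<epsilon>_def using Vf that by (intro Min_le) auto
  qed
  define X where "X = max (2 * M\<^sup>2) (2 * M\<^sup>2 / \<epsilon> + 1)"
  have X: "1 \<le> X" "2 * M\<^sup>2 \<le> X" "2 * M\<^sup>2 / \<epsilon> < X" using M1 eps(1) by (auto simp: X_def le_max_iff_disj)
  have same: "l (2 * x) * b (2 * x) = l x * b x" if x: "X \<le> x" for x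
  proof -
    have x1: "1 \<le> x" using x X by simp
    let ?P = "adj2 (D x) ** D (2 * x)"
    have "?P \<in> \<Delta>" using D adj_mem mult_mem by blast
    then have "\<bar>?P $ 1 $ 2\<bar> \<in> V \<or> ?P $ 1 $ 2 = 0" using prod(1)[OF x1] by (auto simp: V_def)
    moreover have "\<bar>?P $ 1 $ 2\<bar> < \<epsilon>"
    proof -
      have "2 * M\<^sup>2 < \<epsilon> * X" using X(3) eps(1) by (simp add: field_simps)
      also have "\<dots> \<le> \<epsilon> * x" using x eps(1) by simp
      finally have "2 * M\<^sup>2 / x < \<epsilon>" using x1 by (simp add: field_simps)
      then show ?thesis using prod(2,3)[OF x1] by simp
    qed
    ultimately have "d x * b (2 * x) = b x * d (2 * x)" using eps(2) prod(2)[OF x1] by fastforce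
    then have "l (2 * x) * (l x * d x) * b (2 * x) = l x * b x * (l (2 * x) * d (2 * x))" by (simp add: mult_ac)
    then show ?thesis using ld by simp
  qed
  have const: "l (2 ^ n * X) * b (2 ^ n * X) = l X * b X" for n
  proof (induction n)
    case (Suc n)
    have "X \<le> 2 ^ n * X" using X(1) by simp
    from same[OF this] Suc show ?case by (simp add: mult.assoc)
  qed simp
  obtain n where n: "\<bar>l X * b X\<bar> * (2 * M * M) < 2 ^ n" using real_arch_pow[of 2] by auto
  have x: "2 ^ n \<le> 2 ^ n * X" "2 * M\<^sup>2 \<le> 2 ^ n * X" "1 \<le> 2 ^ n * X"
    using X by (auto intro: order_trans[OF _ mult_right_mono[of 1 "2 ^ n" X]] order_trans[OF one_le_power[of 2 n]])
  have "2 ^ n / M * (1 / (2 * M)) \<le> \<bar>l (2 ^ n * X)\<bar> * \<bar>b (2 ^ n * X)\<bar>"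
    using l_ge[OF x(3)] b_ge[OF x(2)] M1 x(1)
    by (intro mult_mono) (auto intro: order_trans[OF divide_right_mono[OF x(1)]])
  also have "\<dots> = \<bar>l X * b X\<bar>" using const[of n] by (simp add: abs_mult[symmetric])
  finally show False using n M1 by (simp add: field_simps)
qed

text \<open>If all of \<Delta> preserved the line of \<open>v\<close>, conjugation by the rotation
  \<open>Q\<close> that takes the first axis to this line would make \<Delta> upper triangular.
  Rotations preserve the Frobenius norm, so the conjugate is again a lattice.\<close>

lemma stabilizer_not_cocompact_aux:
  assumes v: "v \<noteq> 0"
  shows "\<exists>A\<in>\<Delta>. (A *v v)$1 * v$2 - (A *v v)$2 * v$1 \<noteq> 0"
proof (rule ccontr)
  assume "\<not> ?thesis"
  then have fx: "(A *v v)$1 * v$2 = (A *v v)$2 * v$1" if "A \<in> \<Delta>" for A using that by auto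
  define n where "n = norm v"
  have n: "0 < n" "(v$1)\<^sup>2 + (v$2)\<^sup>2 = n\<^sup>2" using v by (auto simp: n_def norm_vec2_sq)
  define Q where "Q = mk2 (v$1 / n) (- v$2 / n) (v$2 / n) (v$1 / n)"
  have uv: "(v$1 / n)\<^sup>2 + (v$2 / n)\<^sup>2 = 1" using n by (simp add: power_divide add_divide_distrib[symmetric])
  have Q: "det Q = 1" using uv by (simp add: Q_def power2_eq_square)
  have iso: "norm (Q ** A) = norm A" "norm (adj2 Q ** A) = norm A" for A :: "real^2^2"
  proof -
    have e: "norm (mk2 a (- b) b a ** A) = norm A" if "a\<^sup>2 + b\<^sup>2 = 1" for a b and A :: "real^2^2"
    proof (rule norm2_eqI)
      have "(norm (mk2 a (- b) b a ** A))\<^sup>2 = (a\<^sup>2 + b\<^sup>2) * (norm A)\<^sup>2"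
        unfolding norm2_sq mult2_sel by (simp add: power2_eq_square algebra_simps)
      then show "(norm (mk2 a (- b) b a ** A))\<^sup>2 = (norm A)\<^sup>2" using that by simp
    qed
    show "norm (Q ** A) = norm A" using e[OF uv] by (simp add: Q_def)
    have "adj2 Q = mk2 (v$1 / n) (- (- v$2 / n)) (- v$2 / n) (v$1 / n)" by (simp add: adj2_def Q_def)
    then show "norm (adj2 Q ** A) = norm A" using e[of "v$1 / n" "- v$2 / n"] uv by simp
  qed
  let ?U = "(\<lambda>A. adj2 Q ** A ** Q) ` \<Delta>"
  have adjU: "adj2 (adj2 Q ** A ** Q) = adj2 Q ** adj2 A ** Q" for A
    by (simp add: adj2_mult matrix_mul_assoc)
  have norm_conj: "norm (adj2 Q ** A ** Q) = norm A" for A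
  proof -
    have "norm (adj2 Q ** A ** Q) = norm (adj2 (A ** Q))" using iso(2)[of "A ** Q"] by (simp add: matrix_mul_assoc)
    also have "\<dots> = norm (adj2 A)" using iso(2)[of "adj2 A"] by (simp add: adj2_mult)
    finally show ?thesis by simp
  qed
  interpret U: sl2_lattice ?U
  proof
    show "det A = 1" if "A \<in> ?U" for A using that det1 Q by (auto simp: det_mul)
    show "mat 1 \<in> ?U" using one_mem adj2_left[OF Q] by (intro image_eqI[of _ _ "mat 1"]) auto
    show "A ** B \<in> ?U" if AB: "A \<in> ?U" "B \<in> ?U" for A B
    proof -
      obtain A' B' where AB': "A' \<in> \<Delta>" "B' \<in> \<Delta>" "A = adj2 Q ** A' ** Q" "B = adj2 Q ** B' ** Q" using AB by auto
      have "A ** B = adj2 Q ** (A' ** B') ** Q"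
        unfolding AB' using Q by (simp add: matrix_mul_assoc[symmetric])
      then show ?thesis using AB' mult_mem by blast
    qed
    show "adj2 A \<in> ?U" if "A \<in> ?U" for A using that adjU adj_mem by auto
    show "finite {A \<in> ?U. norm A \<le> T}" for T
    proof -
      have "{A \<in> ?U. norm A \<le> T} \<subseteq> (\<lambda>A. adj2 Q ** A ** Q) ` {A \<in> \<Delta>. norm A \<le> T}"
        using norm_conj by auto
      then show ?thesis using finite_ball finite_surj by blast
    qed
    obtain M where M: "\<And>A. det A = 1 \<Longrightarrow> \<exists>D\<in>\<Delta>. norm (adj2 D ** A) \<le> M" using cocompact by blast
    have "\<exists>D\<in>?U. norm (adj2 D ** A) \<le> M" if A: "det A = 1" for A
    proof -
      obtain D where D: "D \<in> \<Delta>" "norm (adj2 D ** (Q ** A)) \<le> M" using M[of "Q ** A"] A Q by (auto simp: det_mul)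
      have "norm (adj2 (adj2 Q ** D ** Q) ** A) = norm (adj2 Q ** (adj2 D ** (Q ** A)))"
        unfolding adjU by (simp add: matrix_mul_assoc)
      then have "norm (adj2 (adj2 Q ** D ** Q) ** A) \<le> M" using D iso by simp
      then show ?thesis using D by blast
    qed
    then show "\<exists>M. \<forall>A. det A = 1 \<longrightarrow> (\<exists>D\<in>?U. norm (adj2 D ** A) \<le> M)" by blast
  qed
  have "(adj2 Q ** A ** Q) $ 2 $ 1 = 0" if "A \<in> \<Delta>" for A
  proof -
    have "(adj2 Q ** A ** Q) $ 2 $ 1 = ((A *v v)$2 * v$1 - (A *v v)$1 * v$2) / n\<^sup>2"
      using n(1) by (simp add: Q_def mult2_sel mult2_vec_sel power2_eq_square field_simps)
    then show ?thesis using fx[OF that] by simp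
  qed
  then show False using U.no_upper_triangular by blast
qed

end

section \<open>Orbits of lines and branching elements\<close>

context sl2_lattice
begin

lemma inner2: "(x :: real^2) \<bullet> y = x$1 * y$1 + x$2 * y$2"
  by (simp add: inner_vec_def sum_2)

lemma vec2_eq_iff: "x = y \<longleftrightarrow> x$1 = y$1 \<and> x$2 = (y$2 :: real)" for x y :: "real^2"
  by (auto simp: vec_eq_iff forall_2)

text \<open>If the orbit of \<open>v\<close> stayed in two lines, one of them the line of
  \<open>v\<close>, the stabilizer \<open>U\<close> of this line would have index at most two in
  \<Delta>, so it would still be cocompact, against \<open>stabilizer_not_cocompact_aux\<close>. The
  determinant \<open>cr\<close> detects whether two vectors are parallel.\<close>

lemma two_lines_aux:
  assumes v: "v \<noteq> 0" and xi: "\<xi>1 \<noteq> 0" "\<xi>2 \<noteq> 0" and v1: "\<xi>1 \<bullet> v = 0"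
  shows "\<exists>A\<in>\<Delta>. \<xi>1 \<bullet> (A *v v) \<noteq> 0 \<and> \<xi>2 \<bullet> (A *v v) \<noteq> 0"
proof (rule ccontr)
  assume "\<not> ?thesis"
  then have two: "\<xi>1 \<bullet> (A *v v) = 0 \<or> \<xi>2 \<bullet> (A *v v) = 0" if "A \<in> \<Delta>" for A using that by blast
  define cr where "cr u w = u$1 * w$2 - u$2 * w$1" for u w :: "real^2"
  have cr0: "cr u w = 0" if "\<xi> \<noteq> 0" "\<xi> \<bullet> u = 0" "\<xi> \<bullet> w = 0" for \<xi> u w
  proof -
    have "\<xi>$1 * cr u w = (\<xi> \<bullet> u) * w$2 - (\<xi> \<bullet> w) * u$2" "\<xi>$2 * cr u w = (\<xi> \<bullet> w) * u$1 - (\<xi> \<bullet> u) * w$1"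
      by (simp_all add: cr_def inner2 algebra_simps)
    then show ?thesis using that by (auto simp: vec2_eq_iff)
  qed
  have crm: "cr (A *v u) (A *v w) = det A * cr u w" for A u w
    by (simp add: cr_def mult2_vec_sel det_2 algebra_simps)
  have mult: "\<exists>k. u = k *\<^sub>R v" if "cr u v = 0" for u
  proof -
    have n: "v$1 * v$1 + v$2 * v$2 \<noteq> 0" using v by (auto simp: vec2_eq_iff add_nonneg_eq_0_iff)
    have e: "u$1 * v$2 = u$2 * v$1" using that by (simp add: cr_def)
    have "u = ((u$1 * v$1 + u$2 * v$2) / (v$1 * v$1 + v$2 * v$2)) *\<^sub>R v"
      using n e unfolding vec2_eq_iff
      by (simp add: field_simps)
    then show ?thesis by blast
  qed
  have crsym: "cr u w = 0 \<longleftrightarrow> cr w u = 0" for u w by (auto simp: cr_def algebra_simps)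
  define U where "U = {A \<in> \<Delta>. cr (A *v v) v = 0}"
  obtain A0 where A0: "A0 \<in> \<Delta>" "cr (A0 *v v) v \<noteq> 0"
    using stabilizer_not_cocompact_aux[OF v] unfolding cr_def by blast
  have A0\<xi>: "\<xi>2 \<bullet> (A0 *v v) = 0" using two[OF A0(1)] cr0[OF xi(1) _ v1] A0(2) by blast
  have UA: "adj2 A0 ** A \<in> U" if A: "A \<in> \<Delta>" "A \<notin> U" for A
  proof -
    have "\<xi>2 \<bullet> (A *v v) = 0" using two[OF A(1)] cr0[OF xi(1) _ v1] A by (auto simp: U_def)
    then have "cr (A *v v) (A0 *v v) = 0" using cr0[OF xi(2)] A0\<xi> by blast
    moreover have "A0 *v ((adj2 A0 ** A) *v v) = A *v v"
      using adj2_right[OF det1[OF A0(1)]] by (simp add: matrix_vector_mul_assoc matrix_mul_assoc)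
    ultimately have "cr ((adj2 A0 ** A) *v v) v = 0"
      using crm[of A0 "(adj2 A0 ** A) *v v" v] det1[OF A0(1)] by simp
    then show ?thesis using A A0 adj_mem mult_mem by (simp add: U_def)
  qed
  have Uadj: "adj2 A \<in> U" if "A \<in> U" for A
  proof -
    have A: "A \<in> \<Delta>" "cr (A *v v) v = 0" using that by (auto simp: U_def)
    have "A *v (adj2 A *v v) = v" using adj2_right[OF det1[OF A(1)]] by (simp add: matrix_vector_mul_assoc)
    then have "cr (adj2 A *v v) v = cr v (A *v v)" using crm[of A "adj2 A *v v" v] det1[OF A(1)] by simp
    then show ?thesis using A crsym adj_mem by (simp add: U_def)
  qed
  interpret U: sl2_lattice U
  proof
    show "det A = 1" if "A \<in> U" for A using that det1 by (simp add: U_def)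
    show "mat 1 \<in> U" using one_mem by (simp add: U_def cr_def)
    show "A ** B \<in> U" if AB: "A \<in> U" "B \<in> U" for A B
    proof -
      have "cr (B *v v) v = 0" using AB by (simp add: U_def)
      from mult[OF this] obtain k where k: "B *v v = k *\<^sub>R v" by blast
      have "(A ** B) *v v = k *\<^sub>R (A *v v)"
        using k by (simp add: matrix_vector_mul_assoc[symmetric] vec2_eq_iff mult2_vec_sel algebra_simps)
      then have "cr ((A ** B) *v v) v = k * cr (A *v v) v" by (simp add: cr_def algebra_simps)
      then show ?thesis using AB mult_mem by (simp add: U_def)
    qed
    show "adj2 A \<in> U" if "A \<in> U" for A using Uadj that .
    show "finite {A \<in> U. norm A \<le> T}" for T
      by (rule finite_subset[OF _ finite_ball[of T]]) (auto simp: U_def)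
    obtain M where M: "\<And>A. det A = 1 \<Longrightarrow> \<exists>D\<in>\<Delta>. norm (adj2 D ** A) \<le> M" using cocompact by blast
    have "\<exists>D\<in>U. norm (adj2 D ** A) \<le> max M (norm A0 * M)" if "det A = 1" for A
    proof -
      obtain D where D: "D \<in> \<Delta>" "norm (adj2 D ** A) \<le> M" using M[OF \<open>det A = 1\<close>] by blast
      show ?thesis
      proof (cases "adj2 D \<in> U")
        case True
        then have "D \<in> U" using Uadj[OF True] by simp
        then show ?thesis using D by (intro bexI[of _ D]) auto
      next
        case False
        then have "adj2 (adj2 A0 ** adj2 D) \<in> U" using UA D adj_mem Uadj by blast
        then have U: "D ** A0 \<in> U" by (simp add: adj2_mult)
        have "norm (adj2 (D ** A0) ** A) \<le> norm (adj2 A0) * norm (adj2 D ** A)"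
          using norm_mult2_le[of "adj2 A0" "adj2 D ** A"] by (simp add: adj2_mult matrix_mul_assoc)
        also have "\<dots> \<le> norm A0 * M" using D by (simp add: mult_left_mono)
        finally show ?thesis using U by (intro bexI[of _ "D ** A0"]) auto
      qed
    qed
    then show "\<exists>M. \<forall>A. det A = 1 \<longrightarrow> (\<exists>D\<in>U. norm (adj2 D ** A) \<le> M)" by blast
  qed
  obtain A where "A \<in> U" "(A *v v)$1 * v$2 - (A *v v)$2 * v$1 \<noteq> 0"
    using U.stabilizer_not_cocompact_aux[OF v] by blast
  then show False by (simp add: U_def cr_def)
qed

lemma orbit_not_in_two_lines:
  assumes v: "v \<noteq> 0" and xi: "\<xi>1 \<noteq> 0" "\<xi>2 \<noteq> 0"
  shows "\<exists>A\<in>\<Delta>. \<xi>1 \<bullet> (A *v v) \<noteq> 0 \<and> \<xi>2 \<bullet> (A *v v) \<noteq> 0"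
proof (cases "\<xi>1 \<bullet> v = 0 \<or> \<xi>2 \<bullet> v = 0")
  case True
  then show ?thesis using two_lines_aux[OF v xi] two_lines_aux[OF v xi(2,1)] by blast
next
  case False
  then show ?thesis using one_mem by (intro bexI[of _ "mat 1"]) auto
qed

text \<open>Take rows of \<open>X\<close> and \<open>X'\<close> and a column of \<open>Y\<close>
  carrying at least half of the respective norms, with unit directions \<xi>, \<xi>',
  \<open>v\<close>. An entry of X A Y is then the product of the two lengths with the inner product
  of \<xi> and A v, and likewise for \<open>X'\<close>. By \<open>orbit_not_in_two_lines\<close>
  some \<open>A\<close> makes both inner products nonzero, and compactness of the triples of unit
  vectors leaves finitely many \<open>A\<close>. The two halves give the divisor 4.\<close>

lemma branching:
  obtains F c where "finite F" "F \<subseteq> \<Delta>" "0 < c"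
    "\<And>X X' Y. det X = 1 \<Longrightarrow> det X' = 1 \<Longrightarrow> det Y = 1 \<Longrightarrow>
      \<exists>A\<in>F. c * (norm X * norm Y) \<le> norm (X ** A ** Y) \<and> c * (norm X' * norm Y) \<le> norm (X' ** A ** Y)"
proof -
  let ?S = "sphere (0 :: real^2) 1"
  define f where "f A p = min \<bar>fst p \<bullet> (A *v snd (snd p))\<bar> \<bar>fst (snd p) \<bullet> (A *v snd (snd p))\<bar>"
    for A and p :: "(real^2) \<times> (real^2) \<times> (real^2)"
  have cont: "continuous_on UNIV (f A)" for A
    unfolding f_def
    by (intro continuous_intros bounded_linear.continuous_on[OF matrix_vector_mul_bounded_linear])
  have "compact (?S \<times> ?S \<times> ?S)" by (intro compact_Times compact_sphere)
  then obtain D where D: "D \<subseteq> \<Delta> \<times> UNIV" "finite D" "?S \<times> ?S \<times> ?S \<subseteq> (\<Union>d\<in>D. {p. 1 / real (Suc (snd d)) < f (fst d) p})"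
  proof (rule compactE_image[where C="\<Delta> \<times> (UNIV :: nat set)" and f="\<lambda>d. {p. 1 / real (Suc (snd d)) < f (fst d) p}"])
    show "open {p. 1 / real (Suc (snd d)) < f (fst d) p}" for d :: "(real^2^2) \<times> nat"
      using cont[of "fst d"] by (intro open_Collect_less continuous_on_const) auto
    show "?S \<times> ?S \<times> ?S \<subseteq> (\<Union>d\<in>\<Delta> \<times> UNIV. {p. 1 / real (Suc (snd d)) < f (fst d) p})"
    proof
      fix p assume "p \<in> ?S \<times> ?S \<times> ?S"
      then have "fst p \<noteq> 0" "fst (snd p) \<noteq> 0" "snd (snd p) \<noteq> 0" by auto
      then obtain A where A: "A \<in> \<Delta>" "0 < f A p" using orbit_not_in_two_lines unfolding f_def by fastforce
      obtain n where "inverse (real (Suc n)) < f A p" using reals_Archimedean[OF A(2)] by blast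
      then show "p \<in> (\<Union>d\<in>\<Delta> \<times> UNIV. {p. 1 / real (Suc (snd d)) < f (fst d) p})"
        using A(1) by (intro UN_I[of "(A, n)"]) (auto simp: inverse_eq_divide)
    qed
  qed
  define c where "c = Min (insert 1 ((\<lambda>d. 1 / real (Suc (snd d))) ` D))"
  have c: "0 < c" "\<And>d. d \<in> D \<Longrightarrow> c \<le> 1 / real (Suc (snd d))"
    unfolding c_def using D(2) by (auto intro: Min_le)
  have dir: "\<exists>\<xi> i k. norm \<xi> = 1 \<and> norm X / 2 \<le> k \<and> X $ i = k *\<^sub>R \<xi>" if "det X = 1" for X :: "real^2^2"
  proof -
    have X: "1 \<le> norm X" using norm2_ge[OF that] by simp
    have "\<exists>i. norm X / 2 \<le> norm (X $ i)"
    proof (rule ccontr)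
      assume "\<not> ?thesis"
      then have "norm (X$1) \<le> norm X / 2" "norm (X$2) \<le> norm X / 2" by (auto simp: not_le less_imp_le)
      then have "(norm (X$1))\<^sup>2 + (norm (X$2))\<^sup>2 \<le> (norm X / 2)\<^sup>2 + (norm X / 2)\<^sup>2" by (intro add_mono power_mono) auto
      moreover have "(norm X)\<^sup>2 = (norm (X$1))\<^sup>2 + (norm (X$2))\<^sup>2" unfolding norm2_sq norm_vec2_sq by simp
      ultimately have "(norm X)\<^sup>2 \<le> (norm X)\<^sup>2 / 2" by (simp add: power_divide)
      then show False using X by simp
    qed
    then obtain i where i: "norm X / 2 \<le> norm (X $ i)" by blast
    then have n: "0 < norm (X $ i)" using X by linarith
    show ?thesis using i n X
      by (intro exI[of _ "(1 / norm (X $ i)) *\<^sub>R (X $ i)"] exI[of _ i] exI[of _ "norm (X $ i)"]) auto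
  qed
  have entry: "\<bar>A $ i $ j\<bar> \<le> norm A" for A :: "real^2^2" and i j
    by (metis Finite_Cartesian_Product.norm_nth_le order_trans real_norm_def)
  have main: "\<exists>A\<in>fst ` D. c / 4 * (norm X * norm Y) \<le> norm (X ** A ** Y) \<and> c / 4 * (norm X' * norm Y) \<le> norm (X' ** A ** Y)"
    if det: "det X = 1" "det X' = 1" "det Y = 1" for X X' Y
  proof -
    obtain \<xi> i k where x: "norm \<xi> = 1" "norm X / 2 \<le> k" "X $ i = k *\<^sub>R \<xi>" using dir[OF det(1)] by blast
    obtain \<xi>' i' k' where x': "norm \<xi>' = 1" "norm X' / 2 \<le> k'" "X' $ i' = k' *\<^sub>R \<xi>'" using dir[OF det(2)] by blast
    have "det (transpose Y) = 1" using det by simp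
    from dir[OF this] obtain v j l where v: "norm v = 1" "norm (transpose Y) / 2 \<le> l" "transpose Y $ j = l *\<^sub>R v" by blast
    have nt: "norm (transpose Y) = norm Y"
      by (rule norm2_eqI) (simp add: norm2_sq transpose_def)
    have "(\<xi>, \<xi>', v) \<in> ?S \<times> ?S \<times> ?S" using x x' v by simp
    then obtain d where d: "d \<in> D" "1 / real (Suc (snd d)) < f (fst d) (\<xi>, \<xi>', v)" using D(3) by blast
    let ?A = "fst d"
    have f: "c \<le> \<bar>\<xi> \<bullet> (?A *v v)\<bar>" "c \<le> \<bar>\<xi>' \<bullet> (?A *v v)\<bar>" using c(2)[OF d(1)] d(2) by (auto simp: f_def)
    have Yv: "Y$1$j = l * v$1" "Y$2$j = l * v$2" using v(3) by (auto simp: transpose_def vec2_eq_iff)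
    have E: "(Z ** ?A ** Y) $ a $ j = (m * l) * (\<zeta> \<bullet> (?A *v v))" if "Z $ a = m *\<^sub>R \<zeta>" for Z :: "real^2^2" and a m \<zeta>
    proof -
      have "Z$a$1 = m * \<zeta>$1" "Z$a$2 = m * \<zeta>$2" using that by auto
      then show ?thesis using Yv by (simp add: mult2_sel inner2 mult2_vec_sel algebra_simps)
    qed
    have est: "c / 4 * (norm Z * norm Y) \<le> norm (Z ** ?A ** Y)"
      if z: "Z $ a = m *\<^sub>R \<zeta>" "norm Z / 2 \<le> m" "c \<le> \<bar>\<zeta> \<bullet> (?A *v v)\<bar>" for Z :: "real^2^2" and a m \<zeta>
    proof -
      have m0: "0 \<le> m" using z(2) norm_ge_zero[of Z] by linarith
      have l0: "0 \<le> l" using v(2) norm_ge_zero[of "transpose Y"] by linarith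
      have "c / 4 * (norm Z * norm Y) = (norm Z / 2 * (norm Y / 2)) * c" by simp
      also have "\<dots> \<le> (m * l) * \<bar>\<zeta> \<bullet> (?A *v v)\<bar>"
        using z v(2) nt c(1) m0 l0 by (intro mult_mono) auto
      also have "\<dots> = \<bar>(Z ** ?A ** Y) $ a $ j\<bar>" unfolding E[OF z(1)] using m0 l0 by (simp add: abs_mult)
      also have "\<dots> \<le> norm (Z ** ?A ** Y)" by (rule entry)
      finally show ?thesis .
    qed
    show ?thesis using est[OF x(3,2) f(1)] est[OF x'(3,2) f(2)] d(1) by blast
  qed
  show ?thesis by (rule that[of "fst ` D" "c / 4"]) (use D c main in auto)
qed

text \<open>Otherwise cocompactness would bound all of SL(2,R), including the diagonal matrices with
  arbitrarily large entries.\<close>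

lemma norm_unbounded: "\<exists>A\<in>\<Delta>. B < norm A"
proof (rule ccontr)
  assume "\<not> ?thesis"
  then have B: "norm A \<le> B" if "A \<in> \<Delta>" for A using that by (simp add: not_less)
  obtain M where M: "\<And>A. det A = 1 \<Longrightarrow> \<exists>D\<in>\<Delta>. norm (adj2 D ** A) \<le> M" using cocompact by blast
  define s where "s = max 1 (B * M + 1)"
  have s: "1 \<le> s" "B * M < s" by (auto simp: s_def)
  have det: "det (mk2 s 0 0 (1 / s)) = 1" using s by simp
  obtain D where D: "D \<in> \<Delta>" "norm (adj2 D ** mk2 s 0 0 (1 / s)) \<le> M" using M[OF det] by blast
  have B0: "0 \<le> B" using B[OF D(1)] norm_ge_zero order_trans by blast
  have "s\<^sup>2 \<le> (norm (mk2 s 0 0 (1 / s)))\<^sup>2" unfolding norm2_sq by simp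
  then have "s \<le> norm (mk2 s 0 0 (1 / s))" by (rule power2_le_imp_le) simp
  also have "\<dots> = norm (D ** (adj2 D ** mk2 s 0 0 (1 / s)))" using det1[OF D(1)] by simp
  also have "\<dots> \<le> norm D * norm (adj2 D ** mk2 s 0 0 (1 / s))" by (rule norm_mult2_le)
  also have "\<dots> \<le> B * M" using B[OF D(1)] D(2) B0 by (intro mult_mono) auto
  finally show False using s by simp
qed

end

lemma cmod_cis_diff_le: "cmod (cis a - cis b) \<le> \<bar>a - b\<bar>"
proof (rule power2_le_imp_le)
  have "(cmod (cis a - cis b))\<^sup>2 = 2 - 2 * cos (a - b)"
  proof -
    have "(cmod (cis a - cis b))\<^sup>2 = ((cos a)\<^sup>2 + (sin a)\<^sup>2) + ((cos b)\<^sup>2 + (sin b)\<^sup>2) - 2 * (cos a * cos b + sin a * sin b)"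
      unfolding cmod_power2 by (simp add: power2_eq_square algebra_simps)
    then show ?thesis by (simp only: sin_cos_squared_add2 cos_diff)
  qed
  also have "\<dots> = 4 * (sin ((a - b) / 2))\<^sup>2"
  proof -
    have e: "2 * ((a - b) / 2) = a - b" by simp
    show ?thesis using cos_double_sin[of "(a - b) / 2"] unfolding e by simp
  qed
  also have "\<dots> \<le> 4 * (\<bar>(a - b) / 2\<bar>)\<^sup>2"
    using abs_sin_x_le_abs_x[of "(a - b) / 2"] power_mono[of "\<bar>sin ((a - b) / 2)\<bar>" "\<bar>(a - b) / 2\<bar>" 2] by simp
  also have "\<dots> = \<bar>a - b\<bar>\<^sup>2" by (simp add: power_divide)
  finally show "(cmod (cis a - cis b))\<^sup>2 \<le> \<bar>a - b\<bar>\<^sup>2" .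
qed simp

text \<open>In one dyadic shell the radial and the angular separation of the Klein points are both
  at most 1 / (2 * m) once m >= 2; for m < 2 crude bounds give the number 64. With the two ratios,
  each at most 2, the squared norm is at most 68.\<close>

lemma norm_adj2_mult_le_9:
  assumes A: "det A = 1" and B: "det B = 1"
    and m: "1 \<le> m" "m \<le> half_trace A" "half_trace A \<le> 2 * m" "m \<le> half_trace B" "half_trace B \<le> 2 * m"
    and arg: "\<bar>Arg (klein A) - Arg (klein B)\<bar> \<le> 1 / (2 * m)"
  shows "norm (adj2 A ** B) \<le> 9"
proof (rule power2_le_imp_le)
  let ?a = "half_trace A" and ?b = "half_trace B" and ?e = "cmod (klein A - klein B)"
  have ratio: "?a / ?b \<le> 2" "?b / ?a \<le> 2" using m by (auto simp: field_simps)
  have lt1: "cmod (klein C) \<le> 1" if "det C = 1" for C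
  proof (rule power2_le_imp_le)
    show "(cmod (klein C))\<^sup>2 \<le> 1\<^sup>2" unfolding norm_klein[OF that] by simp
  qed simp
  have "?a * ?b * ?e\<^sup>2 \<le> 64"
  proof (cases "m < 2")
    case True
    have "?e \<le> 2" using norm_triangle_ineq4[of "klein A" "klein B"] lt1[OF A] lt1[OF B] by linarith
    then have "?e\<^sup>2 \<le> 2\<^sup>2" by (intro power_mono) auto
    moreover have "?a * ?b \<le> 4 * 4" using m True by (intro mult_mono) auto
    ultimately have "?a * ?b * ?e\<^sup>2 \<le> (4 * 4) * 2\<^sup>2" by (intro mult_mono[of "?a * ?b"]) auto
    then show ?thesis by simp
  next
    case False
    let ?p = "cmod (klein A)" and ?q = "cmod (klein B)"
    have half: "1 / 2 \<le> cmod (klein C)" if C: "det C = 1" "m \<le> half_trace C" for C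
    proof (rule power2_le_imp_le)
      have "2\<^sup>2 \<le> (half_trace C)\<^sup>2" using False C by (intro power_mono) auto
      then have "1 / (half_trace C)\<^sup>2 \<le> 1 / 2\<^sup>2" by (intro divide_left_mono) auto
      then show "(1 / 2)\<^sup>2 \<le> (cmod (klein C))\<^sup>2" unfolding norm_klein[OF C(1)] by (simp add: power_divide)
    qed simp
    have inv: "0 \<le> 1 / (half_trace C)\<^sup>2 \<and> 1 / (half_trace C)\<^sup>2 \<le> 1 / m\<^sup>2" if "m \<le> half_trace C" for C
    proof -
      have "m\<^sup>2 \<le> (half_trace C)\<^sup>2" "0 < m\<^sup>2" using that m by (auto intro!: power_mono)
      then show ?thesis by (auto intro!: divide_left_mono mult_pos_pos simp del: zero_less_power2)
    qed
    have "\<bar>?p - ?q\<bar> \<le> \<bar>?p - ?q\<bar> * (?p + ?q)"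
      using half[OF A m(2)] half[OF B m(4)] mult_left_mono[of 1 "?p + ?q" "\<bar>?p - ?q\<bar>"] by simp
    also have "\<dots> = \<bar>?p\<^sup>2 - ?q\<^sup>2\<bar>"
    proof -
      have "?p\<^sup>2 - ?q\<^sup>2 = (?p - ?q) * (?p + ?q)" by (simp add: power2_eq_square algebra_simps)
      then show ?thesis by (simp add: abs_mult)
    qed
    also have "\<dots> \<le> 1 / m\<^sup>2"
      unfolding norm_klein[OF A] norm_klein[OF B] using inv[OF m(2)] inv[OF m(4)] unfolding abs_le_iff by linarith
    also have "1 / m\<^sup>2 \<le> 1 / (2 * m)" using False by (simp add: power2_eq_square field_simps)
    finally have pq: "\<bar>?p - ?q\<bar> \<le> 1 / (2 * m)" .
    have eq: "klein A - klein B = of_real (?p - ?q) * cis (Arg (klein A)) + of_real ?q * (cis (Arg (klein A)) - cis (Arg (klein B)))"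
      using rcis_cmod_Arg[of "klein A"] rcis_cmod_Arg[of "klein B"] unfolding rcis_def
      by (simp add: algebra_simps)
    have "?e \<le> cmod (of_real (?p - ?q) * cis (Arg (klein A))) + cmod (of_real ?q * (cis (Arg (klein A)) - cis (Arg (klein B))))"
      by (rule ord_eq_le_trans[OF arg_cong[OF eq, of cmod] norm_triangle_ineq])
    also have "\<dots> = \<bar>?p - ?q\<bar> + ?q * cmod (cis (Arg (klein A)) - cis (Arg (klein B)))"
      by (simp only: norm_mult norm_of_real norm_cis abs_norm_cancel mult_1_right)
    also have "\<dots> \<le> 1 / (2 * m) + 1 * (1 / (2 * m))"
      using pq lt1[OF B] order_trans[OF cmod_cis_diff_le arg] by (intro add_mono mult_mono) auto
    finally have "?e \<le> 1 / m" by simp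
    then have "?e\<^sup>2 \<le> (1 / m)\<^sup>2" by (intro power_mono) auto
    moreover have "?a * ?b \<le> (2 * m) * (2 * m)" using m by (intro mult_mono) auto
    ultimately have "?a * ?b * ?e\<^sup>2 \<le> ((2 * m) * (2 * m)) * (1 / m)\<^sup>2" by (intro mult_mono[of "?a * ?b"]) auto
    also have "\<dots> = 4" using m by (simp add: power2_eq_square)
    finally show ?thesis by simp
  qed
  then show "(norm (adj2 A ** B))\<^sup>2 \<le> 9\<^sup>2"
    unfolding norm_adj2_mult_sq[OF A B] using ratio by simp
qed simp

section \<open>Counting lattice elements by norm\<close>

context sl2_lattice
begin

text \<open>The ball is divided into cells by the dyadic size of \<open>half_trace\<close> and by
  the argument of \<open>klein\<close> up to 1 / (2 * T^2). Translating by one element of a cell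
  puts the others into the ball of radius 9, so each cell has at most \<open>c0\<close> elements.
  There are O(T^2 log T) cells, and the cube absorbs the logarithm.\<close>

lemma card_ball_le:
  obtains K :: real where "\<And>T. 1 \<le> T \<Longrightarrow> card {A \<in> \<Delta>. norm A \<le> T} \<le> K * T ^ 3"
proof -
  define c0 where "c0 = card {A \<in> \<Delta>. norm A \<le> 9}"
  have main: "card {A \<in> \<Delta>. norm A \<le> T} \<le> (real c0 * 115) * T ^ 3" if T: "1 \<le> T" for T :: real
  proof -
    let ?S = "{A \<in> \<Delta>. norm A \<le> T}"
    define \<tau> where "\<tau> = T\<^sup>2"
    have tau: "1 \<le> \<tau>" using T by (simp add: \<tau>_def)
    define f where "f A = (\<lfloor>log 2 (half_trace A)\<rfloor>, \<lfloor>2 * \<tau> * Arg (klein A)\<rfloor>)" for A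
    have ht: "1 \<le> half_trace A" "half_trace A \<le> \<tau>" if "A \<in> ?S" for A
    proof -
      show "1 \<le> half_trace A" using that det1 half_trace_ge_1 by auto
      have "(norm A)\<^sup>2 \<le> T\<^sup>2" using that by (intro power_mono) auto
      then show "half_trace A \<le> \<tau>" using tau by (simp add: half_trace_def \<tau>_def)
    qed
    have fibre: "card {A \<in> ?S. f A = y} \<le> c0" for y
    proof (cases "{A \<in> ?S. f A = y} = {}")
      case False
      then obtain A where A: "A \<in> ?S" "f A = y" by blast
      show ?thesis unfolding c0_def
      proof (rule card_inj_on_le[where f="\<lambda>B. adj2 A ** B"])
        show "inj_on ((**) (adj2 A)) {A \<in> ?S. f A = y}"
          by (rule inj_on_inverseI[where g="\<lambda>B. A ** B"]) (use A det1 in auto)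
        show "(**) (adj2 A) ` {A \<in> ?S. f A = y} \<subseteq> {A \<in> \<Delta>. norm A \<le> 9}"
        proof (rule image_subsetI)
          fix B assume B: "B \<in> {A \<in> ?S. f A = y}"
          define k where "k = \<lfloor>log 2 (half_trace A)\<rfloor>"
          have k0: "0 \<le> k" using ht[OF A(1)] by (simp add: k_def)
          have kB: "k = \<lfloor>log 2 (half_trace B)\<rfloor>" using A B by (auto simp: f_def k_def)
          have sh: "2 powr k \<le> half_trace C \<and> half_trace C \<le> 2 * 2 powr k"
            if "k = \<lfloor>log 2 (half_trace C)\<rfloor>" "1 \<le> half_trace C" for C
          proof -
            have "real_of_int k \<le> log 2 (half_trace C)" "log 2 (half_trace C) \<le> real_of_int k + 1" using that by linarith+
            then have "2 powr real_of_int k \<le> half_trace C" "half_trace C \<le> 2 powr (real_of_int k + 1)"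
              using that(2) le_log_iff[of 2 "half_trace C" "real_of_int k"]
                log_le_iff[of 2 "half_trace C" "real_of_int k + 1"] by auto
            then show ?thesis by (simp add: powr_add)
          qed
          have shA: "2 powr k \<le> half_trace A \<and> half_trace A \<le> 2 * 2 powr k" using sh k_def ht[OF A(1)] by blast
          have shB: "2 powr k \<le> half_trace B \<and> half_trace B \<le> 2 * 2 powr k" using sh kB ht B by blast
          have "\<bar>a - b\<bar> \<le> 1" if "\<lfloor>a\<rfloor> = \<lfloor>b\<rfloor>" for a b :: real using that by linarith
          moreover have "\<lfloor>2 * \<tau> * Arg (klein A)\<rfloor> = \<lfloor>2 * \<tau> * Arg (klein B)\<rfloor>" using A B by (auto simp: f_def)
          ultimately have "\<bar>2 * \<tau> * Arg (klein A) - 2 * \<tau> * Arg (klein B)\<bar> \<le> 1" by blast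
          then have "2 * \<tau> * \<bar>Arg (klein A) - Arg (klein B)\<bar> \<le> 1"
            using tau by (simp add: right_diff_distrib[symmetric] abs_mult)
          then have "\<bar>Arg (klein A) - Arg (klein B)\<bar> \<le> 1 / (2 * \<tau>)" using tau by (simp add: field_simps)
          also have "\<dots> \<le> 1 / (2 * 2 powr k)" using shA ht[OF A(1)] tau by (intro divide_left_mono) auto
          finally have "norm (adj2 A ** B) \<le> 9"
            using A B shA shB k0 det1 by (intro norm_adj2_mult_le_9[where m="2 powr k"]) (auto simp: ge_one_powr_ge_zero)
          then show "adj2 A ** B \<in> {A \<in> \<Delta>. norm A \<le> 9}" using A B adj_mem mult_mem by auto
        qed
      qed (rule finite_ball)
    next
      case True
      show ?thesis unfolding True by simp
    qed
    have "card ?S = (\<Sum>A\<in>?S. 1)" by simp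
    also have "\<dots> = (\<Sum>y\<in>f ` ?S. \<Sum>A\<in>{A \<in> ?S. f A = y}. 1)" by (rule sum.image_gen[OF finite_ball])
    also have "\<dots> = (\<Sum>y\<in>f ` ?S. card {A \<in> ?S. f A = y})" by simp
    also have "\<dots> \<le> (\<Sum>y\<in>f ` ?S. c0)" by (intro sum_mono fibre)
    also have "\<dots> = c0 * card (f ` ?S)" by simp
    finally have "real (card ?S) \<le> real (c0 * card (f ` ?S))" by (rule of_nat_mono)
    then have 1: "real (card ?S) \<le> real c0 * real (card (f ` ?S))" by simp
    let ?I = "{0..\<lfloor>log 2 \<tau>\<rfloor>}" and ?J = "{\<lfloor>- (2 * \<tau> * pi)\<rfloor>..\<lfloor>2 * \<tau> * pi\<rfloor>}"
    have "f ` ?S \<subseteq> ?I \<times> ?J"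
    proof (rule image_subsetI)
      fix A assume A: "A \<in> ?S"
      have "- (2 * \<tau> * pi) \<le> 2 * \<tau> * Arg (klein A)" "2 * \<tau> * Arg (klein A) \<le> 2 * \<tau> * pi"
        using Arg_bounded[of "klein A"] tau mult_left_mono[of "- pi" "Arg (klein A)" "2 * \<tau>"] by auto
      then show "f A \<in> ?I \<times> ?J" using ht[OF A] by (auto simp: f_def intro!: floor_mono)
    qed
    then have "card (f ` ?S) \<le> card (?I \<times> ?J)" by (intro card_mono) auto
    also have "\<dots> = nat (\<lfloor>log 2 \<tau>\<rfloor> + 1) * nat (\<lfloor>2 * \<tau> * pi\<rfloor> - \<lfloor>- (2 * \<tau> * pi)\<rfloor> + 1)"
      by (simp add: card_cartesian_product)
    finally have "real (card (f ` ?S)) \<le> real (nat (\<lfloor>log 2 \<tau>\<rfloor> + 1) * nat (\<lfloor>2 * \<tau> * pi\<rfloor> - \<lfloor>- (2 * \<tau> * pi)\<rfloor> + 1))"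
      by (rule of_nat_mono)
    then have "real (card (f ` ?S)) \<le> real (nat (\<lfloor>log 2 \<tau>\<rfloor> + 1)) * real (nat (\<lfloor>2 * \<tau> * pi\<rfloor> - \<lfloor>- (2 * \<tau> * pi)\<rfloor> + 1))"
      by (simp only: of_nat_mult)
    also have "\<dots> \<le> (log 2 \<tau> + 1) * (4 * \<tau> * pi + 2)"
    proof (intro mult_mono)
      have l: "0 \<le> log 2 \<tau>" using tau by simp
      then show "real (nat (\<lfloor>log 2 \<tau>\<rfloor> + 1)) \<le> log 2 \<tau> + 1" "0 \<le> log 2 \<tau> + 1" by linarith+
      have "0 \<le> 2 * \<tau> * pi" using tau by simp
      then show "real (nat (\<lfloor>2 * \<tau> * pi\<rfloor> - \<lfloor>- (2 * \<tau> * pi)\<rfloor> + 1)) \<le> 4 * \<tau> * pi + 2" by linarith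
    qed simp
    also have "\<dots> \<le> (5 * T) * (23 * T\<^sup>2)"
    proof (intro mult_mono)
      have "ln T \<le> T - 1" using T by (intro ln_le_minus_one) auto
      moreover have "log 2 \<tau> = 2 * ln T / ln 2" using T by (simp add: \<tau>_def log_def ln_realpow)
      moreover have "2 * ln T / ln 2 \<le> 2 * ln T / (1 / 2)"
        using ln2_ge_two_thirds T by (intro divide_left_mono) auto
      ultimately show "log 2 \<tau> + 1 \<le> 5 * T" using T by simp
      have "pi \<le> 4" using pi_less_4 by simp
      then have "\<tau> * pi \<le> \<tau> * 4" using tau by (intro mult_left_mono) auto
      then show "4 * \<tau> * pi + 2 \<le> 23 * T\<^sup>2" using tau by (simp add: \<tau>_def)
    qed (use T tau in auto)
    also have "\<dots> = 115 * T ^ 3" by (simp add: power2_eq_square power3_eq_cube)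
    finally have "real c0 * real (card (f ` ?S)) \<le> real c0 * (115 * T ^ 3)" by (intro mult_left_mono) auto
    with 1 show ?thesis by (simp add: mult.assoc)
  qed
  show ?thesis by (rule that) (rule main)
qed

end

section \<open>Chains of lattice elements\<close>

context sl2_lattice
begin

text \<open>The \<open>Q R\<close> decomposition of \<open>A\<close>, with \<open>Q\<close> sending the first basis vector to the larger column,
  gives a path \<open>Q diag(s, 1/s)\<close> from \<open>Q\<close> to \<open>A\<close> that is a geodesic up to bounded errors.\<close>

lemma qr_path:
  assumes A: "det A = 1"
  shows "\<exists>lam W. 1 \<le> lam \<and> lam \<le> norm A \<and> (\<forall>s>0. det (W s) = 1) \<and>
    (\<forall>s\<ge>1. norm (W s) \<le> 2 * s) \<and> (\<forall>s\<ge>1. s \<le> lam \<longrightarrow> norm (adj2 (W s) ** A) \<le> 2 * lam / s) \<and>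
    (\<forall>s>0. \<forall>t\<ge>s. norm (adj2 (W s) ** W t) \<le> 2 * t / s)"
proof -
  \<comment> \<open>The columns are named so that \<open>u\<close> is the longer one. Only the
    square of the determinant is kept, as exchanging the columns changes its sign; the last clause
    lets the rest of the proof ignore which column was chosen.\<close>
  have "\<exists>u1 u2 w1 w2. (norm A)\<^sup>2 = u1\<^sup>2 + u2\<^sup>2 + w1\<^sup>2 + w2\<^sup>2 \<and> w1\<^sup>2 + w2\<^sup>2 \<le> u1\<^sup>2 + u2\<^sup>2 \<and> (u1 * w2 - u2 * w1)\<^sup>2 = 1 \<and>
     (\<forall>a b c d. (norm (mk2 a b c d ** A))\<^sup>2 = (a * u1 + b * u2)\<^sup>2 + (c * u1 + d * u2)\<^sup>2 + (a * w1 + b * w2)\<^sup>2 + (c * w1 + d * w2)\<^sup>2)"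
  proof (cases "(A$1$2)\<^sup>2 + (A$2$2)\<^sup>2 \<le> (A$1$1)\<^sup>2 + (A$2$1)\<^sup>2")
    case True
    have d: "A$1$1 * A$2$2 - A$2$1 * A$1$2 = 1" using A by (simp add: det_2 mult.commute)
    show ?thesis
    proof (intro exI conjI allI)
      show "(norm A)\<^sup>2 = (A$1$1)\<^sup>2 + (A$2$1)\<^sup>2 + (A$1$2)\<^sup>2 + (A$2$2)\<^sup>2" by (simp add: norm2_sq)
      show "(A$1$1 * A$2$2 - A$2$1 * A$1$2)\<^sup>2 = 1" unfolding d by simp
      show "(norm (mk2 a b c d ** A))\<^sup>2 = (a * A$1$1 + b * A$2$1)\<^sup>2 + (c * A$1$1 + d * A$2$1)\<^sup>2 +
          (a * A$1$2 + b * A$2$2)\<^sup>2 + (c * A$1$2 + d * A$2$2)\<^sup>2" for a b c d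
        by (simp add: norm2_sq mult2_sel)
    qed (rule True)
  next
    case False
    have d: "A$1$2 * A$2$1 - A$2$2 * A$1$1 = -1" using A by (simp add: det_2 mult.commute)
    show ?thesis
    proof (intro exI conjI allI)
      show "(norm A)\<^sup>2 = (A$1$2)\<^sup>2 + (A$2$2)\<^sup>2 + (A$1$1)\<^sup>2 + (A$2$1)\<^sup>2" by (simp add: norm2_sq)
      show "(A$1$2 * A$2$1 - A$2$2 * A$1$1)\<^sup>2 = 1" unfolding d by simp
      show "(norm (mk2 a b c d ** A))\<^sup>2 = (a * A$1$2 + b * A$2$2)\<^sup>2 + (c * A$1$2 + d * A$2$2)\<^sup>2 +
          (a * A$1$1 + b * A$2$1)\<^sup>2 + (c * A$1$1 + d * A$2$1)\<^sup>2" for a b c d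
        by (simp add: norm2_sq mult2_sel)
      show "(A$1$1)\<^sup>2 + (A$2$1)\<^sup>2 \<le> (A$1$2)\<^sup>2 + (A$2$2)\<^sup>2" using False by simp
    qed
  qed
  then obtain u1 u2 w1 w2 where nA: "(norm A)\<^sup>2 = u1\<^sup>2 + u2\<^sup>2 + w1\<^sup>2 + w2\<^sup>2" and uw: "w1\<^sup>2 + w2\<^sup>2 \<le> u1\<^sup>2 + u2\<^sup>2"
    and det: "(u1 * w2 - u2 * w1)\<^sup>2 = 1"
    and nm: "\<And>a b c d. (norm (mk2 a b c d ** A))\<^sup>2 = (a * u1 + b * u2)\<^sup>2 + (c * u1 + d * u2)\<^sup>2 + (a * w1 + b * w2)\<^sup>2 + (c * w1 + d * w2)\<^sup>2"
    by blast
  define lam where "lam = sqrt (u1\<^sup>2 + u2\<^sup>2)"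
  have l2: "lam\<^sup>2 = u1\<^sup>2 + u2\<^sup>2" by (simp add: lam_def)
  have l0: "0 \<le> lam" by (simp add: lam_def)
  have l1: "1 \<le> lam"
  proof (rule power2_le_imp_le)
    show "1\<^sup>2 \<le> lam\<^sup>2" using norm2_ge(1)[OF A] nA uw l2 by simp
  qed (rule l0)
  have lA: "lam \<le> norm A"
  proof (rule power2_le_imp_le)
    show "lam\<^sup>2 \<le> (norm A)\<^sup>2" unfolding nA l2 by simp
  qed simp
  define p where "p = u1 / lam"
  define q where "q = u2 / lam"
  have pq: "p\<^sup>2 + q\<^sup>2 = 1"
    unfolding p_def q_def power_divide add_divide_distrib[symmetric] l2[symmetric] using l1 by simp
  have u: "p * u1 + q * u2 = lam" "- q * u1 + p * u2 = 0"
  proof -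
    have "p * u1 + q * u2 = (u1\<^sup>2 + u2\<^sup>2) / lam" by (simp add: p_def q_def power2_eq_square add_divide_distrib)
    then show "p * u1 + q * u2 = lam" unfolding l2[symmetric] using l1 by (simp add: power2_eq_square)
    show "- q * u1 + p * u2 = 0" by (simp add: p_def q_def)
  qed
  define W where "W s = mk2 (p * s) (- q / s) (q * s) (p / s)" for s
  have adjW: "adj2 (W s) = mk2 (p / s) (q / s) (- q * s) (p * s)" for s by (simp add: W_def adj2_def)
  have detW: "det (W s) = 1" if "0 < s" for s
    using that pq by (simp add: W_def power2_eq_square)
  have n1: "norm (W s) \<le> 2 * s" if s: "1 \<le> s" for s
  proof (rule power2_le_imp_le)
    have "(norm (W s))\<^sup>2 = (p\<^sup>2 + q\<^sup>2) * s\<^sup>2 + (p\<^sup>2 + q\<^sup>2) / s\<^sup>2"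
      unfolding norm2_sq W_def by (simp add: power_mult_distrib power_divide add_divide_distrib algebra_simps)
    also have "\<dots> = s\<^sup>2 + 1 / s\<^sup>2" using pq by simp
    also have "\<dots> \<le> (2 * s)\<^sup>2"
    proof -
      have "x + y \<le> 2\<^sup>2 * x" if "y \<le> 1" "1 \<le> x" for x y :: real using that by simp
      moreover have "1 \<le> s\<^sup>2" using s by (rule one_le_power)
      moreover have "1 / x \<le> 1" if "1 \<le> x" for x :: real using that by simp
      ultimately show ?thesis unfolding power_mult_distrib by blast
    qed
    finally show "(norm (W s))\<^sup>2 \<le> (2 * s)\<^sup>2" .
  qed (use s in simp)
  have n2: "norm (adj2 (W s) ** A) \<le> 2 * lam / s" if s: "1 \<le> s" "s \<le> lam" for s
  proof (rule power2_le_imp_le)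
    have col: "(p * w1 + q * w2)\<^sup>2 + (- q * w1 + p * w2)\<^sup>2 = (p\<^sup>2 + q\<^sup>2) * (w1\<^sup>2 + w2\<^sup>2)"
      by (simp add: power2_eq_square algebra_simps)
    have low: "lam\<^sup>2 * (- q * w1 + p * w2)\<^sup>2 = 1"
    proof -
      have "lam * (- q * w1 + p * w2) = u1 * w2 - u2 * w1" using l1 by (simp add: p_def q_def field_simps)
      then show ?thesis using det by (simp only: power_mult_distrib[symmetric])
    qed
    have "(norm (adj2 (W s) ** A))\<^sup>2 = ((p * u1 + q * u2) / s)\<^sup>2 + ((- q * u1 + p * u2) * s)\<^sup>2
        + ((p * w1 + q * w2) / s)\<^sup>2 + ((- q * w1 + p * w2) * s)\<^sup>2"
      unfolding adjW nm by (simp add: algebra_simps add_divide_distrib)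
    also have "\<dots> = lam\<^sup>2 / s\<^sup>2 + (p * w1 + q * w2)\<^sup>2 / s\<^sup>2 + (- q * w1 + p * w2)\<^sup>2 * s\<^sup>2"
      unfolding u by (simp add: power_divide power_mult_distrib)
    also have "\<dots> \<le> lam\<^sup>2 / s\<^sup>2 + lam\<^sup>2 / s\<^sup>2 + lam\<^sup>2 / s\<^sup>2"
    proof (intro add_mono divide_right_mono)
      have "(p * w1 + q * w2)\<^sup>2 \<le> (p * w1 + q * w2)\<^sup>2 + (- q * w1 + p * w2)\<^sup>2" by simp
      also have "\<dots> = w1\<^sup>2 + w2\<^sup>2" unfolding col pq by simp
      also have "\<dots> \<le> lam\<^sup>2" using uw l2 by simp
      finally show "(p * w1 + q * w2)\<^sup>2 \<le> lam\<^sup>2" .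
      have "s\<^sup>2 \<le> lam\<^sup>2" using s by (intro power_mono) auto
      then have "s\<^sup>2 * s\<^sup>2 \<le> lam\<^sup>2 * lam\<^sup>2" by (intro mult_mono) auto
      then have "(- q * w1 + p * w2)\<^sup>2 * (s\<^sup>2 * s\<^sup>2) \<le> (- q * w1 + p * w2)\<^sup>2 * (lam\<^sup>2 * lam\<^sup>2)" by (intro mult_left_mono) auto
      also have "\<dots> = (lam\<^sup>2 * (- q * w1 + p * w2)\<^sup>2) * lam\<^sup>2" by (simp only: mult_ac)
      also have "\<dots> = lam\<^sup>2" unfolding low by simp
      finally have 1: "(- q * w1 + p * w2)\<^sup>2 * (s\<^sup>2 * s\<^sup>2) \<le> lam\<^sup>2" .
      have "z * y \<le> x / y" if "z * (y * y) \<le> x" "0 < y" for x y z :: real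
        using that by (simp add: field_simps)
      from this[OF 1] show "(- q * w1 + p * w2)\<^sup>2 * s\<^sup>2 \<le> lam\<^sup>2 / s\<^sup>2" using s by simp
    qed auto
    also have "\<dots> \<le> (2 * lam / s)\<^sup>2"
    proof -
      have e: "(2 * lam / s)\<^sup>2 = 4 * (lam\<^sup>2 / s\<^sup>2)" by (simp add: power_divide power_mult_distrib)
      have g: "y + y + y \<le> 4 * y" if "0 \<le> y" for y :: real using that by simp
      show ?thesis unfolding e by (rule g) simp
    qed
    finally show "(norm (adj2 (W s) ** A))\<^sup>2 \<le> (2 * lam / s)\<^sup>2" .
  qed (use s in simp)
  have n3: "norm (adj2 (W s) ** W t) \<le> 2 * t / s" if st: "0 < s" "s \<le> t" for s t
  proof (rule power2_le_imp_le)
    have "adj2 (W s) ** W t = mk2 (t / s) 0 0 (s / t)"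
    proof -
      have "p / s * (p * t) + q / s * (q * t) = (p\<^sup>2 + q\<^sup>2) * (t / s)"
        by (simp add: power2_eq_square distrib_left distrib_right add_divide_distrib mult_ac)
      moreover have "- q * s * (- q / t) + p * s * (p / t) = (p\<^sup>2 + q\<^sup>2) * (s / t)"
        by (simp add: power2_eq_square distrib_left distrib_right add_divide_distrib mult_ac)
      ultimately show ?thesis
        unfolding mat2_eq_iff mult2_sel adjW W_def mk2_sel pq by simp
    qed
    then have "(norm (adj2 (W s) ** W t))\<^sup>2 = (t / s)\<^sup>2 + (s / t)\<^sup>2" by (simp add: norm2_sq)
    also have "\<dots> \<le> (t / s)\<^sup>2 + (t / s)\<^sup>2"
    proof -
      have "s / t \<le> 1" "1 \<le> t / s" using st by auto
      then have "s / t \<le> t / s" by (rule order_trans)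
      then show ?thesis using st by (intro add_left_mono power_mono) auto
    qed
    also have "\<dots> \<le> (2 * t / s)\<^sup>2"
    proof -
      have e: "(2 * t / s)\<^sup>2 = 4 * (t / s)\<^sup>2" by (simp add: power_divide power_mult_distrib)
      have g: "y + y \<le> 4 * y" if "0 \<le> y" for y :: real using that by simp
      show ?thesis unfolding e by (rule g) simp
    qed
    finally show "(norm (adj2 (W s) ** W t))\<^sup>2 \<le> (2 * t / s)\<^sup>2" .
  qed (use st in simp)
  show ?thesis
    by (rule exI[of _ lam], rule exI[of _ W]) (intro conjI allI impI l1 lA detW n1 n2 n3)
qed

text \<open>The path of \<open>qr_path\<close> is sampled at s = exp i, and each sample is replaced
  by an element of \<Delta> at bounded distance. The chain starts at the identity and ends at
  \<open>A\<close> exactly, which adds one step at either end.\<close>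

lemma chain:
  obtains C where "\<And>A. A \<in> \<Delta> \<Longrightarrow> \<exists>T \<gamma>. \<gamma> 0 = mat 1 \<and> \<gamma> T = A \<and> (\<forall>i\<le>T. \<gamma> i \<in> \<Delta>) \<and>
      (\<forall>i\<le>T. norm (\<gamma> i) * norm (adj2 (\<gamma> i) ** A) \<le> C * norm A) \<and>
      (\<forall>i<T. norm (adj2 (\<gamma> i) ** \<gamma> (Suc i)) \<le> C) \<and> real T \<le> C * (ln (norm A) + 1)"
proof -
  obtain M0 where M0: "\<And>A. det A = 1 \<Longrightarrow> \<exists>D\<in>\<Delta>. norm (adj2 D ** A) \<le> M0" using cocompact by blast
  define M where "M = max 1 M0"
  have M1: "1 \<le> M" by (simp add: M_def)
  have near: "\<exists>D\<in>\<Delta>. norm (adj2 D ** A) \<le> M" if "det A = 1" for A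
  proof -
    have "M0 \<le> M" by (simp add: M_def)
    then show ?thesis using M0[OF that] by (meson order_trans)
  qed
  define C where "C = 10 * exp 1 * M\<^sup>2"
  have e1: "1 \<le> exp (1::real)" by simp
  have M2: "1 \<le> M\<^sup>2" "M \<le> M\<^sup>2"
    using one_le_power[OF M1, of 2] power_increasing[of 1 2 M] M1 by simp_all
  have C: "10 * M\<^sup>2 \<le> C" "10 * exp 1 * M \<le> C" "10 \<le> C"
  proof -
    show "10 * M\<^sup>2 \<le> C" unfolding C_def using e1 M2 by (intro mult_right_mono) auto
    then show "10 \<le> C" using M2 by linarith
    show "10 * exp 1 * M \<le> C" unfolding C_def using M2 by (intro mult_left_mono) auto
  qed
  have n1: "norm (mat 1 :: real^2^2) \<le> 2"
  proof (rule power2_le_imp_le)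
    show "(norm (mat 1 :: real^2^2))\<^sup>2 \<le> 2\<^sup>2" unfolding norm2_sq by simp
  qed simp
  have main: "\<exists>T \<gamma>. \<gamma> 0 = mat 1 \<and> \<gamma> T = A \<and> (\<forall>i\<le>T. \<gamma> i \<in> \<Delta>) \<and>
      (\<forall>i\<le>T. norm (\<gamma> i) * norm (adj2 (\<gamma> i) ** A) \<le> C * norm A) \<and>
      (\<forall>i<T. norm (adj2 (\<gamma> i) ** \<gamma> (Suc i)) \<le> C) \<and> real T \<le> C * (ln (norm A) + 1)"
    if A: "A \<in> \<Delta>" for A
  proof -
    have dA: "det A = 1" using A det1 by blast
    obtain lam W where l: "1 \<le> lam" "lam \<le> norm A" and W: "\<And>s. 0 < s \<Longrightarrow> det (W s) = 1"
      "\<And>s. 1 \<le> s \<Longrightarrow> norm (W s) \<le> 2 * s" "\<And>s. 1 \<le> s \<Longrightarrow> s \<le> lam \<Longrightarrow> norm (adj2 (W s) ** A) \<le> 2 * lam / s"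
      "\<And>s t. 0 < s \<Longrightarrow> s \<le> t \<Longrightarrow> norm (adj2 (W s) ** W t) \<le> 2 * t / s"
      using qr_path[OF dA] by blast
    define T where "T = nat \<lfloor>ln lam\<rfloor>"
    have T: "real T \<le> ln lam" "ln lam \<le> real T + 1"
    proof -
      have "0 \<le> ln lam" using l(1) by simp
      then show "real T \<le> ln lam" "ln lam \<le> real T + 1" unfolding T_def by linarith+
    qed
    define s where "s i = exp (real i)" for i :: nat
    have s1: "1 \<le> s i" "0 < s i" for i by (auto simp: s_def)
    have sT: "s i \<le> lam" if "i \<le> T" for i
    proof -
      have "s i \<le> exp (ln lam)" unfolding s_def using that T(1) by simp
      then show ?thesis using l(1) by simp
    qed
    have lT: "lam / s T \<le> exp 1"
    proof -
      have "lam = exp (ln lam)" using l(1) by simp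
      also have "\<dots> \<le> exp (real T + 1)" using T(2) by simp
      finally show ?thesis using s1(2)[of T] by (simp add: s_def exp_add field_simps)
    qed
    have "\<exists>D\<in>\<Delta>. norm (adj2 D ** W (s i)) \<le> M" for i using near W(1) s1 by blast
    then obtain D where D: "\<And>i. D i \<in> \<Delta>" "\<And>i. norm (adj2 (D i) ** W (s i)) \<le> M" by metis
    have dD: "det (D i) = 1" for i using D det1 by blast
    have normD: "norm (D i) \<le> 2 * M * s i" for i
    proof -
      have "D i = W (s i) ** adj2 (adj2 (D i) ** W (s i))"
        using W(1)[OF s1(2)[of i]] by (simp add: adj2_mult)
      then have "norm (D i) \<le> norm (W (s i)) * norm (adj2 (D i) ** W (s i))"
        using norm_mult2_le[of "W (s i)" "adj2 (adj2 (D i) ** W (s i))"] by simp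
      also have "\<dots> \<le> 2 * s i * M" using W(2)[OF s1(1)] D(2) s1[of i] by (intro mult_mono) auto
      finally show ?thesis by (simp add: mult_ac)
    qed
    have via: "norm (adj2 (D i) ** B) \<le> M * norm (adj2 (W (s i)) ** B)" for i and B :: "real^2^2"
    proof -
      have e: "adj2 (D i) ** B = (adj2 (D i) ** W (s i)) ** (adj2 (W (s i)) ** B)"
        using W(1)[OF s1(2)[of i]] by (simp add: matrix_mul_assoc[symmetric])
      have "norm (adj2 (D i) ** B) \<le> norm (adj2 (D i) ** W (s i)) * norm (adj2 (W (s i)) ** B)"
        unfolding e by (rule norm_mult2_le)
      also have "\<dots> \<le> M * norm (adj2 (W (s i)) ** B)" using D(2) by (intro mult_right_mono) auto
      finally show ?thesis .
    qed
    have DA: "norm (adj2 (D i) ** A) \<le> M * (2 * lam / s i)" if "i \<le> T" for i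
      using via[of i A] W(3)[OF s1(1) sT[OF that]] M1 mult_left_mono[of "norm (adj2 (W (s i)) ** A)" "2 * lam / s i" M] by linarith
    have DD: "norm (adj2 (D i) ** D (Suc i)) \<le> C" for i
    proof -
      have "norm (adj2 (W (s i)) ** D (Suc i)) = norm (adj2 (D (Suc i)) ** W (s i))"
        by (metis adj2_adj2 adj2_mult norm_adj2)
      also have "\<dots> \<le> M * norm (adj2 (W (s (Suc i))) ** W (s i))" by (rule via)
      also have "norm (adj2 (W (s (Suc i))) ** W (s i)) = norm (adj2 (W (s i)) ** W (s (Suc i)))"
        by (metis adj2_adj2 adj2_mult norm_adj2)
      also have "M * \<dots> \<le> M * (2 * s (Suc i) / s i)"
        using M1 s1 by (intro mult_left_mono W(4)) (auto simp: s_def)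
      also have "2 * s (Suc i) / s i = 2 * exp 1" by (simp add: s_def exp_add)
      finally have "M * norm (adj2 (W (s i)) ** D (Suc i)) \<le> M * (M * (2 * exp 1))" using M1 by (intro mult_left_mono) auto
      then have "norm (adj2 (D i) ** D (Suc i)) \<le> 2 * (exp 1 * M\<^sup>2)"
        using via[of i "D (Suc i)"] by (simp add: power2_eq_square mult_ac)
      also have "\<dots> \<le> C" unfolding C_def by simp
      finally show ?thesis .
    qed
    define \<gamma> where "\<gamma> i = (if i = 0 then mat 1 else if i \<le> Suc T then D (i - 1) else A)" for i
    show ?thesis
    proof (intro exI[of _ "Suc (Suc T)"] exI[of _ \<gamma>] conjI allI impI)
      show "\<gamma> 0 = mat 1" "\<gamma> (Suc (Suc T)) = A" by (auto simp: \<gamma>_def)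
      show "\<gamma> i \<in> \<Delta>" for i using one_mem D A by (simp add: \<gamma>_def)
      show "norm (\<gamma> i) * norm (adj2 (\<gamma> i) ** A) \<le> C * norm A" for i
      proof -
        have "norm (mat 1 :: real^2^2) * norm A \<le> C * norm A" using n1 C(3) by (intro mult_right_mono) auto
        moreover have "norm A * norm (adj2 A ** A) \<le> C * norm A"
          using n1 C(3) adj2_left[OF dA] mult_left_mono[of "norm (mat 1 :: real^2^2)" C "norm A"] by (simp add: mult.commute)
        moreover have "norm (D j) * norm (adj2 (D j) ** A) \<le> C * norm A" if "j \<le> T" for j
        proof -
          have "norm (D j) * norm (adj2 (D j) ** A) \<le> (2 * M * s j) * (M * (2 * lam / s j))"
            using normD DA[OF that] M1 s1(2)[of j] by (intro mult_mono) auto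
          also have "\<dots> = 4 * M\<^sup>2 * lam" using s1(2)[of j] by (simp add: power2_eq_square)
          also have "\<dots> \<le> C * norm A" using C(1) l M2 by (intro mult_mono) auto
          finally show ?thesis .
        qed
        ultimately show ?thesis by (auto simp: \<gamma>_def)
      qed
      fix i assume i: "i < Suc (Suc T)"
      have a: "norm (adj2 (mat 1) ** D 0) \<le> C"
      proof -
        have "norm (D 0) \<le> 2 * M" using normD[of 0] by (simp add: s_def)
        also have "\<dots> \<le> C" using C(1) M2 M1 by linarith
        finally show ?thesis by simp
      qed
      have b: "norm (adj2 (D T) ** A) \<le> C"
      proof -
        have "norm (adj2 (D T) ** A) \<le> M * (2 * (lam / s T))" using DA[of T] by simp
        also have "\<dots> \<le> M * (2 * exp 1)" using lT M1 by (intro mult_left_mono) auto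
        also have "\<dots> \<le> 10 * exp 1 * M" using M1 by simp
        also note C(2)
        finally show ?thesis .
      qed
      show "norm (adj2 (\<gamma> i) ** \<gamma> (Suc i)) \<le> C"
        using i a b DD[of "i - 1"] by (cases i) (auto simp: \<gamma>_def not_le le_less_Suc_eq)
    next
      have "0 < norm A" using l by linarith
      then have "0 \<le> ln (norm A)" "ln lam \<le> ln (norm A)" using l by auto
      then have "real (Suc (Suc T)) \<le> 10 * (ln (norm A) + 1)" using T by simp
      also have "\<dots> \<le> C * (ln (norm A) + 1)" using C(3) \<open>0 \<le> ln (norm A)\<close> by (intro mult_right_mono) auto
      finally show "real (Suc (Suc T)) \<le> C * (ln (norm A) + 1)" .
    qed
  qed
  show ?thesis by (rule that) (rule main)
qed

end

section \<open>Cocompact Fuchsian groups\<close>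

definition cls :: "real^2^2 \<Rightarrow> (real^2^2) set" where
  "cls A = SL2R_centre #>\<^bsub>SL2R\<^esub> A"

lemma cls_eq: "cls A = {A, - A}"
  by (auto simp: cls_def r_coset_def SL2R_centre_def SL2R_def minus_matrix_mult)

lemma cls_eq_iff: "cls A = cls B \<longleftrightarrow> A = B \<or> A = - B"
  by (auto simp: cls_eq doubleton_eq_iff)

lemma carrier_PSL2R: "carrier PSL2R = cls ` {A. det A = 1}"
  by (simp add: PSL2R_def carrier_FactGroup cls_def[abs_def] SL2R_def)

lemma cls_carrier: "det A = 1 \<Longrightarrow> cls A \<in> carrier PSL2R"
  by (simp add: carrier_PSL2R)

lemma cls_mult:
  assumes "det A = 1" "det B = 1"
  shows "cls A \<otimes>\<^bsub>PSL2R\<^esub> cls B = cls (A ** B)"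
  using normal.rcos_sum[OF normal_SL2R_centre, of A B] assms
  by (simp add: PSL2R_def cls_def SL2R_def)

lemma cls_one: "\<one>\<^bsub>PSL2R\<^esub> = cls (mat 1)"
  by (simp add: PSL2R_def cls_eq SL2R_centre_def)

lemma cls_inv:
  assumes "det A = 1"
  shows "inv\<^bsub>PSL2R\<^esub> (cls A) = cls (adj2 A)"
proof -
  interpret group PSL2R by (rule group_PSL2R)
  show ?thesis using assms
    by (intro inv_equality) (auto simp: cls_mult cls_carrier adj2_left cls_one)
qed

text \<open>The choice is harmless, since the two representatives of a class differ by a sign and
  have the same norm.\<close>

definition psl_norm :: "(real^2^2) set \<Rightarrow> real" where
  "psl_norm x = norm (SOME A. x = cls A)"

lemma psl_norm_cls [simp]: "psl_norm (cls A) = norm A"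
proof -
  define B where "B = (SOME B. cls A = cls B)"
  have "cls A = cls B" unfolding B_def by (rule someI) simp
  then have "norm B = norm A" by (auto simp: cls_eq_iff)
  then show ?thesis by (simp add: psl_norm_def B_def)
qed

definition lift :: "(real^2^2) set set \<Rightarrow> (real^2^2) set" where
  "lift \<Gamma> = {A. det A = 1 \<and> cls A \<in> \<Gamma>}"

context
  fixes \<Gamma> :: "(real^2^2) set set"
  assumes fuchsian: "cocompact_Fuchsian \<Gamma>"
begin

lemma subgroup_Fuchsian: "subgroup \<Gamma> PSL2R"
  using fuchsian by (simp add: cocompact_Fuchsian_def)

lemma Fuchsian_subset: "\<Gamma> \<subseteq> carrier PSL2R"
  by (rule subgroup.subset[OF subgroup_Fuchsian])

lemma Fuchsian_eq: "\<Gamma> = cls ` lift \<Gamma>"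
  using Fuchsian_subset by (auto simp: lift_def carrier_PSL2R)

lemma lift_one: "mat 1 \<in> lift \<Gamma>"
  using subgroup.one_closed[OF subgroup_Fuchsian] by (simp add: lift_def cls_one)

lemma lift_mult: "A \<in> lift \<Gamma> \<Longrightarrow> B \<in> lift \<Gamma> \<Longrightarrow> A ** B \<in> lift \<Gamma>"
  using subgroup.m_closed[OF subgroup_Fuchsian, of "cls A" "cls B"] by (simp add: lift_def det_mul cls_mult)

lemma lift_adj: "A \<in> lift \<Gamma> \<Longrightarrow> adj2 A \<in> lift \<Gamma>"
  using subgroup.m_inv_closed[OF subgroup_Fuchsian, of "cls A"] by (simp add: lift_def cls_inv)

text \<open>An open set of PSL(2,R) isolating the identity in \<Gamma> pulls back to an open set of
  matrices meeting \<open>lift \<Gamma>\<close> only in the two preimages of the identity.\<close>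

lemma lift_discrete: "\<exists>e>0. \<forall>A\<in>lift \<Gamma>. dist A (mat 1) < e \<longrightarrow> A = mat 1 \<or> A = - mat 1"
proof -
  let ?S = "carrier SL2R"
  have "openin (subtopology PSL2R_topology \<Gamma>) {\<one>\<^bsub>PSL2R\<^esub>}"
    using fuchsian subgroup.one_closed[OF subgroup_Fuchsian] by (simp add: cocompact_Fuchsian_def)
  then obtain T where T: "openin PSL2R_topology T" "{\<one>\<^bsub>PSL2R\<^esub>} = T \<inter> \<Gamma>"
    by (auto simp: openin_subtopology)
  have "openin (top_of_set ?S) {A \<in> ?S. cls A \<in> T}"
    using T(1) by (simp add: PSL2R_topology_def openin_quotient_topology cls_def)
  moreover have "mat 1 \<in> {A \<in> ?S. cls A \<in> T}" using T(2) by (auto simp: SL2R_def cls_one)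
  ultimately obtain e where e: "0 < e" "\<And>A. A \<in> ?S \<Longrightarrow> dist A (mat 1) < e \<Longrightarrow> cls A \<in> T"
    unfolding openin_euclidean_subtopology_iff by blast
  have "A = mat 1 \<or> A = - mat 1" if "A \<in> lift \<Gamma>" "dist A (mat 1) < e" for A
  proof -
    have "cls A \<in> T \<inter> \<Gamma>" using e(2)[of A] that by (auto simp: lift_def SL2R_def)
    then have "cls A = cls (mat 1)" using T(2) by (auto simp: cls_one)
    then show ?thesis by (simp add: cls_eq_iff)
  qed
  with e(1) show ?thesis by blast
qed

lemma lift_finite_ball: "finite {A \<in> lift \<Gamma>. norm A \<le> T}"
proof (rule ccontr)
  let ?S = "{A \<in> lift \<Gamma>. norm A \<le> T}"
  assume inf: "infinite ?S"
  obtain e where e: "0 < e" "\<And>A. A \<in> lift \<Gamma> \<Longrightarrow> dist A (mat 1) < e \<Longrightarrow> A = mat 1 \<or> A = - mat 1"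
    using lift_discrete by blast
  have "bounded ?S" by (auto simp: bounded_iff)
  then obtain x where x: "x islimpt ?S" using bounded_infinite_imp_islimpt inf by blast
  \<comment> \<open>Two lattice elements of norm at most \<open>T\<close> within 2 * d differ by an
    element that is closer than \<open>e\<close> to the identity, hence by a sign; and 2 * d <= 1
    excludes B = - A, as these two are at distance 2 * norm A.\<close>
  define d where "d = min 1 (e / (1 + \<bar>T\<bar>)) / 2"
  have d: "0 < d" "2 * d \<le> 1" "2 * d * (1 + \<bar>T\<bar>) \<le> e"
  proof -
    show "0 < d" "2 * d \<le> 1" using e(1) by (auto simp: d_def)
    have "2 * d \<le> e / (1 + \<bar>T\<bar>)" by (simp add: d_def)
    then show "2 * d * (1 + \<bar>T\<bar>) \<le> e" by (simp add: field_simps)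
  qed
  have "infinite (?S \<inter> ball x d)" using x d(1) by (simp add: islimpt_eq_infinite_ball)
  then have "?S \<inter> ball x d \<noteq> {}" by (metis finite.emptyI)
  then obtain A where A: "A \<in> ?S \<inter> ball x d" by blast
  have "infinite (?S \<inter> ball x d - {A})" using \<open>infinite (?S \<inter> ball x d)\<close> by simp
  then have "?S \<inter> ball x d - {A} \<noteq> {}" by (metis finite.emptyI)
  then obtain B where B: "B \<in> ?S \<inter> ball x d" "B \<noteq> A" by blast
  have "dist A B \<le> dist x A + dist x B" by (rule dist_triangle3)
  then have AB: "norm (B - A) < 2 * d" using A B by (simp add: dist_norm norm_minus_commute)
  have dA: "det A = 1" using A by (simp add: lift_def)
  have "adj2 A ** B - mat 1 = adj2 A ** (B - A)"
    using adj2_left[OF dA] matrix_add_ldistrib[of "adj2 A" "B - A" A] by simp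
  then have "norm (adj2 A ** B - mat 1) \<le> norm A * norm (B - A)"
    using norm_mult2_le[of "adj2 A" "B - A"] by simp
  also have "\<dots> \<le> (1 + \<bar>T\<bar>) * norm (B - A)" using A by (intro mult_right_mono) auto
  also have "\<dots> < (1 + \<bar>T\<bar>) * (2 * d)" using AB by (intro mult_strict_left_mono) auto
  also have "\<dots> \<le> e" using d(3) by (simp add: mult_ac)
  finally have "dist (adj2 A ** B) (mat 1) < e" by (simp add: dist_norm)
  moreover have "adj2 A ** B \<in> lift \<Gamma>" using A B lift_mult lift_adj by simp
  ultimately have "adj2 A ** B = mat 1 \<or> adj2 A ** B = - mat 1" using e(2) by blast
  moreover have "B = A ** (adj2 A ** B)" using dA by simp
  ultimately have "B = A ** mat 1 \<or> B = A ** (- mat 1)" by metis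
  then have "B = - A" using B(2) by (auto simp: minus_matrix_mult)
  then have "norm (B - A) = 2 * norm A"
  proof -
    have "B - A = (- 2) *\<^sub>R A" using \<open>B = - A\<close> by (simp add: scaleR_2 algebra_simps)
    then show ?thesis by simp
  qed
  then show False using AB d(2) norm2_ge(2)[OF dA] by simp
qed

text \<open>The sign left undetermined by \<open>cls\<close> is absorbed into
  \<open>lift \<Gamma>\<close>, which contains - D along with D.\<close>

lemma Fuchsian_coset_eq_iff:
  assumes "det A = 1" "det B = 1"
  shows "\<Gamma> #>\<^bsub>PSL2R\<^esub> cls B = \<Gamma> #>\<^bsub>PSL2R\<^esub> cls A \<longleftrightarrow> (\<exists>D\<in>lift \<Gamma>. B = D ** A)"
proof
  interpret group PSL2R by (rule group_PSL2R)
  assume eq: "\<Gamma> #>\<^bsub>PSL2R\<^esub> cls B = \<Gamma> #>\<^bsub>PSL2R\<^esub> cls A"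
  have "cls B \<in> \<Gamma> #>\<^bsub>PSL2R\<^esub> cls B" by (rule rcos_self[OF cls_carrier[OF assms(2)] subgroup_Fuchsian])
  then obtain g where g: "g \<in> \<Gamma>" "cls B = g \<otimes>\<^bsub>PSL2R\<^esub> cls A" unfolding eq by (auto simp: r_coset_def)
  then obtain D where D: "D \<in> lift \<Gamma>" "g = cls D" using Fuchsian_eq by blast
  then have "cls B = cls (D ** A)" using g assms by (simp add: lift_def cls_mult)
  then consider "B = D ** A" | "B = (- D) ** A" by (auto simp: cls_eq_iff minus_matrix_mult)
  moreover have "- D \<in> lift \<Gamma>" using D by (auto simp: lift_def cls_eq det_2 insert_commute)
  ultimately show "\<exists>D\<in>lift \<Gamma>. B = D ** A" using D by cases auto
next
  interpret group PSL2R by (rule group_PSL2R)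
  assume "\<exists>D\<in>lift \<Gamma>. B = D ** A"
  then obtain D where D: "D \<in> lift \<Gamma>" "B = D ** A" by blast
  then have c: "cls D \<in> carrier PSL2R" "cls D \<in> \<Gamma>" "cls B = cls D \<otimes>\<^bsub>PSL2R\<^esub> cls A"
    using assms by (auto simp: lift_def cls_carrier cls_mult)
  have "\<Gamma> #>\<^bsub>PSL2R\<^esub> cls B = (\<Gamma> #>\<^bsub>PSL2R\<^esub> cls D) #>\<^bsub>PSL2R\<^esub> cls A"
    unfolding c(3) using coset_mult_assoc[OF Fuchsian_subset c(1) cls_carrier[OF assms(1)]] by simp
  also have "\<Gamma> #>\<^bsub>PSL2R\<^esub> cls D = \<Gamma>" by (rule coset_join2[OF c(1) subgroup_Fuchsian c(2)])
  finally show "\<Gamma> #>\<^bsub>PSL2R\<^esub> cls B = \<Gamma> #>\<^bsub>PSL2R\<^esub> cls A" .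
qed

text \<open>The images of the open norm balls cover the quotient. They are open, because the
  preimage of such an image in SL(2,R) is a union of translates of the ball; the largest radius in a
  finite subcover is the constant.\<close>

lemma lift_cocompact: "\<exists>M. \<forall>A. det A = 1 \<longrightarrow> (\<exists>D\<in>lift \<Gamma>. norm (adj2 D ** A) \<le> M)"
proof -
  let ?S = "carrier SL2R"
  define q where "q g = \<Gamma> #>\<^bsub>PSL2R\<^esub> g" for g
  let ?X = "quotient_topology PSL2R_topology q"
  have SL: "A \<in> ?S \<longleftrightarrow> det A = 1" for A by (simp add: SL2R_def)
  have comp: "compact_space ?X"
    using fuchsian by (simp add: cocompact_Fuchsian_def q_def[abs_def])
  have top: "topspace ?X = q ` carrier PSL2R" by (simp add: topspace_PSL2R_topology)
  define U where "U n = q ` cls ` {A. det A = 1 \<and> norm A < real n}" for n :: nat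
  have mem: "q (cls A) \<in> U n \<longleftrightarrow> (\<exists>D\<in>lift \<Gamma>. norm (D ** A) < real n)" if A: "det A = 1" for A n
  proof
    assume "q (cls A) \<in> U n"
    then obtain B where B: "det B = 1" "norm B < real n" "q (cls B) = q (cls A)" by (auto simp: U_def)
    then show "\<exists>D\<in>lift \<Gamma>. norm (D ** A) < real n" using Fuchsian_coset_eq_iff[OF A B(1)] by (auto simp: q_def)
  next
    assume "\<exists>D\<in>lift \<Gamma>. norm (D ** A) < real n"
    then obtain D where D: "D \<in> lift \<Gamma>" "norm (D ** A) < real n" by blast
    have "det (D ** A) = 1" using D A by (simp add: lift_def det_mul)
    moreover have "q (cls A) = q (cls (D ** A))"
      using Fuchsian_coset_eq_iff[OF A \<open>det (D ** A) = 1\<close>] D by (auto simp: q_def)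
    ultimately show "q (cls A) \<in> U n" using D(2) unfolding U_def by blast
  qed
  have open_U: "openin ?X (U n)" for n
  proof -
    have 1: "U n \<subseteq> q ` topspace PSL2R_topology"
      by (auto simp: U_def topspace_PSL2R_topology cls_carrier)
    have "openin PSL2R_topology {g \<in> carrier PSL2R. q g \<in> U n}"
    proof -
      have "{A \<in> ?S. cls A \<in> {g \<in> carrier PSL2R. q g \<in> U n}} = ?S \<inter> (\<Union>D\<in>lift \<Gamma>. {A. norm (D ** A) < real n})"
        using mem by (auto simp: SL cls_carrier)
      moreover have "open {A. norm (D ** A) < real n}" for D :: "real^2^2"
        unfolding matrix_matrix_mult_def by (intro open_Collect_less continuous_intros)
      then have "open (\<Union>D\<in>lift \<Gamma>. {A. norm (D ** A) < real n})" by (intro open_UN ballI)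
      ultimately have "openin (top_of_set ?S) {A \<in> ?S. cls A \<in> {g \<in> carrier PSL2R. q g \<in> U n}}"
        by (simp only:) (rule openin_open_Int)
      moreover have "{g \<in> carrier PSL2R. q g \<in> U n} \<subseteq> cls ` ?S" by (auto simp: carrier_PSL2R SL)
      ultimately show ?thesis by (simp add: PSL2R_topology_def openin_quotient_topology cls_def[abs_def, symmetric])
    qed
    with 1 show ?thesis by (simp add: openin_quotient_topology topspace_PSL2R_topology)
  qed
  have cover: "topspace ?X \<subseteq> \<Union> (range U)"
  proof
    fix z assume "z \<in> topspace ?X"
    then obtain A where A: "det A = 1" "z = q (cls A)" unfolding top carrier_PSL2R by blast
    obtain n where "norm A < real n" using reals_Archimedean2 by blast
    then have "z \<in> U n" using A by (auto simp: U_def)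
    then show "z \<in> \<Union> (range U)" by blast
  qed
  obtain F where F: "finite F" "F \<subseteq> range U" "topspace ?X \<subseteq> \<Union> F"
    using comp open_U cover unfolding compact_space_alt by (metis (no_types, lifting) rangeE)
  then obtain I where I: "finite I" "F = U ` I" by (metis finite_subset_image)
  have "\<exists>D\<in>lift \<Gamma>. norm (adj2 D ** A) \<le> real (Max (insert 0 I))" if A: "det A = 1" for A
  proof -
    have "q (cls A) \<in> topspace ?X" unfolding top using A cls_carrier by blast
    then obtain n where n: "n \<in> I" "q (cls A) \<in> U n" using F I by blast
    then obtain D where D: "D \<in> lift \<Gamma>" "norm (D ** A) < real n" using mem[OF A] by blast
    have "n \<le> Max (insert 0 I)" using I(1) n(1) by (intro Max_ge) auto
    then show ?thesis using D lift_adj by (intro bexI[of _ "adj2 D"]) auto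
  qed
  then show ?thesis by blast
qed

lemma sl2_lattice_lift: "sl2_lattice (lift \<Gamma>)"
  by unfold_locales
     (use lift_one lift_mult lift_adj lift_finite_ball lift_cocompact in \<open>auto simp: lift_def\<close>)

lemma norm_group_Fuchsian: "norm_group (PSL2R\<lparr>carrier := \<Gamma>\<rparr>) psl_norm"
proof -
  let ?G = "PSL2R\<lparr>carrier := \<Gamma>\<rparr>"
  interpret L: sl2_lattice "lift \<Gamma>" by (rule sl2_lattice_lift)
  have gr: "group ?G" by (rule subgroup.subgroup_is_group[OF subgroup_Fuchsian group_PSL2R])
  have ex: "\<exists>A\<in>lift \<Gamma>. x = cls A" if "x \<in> \<Gamma>" for x using that Fuchsian_eq by blast
  have clsG: "cls A \<in> \<Gamma>" "det A = 1" if "A \<in> lift \<Gamma>" for A using that by (auto simp: lift_def)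
  have inv: "inv\<^bsub>?G\<^esub> (cls A) = cls (adj2 A)" if "A \<in> lift \<Gamma>" for A
    using group.m_inv_consistent[OF group_PSL2R subgroup_Fuchsian] clsG[OF that] by (simp add: cls_inv)
  have mult: "cls A \<otimes>\<^bsub>?G\<^esub> cls B = cls (A ** B)" if "A \<in> lift \<Gamma>" "B \<in> lift \<Gamma>" for A B
    using clsG[OF that(1)] clsG[OF that(2)] by (simp add: cls_mult)
  note sim = inv mult lift_adj lift_mult
  have "norm_group_axioms ?G psl_norm"
  proof
    fix x y assume xy: "x \<in> carrier ?G" "y \<in> carrier ?G"
    obtain A B where AB: "A \<in> lift \<Gamma>" "x = cls A" "B \<in> lift \<Gamma>" "y = cls B" using ex xy by auto metis
    show "psl_norm (x \<otimes>\<^bsub>?G\<^esub> y) \<le> psl_norm x * psl_norm y"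
      using mult[OF AB(1,3)] norm_mult2_le[of A B] AB by simp
  next
    fix x assume "x \<in> carrier ?G"
    then obtain A where A: "A \<in> lift \<Gamma>" "x = cls A" using ex by auto
    show "1 \<le> psl_norm x" using A norm2_ge(2)[of A] clsG by simp
    show "psl_norm (inv\<^bsub>?G\<^esub> x) = psl_norm x" using A inv by simp
  next
    fix a b c assume "a \<in> carrier ?G" "b \<in> carrier ?G" "c \<in> carrier ?G"
    then obtain A B C where ABC: "A \<in> lift \<Gamma>" "a = cls A" "B \<in> lift \<Gamma>" "b = cls B" "C \<in> lift \<Gamma>" "c = cls C"
      using ex by auto metis
    have "inv\<^bsub>?G\<^esub> a \<otimes>\<^bsub>?G\<^esub> c = cls (adj2 A ** C)" "inv\<^bsub>?G\<^esub> a \<otimes>\<^bsub>?G\<^esub> b = cls (adj2 A ** B)"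
      "inv\<^bsub>?G\<^esub> b \<otimes>\<^bsub>?G\<^esub> c = cls (adj2 B ** C)" using ABC by (simp_all only: sim)
    then show "psl_norm (inv\<^bsub>?G\<^esub> a \<otimes>\<^bsub>?G\<^esub> c) * psl_norm b
        \<le> psl_norm (inv\<^bsub>?G\<^esub> a \<otimes>\<^bsub>?G\<^esub> b) * psl_norm c + psl_norm (inv\<^bsub>?G\<^esub> b \<otimes>\<^bsub>?G\<^esub> c) * psl_norm a"
      using norm_ptolemy[of A B C] ABC clsG by simp
  next
    obtain K :: real where K: "\<And>T. 1 \<le> T \<Longrightarrow> card {A \<in> lift \<Gamma>. norm A \<le> T} \<le> K * T ^ 3"
      using L.card_ball_le by blast
    have sub: "{x \<in> carrier ?G. psl_norm x \<le> T} = cls ` {A \<in> lift \<Gamma>. norm A \<le> T}" for T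
    proof
      show "{x \<in> carrier ?G. psl_norm x \<le> T} \<subseteq> cls ` {A \<in> lift \<Gamma>. norm A \<le> T}"
      proof
        fix x assume x: "x \<in> {x \<in> carrier ?G. psl_norm x \<le> T}"
        then obtain A where "A \<in> lift \<Gamma>" "x = cls A" using ex[of x] by auto
        with x show "x \<in> cls ` {A \<in> lift \<Gamma>. norm A \<le> T}" by auto
      qed
      show "cls ` {A \<in> lift \<Gamma>. norm A \<le> T} \<subseteq> {x \<in> carrier ?G. psl_norm x \<le> T}"
        using clsG by auto
    qed
    have "finite {x \<in> carrier ?G. psl_norm x \<le> T} \<and> real (card {x \<in> carrier ?G. psl_norm x \<le> T}) \<le> K * T ^ 3"
      if T: "1 \<le> T" for T :: real
    proof -
      have "real (card (cls ` {A \<in> lift \<Gamma>. norm A \<le> T})) \<le> real (card {A \<in> lift \<Gamma>. norm A \<le> T})"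
        by (intro of_nat_mono card_image_le lift_finite_ball)
      then show ?thesis unfolding sub using K[OF T] lift_finite_ball by auto
    qed
    then show "\<exists>K::real. \<forall>T::real. 1 \<le> T \<longrightarrow> finite {x \<in> carrier ?G. psl_norm x \<le> T} \<and>
      real (card {x \<in> carrier ?G. psl_norm x \<le> T}) \<le> K * T ^ 3" by blast
  next
    obtain C where C: "\<And>A. A \<in> lift \<Gamma> \<Longrightarrow> \<exists>T \<gamma>. \<gamma> 0 = mat 1 \<and> \<gamma> T = A \<and> (\<forall>i\<le>T. \<gamma> i \<in> lift \<Gamma>) \<and>
      (\<forall>i\<le>T. norm (\<gamma> i) * norm (adj2 (\<gamma> i) ** A) \<le> C * norm A) \<and>
      (\<forall>i<T. norm (adj2 (\<gamma> i) ** \<gamma> (Suc i)) \<le> C) \<and> real T \<le> C * (ln (norm A) + 1)"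
      using L.chain by blast
    have "\<exists>T \<gamma>. \<gamma> 0 = \<one>\<^bsub>?G\<^esub> \<and> \<gamma> T = g \<and> (\<forall>i\<le>T. \<gamma> i \<in> carrier ?G) \<and>
      (\<forall>i\<le>T. psl_norm (\<gamma> i) * psl_norm (inv\<^bsub>?G\<^esub> (\<gamma> i) \<otimes>\<^bsub>?G\<^esub> g) \<le> C * psl_norm g) \<and>
      (\<forall>i<T. psl_norm (inv\<^bsub>?G\<^esub> (\<gamma> i) \<otimes>\<^bsub>?G\<^esub> \<gamma> (Suc i)) \<le> C) \<and> real T \<le> C * (ln (psl_norm g) + 1)"
      if g: "g \<in> carrier ?G" for g
    proof -
      obtain A where A: "A \<in> lift \<Gamma>" "g = cls A" using ex g by auto
      obtain T \<gamma> where \<gamma>: "\<gamma> 0 = mat 1" "\<gamma> T = A" "\<And>i. i \<le> T \<Longrightarrow> \<gamma> i \<in> lift \<Gamma>"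
        "\<And>i. i \<le> T \<Longrightarrow> norm (\<gamma> i) * norm (adj2 (\<gamma> i) ** A) \<le> C * norm A"
        "\<And>i. i < T \<Longrightarrow> norm (adj2 (\<gamma> i) ** \<gamma> (Suc i)) \<le> C" "real T \<le> C * (ln (norm A) + 1)"
        using C[OF A(1)] by blast
      have e: "inv\<^bsub>?G\<^esub> (cls (\<gamma> i)) \<otimes>\<^bsub>?G\<^esub> cls B = cls (adj2 (\<gamma> i) ** B)" if "i \<le> T" "B \<in> lift \<Gamma>" for i B
        using \<gamma>(3)[OF that(1)] that(2) by (simp only: sim)
      show ?thesis
      proof (intro exI[of _ T] exI[of _ "\<lambda>i. cls (\<gamma> i)"] conjI allI impI)
        fix i assume i: "i \<le> T"
        show "cls (\<gamma> i) \<in> carrier ?G" using \<gamma>(3)[OF i] clsG by simp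
        show "psl_norm (cls (\<gamma> i)) * psl_norm (inv\<^bsub>?G\<^esub> (cls (\<gamma> i)) \<otimes>\<^bsub>?G\<^esub> g) \<le> C * psl_norm g"
          unfolding A(2) e[OF i A(1)] using \<gamma>(4)[OF i] by simp
      next
        fix i assume i: "i < T"
        then have i': "i \<le> T" "\<gamma> (Suc i) \<in> lift \<Gamma>" using \<gamma>(3) by auto
        show "psl_norm (inv\<^bsub>?G\<^esub> (cls (\<gamma> i)) \<otimes>\<^bsub>?G\<^esub> cls (\<gamma> (Suc i))) \<le> C"
          unfolding e[OF i'] using \<gamma>(5)[OF i] by simp
      qed (use \<gamma> A cls_one in auto)
    qed
    then show "\<exists>C. \<forall>g\<in>carrier ?G. \<exists>T \<gamma>. \<gamma> 0 = \<one>\<^bsub>?G\<^esub> \<and> \<gamma> T = g \<and> (\<forall>i\<le>T. \<gamma> i \<in> carrier ?G) \<and>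
      (\<forall>i\<le>T. psl_norm (\<gamma> i) * psl_norm (inv\<^bsub>?G\<^esub> (\<gamma> i) \<otimes>\<^bsub>?G\<^esub> g) \<le> C * psl_norm g) \<and>
      (\<forall>i<T. psl_norm (inv\<^bsub>?G\<^esub> (\<gamma> i) \<otimes>\<^bsub>?G\<^esub> \<gamma> (Suc i)) \<le> C) \<and> real T \<le> C * (ln (psl_norm g) + 1)"
      by blast
  next
    obtain F c where F: "finite F" "F \<subseteq> lift \<Gamma>" "0 < c" and br:
      "\<And>X X' Y. det X = 1 \<Longrightarrow> det X' = 1 \<Longrightarrow> det Y = 1 \<Longrightarrow>
      \<exists>A\<in>F. c * (norm X * norm Y) \<le> norm (X ** A ** Y) \<and> c * (norm X' * norm Y) \<le> norm (X' ** A ** Y)"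
      using L.branching by blast
    have "\<exists>a\<in>cls ` F. c * (psl_norm x * psl_norm y) \<le> psl_norm (x \<otimes>\<^bsub>?G\<^esub> a \<otimes>\<^bsub>?G\<^esub> y) \<and>
        c * (psl_norm x' * psl_norm y) \<le> psl_norm (x' \<otimes>\<^bsub>?G\<^esub> a \<otimes>\<^bsub>?G\<^esub> y)"
      if xy: "x \<in> carrier ?G" "x' \<in> carrier ?G" "y \<in> carrier ?G" for x x' y
    proof -
      obtain X where X: "X \<in> lift \<Gamma>" "x = cls X" using ex xy(1) by auto
      obtain X' where X': "X' \<in> lift \<Gamma>" "x' = cls X'" using ex xy(2) by auto
      obtain Y where Y: "Y \<in> lift \<Gamma>" "y = cls Y" using ex xy(3) by auto
      obtain A where A: "A \<in> F" "c * (norm X * norm Y) \<le> norm (X ** A ** Y)" "c * (norm X' * norm Y) \<le> norm (X' ** A ** Y)"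
        using br[of X X' Y] X X' Y clsG by blast
      have "cls Z \<otimes>\<^bsub>?G\<^esub> cls A \<otimes>\<^bsub>?G\<^esub> cls Y = cls (Z ** A ** Y)" if "Z \<in> lift \<Gamma>" for Z
      proof -
        have "A \<in> lift \<Gamma>" using A(1) F(2) by blast
        with that Y(1) show ?thesis by (simp only: mult lift_mult)
      qed
      then show ?thesis using A X X' Y by (intro bexI[of _ "cls A"]) auto
    qed
    moreover have "cls ` F \<subseteq> carrier ?G" using F(2) clsG by auto
    ultimately show "\<exists>F c. finite F \<and> F \<subseteq> carrier ?G \<and> 0 < c \<and>
      (\<forall>x\<in>carrier ?G. \<forall>x'\<in>carrier ?G. \<forall>y\<in>carrier ?G. \<exists>a\<in>F.
         c * (psl_norm x * psl_norm y) \<le> psl_norm (x \<otimes>\<^bsub>?G\<^esub> a \<otimes>\<^bsub>?G\<^esub> y) \<and>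
         c * (psl_norm x' * psl_norm y) \<le> psl_norm (x' \<otimes>\<^bsub>?G\<^esub> a \<otimes>\<^bsub>?G\<^esub> y))"
      using F(1,3) by (intro exI[of _ "cls ` F"] exI[of _ c]) auto
  next
    show "infinite (carrier ?G)"
    proof
      assume "finite (carrier ?G)"
      then have "finite (psl_norm ` \<Gamma>)" by simp
      then have B: "psl_norm x \<le> Max (psl_norm ` \<Gamma>)" if "x \<in> \<Gamma>" for x using that by simp
      obtain A where "A \<in> lift \<Gamma>" "Max (psl_norm ` \<Gamma>) < norm A" using L.norm_unbounded by blast
      then show False using B[of "cls A"] clsG(1)[of A] by simp
    qed
  qed
  with gr show ?thesis by (simp add: norm_group_def)
qed

end

theorem theorem1p3:
  fixes \<Gamma> S :: "(real^2^2) set set" and \<mu> :: "(real^2^2) set pmf" and R :: real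
  assumes "cocompact_Fuchsian \<Gamma>"
    and "finite_symmetric_generating_set PSL2R \<Gamma> S"
    and "symmetric_step PSL2R \<mu>"
    and "irreducible_step PSL2R \<Gamma> \<mu>"
    and "finite_range_step \<mu>"
    and "green_radius PSL2R \<mu> = ereal R"
  shows
    "(\<exists>(C::real) (\<rho>::real). 0 < \<rho> \<and> \<rho> < 1 \<and>
        (\<forall>x\<in>\<Gamma>. \<forall>y\<in>\<Gamma>.
           green PSL2R \<mu> R x y \<le> ennreal (C * \<rho> ^ word_metric PSL2R S x y))) \<and>
     (\<exists>C::real. \<forall>r\<in>{1..R}. \<forall>m x. geodesic_segment PSL2R \<Gamma> S x m \<longrightarrow>
        (\<forall>k\<in>{1..m}.
           green PSL2R \<mu> r (x 0) (x m)
             \<le> ennreal C * green PSL2R \<mu> r (x 0) (x k) * green PSL2R \<mu> r (x k) (x m)))"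
proof -
  let ?G = "PSL2R\<lparr>carrier := \<Gamma>\<rparr>"
  have sg: "subgroup \<Gamma> PSL2R" using assms(1) by (rule subgroup_Fuchsian)
  have inv: "inv\<^bsub>?G\<^esub> x = inv\<^bsub>PSL2R\<^esub> x" if "x \<in> \<Gamma>" for x
    using group.m_inv_consistent[OF group_PSL2R sg that] .
  have tp: "transition_prob ?G \<mu> n x y = transition_prob PSL2R \<mu> n x y" for n x y
    by (simp add: transition_prob_def walk_law_def)
  have gen: "generated_semigroup PSL2R (set_pmf \<mu>) = \<Gamma>"
    using assms(4) by (simp add: irreducible_step_def)
  have supp: "set_pmf \<mu> \<subseteq> \<Gamma>" unfolding gen[symmetric] by (rule subsetI) (rule generated_semigroup.incl)
  have sub: "x \<in> generated_semigroup ?G (set_pmf \<mu>)" if "x \<in> generated_semigroup PSL2R (set_pmf \<mu>)" for x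
    using that
  proof induction
    case (mult a b)
    then have "a \<otimes>\<^bsub>?G\<^esub> b \<in> generated_semigroup ?G (set_pmf \<mu>)" by (intro generated_semigroup.mult)
    then show ?case by simp
  qed (rule generated_semigroup.incl)
  \<comment> \<open>\<open>m_inv\<close> is unspecified off the carrier, so it is injective only
    where the group laws apply, in particular on the support. If neither \<open>s\<close> nor its
    inverse lies in the support, both masses are 0.\<close>
  have mu_inv: "pmf \<mu> (inv\<^bsub>PSL2R\<^esub> s) = pmf \<mu> s" if s: "s \<in> \<Gamma>" for s
  proof -
    interpret group PSL2R by (rule group_PSL2R)
    have c: "\<Gamma> \<subseteq> carrier PSL2R" by (rule subgroup.subset[OF sg])
    have m: "map_pmf (m_inv PSL2R) \<mu> = \<mu>" using assms(3) by (simp add: symmetric_step_def)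
    have inj: "inj_on (m_inv PSL2R) (set_pmf \<mu>)"
    proof (rule inj_onI)
      fix a b assume ab: "a \<in> set_pmf \<mu>" "b \<in> set_pmf \<mu>" "inv\<^bsub>PSL2R\<^esub> a = inv\<^bsub>PSL2R\<^esub> b"
      have "a = inv\<^bsub>PSL2R\<^esub> (inv\<^bsub>PSL2R\<^esub> a)" "b = inv\<^bsub>PSL2R\<^esub> (inv\<^bsub>PSL2R\<^esub> b)"
        using ab(1,2) supp c by (auto simp: subset_iff)
      with ab(3) show "a = b" by metis
    qed
    have eq: "pmf \<mu> (inv\<^bsub>PSL2R\<^esub> t) = pmf \<mu> t" if "t \<in> set_pmf \<mu>" for t
      using pmf_map_inj[OF inj that] m by simp
    show ?thesis
    proof (cases "s \<in> set_pmf \<mu> \<or> inv\<^bsub>PSL2R\<^esub> s \<in> set_pmf \<mu>")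
      case True
      have "inv\<^bsub>PSL2R\<^esub> (inv\<^bsub>PSL2R\<^esub> s) = s" using s c by (intro inv_inv) blast
      with True show ?thesis using eq[of s] eq[of "inv\<^bsub>PSL2R\<^esub> s"] by auto
    next
      case False
      then show ?thesis by (simp add: set_pmf_iff)
    qed
  qed
  interpret W: hyp_walk ?G \<mu> R psl_norm S
  proof (intro hyp_walk.intro sym_walk.intro sym_walk_axioms.intro norm_group_gen.intro norm_group_gen_axioms.intro)
    show "group ?G" by (rule subgroup.subgroup_is_group[OF sg group_PSL2R])
    show "norm_group ?G psl_norm" by (rule norm_group_Fuchsian[OF assms(1)])
    show "set_pmf \<mu> \<subseteq> carrier ?G" using supp by simp
    show "finite (set_pmf \<mu>)" using assms(5) by (simp add: finite_range_step_def)
    show "pmf \<mu> (inv\<^bsub>?G\<^esub> s) = pmf \<mu> s" if "s \<in> carrier ?G" for s using that inv mu_inv by simp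
    show "carrier ?G \<subseteq> generated_semigroup ?G (set_pmf \<mu>)" using sub gen by auto
    show "conv_radius (\<lambda>n. transition_prob ?G \<mu> n \<one>\<^bsub>?G\<^esub> \<one>\<^bsub>?G\<^esub>) = ereal R"
      using assms(6) by (simp add: green_radius_def tp)
    show "finite_symmetric_generating_set ?G (carrier ?G) S"
      using assms(2) inv group.generate_consistent[OF group_PSL2R, of S \<Gamma>] sg
      by (auto simp: finite_symmetric_generating_set_def subset_iff)
  qed
  have "green ?G \<mu> r x y = green PSL2R \<mu> r x y" for r x y by (simp add: green_def tp)
  moreover have "word_metric ?G S x y = word_metric PSL2R S x y" for x y by (simp add: word_metric_def)
  moreover have "geodesic_segment ?G (carrier ?G) S x m \<longleftrightarrow> geodesic_segment PSL2R \<Gamma> S x m" for x m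
    by (simp add: geodesic_segment_def cayley_adj_def word_metric_def)
  ultimately show ?thesis using W.green_decay_and_ancona by simp
qed

end
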